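(* Assume the following conjecture: for every $\alpha\in(0,\alpha_3^* )$ and $\varepsilon>0$, there exists $\overline n(\alpha,\varepsilon)$ such that for $n\ge\overline n(\alpha,\varepsilon)$ an $n$-vertex random 3-regular graph is 2-independent-set-$(\alpha,\varepsilon)$-typical with high probability. Let $\alpha\in(0,\alpha_3^* )$. Let $G=(V,E)$ be a random 3-regular graph with $n$ vertices sampled from the configuration model and $V_0$ a (uniformly random) 2-independent set of $G$ of size $\alpha n$. Then for all $\varepsilon>0$ there exists $\overline n=\overline n(\varepsilon)$ such that for all $n\ge\overline n$, with high probability on $G$ and on the choice of the 2-independent set $V_0$ of $G$, $$\max_{\sigma\in\{-1,1\}^{V_0}}\frac{\langle\psi_G|\Pi_\sigma H_{\mathrm{MaxCut}}(G)\Pi_\sigma|\psi_G\rangle}{\lVert \Pi_\sigma|\psi_G\rangle\rVert^2}-\langle\psi_G|H_{\mathrm{MaxCut}}(G)|\psi_G\rangle\le\left(\frac{\alpha^2(0.18125-0.83875\,\alpha+0.99\,\alpha^2)}{(0.5-\alpha)^3}+0.59\,\varepsilon\right)n+\mathcal{O}(1),$$ where $\Pi_\sigma:=\prod_{v_0\in V_0}\frac{1+\sigma_{v_0}Z_{v_0}}{2}$.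
   Context: "With high probability" means with probability tending to $1$ as $n\to\infty$. Configuration model: on $n$ vertices of degree $d$ ($nd$ even), attach $d$ half-edges to each vertex, draw a uniformly random perfect matching of the $nd$ half-edges, and let each matched pair form an edge between the corresponding vertices (loops and multiple edges possible). In this model, $V_0$ is 2-independent (2-id) in $G$ if the $d|V_0|$ half-edges attached to $V_0$ are matched to half-edges belonging to pairwise distinct vertices outside $V_0$ (for simple graphs: any two distinct vertices of $V_0$ are at distance at least $3$). $\alpha_d^*\in(0,\frac1{d+1})$ is the threshold such that the expected number of 2-independent sets of size $\alpha n$ in a degree-$d$ configuration-model multigraph grows exponentially in $n$ for $\alpha<\alpha_d^*$ and decays exponentially for $\alpha>\alpha_d^*$; $\alpha_3^*\in(0.235,0.236)$. A $d$-regular graph $G_0$ on $n$ vertices is 2-independent-set-$(\alpha,\varepsilon)$-typical if $$\sum_{V_0\subset V,\,|V_0|=\alpha n}\mathbf 1_{V_0\text{ 2-id in }G_0}\ \ge\ e^{-\varepsilon n}\ \mathbf E_G\Big[\sum_{V_0\subset V,\,|V_0|=\alpha n}\mathbf 1_{V_0\text{ 2-id in }G}\Big],$$ the expectation being over the configuration model. Qubits are labelled by vertices. $H_{\mathrm{MaxCut}}(G)=\sum_{\{e_0,e_1\}\in E}\frac{1-Z_{e_0}Z_{e_1}}{2}$. The depth-1 QAOA state is $$|\psi_G\rangle=\exp\Big(-\tfrac{i\beta}{2}\sum_{v}X_v\Big)\exp\Big(-\tfrac{i\gamma}{2}\sum_{\{e_0,e_1\}\in E}Z_{e_0}Z_{e_1}\Big)|+\rangle^{\otimes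 n}$$ with the optimal parameters for 3-regular graphs $\beta=-\frac{\pi}{4}$, $\gamma=\arctan\frac{1}{\sqrt2}$. *)

theory Defs
  imports
    "HOL-Probability.Probability_Mass_Function"
    "HOL-Library.Disjoint_Sets"
    "Jordan_Normal_Form.Matrix"
begin

text \<open>
  The vertices are \<open>0, \<dots>, n - 1\<close> and the half-edges are \<open>0, \<dots>, n * d - 1\<close>; half-edge \<open>h\<close> is
  attached to vertex \<open>h div d\<close>. A multigraph is represented by the underlying perfect matching
  \<open>M\<close> of the half-edges, whose members (two-element sets of half-edges) are the edges, so that
  loops and parallel edges are retained.
\<close>

definition half_edges_at :: "nat \<Rightarrow> nat set \<Rightarrow> nat set" where
  "half_edges_at d W = (\<Union>v\<in>W. {v * d..<(v + 1) * d})"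

definition perfect_matchings :: "nat set \<Rightarrow> nat set set set" where
  "perfect_matchings H = {M. partition_on H M \<and> (\<forall>e\<in>M. card e = 2)}"

definition config_model :: "nat \<Rightarrow> nat \<Rightarrow> nat set set pmf" where
  "config_model d n = pmf_of_set (perfect_matchings (half_edges_at d {..<n}))"

text \<open>Asymptotics in \<open>n\<close> are taken along those \<open>n\<close> for which the model exists, i.e. \<open>n * d\<close> even.\<close>

definition admissible :: "nat \<Rightarrow> nat filter" where
  "admissible d = inf sequentially (principal {n. even (n * d)})"

definition whp :: "nat \<Rightarrow> (nat \<Rightarrow> 'a pmf) \<Rightarrow> (nat \<Rightarrow> 'a \<Rightarrow> bool) \<Rightarrow> bool" where
  "whp d p P \<longleftrightarrow>
     ((\<lambda>n. measure_pmf.prob (p n) {x. P n x}) \<longlongrightarrow> 1) (admissible d)"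


definition partner :: "nat set set \<Rightarrow> nat \<Rightarrow> nat" where
  "partner M h = (THE h'. {h, h'} \<in> M)"

definition two_independent :: "nat \<Rightarrow> nat set set \<Rightarrow> nat set \<Rightarrow> bool" where
  "two_independent d M V0 \<longleftrightarrow>
     inj_on (\<lambda>h. partner M h div d) (half_edges_at d V0) \<and>
     (\<forall>h\<in>half_edges_at d V0. partner M h div d \<notin> V0)"

text \<open>A set of ``size \<open>\<alpha> n\<close>'' is one of size \<open>\<lfloor>\<alpha> n\<rfloor>\<close>.\<close>

definition two_ind_sets :: "nat \<Rightarrow> real \<Rightarrow> nat \<Rightarrow> nat set set \<Rightarrow> nat set set" where
  "two_ind_sets d \<alpha> n M =
     {V0. V0 \<subseteq> {..<n} \<and> card V0 = nat \<lfloor>\<alpha> * real n\<rfloor> \<and> two_independent d M V0}"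

definition expected_two_ind_sets :: "nat \<Rightarrow> real \<Rightarrow> nat \<Rightarrow> real" where
  "expected_two_ind_sets d \<alpha> n =
     measure_pmf.expectation (config_model d n) (\<lambda>M. real (card (two_ind_sets d \<alpha> n M)))"

definition two_ind_threshold :: "nat \<Rightarrow> real \<Rightarrow> bool" where
  "two_ind_threshold d a \<longleftrightarrow>
     0 < a \<and> a < 1 / (real d + 1) \<and>
     (\<forall>\<alpha>. 0 < \<alpha> \<and> \<alpha> < a \<longrightarrow>
        (\<exists>c>0. \<forall>\<^sub>F n in admissible d. expected_two_ind_sets d \<alpha> n \<ge> exp (c * real n))) \<and>
     (\<forall>\<alpha>. a < \<alpha> \<longrightarrow>
        (\<exists>c>0. \<forall>\<^sub>F n in admissible d. expected_two_ind_sets d \<alpha> n \<le> exp (- c * real n)))"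

lemma admissible_nontrivial: "admissible d \<noteq> bot"
proof
  assume "admissible d = bot"
  then have "eventually (\<lambda>_. False) (admissible d)"
    by simp
  then obtain N where N: "\<And>n. n \<ge> N \<Longrightarrow> odd (n * d)"
    by (auto simp: admissible_def eventually_inf_principal eventually_sequentially)
  from N[of "2 * N"] show False
    by simp
qed

lemma two_ind_threshold_unique:
  assumes "two_ind_threshold d a" and "two_ind_threshold d b"
  shows "a = b"
proof -
  have False if ab: "two_ind_threshold d a" "two_ind_threshold d b" "a < b" for a b
  proof -
    define \<alpha> where "\<alpha> = (a + b) / 2"
    have \<alpha>: "0 < \<alpha>" "a < \<alpha>" "\<alpha> < b"
      using ab by (auto simp: \<alpha>_def two_ind_threshold_def)
    obtain c where c: "c > 0"
      "\<forall>\<^sub>F n in admissible d. expected_two_ind_sets d \<alpha> n \<ge> exp (c * real n)"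
      using ab(2) \<alpha> unfolding two_ind_threshold_def by blast
    obtain c' where c': "c' > 0"
      "\<forall>\<^sub>F n in admissible d. expected_two_ind_sets d \<alpha> n \<le> exp (- c' * real n)"
      using ab(1) \<alpha> unfolding two_ind_threshold_def by blast
    have "\<forall>\<^sub>F n in admissible d. n > 0"
      unfolding admissible_def eventually_inf_principal
      by (rule eventually_mono[OF eventually_gt_at_top[of 0]]) auto
    with c(2) c'(2) have "\<forall>\<^sub>F n in admissible d. False"
    proof eventually_elim
      case (elim n)
      then have "exp (c * real n) \<le> exp (- c' * real n)"
        by linarith
      then have "c * real n \<le> - c' * real n"
        by simp
      moreover have "c * real n > 0" "c' * real n > 0"
        using c(1) c'(1) elim by simp_all
      ultimately show ?case
        by linarith
    qed
    then show False
      using admissible_nontrivial by (simp add: trivial_limit_def)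
  qed
  then show ?thesis
    using assms by (metis linorder_neqE)
qed

definition two_ind_typical :: "nat \<Rightarrow> real \<Rightarrow> real \<Rightarrow> nat \<Rightarrow> nat set set \<Rightarrow> bool" where
  "two_ind_typical d \<alpha> \<epsilon> n M \<longleftrightarrow>
     real (card (two_ind_sets d \<alpha> n M)) \<ge> exp (- \<epsilon> * real n) * expected_two_ind_sets d \<alpha> n"

text \<open>
  Joint law of the graph and of a uniformly random 2-independent set of it. If the graph has no
  2-independent set of the prescribed size, the second component is unspecified, so events
  of interest have to require it to be a member of \<^const>\<open>two_ind_sets\<close>.
\<close>

definition config_model_two_ind :: "nat \<Rightarrow> real \<Rightarrow> nat \<Rightarrow> (nat set set \<times> nat set) pmf" where
  "config_model_two_ind d \<alpha> n =
     bind_pmf (config_model d n) (\<lambda>M. map_pmf (Pair M) (pmf_of_set (two_ind_sets d \<alpha> n M)))"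


text \<open>
  Computational basis states are indexed by \<open>i < 2 ^ n\<close>; the value of qubit \<open>v\<close> in basis state
  \<open>i\<close> is bit number \<open>v\<close> of \<open>i\<close>.
\<close>

definition pauli_X :: "nat \<Rightarrow> nat \<Rightarrow> complex mat" where
  "pauli_X n v = mat (2 ^ n) (2 ^ n) (\<lambda>(i, j). if i = flip_bit v j then 1 else 0)"

definition pauli_Z :: "nat \<Rightarrow> nat \<Rightarrow> complex mat" where
  "pauli_Z n v = mat (2 ^ n) (2 ^ n) (\<lambda>(i, j). if i = j then (if bit i v then -1 else 1) else 0)"

definition op_sum :: "nat \<Rightarrow> ('a \<Rightarrow> complex mat) \<Rightarrow> 'a set \<Rightarrow> complex mat" where
  "op_sum n A S = mat (2 ^ n) (2 ^ n) (\<lambda>ij. \<Sum>s\<in>S. A s $$ ij)"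

text \<open>Product in increasing order of the index; it is only used for commuting factors.\<close>

definition op_prod :: "nat \<Rightarrow> (nat \<Rightarrow> complex mat) \<Rightarrow> nat set \<Rightarrow> complex mat" where
  "op_prod n A S = foldr (\<lambda>s B. A s * B) (sorted_list_of_set S) (1\<^sub>m (2 ^ n))"

definition op_exp :: "complex mat \<Rightarrow> complex mat" where
  "op_exp A = mat (dim_row A) (dim_col A) (\<lambda>ij. \<Sum>k. (A ^\<^sub>m k) $$ ij / fact k)"

text \<open>\<open>v \<bullet>c w\<close> conjugates its second argument; the real part is taken only to obtain a real number.\<close>

definition quad_form :: "complex vec \<Rightarrow> complex mat \<Rightarrow> real" where
  "quad_form \<psi> A = Re ((A *\<^sub>v \<psi>) \<bullet>c \<psi>)"

definition norm_sq :: "complex vec \<Rightarrow> real" where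
  "norm_sq \<psi> = Re (\<psi> \<bullet>c \<psi>)"


definition edge_ZZ :: "nat \<Rightarrow> nat \<Rightarrow> nat set \<Rightarrow> complex mat" where
  "edge_ZZ d n e = pauli_Z n (Min e div d) * pauli_Z n (Max e div d)"

definition H_MaxCut :: "nat \<Rightarrow> nat \<Rightarrow> nat set set \<Rightarrow> complex mat" where
  "H_MaxCut d n M = op_sum n (\<lambda>e. (1 / 2) \<cdot>\<^sub>m (1\<^sub>m (2 ^ n) - edge_ZZ d n e)) M"

definition plus_state :: "nat \<Rightarrow> complex vec" where
  "plus_state n = vec (2 ^ n) (\<lambda>_. 1 / complex_of_real (sqrt (2 ^ n)))"

definition qaoa_state :: "real \<Rightarrow> real \<Rightarrow> nat \<Rightarrow> nat \<Rightarrow> nat set set \<Rightarrow> complex vec" where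
  "qaoa_state \<beta> \<gamma> d n M =
     op_exp ((- \<i> * complex_of_real \<beta> / 2) \<cdot>\<^sub>m op_sum n (pauli_X n) {..<n}) *\<^sub>v
     (op_exp ((- \<i> * complex_of_real \<gamma> / 2) \<cdot>\<^sub>m op_sum n (edge_ZZ d n) M) *\<^sub>v plus_state n)"

definition psi3 :: "nat \<Rightarrow> nat set set \<Rightarrow> complex vec" where
  "psi3 n M = qaoa_state (- (pi / 4)) (arctan (1 / sqrt 2)) 3 n M"

definition spin_proj :: "nat \<Rightarrow> nat set \<Rightarrow> (nat \<Rightarrow> int) \<Rightarrow> complex mat" where
  "spin_proj n V0 \<sigma> =
     op_prod n (\<lambda>v. (1 / 2) \<cdot>\<^sub>m (1\<^sub>m (2 ^ n) + of_int (\<sigma> v) \<cdot>\<^sub>m pauli_Z n v)) V0"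

definition max_conditional_energy :: "nat \<Rightarrow> nat set set \<Rightarrow> nat set \<Rightarrow> real" where
  "max_conditional_energy n M V0 =
     Max ((\<lambda>\<sigma>. quad_form (psi3 n M) (spin_proj n V0 \<sigma> * H_MaxCut 3 n M * spin_proj n V0 \<sigma>)
                / norm_sq (spin_proj n V0 \<sigma> *\<^sub>v psi3 n M))
          ` (V0 \<rightarrow>\<^sub>E {-1, 1}))"

end

theory Submission
  imports Defs
begin

text \<open>
  For a diagonal observable, the QAOA expectation is a path sum over the ket's spin configuration
  and the set of vertices where the bra differs from it. A measured vertex with outcome \<open>s\<close> can be
  summed out of this path sum; its only trace is a factor \<open>1 - \<kappa> s y\<close> on the spin \<open>y\<close> of one neighbour.
  Hence, wherever \<open>G\<close> is locally a tree, the conditional correlation along an edge has a closed form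
  in the outcomes measured at distance at most two from it. Relative to its unconditional value,
  the energy changes by a quarter of a sum over half-edges of a quadratic form in the outcomes;
  maximising over the outcomes bounds this form by \<open>5/18 X + 1/(9 \<surd>3) Y + 2/243 Z\<close>, where
  \<open>X, Y, Z\<close> count pairs of unmeasured vertices adjacent to \<open>V\<^sub>0\<close> at distance one, two and three. Half-edges
  where \<open>G\<close> is not locally a tree lie near cycles of length at most five, whose expected number
  is bounded in \<open>n\<close>.

  Under the planted law, where \<open>V\<^sub>0\<close> and its edges are fixed first, the other half-edges are matched
  uniformly. The averages of \<open>X, Y, Z\<close> are then explicit, and a martingale argument
  gives exponential concentration. The joint law of the theorem differs from the planted one by the
  weight \<open>E[N] / N(G)\<close>, with \<open>N(G)\<close> the number of 2-independent sets of the given size; on typical graphs this is at most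
  \<open>exp (\<epsilon>' n)\<close>, which exponential concentration absorbs.
\<close>

section \<open>Operators in the computational basis\<close>

text \<open>The maximum runs over exponentially many outcomes \<sigma>, so no probabilistic estimate
  may depend on \<sigma>. Once the energy shift is a quadratic form in the outcomes with constant
  coefficients, absolute values replace every outcome by an indicator of adjacency to
  \<open>V0\<close>, and only this outcome-free count has to concentrate. The two kinds of error
  need different laws. Passing from the planted law to the law of the theorem costs a factor
  \<open>exp (\<epsilon>' n)\<close>, which the exponential tail of the local sum survives but a
  Markov bound for short cycles would not. Short cycles depend on the graph alone, however, so they
  are controlled under the configuration model itself, before any change of measure. Sums run over
  half-edges rather than edges because all double counting then becomes invariance under two maps:
  the cyclic shift \<open>sib\<close> of the half-edges at a vertex and the exchange
  \<open>opp\<close> of the two ends of an edge.\<close>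

definition spin :: "nat set \<Rightarrow> nat \<Rightarrow> complex" where
  "spin Y v = (if v \<in> Y then -1 else 1)"

text \<open>Basis states are replaced by the set of qubits in state 1, so that flipping a qubit is a
  symmetric difference and sums over states are sums over a powerset.\<close>

definition bits :: "nat \<Rightarrow> nat set" where
  "bits i = {v. bit i v}"

definition diag_op :: "nat \<Rightarrow> (nat \<Rightarrow> complex) \<Rightarrow> complex mat" where
  "diag_op n f = mat (2 ^ n) (2 ^ n) (\<lambda>(i, j). if i = j then f i else 0)"

lemma spin_sq [simp]: "spin Y v * spin Y v = 1"
  by (simp add: spin_def)

lemma cnj_spin [simp]: "cnj (spin Y v) = spin Y v"
  by (simp add: spin_def)

lemma bits_subset: "i < 2 ^ n \<Longrightarrow> bits i \<subseteq> {..<n}"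
proof
  fix v assume i: "i < 2 ^ n" and "v \<in> bits i"
  then have b: "bit i v" by (simp add: bits_def)
  show "v \<in> {..<n}"
  proof (rule ccontr)
    assume "v \<notin> {..<n}"
    then have "(2::nat) ^ n \<le> 2 ^ v" by simp
    then have "i < 2 ^ v" using i by (rule less_le_trans[rotated])
    then have "i div 2 ^ v = 0" by simp
    then show False using b by (simp add: bit_iff_odd)
  qed
qed

lemma inj_bits: "inj bits"
  by (auto simp: inj_def bits_def set_eq_iff intro: bit_eqI)

lemma bij_betw_bits: "bij_betw bits {..<2 ^ n} (Pow {..<n})"
proof -
  have inj: "inj_on bits {..<2 ^ n}"
    using inj_bits by (rule inj_on_subset) simp
  have "bits ` {..<2 ^ n} = Pow {..<n}"
  proof (rule card_subset_eq)
    show "bits ` {..<2 ^ n} \<subseteq> Pow {..<n}"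
      using bits_subset by auto
    show "card (bits ` {..<2 ^ n}) = card (Pow {..<n})"
      using inj by (simp add: card_image card_Pow)
  qed simp
  with inj show ?thesis
    by (simp add: bij_betw_def)
qed

lemma sum_bits: "(\<Sum>i<2 ^ n. f (bits i)) = (\<Sum>Y\<in>Pow {..<n}. f Y)"
  by (rule sum.reindex_bij_betw[OF bij_betw_bits])

lemma bits_flip_bit: "bits (flip_bit v i) = sym_diff (bits i) {v}"
  by (auto simp: bits_def bit_flip_bit_iff set_eq_iff)

lemma flip_bit_less: "v < n \<Longrightarrow> i < 2 ^ n \<Longrightarrow> flip_bit v i < (2::nat) ^ n"
proof -
  assume v: "v < n" and i: "i < 2 ^ n"
  have "sym_diff (bits i) {v} \<in> Pow {..<n}"
    using bits_subset[OF i] v by auto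
  then have "bits (flip_bit v i) \<in> bits ` {..<2 ^ n}"
    using bij_betw_bits[of n] by (simp add: bij_betw_def bits_flip_bit)
  then show ?thesis
    using inj_bits by (auto dest: injD)
qed

lemma dim_diag_op [simp]: "dim_row (diag_op n f) = 2 ^ n" "dim_col (diag_op n f) = 2 ^ n"
  by (simp_all add: diag_op_def)

lemma diag_op_carrier [simp]: "diag_op n f \<in> carrier_mat (2 ^ n) (2 ^ n)"
  by (simp add: diag_op_def)

lemma index_diag_op [simp]:
  "i < 2 ^ n \<Longrightarrow> j < 2 ^ n \<Longrightarrow> diag_op n f $$ (i, j) = (if i = j then f i else 0)"
  by (simp add: diag_op_def)

lemma diag_op_mult: "diag_op n f * diag_op n g = diag_op n (\<lambda>i. f i * g i)"
proof (rule eq_matI)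
  fix i j assume "i < dim_row (diag_op n (\<lambda>i. f i * g i))" "j < dim_col (diag_op n (\<lambda>i. f i * g i))"
  then have ij: "i < 2 ^ n" "j < 2 ^ n" by simp_all
  then have "(diag_op n f * diag_op n g) $$ (i, j) =
      (\<Sum>k = 0..<2 ^ n. (if i = k then f i else 0) * (if k = j then g k else 0))"
    by (simp add: scalar_prod_def)
  also have "\<dots> = (\<Sum>k = 0..<2 ^ n. if i = k then f i * (if i = j then g i else 0) else 0)"
    by (rule sum.cong) auto
  also have "\<dots> = diag_op n (\<lambda>i. f i * g i) $$ (i, j)"
    using ij by simp
  finally show "(diag_op n f * diag_op n g) $$ (i, j) = diag_op n (\<lambda>i. f i * g i) $$ (i, j)" .
qed simp_all

lemma diag_op_one: "1\<^sub>m (2 ^ n) = diag_op n (\<lambda>_. 1)"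
  by (rule eq_matI) auto

lemma diag_op_add: "diag_op n f + diag_op n g = diag_op n (\<lambda>i. f i + g i)"
  by (rule eq_matI) auto

lemma diag_op_diff: "diag_op n f - diag_op n g = diag_op n (\<lambda>i. f i - g i)"
  by (rule eq_matI) auto

lemma diag_op_smult: "c \<cdot>\<^sub>m diag_op n f = diag_op n (\<lambda>i. c * f i)"
  by (rule eq_matI) auto

lemma op_sum_diag: "op_sum n (\<lambda>s. diag_op n (f s)) S = diag_op n (\<lambda>i. \<Sum>s\<in>S. f s i)"
  by (rule eq_matI) (auto simp: op_sum_def)

lemma op_prod_diag:
  assumes "finite S"
  shows "op_prod n (\<lambda>s. diag_op n (f s)) S = diag_op n (\<lambda>i. \<Prod>s\<in>S. f s i)"
proof -
  have "foldr (\<lambda>s B. diag_op n (f s) * B) xs (1\<^sub>m (2 ^ n)) = diag_op n (\<lambda>i. \<Prod>s\<leftarrow>xs. f s i)" for xs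
    by (induction xs) (simp_all add: diag_op_one diag_op_mult)
  then show ?thesis
    using assms by (simp add: op_prod_def prod.distinct_set_conv_list[symmetric])
qed

lemma diag_op_pow: "diag_op n f ^\<^sub>m k = diag_op n (\<lambda>i. f i ^ k)"
  by (induction k) (simp_all add: diag_op_one diag_op_mult mult.commute)

lemma op_exp_diag: "op_exp (diag_op n f) = diag_op n (\<lambda>i. exp (f i))"
proof (rule eq_matI)
  fix i j assume "i < dim_row (diag_op n (\<lambda>i. exp (f i)))" "j < dim_col (diag_op n (\<lambda>i. exp (f i)))"
  then have ij: "i < 2 ^ n" "j < 2 ^ n" by simp_all
  show "op_exp (diag_op n f) $$ (i, j) = diag_op n (\<lambda>i. exp (f i)) $$ (i, j)"
    using ij by (simp add: op_exp_def diag_op_pow exp_def scaleR_conv_of_real field_simps)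
qed (simp_all add: op_exp_def)

lemma pauli_Z_diag: "v < n \<Longrightarrow> pauli_Z n v = diag_op n (\<lambda>i. spin (bits i) v)"
  by (rule eq_matI) (auto simp: pauli_Z_def spin_def bits_def)

lemma diag_op_mult_vec:
  assumes "dim_vec \<psi> = 2 ^ n"
  shows "diag_op n f *\<^sub>v \<psi> = vec (2 ^ n) (\<lambda>i. f i * \<psi> $ i)"
proof (rule eq_vecI)
  fix i assume "i < dim_vec (vec (2 ^ n) (\<lambda>i. f i * \<psi> $ i))"
  then have i: "i < 2 ^ n" by simp
  have "(diag_op n f *\<^sub>v \<psi>) $ i = (\<Sum>k = 0..<2 ^ n. (if i = k then f i else 0) * \<psi> $ k)"
    using i assms by (simp add: scalar_prod_def)
  also have "\<dots> = (\<Sum>k = 0..<2 ^ n. if i = k then f i * \<psi> $ i else 0)"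
    by (rule sum.cong) auto
  also have "\<dots> = f i * \<psi> $ i"
    using i by simp
  finally show "(diag_op n f *\<^sub>v \<psi>) $ i = vec (2 ^ n) (\<lambda>i. f i * \<psi> $ i) $ i"
    using i by simp
qed (simp add: assms)

lemma quad_form_diag:
  assumes "dim_vec \<psi> = 2 ^ n"
  shows "quad_form \<psi> (diag_op n f) = (\<Sum>i<2 ^ n. (cmod (\<psi> $ i))\<^sup>2 * Re (f i))"
proof -
  have "(diag_op n f *\<^sub>v \<psi>) \<bullet>c \<psi> = (\<Sum>i<2 ^ n. f i * (\<psi> $ i * cnj (\<psi> $ i)))"
    using assms by (simp add: diag_op_mult_vec scalar_prod_def atLeast0LessThan mult.assoc)
  also have "\<dots> = (\<Sum>i<2 ^ n. f i * of_real ((cmod (\<psi> $ i))\<^sup>2))"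
    by (simp add: complex_norm_square del: of_real_power)
  finally show ?thesis
    by (simp add: quad_form_def mult.commute del: of_real_power)
qed

lemma norm_sq_diag:
  assumes "dim_vec \<psi> = 2 ^ n"
  shows "norm_sq (diag_op n f *\<^sub>v \<psi>) = (\<Sum>i<2 ^ n. (cmod (\<psi> $ i))\<^sup>2 * (cmod (f i))\<^sup>2)"
proof -
  have "(diag_op n f *\<^sub>v \<psi>) \<bullet>c (diag_op n f *\<^sub>v \<psi>) =
      (\<Sum>i<2 ^ n. (f i * \<psi> $ i) * cnj (f i * \<psi> $ i))"
    using assms by (simp add: diag_op_mult_vec scalar_prod_def atLeast0LessThan)
  also have "\<dots> = (\<Sum>i<2 ^ n. of_real ((cmod (f i * \<psi> $ i))\<^sup>2))"
    by (simp only: complex_norm_square)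
  finally show ?thesis
    by (simp add: norm_sq_def norm_mult power_mult_distrib mult.commute del: of_real_power)
qed

section \<open>Walsh characters and the exponential of the transverse field\<close>

definition character :: "nat set \<Rightarrow> nat set \<Rightarrow> complex" where
  "character K Y = (\<Prod>v\<in>K. spin Y v)"

lemma sum_Pow_prod:
  fixes f g :: "nat \<Rightarrow> complex"
  assumes "finite V"
  shows "(\<Sum>Y\<in>Pow V. \<Prod>v\<in>V. if v \<in> Y then f v else g v) = (\<Prod>v\<in>V. f v + g v)"
proof -
  have "(\<Prod>v\<in>V. if v \<in> Y then f v else g v) = (\<Prod>v\<in>Y. f v) * (\<Prod>v\<in>V - Y. g v)" if "Y \<in> Pow V" for Y
  proof -
    have "(\<Prod>v\<in>V. if v \<in> Y then f v else g v) =
        (\<Prod>v\<in>V \<inter> {v. v \<in> Y}. f v) * (\<Prod>v\<in>V \<inter> - {v. v \<in> Y}. g v)"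
      using assms by (rule prod.If_cases)
    also have "V \<inter> {v. v \<in> Y} = Y"
      using that by auto
    also have "V \<inter> - {v. v \<in> Y} = V - Y"
      by auto
    finally show ?thesis .
  qed
  then show ?thesis
    using assms by (simp add: prod_add)
qed

text \<open>The sum over \<open>K\<close> factorises over the vertices, and a vertex where
  \<open>I\<close> and \<open>J\<close> differ contributes 1 - 1 = 0.\<close>

lemma character_orthogonal:
  assumes "I \<subseteq> {..<n}" "J \<subseteq> {..<n}"
  shows "(\<Sum>K\<in>Pow {..<n}. character K I * character K J) = (if I = J then 2 ^ n else 0)"
proof -
  have "character K I * character K J = (\<Prod>v<n. if v \<in> K then spin I v * spin J v else 1)"
    if "K \<in> Pow {..<n}" for K
    using that by (simp add: character_def prod.distrib[symmetric] prod.If_cases Int_absorb1 Int_absorb2)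
  then have "(\<Sum>K\<in>Pow {..<n}. character K I * character K J) = (\<Prod>v<n. spin I v * spin J v + 1)"
    by (simp add: sum_Pow_prod)
  also have "\<dots> = (if I = J then 2 ^ n else 0)"
  proof (cases "I = J")
    case False
    then obtain v where "(v \<in> I) \<noteq> (v \<in> J)" by auto
    moreover from this have "v < n" using assms by auto
    ultimately have "\<exists>v\<in>{..<n}. spin I v * spin J v + 1 = 0"
      by (auto simp: spin_def)
    then show ?thesis using False by (simp add: prod_zero_iff)
  qed simp
  finally show ?thesis .
qed

text \<open>The eigenvalue equation of \<open>pauli_X\<close>: the character of \<open>K\<close> is
  an eigenvector for vertex \<open>v\<close> with eigenvalue \<open>spin K v\<close>.\<close>

lemma character_flip:
  "finite K \<Longrightarrow> character K (sym_diff Y {v}) = spin K v * character K Y"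
proof -
  assume K: "finite K"
  show ?thesis
  proof (cases "v \<in> K")
    case True
    have "character K (sym_diff Y {v}) = spin (sym_diff Y {v}) v * (\<Prod>w\<in>K - {v}. spin (sym_diff Y {v}) w)"
      unfolding character_def using K True by (rule prod.remove)
    also have "(\<Prod>w\<in>K - {v}. spin (sym_diff Y {v}) w) = (\<Prod>w\<in>K - {v}. spin Y w)"
      by (rule prod.cong) (auto simp: spin_def)
    also have "spin (sym_diff Y {v}) v = - spin Y v"
      by (auto simp: spin_def)
    finally have "character K (sym_diff Y {v}) = - character K Y"
      using prod.remove[OF K True, of "spin Y"] by (simp add: character_def)
    then show ?thesis using True by (simp add: spin_def)
  next
    case False
    have "character K (sym_diff Y {v}) = character K Y"
      unfolding character_def by (rule prod.cong) (use False in \<open>auto simp: spin_def\<close>)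
    then show ?thesis using False by (simp add: spin_def)
  qed
qed

lemma dim_op_sum [simp]: "dim_row (op_sum n A S) = 2 ^ n" "dim_col (op_sum n A S) = 2 ^ n"
  by (simp_all add: op_sum_def)

text \<open>Spectral decomposition in the character basis, where the field has eigenvalue
  \<open>\<theta> * (\<Sum>v<n. spin K v)\<close>. It is stated entrywise because
  \<open>op_exp\<close> is an entrywise series; the induction step moves one bit flip onto the
  second character.\<close>

lemma transverse_field_power:
  assumes "i < 2 ^ n" "j < 2 ^ n"
  shows "((\<theta> \<cdot>\<^sub>m op_sum n (pauli_X n) {..<n}) ^\<^sub>m k) $$ (i, j) =
    (\<Sum>K\<in>Pow {..<n}. character K (bits i) * character K (bits j) * (\<theta> * (\<Sum>v<n. spin K v)) ^ k) / 2 ^ n"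
  using assms(2)
proof (induction k arbitrary: j)
  case 0
  have "(bits i = bits j) = (i = j)"
    using inj_bits by (auto dest: injD)
  with 0 assms show ?case
    by (simp add: character_orthogonal bits_subset op_sum_def)
next
  case (Suc k)
  let ?A = "\<theta> \<cdot>\<^sub>m op_sum n (pauli_X n) {..<n}"
  have car: "?A \<in> carrier_mat (2 ^ n) (2 ^ n)"
    by (simp add: op_sum_def)
  have Ak: "?A ^\<^sub>m k \<in> carrier_mat (2 ^ n) (2 ^ n)"
    using car by (rule pow_carrier_mat)
  have entry: "?A $$ (l, j) = (\<Sum>v<n. if l = flip_bit v j then \<theta> else 0)" if "l < 2 ^ n" for l
    using that Suc.prems by (simp add: op_sum_def pauli_X_def sum_distrib_left if_distrib cong: if_cong)
  have "(?A ^\<^sub>m Suc k) $$ (i, j) = (\<Sum>l<2 ^ n. (?A ^\<^sub>m k) $$ (i, l) * ?A $$ (l, j))"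
    using carrier_matD[OF car] carrier_matD[OF Ak] Suc.prems assms(1)
    by (simp add: scalar_prod_def atLeast0LessThan)
  also have "\<dots> = (\<Sum>l<2 ^ n. \<Sum>v<n. if l = flip_bit v j then (?A ^\<^sub>m k) $$ (i, l) * \<theta> else 0)"
    by (simp add: entry sum_distrib_left if_distrib cong: if_cong)
  also have "\<dots> = (\<Sum>v<n. \<Sum>l<2 ^ n. if l = flip_bit v j then (?A ^\<^sub>m k) $$ (i, l) * \<theta> else 0)"
    by (rule sum.swap)
  also have "\<dots> = (\<Sum>v<n. (?A ^\<^sub>m k) $$ (i, flip_bit v j) * \<theta>)"
    using Suc.prems by (intro sum.cong) (simp_all add: flip_bit_less)
  also have "\<dots> = (\<Sum>v<n. \<Sum>K\<in>Pow {..<n}. character K (bits i) * character K (bits j) *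
      (\<theta> * (\<Sum>v<n. spin K v)) ^ k * (\<theta> * spin K v) / 2 ^ n)"
  proof (rule sum.cong[OF refl])
    fix v assume "v \<in> {..<n}"
    then have "flip_bit v j < 2 ^ n"
      using Suc.prems by (simp add: flip_bit_less)
    from Suc.IH[OF this] show "(?A ^\<^sub>m k) $$ (i, flip_bit v j) * \<theta> =
      (\<Sum>K\<in>Pow {..<n}. character K (bits i) * character K (bits j) *
        (\<theta> * (\<Sum>v<n. spin K v)) ^ k * (\<theta> * spin K v) / 2 ^ n)"
      by (simp add: sum_divide_distrib sum_distrib_right bits_flip_bit)
        (rule sum.cong, auto simp: character_flip[OF finite_subset[OF _ finite_lessThan]])
  qed
  also have "\<dots> = (\<Sum>K\<in>Pow {..<n}. \<Sum>v<n. character K (bits i) * character K (bits j) *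
      (\<theta> * (\<Sum>v<n. spin K v)) ^ k * (\<theta> * spin K v) / 2 ^ n)"
    by (rule sum.swap)
  also have "\<dots> = (\<Sum>K\<in>Pow {..<n}. character K (bits i) * character K (bits j) *
      (\<theta> * (\<Sum>v<n. spin K v)) ^ Suc k) / 2 ^ n"
  proof -
    have "(\<Sum>v<n. a * t ^ k * (\<theta> * spin K v) / 2 ^ n) = a * t ^ Suc k / 2 ^ n"
      if "t = \<theta> * (\<Sum>v<n. spin K v)" for a t K
      by (simp add: sum_distrib_left[symmetric] sum_divide_distrib[symmetric] that[symmetric])
    then show ?thesis by (simp add: sum_divide_distrib)
  qed
  finally show ?case .
qed

text \<open>The exponential of a sum of eigenvalues is a product over vertices, so the sum over
  \<open>K\<close> factorises: every vertex contributes an entry of the exponential of \<theta> X,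
  namely cosh \<theta> if its bit is kept and sinh \<theta> if it is flipped.\<close>

lemma op_exp_transverse_field:
  assumes "i < 2 ^ n" "j < 2 ^ n"
  shows "op_exp (\<theta> \<cdot>\<^sub>m op_sum n (pauli_X n) {..<n}) $$ (i, j) =
    (\<Prod>v<n. if (v \<in> bits i) = (v \<in> bits j) then (exp \<theta> + exp (- \<theta>)) / 2 else (exp \<theta> - exp (- \<theta>)) / 2)"
proof -
  have "(\<lambda>k. (\<Sum>K\<in>Pow {..<n}. character K (bits i) * character K (bits j) *
      (\<theta> * (\<Sum>v<n. spin K v)) ^ k) / 2 ^ n / fact k) sums
    ((\<Sum>K\<in>Pow {..<n}. character K (bits i) * character K (bits j) * exp (\<theta> * (\<Sum>v<n. spin K v))) / 2 ^ n)"
  proof -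
    have "(\<lambda>k. (\<Sum>K\<in>Pow {..<n}. character K (bits i) * character K (bits j) / 2 ^ n *
        ((\<theta> * (\<Sum>v<n. spin K v)) ^ k /\<^sub>R fact k))) sums
      (\<Sum>K\<in>Pow {..<n}. character K (bits i) * character K (bits j) / 2 ^ n * exp (\<theta> * (\<Sum>v<n. spin K v)))"
      by (intro sums_sum sums_mult exp_converges)
    then show ?thesis
      by (simp add: sum_divide_distrib scaleR_conv_of_real field_simps)
  qed
  then have "op_exp (\<theta> \<cdot>\<^sub>m op_sum n (pauli_X n) {..<n}) $$ (i, j) =
    (\<Sum>K\<in>Pow {..<n}. character K (bits i) * character K (bits j) * exp (\<theta> * (\<Sum>v<n. spin K v))) / 2 ^ n"
    using assms
    by (simp only: op_exp_def index_mat transverse_field_power index_smult_mat dim_op_sum case_prod_conv sums_iff)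
  also have "(\<Sum>K\<in>Pow {..<n}. character K (bits i) * character K (bits j) * exp (\<theta> * (\<Sum>v<n. spin K v))) =
    (\<Sum>K\<in>Pow {..<n}. \<Prod>v<n. if v \<in> K then spin (bits i) v * spin (bits j) v * exp (- \<theta>) else exp \<theta>)"
  proof (rule sum.cong[OF refl])
    fix K assume "K \<in> Pow {..<n}"
    then have ch: "character K Y = (\<Prod>v<n. if v \<in> K then spin Y v else 1)" for Y
      by (simp add: character_def prod.If_cases Int_absorb1)
    have "exp (\<theta> * (\<Sum>v<n. spin K v)) = (\<Prod>v<n. exp (\<theta> * spin K v))"
      by (simp add: sum_distrib_left exp_sum)
    then show "character K (bits i) * character K (bits j) * exp (\<theta> * (\<Sum>v<n. spin K v)) =
      (\<Prod>v<n. if v \<in> K then spin (bits i) v * spin (bits j) v * exp (- \<theta>) else exp \<theta>)"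
      by (simp add: ch prod.distrib[symmetric]) (rule prod.cong, auto simp: spin_def)
  qed
  also have "\<dots> = (\<Prod>v<n. spin (bits i) v * spin (bits j) v * exp (- \<theta>) + exp \<theta>)"
    by (simp add: sum_Pow_prod)
  also have "\<dots> / 2 ^ n = (\<Prod>v<n. (spin (bits i) v * spin (bits j) v * exp (- \<theta>) + exp \<theta>) / 2)"
    by (simp add: prod_dividef)
  also have "\<dots> = (\<Prod>v<n. if (v \<in> bits i) = (v \<in> bits j) then (exp \<theta> + exp (- \<theta>)) / 2 else (exp \<theta> - exp (- \<theta>)) / 2)"
    by (rule prod.cong) (auto simp: spin_def)
  finally show ?thesis .
qed

section \<open>Perfect matchings\<close>

lemma perfect_matchings_disjoint:
  "M \<in> perfect_matchings H \<Longrightarrow> e \<in> M \<Longrightarrow> e' \<in> M \<Longrightarrow> x \<in> e \<Longrightarrow> x \<in> e' \<Longrightarrow> e = e'"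
  unfolding perfect_matchings_def partition_on_def disjoint_def by blast

lemma perfect_matchings_Union: "M \<in> perfect_matchings H \<Longrightarrow> \<Union>M = H"
  by (auto simp: perfect_matchings_def partition_on_def)

lemma perfect_matchings_card: "M \<in> perfect_matchings H \<Longrightarrow> e \<in> M \<Longrightarrow> card e = 2"
  by (auto simp: perfect_matchings_def)

lemma partner_eqI:
  assumes "M \<in> perfect_matchings H" "{h, h'} \<in> M"
  shows "partner M h = h'"
  unfolding partner_def
proof (rule the_equality)
  fix x assume "{h, x} \<in> M"
  then have "{h, x} = {h, h'}"
    using assms perfect_matchings_disjoint[of M H "{h, x}" "{h, h'}" h] by auto
  then show "x = h'"
    by (auto simp: doubleton_eq_iff)
qed fact

lemma partner_props:
  assumes "M \<in> perfect_matchings H" "h \<in> H"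
  shows "{h, partner M h} \<in> M" "partner M h \<noteq> h" "partner M h \<in> H" "partner M (partner M h) = h"
proof -
  obtain e where e: "e \<in> M" "h \<in> e"
    using assms perfect_matchings_Union by blast
  then obtain h' where h': "e = {h, h'}" "h \<noteq> h'"
    using perfect_matchings_card[OF assms(1) e(1)] by (auto simp: card_2_iff)
  then have p: "partner M h = h'" "partner M h' = h"
    using partner_eqI assms(1) e(1) by (auto simp: insert_commute)
  show "{h, partner M h} \<in> M" "partner M h \<noteq> h" "partner M h \<in> H" "partner M (partner M h) = h"
    using p h' e(1) perfect_matchings_Union[OF assms(1)] by auto
qed

lemma edge_obtain:
  assumes "M \<in> perfect_matchings H" "e \<in> M"
  obtains h where "h \<in> H" "e = {h, partner M h}" "partner M h \<noteq> h"
proof -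
  obtain h h' where e: "e = {h, h'}" "h \<noteq> h'"
    using perfect_matchings_card[OF assms] by (auto simp: card_2_iff)
  then have "partner M h = h'" using assms partner_eqI by blast
  moreover have "h \<in> H" using perfect_matchings_Union[OF assms(1)] assms(2) e by auto
  ultimately show ?thesis using e that by auto
qed

lemma finite_matching: "finite H \<Longrightarrow> M \<in> perfect_matchings H \<Longrightarrow> finite M"
  using perfect_matchings_Union finite_UnionD by blast

lemma prod_half_edges:
  fixes F :: "nat \<Rightarrow> complex"
  assumes "M \<in> perfect_matchings H"
  shows "(\<Prod>h\<in>H. F h) = (\<Prod>e\<in>M. \<Prod>h\<in>e. F h)"
proof -
  have "prod F (\<Union>M) = (prod \<circ> prod) F M"
  proof (rule prod.Union_disjoint)
    show "\<forall>A\<in>M. finite A"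
      using perfect_matchings_card[OF assms] by (auto intro!: card_ge_0_finite)
    show "\<forall>A\<in>M. \<forall>B\<in>M. A \<noteq> B \<longrightarrow> A \<inter> B = {}"
      using perfect_matchings_disjoint[OF assms] by blast
  qed
  then show ?thesis
    using perfect_matchings_Union[OF assms] by simp
qed

lemma sum_half_edges:
  fixes F :: "nat \<Rightarrow> complex"
  assumes "M \<in> perfect_matchings H"
  shows "(\<Sum>h\<in>H. F h) = (\<Sum>e\<in>M. \<Sum>h\<in>e. F h)"
proof -
  have "sum F (\<Union>M) = (sum \<circ> sum) F M"
  proof (rule sum.Union_disjoint)
    show "\<forall>A\<in>M. finite A"
      using perfect_matchings_card[OF assms] by (auto intro!: card_ge_0_finite)
    show "\<forall>A\<in>M. \<forall>B\<in>M. A \<noteq> B \<longrightarrow> A \<inter> B = {}"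
      using perfect_matchings_disjoint[OF assms] by blast
  qed
  then show ?thesis
    using perfect_matchings_Union[OF assms] by simp
qed

lemma half_edges_at_lessThan: "half_edges_at 3 {..<n} = {..<3 * n}"
proof
  show "{..<3 * n} \<subseteq> half_edges_at 3 {..<n}"
  proof
    fix h assume "h \<in> {..<3 * n}"
    then have "h div 3 < n" "h \<in> {h div 3 * 3..<(h div 3 + 1) * 3}" by auto
    then show "h \<in> half_edges_at 3 {..<n}" unfolding half_edges_at_def by blast
  qed
qed (auto simp: half_edges_at_def)

lemma half_edges_at_iff: "h \<in> half_edges_at 3 W \<longleftrightarrow> h div 3 \<in> W"
proof
  assume "h div 3 \<in> W"
  moreover have "h \<in> {h div 3 * 3..<(h div 3 + 1) * 3}" by auto
  ultimately show "h \<in> half_edges_at 3 W" unfolding half_edges_at_def by blast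
next
  assume "h \<in> half_edges_at 3 W"
  then obtain v where v: "v \<in> W" "v * 3 \<le> h" "h < (v + 1) * 3"
    by (auto simp: half_edges_at_def)
  then have "h div 3 = v" by auto
  then show "h div 3 \<in> W" using v by simp
qed

section \<open>Amplitudes and weighted statistics\<close>

text \<open>Minimum and maximum mirror the arbitrary ordering in \<open>edge_ZZ\<close>; for a loop
  both ends are the same vertex and the value is 1.\<close>

definition edge_spins :: "nat set \<Rightarrow> nat set \<Rightarrow> complex" where
  "edge_spins e Y = spin Y (Min e div 3) * spin Y (Max e div 3)"

lemma edge_spins_pair: "edge_spins {h, h'} Y = spin Y (h div 3) * spin Y (h' div 3)"
  by (cases "h \<le> h'") (simp_all add: edge_spins_def min_def max_def)

text \<open>Entries of the product over all vertices of the exponential of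
  \<open>\<i> * pi / 8\<close> times X; the angle is - \<beta> / 2 for \<beta> = - pi / 4.\<close>

definition mixer_amp :: "nat \<Rightarrow> nat set \<Rightarrow> nat set \<Rightarrow> complex" where
  "mixer_amp n X Y =
     (\<Prod>v<n. if (v \<in> X) = (v \<in> Y) then complex_of_real (cos (pi / 8)) else \<i> * complex_of_real (sin (pi / 8)))"

definition phase_amp :: "nat set set \<Rightarrow> nat set \<Rightarrow> complex" where
  "phase_amp M Y = exp ((- \<i> * complex_of_real (arctan (1 / sqrt 2)) / 2) * (\<Sum>e\<in>M. edge_spins e Y))"

definition amp :: "nat \<Rightarrow> nat set set \<Rightarrow> nat set \<Rightarrow> complex" where
  "amp n M X = (\<Sum>Y\<in>Pow {..<n}. mixer_amp n X Y * phase_amp M Y) / complex_of_real (sqrt (2 ^ n))"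

text \<open>Cosine and sine of \<gamma> = arctan (1 / sqrt 2). A cut edge carries the full angle
  \<gamma>, half of it from the ket and half from the bra.\<close>

definition cos_ph :: complex where "cos_ph = complex_of_real (sqrt (2 / 3))"
definition sin_ph :: complex where "sin_ph = complex_of_real (1 / sqrt 3)"

lemma cos_ph_sq: "cos_ph * cos_ph = 2 / 3"
  by (simp add: cos_ph_def flip: of_real_mult)

lemma sin_ph_sq: "sin_ph * sin_ph = 1 / 3"
  by (simp add: sin_ph_def flip: of_real_mult)

text \<open>The common value of cosine and sine at pi / 4, twice the angle in
  \<open>mixer_amp\<close>.\<close>

definition rt2 :: complex where "rt2 = complex_of_real (1 / sqrt 2)"

lemma rt2_sq: "rt2 * rt2 = 1 / 2"
  by (simp add: rt2_def flip: of_real_mult)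

lemma op_sum_cong: "(\<And>s. s \<in> S \<Longrightarrow> A s = B s) \<Longrightarrow> op_sum n A S = op_sum n B S"
  by (auto simp: op_sum_def)

lemma op_prod_cong:
  assumes "finite S" "\<And>s. s \<in> S \<Longrightarrow> A s = B s"
  shows "op_prod n A S = op_prod n B S"
  unfolding op_prod_def by (rule foldr_cong) (use assms in auto)

section \<open>Amplitudes of the QAOA state on a 3-regular multigraph\<close>

locale cubic_multigraph =
  fixes n :: nat and M :: "nat set set"
  assumes matching: "M \<in> perfect_matchings (half_edges_at 3 {..<n})"
begin

definition opp :: "nat \<Rightarrow> nat" where "opp = partner M"

lemma matching': "M \<in> perfect_matchings {..<3 * n}"
  using matching by (simp add: half_edges_at_lessThan)

lemma opp_props:
  assumes "h < 3 * n"
  shows "{h, opp h} \<in> M" "opp h \<noteq> h" "opp h < 3 * n" "opp (opp h) = h"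
  using partner_props[OF matching', of h] assms by (auto simp: opp_def)

lemma edge_cases:
  assumes "e \<in> M"
  obtains h where "h < 3 * n" "e = {h, opp h}" "opp h \<noteq> h"
  using edge_obtain[OF matching' assms] by (auto simp: opp_def)

lemma finite_M [simp]: "finite M"
  using finite_matching[OF _ matching'] by simp

lemma edge_ZZ_diag: "e \<in> M \<Longrightarrow> edge_ZZ 3 n e = diag_op n (\<lambda>i. edge_spins e (bits i))"
proof -
  assume "e \<in> M"
  then obtain h where h: "h < 3 * n" "e = {h, opp h}" "opp h \<noteq> h" by (rule edge_cases)
  then have "opp h < 3 * n" by (simp add: opp_props)
  then have "Min e div 3 < n" "Max e div 3 < n" using h by (auto simp: min_def max_def)
  then show ?thesis
    by (simp add: edge_ZZ_def pauli_Z_diag diag_op_mult edge_spins_def)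
qed

lemma H_MaxCut_diag: "H_MaxCut 3 n M = diag_op n (\<lambda>i. \<Sum>e\<in>M. (1 / 2) * (1 - edge_spins e (bits i)))"
proof -
  have "H_MaxCut 3 n M = op_sum n (\<lambda>e. diag_op n (\<lambda>i. (1 / 2) * (1 - edge_spins e (bits i)))) M"
    unfolding H_MaxCut_def
    by (rule op_sum_cong) (simp add: edge_ZZ_diag diag_op_one diag_op_diff diag_op_smult)
  then show ?thesis by (simp add: op_sum_diag)
qed

lemma phase_op:
  "op_exp ((- \<i> * complex_of_real (arctan (1 / sqrt 2)) / 2) \<cdot>\<^sub>m op_sum n (edge_ZZ 3 n) M) =
    diag_op n (\<lambda>i. phase_amp M (bits i))"
proof -
  have "op_sum n (edge_ZZ 3 n) M = diag_op n (\<lambda>i. \<Sum>e\<in>M. edge_spins e (bits i))"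
    by (subst op_sum_diag[symmetric], rule op_sum_cong) (simp add: edge_ZZ_diag)
  then show ?thesis
    by (simp add: diag_op_smult op_exp_diag phase_amp_def)
qed

lemma spin_proj_diag:
  assumes "V0 \<subseteq> {..<n}"
  shows "spin_proj n V0 \<sigma> = diag_op n (\<lambda>i. \<Prod>v\<in>V0. (1 / 2) * (1 + of_int (\<sigma> v) * spin (bits i) v))"
proof -
  have fin: "finite V0" using assms finite_subset by blast
  have "spin_proj n V0 \<sigma> = op_prod n (\<lambda>v. diag_op n (\<lambda>i. (1 / 2) * (1 + of_int (\<sigma> v) * spin (bits i) v))) V0"
    unfolding spin_proj_def
    by (rule op_prod_cong[OF fin]) (use assms in \<open>auto simp: pauli_Z_diag diag_op_one diag_op_smult diag_op_add\<close>)
  then show ?thesis using fin by (simp add: op_prod_diag)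
qed

lemma mixer_entry:
  assumes "i < 2 ^ n" "j < 2 ^ n"
  shows "op_exp ((- \<i> * complex_of_real (- (pi / 4)) / 2) \<cdot>\<^sub>m op_sum n (pauli_X n) {..<n}) $$ (i, j) =
    mixer_amp n (bits i) (bits j)"
proof -
  have th: "- \<i> * complex_of_real (- (pi / 4)) / 2 = \<i> * complex_of_real (pi / 8)"
    by simp
  have "(exp (\<i> * complex_of_real (pi / 8)) + exp (- (\<i> * complex_of_real (pi / 8)))) / 2 = complex_of_real (cos (pi / 8))"
    unfolding cos_of_real[symmetric] cos_exp_eq by simp
  moreover have "(exp (\<i> * complex_of_real (pi / 8)) - exp (- (\<i> * complex_of_real (pi / 8)))) / 2 = \<i> * complex_of_real (sin (pi / 8))"
    unfolding sin_of_real[symmetric] sin_exp_eq by (simp add: field_simps)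
  ultimately show ?thesis
    unfolding th op_exp_transverse_field[OF assms] mixer_amp_def by (simp only:)
qed

lemma dim_psi3 [simp]: "dim_vec (psi3 n M) = 2 ^ n"
  by (simp add: psi3_def qaoa_state_def op_exp_def op_sum_def)

lemma psi3_entry:
  assumes "i < 2 ^ n"
  shows "psi3 n M $ i = amp n M (bits i)"
proof -
  let ?U = "op_exp ((- \<i> * complex_of_real (- (pi / 4)) / 2) \<cdot>\<^sub>m op_sum n (pauli_X n) {..<n})"
  let ?w = "vec (2 ^ n) (\<lambda>j. phase_amp M (bits j) * (1 / complex_of_real (sqrt (2 ^ n))))"
  have U: "dim_row ?U = 2 ^ n" "dim_col ?U = 2 ^ n"
    by (simp_all add: op_exp_def op_sum_def)
  have "psi3 n M = ?U *\<^sub>v ?w"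
    unfolding psi3_def qaoa_state_def phase_op
    by (rule arg_cong2[where f = "(*\<^sub>v)", OF refl], subst diag_op_mult_vec)
      (auto simp: plus_state_def intro!: eq_vecI)
  then have "psi3 n M $ i = (\<Sum>j<2 ^ n. ?U $$ (i, j) * (phase_amp M (bits j) * (1 / complex_of_real (sqrt (2 ^ n)))))"
    using assms U by (simp add: scalar_prod_def atLeast0LessThan)
  also have "\<dots> = (\<Sum>j<2 ^ n. mixer_amp n (bits i) (bits j) * phase_amp M (bits j) / complex_of_real (sqrt (2 ^ n)))"
    by (rule sum.cong[OF refl], subst mixer_entry) (use assms in auto)
  also have "\<dots> = amp n M (bits i)"
    by (simp add: sum_bits[of "\<lambda>Y. mixer_amp n (bits i) Y * phase_amp M Y / complex_of_real (sqrt (2 ^ n))"]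
        amp_def sum_divide_distrib)
  finally show ?thesis .
qed

text \<open>The expectation of a product observable with factor \<open>p v + q v * Z\<close> at
  \<open>v\<close>. The pair (1, 0) ignores a vertex, (0, 1) inserts Z there, and (1, \<sigma>) is
  twice the projector onto outcome \<sigma>.\<close>

definition stat :: "(nat \<Rightarrow> complex) \<Rightarrow> (nat \<Rightarrow> complex) \<Rightarrow> complex" where
  "stat p q = (\<Sum>X\<in>Pow {..<n}. of_real ((cmod (amp n M X))\<^sup>2) * (\<Prod>v<n. p v + q v * spin X v))"

text \<open>
  The doubled path sum: \<open>Y\<close> is the spin configuration of the ket, \<open>R\<close> the set of vertices where
  the bra differs from it, and only edges with exactly one end in \<open>R\<close> contribute a phase.
\<close>

definition cut_weight :: "nat set \<Rightarrow> nat set \<Rightarrow> complex" where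
  "cut_weight R Y = (\<Prod>h<3 * n. if h div 3 \<in> R \<and> opp h div 3 \<notin> R
     then cos_ph - \<i> * sin_ph * spin Y (h div 3) * spin Y (opp h div 3) else 1)"

text \<open>\<open>D v\<close> is the weight of a vertex where bra and ket agree, \<open>Q v\<close>
  of one where they differ, both as functions of the ket's spin. Keeping them arbitrary lets
  measured vertices be eliminated one at a time.\<close>

definition path_sum :: "(nat \<Rightarrow> complex \<Rightarrow> complex) \<Rightarrow> (nat \<Rightarrow> complex \<Rightarrow> complex) \<Rightarrow> complex" where
  "path_sum D Q = (\<Sum>Y\<in>Pow {..<n}. \<Sum>R\<in>Pow {..<n}.
     (\<Prod>v<n. if v \<in> R then Q v (spin Y v) else D v (spin Y v)) * cut_weight R Y) / 2 ^ n"

lemma exp_gamma: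
  assumes "x = 1 \<or> x = -1"
  shows "exp (- (\<i> * complex_of_real (arctan (1 / sqrt 2)) * x)) = cos_ph - \<i> * sin_ph * x"
proof -
  have "sqrt (1 + (1 / sqrt 2)\<^sup>2) = sqrt 3 / sqrt 2"
    by (simp add: power_divide real_sqrt_divide[symmetric])
  then have cs: "cos (arctan (1 / sqrt 2)) = sqrt (2 / 3)" "sin (arctan (1 / sqrt 2)) = 1 / sqrt 3"
    by (simp_all add: cos_arctan sin_arctan real_sqrt_divide)
  have "exp (\<i> * complex_of_real t) = complex_of_real (cos t) + \<i> * complex_of_real (sin t)" for t
    using cis_conv_exp[of t] by (simp add: complex_eq_iff)
  from this[of "arctan (1 / sqrt 2)"] this[of "- arctan (1 / sqrt 2)"] show ?thesis
    using assms by (auto simp: cs cos_ph_def sin_ph_def)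
qed

text \<open>The phases of bra and ket cancel on an edge with both or no ends in \<open>R\<close>; on
  a cut edge the spin product changes sign and the two half phases add up to the angle \<gamma>.
  Demanding that the half-edge starts inside \<open>R\<close> picks each cut edge exactly
  once.\<close>

lemma phase_ratio:
  assumes "R \<subseteq> {..<n}"
  shows "phase_amp M Y * cnj (phase_amp M (sym_diff Y R)) = cut_weight R Y"
proof -
  let ?Y = "sym_diff Y R" and ?g = "complex_of_real (arctan (1 / sqrt 2))"
  have sp: "spin ?Y v = (if v \<in> R then - spin Y v else spin Y v)" for v
    by (auto simp: spin_def)
  have "phase_amp M Y * cnj (phase_amp M ?Y) =
      exp (\<Sum>e\<in>M. - (\<i> * ?g) * ((edge_spins e Y - edge_spins e ?Y) / 2))"
  proof -
    have "cnj (\<Sum>e\<in>M. edge_spins e Z) = (\<Sum>e\<in>M. edge_spins e Z)" for Z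
      by (simp add: edge_spins_def)
    then show ?thesis
      unfolding phase_amp_def exp_cnj exp_add[symmetric] sum_distrib_left[symmetric] sum_divide_distrib[symmetric] sum_subtractf
      by (simp add: algebra_simps diff_divide_distrib)
  qed
  also have "\<dots> = (\<Prod>e\<in>M. exp (- (\<i> * ?g) * ((edge_spins e Y - edge_spins e ?Y) / 2)))"
    by (simp only: exp_sum finite_M)
  also have "\<dots> = (\<Prod>e\<in>M. \<Prod>h\<in>e. if h div 3 \<in> R \<and> opp h div 3 \<notin> R
     then cos_ph - \<i> * sin_ph * spin Y (h div 3) * spin Y (opp h div 3) else 1)"
  proof (rule prod.cong[OF refl])
    fix e assume "e \<in> M"
    then obtain h where h: "h < 3 * n" "e = {h, opp h}" "opp h \<noteq> h" by (rule edge_cases)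
    let ?x = "spin Y (h div 3) * spin Y (opp h div 3)"
    have x: "?x = 1 \<or> ?x = -1" by (auto simp: spin_def)
    show "exp (- (\<i> * ?g) * ((edge_spins e Y - edge_spins e ?Y) / 2)) =
      (\<Prod>h\<in>e. if h div 3 \<in> R \<and> opp h div 3 \<notin> R
         then cos_ph - \<i> * sin_ph * spin Y (h div 3) * spin Y (opp h div 3) else 1)"
      using h exp_gamma[OF x] opp_props(4)[OF h(1)]
      by (auto simp: edge_spins_pair sp mult_ac)
  qed
  also have "\<dots> = cut_weight R Y"
    unfolding cut_weight_def by (rule prod_half_edges[OF matching', symmetric])
  finally show ?thesis .
qed

lemma half_angles:
  "complex_of_real (cos (pi / 8)) * complex_of_real (cos (pi / 8)) + complex_of_real (sin (pi / 8)) * complex_of_real (sin (pi / 8)) = 1"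
  "complex_of_real (cos (pi / 8)) * complex_of_real (cos (pi / 8)) - complex_of_real (sin (pi / 8)) * complex_of_real (sin (pi / 8)) = rt2"
  "2 * (complex_of_real (cos (pi / 8)) * complex_of_real (sin (pi / 8))) = rt2"
proof -
  have rt: "1 / sqrt 2 = sqrt 2 / 2" by (simp add: field_simps)
  have dbl: "cos (pi / 8 + pi / 8) = sqrt 2 / 2" "sin (pi / 8 + pi / 8) = sqrt 2 / 2"
    using cos_45 sin_45 by simp_all
  have 1: "cos (pi / 8) * cos (pi / 8) + sin (pi / 8) * sin (pi / 8) = 1"
    using sin_cos_squared_add2[of "pi / 8"] by (simp add: power2_eq_square)
  have 2: "cos (pi / 8) * cos (pi / 8) - sin (pi / 8) * sin (pi / 8) = 1 / sqrt 2"
    using dbl(1) unfolding rt cos_add .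
  have 3: "2 * (cos (pi / 8) * sin (pi / 8)) = 1 / sqrt 2"
    using dbl(2) unfolding rt sin_add by (simp add: mult.commute)
  show "complex_of_real (cos (pi / 8)) * complex_of_real (cos (pi / 8)) + complex_of_real (sin (pi / 8)) * complex_of_real (sin (pi / 8)) = 1"
    using arg_cong[OF 1, of complex_of_real] by (simp only: of_real_mult of_real_add of_real_diff of_real_1)
  show "complex_of_real (cos (pi / 8)) * complex_of_real (cos (pi / 8)) - complex_of_real (sin (pi / 8)) * complex_of_real (sin (pi / 8)) = rt2"
    using arg_cong[OF 2, of complex_of_real] by (simp only: of_real_mult of_real_add of_real_diff of_real_numeral rt2_def)
  show "2 * (complex_of_real (cos (pi / 8)) * complex_of_real (sin (pi / 8))) = rt2"
    using arg_cong[OF 3, of complex_of_real] by (simp only: of_real_mult of_real_add of_real_diff of_real_numeral rt2_def)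
qed

lemma sum_sym_diff:
  assumes "Y \<subseteq> V"
  shows "(\<Sum>Y'\<in>Pow V. f Y') = (\<Sum>R\<in>Pow V. f (sym_diff Y R))"
proof -
  have eq: "sym_diff Y (sym_diff Y a) = a" for a by blast
  show ?thesis
    by (rule sum.reindex_bij_witness[where i = "\<lambda>R. sym_diff Y R" and j = "\<lambda>R. sym_diff Y R"])
    (use assms eq in \<open>simp_all only: eq Pow_iff\<close>, blast+)
qed

text \<open>The measured configuration \<open>X\<close> is summed first. That sum factorises over
  vertices, and the double-angle formulas evaluate each factor according to whether the two inner
  configurations agree there. Afterwards the bra's configuration is traded for its difference set
  from the ket's.\<close>

lemma stat_path_sum:
  "stat p q = path_sum (\<lambda>v y. p v + q v * (rt2 * y)) (\<lambda>v y. - \<i> * q v * (rt2 * y))"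
proof -
  let ?c = "complex_of_real (cos (pi / 8))" and ?s = "complex_of_real (sin (pi / 8))"
  let ?V = "Pow {..<n}"
  let ?f = "\<lambda>v x y. if x = y then ?c else \<i> * ?s"
  have amp2: "of_real ((cmod (amp n M X))\<^sup>2) =
      (\<Sum>Y\<in>?V. \<Sum>Y'\<in>?V. mixer_amp n X Y * cnj (mixer_amp n X Y') * (phase_amp M Y * cnj (phase_amp M Y'))) / 2 ^ n" for X
  proof -
    have "complex_of_real (sqrt (2 ^ n)) * complex_of_real (sqrt (2 ^ n)) = 2 ^ n"
      by (simp flip: of_real_mult)
    then have "of_real ((cmod (amp n M X))\<^sup>2) =
      (\<Sum>Y\<in>?V. mixer_amp n X Y * phase_amp M Y) * (\<Sum>Y'\<in>?V. cnj (mixer_amp n X Y') * cnj (phase_amp M Y')) / 2 ^ n"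
      unfolding complex_norm_square amp_def by simp
    then show ?thesis
      unfolding sum_product by (simp only: mult.assoc mult.left_commute)
  qed
  have kernel: "(\<Sum>X\<in>?V. mixer_amp n X Y * cnj (mixer_amp n X Y') * (\<Prod>v<n. p v + q v * spin X v)) =
      (\<Prod>v<n. if (v \<in> Y) = (v \<in> Y') then p v + q v * (rt2 * spin Y v) else - \<i> * q v * (rt2 * spin Y v))" for Y Y'
  proof -
    have "(\<Sum>X\<in>?V. mixer_amp n X Y * cnj (mixer_amp n X Y') * (\<Prod>v<n. p v + q v * spin X v)) =
      (\<Sum>X\<in>?V. \<Prod>v<n. if v \<in> X then ?f v True (v \<in> Y) * cnj (?f v True (v \<in> Y')) * (p v - q v)
         else ?f v False (v \<in> Y) * cnj (?f v False (v \<in> Y')) * (p v + q v))"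
      unfolding mixer_amp_def cnj_prod prod.distrib[symmetric]
      by (intro sum.cong prod.cong refl) (auto simp: spin_def)
    also have "\<dots> = (\<Prod>v<n. ?f v True (v \<in> Y) * cnj (?f v True (v \<in> Y')) * (p v - q v) +
        ?f v False (v \<in> Y) * cnj (?f v False (v \<in> Y')) * (p v + q v))"
      by (rule sum_Pow_prod) simp
    also have "\<dots> = (\<Prod>v<n. if (v \<in> Y) = (v \<in> Y') then p v + q v * (rt2 * spin Y v) else - \<i> * q v * (rt2 * spin Y v))"
    proof (rule prod.cong[OF refl])
      fix v
      have a: "?c * ?c * (p v - q v) + ?s * ?s * (p v + q v) = p v - q v * rt2"
        "?c * ?c * (p v + q v) + ?s * ?s * (p v - q v) = p v + q v * rt2"
      proof -
        have "?c * ?c * (p v - q v) + ?s * ?s * (p v + q v) = p v * (?c * ?c + ?s * ?s) - q v * (?c * ?c - ?s * ?s)"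
          "?c * ?c * (p v + q v) + ?s * ?s * (p v - q v) = p v * (?c * ?c + ?s * ?s) + q v * (?c * ?c - ?s * ?s)"
          by (simp_all only: ring_distribs) (simp_all only: mult_ac diff_conv_add_uminus minus_add_distrib minus_minus add_ac)
        then show "?c * ?c * (p v - q v) + ?s * ?s * (p v + q v) = p v - q v * rt2"
          "?c * ?c * (p v + q v) + ?s * ?s * (p v - q v) = p v + q v * rt2"
          by (simp_all only: half_angles mult_1_right)
      qed
      have b: "q v * rt2 = 2 * (?c * ?s) * q v"
        using half_angles(3) by simp
      show "?f v True (v \<in> Y) * cnj (?f v True (v \<in> Y')) * (p v - q v) +
        ?f v False (v \<in> Y) * cnj (?f v False (v \<in> Y')) * (p v + q v) =
        (if (v \<in> Y) = (v \<in> Y') then p v + q v * (rt2 * spin Y v) else - \<i> * q v * (rt2 * spin Y v))"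
      proof (cases "v \<in> Y"; cases "v \<in> Y'")
      qed (use a b in \<open>simp_all add: spin_def mult.assoc, simp_all add: algebra_simps\<close>)
    qed
    finally show ?thesis .
  qed
  have "stat p q = (\<Sum>X\<in>?V. \<Sum>Y\<in>?V. \<Sum>Y'\<in>?V. (phase_amp M Y * cnj (phase_amp M Y')) *
      (mixer_amp n X Y * cnj (mixer_amp n X Y') * (\<Prod>v<n. p v + q v * spin X v))) / 2 ^ n"
    unfolding stat_def amp2 sum_divide_distrib sum_distrib_right
    by (intro sum.cong refl) (simp only: times_divide_eq_left times_divide_eq_right mult_ac)
  also have "\<dots> = (\<Sum>Y\<in>?V. \<Sum>Y'\<in>?V. \<Sum>X\<in>?V. (phase_amp M Y * cnj (phase_amp M Y')) *
      (mixer_amp n X Y * cnj (mixer_amp n X Y') * (\<Prod>v<n. p v + q v * spin X v))) / 2 ^ n"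
    by (subst sum.swap, rule arg_cong[where f = "\<lambda>x. x / 2 ^ n"], rule sum.cong[OF refl], rule sum.swap)
  also have "\<dots> = (\<Sum>Y\<in>?V. \<Sum>Y'\<in>?V. (phase_amp M Y * cnj (phase_amp M Y')) *
      (\<Prod>v<n. if (v \<in> Y) = (v \<in> Y') then p v + q v * (rt2 * spin Y v) else - \<i> * q v * (rt2 * spin Y v))) / 2 ^ n"
    by (simp only: sum_distrib_left[symmetric] kernel)
  also have "\<dots> = path_sum (\<lambda>v y. p v + q v * (rt2 * y)) (\<lambda>v y. - \<i> * q v * (rt2 * y))"
    unfolding path_sum_def
  proof (rule arg_cong[where f = "\<lambda>x. x / 2 ^ n"], rule sum.cong[OF refl])
    fix Y assume Y: "Y \<in> ?V"
    show "(\<Sum>Y'\<in>?V. (phase_amp M Y * cnj (phase_amp M Y')) *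
      (\<Prod>v<n. if (v \<in> Y) = (v \<in> Y') then p v + q v * (rt2 * spin Y v) else - \<i> * q v * (rt2 * spin Y v))) =
      (\<Sum>R\<in>?V. (\<Prod>v<n. if v \<in> R then - \<i> * q v * (rt2 * spin Y v) else p v + q v * (rt2 * spin Y v)) * cut_weight R Y)"
      using Y by (subst sum_sym_diff[of Y]) (auto simp: phase_ratio mult.commute intro!: sum.cong prod.cong)
  qed
  finally show ?thesis .
qed

end

section \<open>Eliminating observed vertices from the path sum\<close>

lemma spin_flip: "spin (sym_diff Y {a}) v = (if v = a then - spin Y v else spin Y v)"
  by (auto simp: spin_def)

text \<open>The integrand takes the spin at \<open>a\<close> as a separate argument, so that the
  hypothesis can say that everything else ignores a flip of \<open>a\<close>. Pairing each
  configuration with its flip then averages that argument.\<close>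

lemma sum_avg_out:
  fixes G :: "nat set \<Rightarrow> complex \<Rightarrow> complex"
  assumes "a < n" "\<And>Y s. G (sym_diff Y {a}) s = G Y s"
  shows "(\<Sum>Y\<in>Pow {..<n}. G Y (spin Y a)) = (\<Sum>Y\<in>Pow {..<n}. (G Y 1 + G Y (-1)) / 2)"
proof -
  have "(\<Sum>Y\<in>Pow {..<n}. G Y (spin Y a)) = (\<Sum>Y\<in>Pow {..<n}. G (sym_diff Y {a}) (spin (sym_diff Y {a}) a))"
    by (rule sum.reindex_bij_witness[where i = "\<lambda>Y. sym_diff Y {a}" and j = "\<lambda>Y. sym_diff Y {a}"])
      (use assms(1) in \<open>auto intro!: arg_cong2[where f = G]\<close>, (simp add: spin_def)+)
  also have "\<dots> = (\<Sum>Y\<in>Pow {..<n}. G Y (- spin Y a))"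
    unfolding assms(2) by (simp add: spin_flip)
  finally have "(\<Sum>Y\<in>Pow {..<n}. G Y (spin Y a)) =
      ((\<Sum>Y\<in>Pow {..<n}. G Y (spin Y a)) + (\<Sum>Y\<in>Pow {..<n}. G Y (- spin Y a))) / 2"
    by simp
  also have "\<dots> = (\<Sum>Y\<in>Pow {..<n}. (G Y (spin Y a) + G Y (- spin Y a)) / 2)"
    by (simp add: sum.distrib sum_divide_distrib[symmetric])
  also have "\<dots> = (\<Sum>Y\<in>Pow {..<n}. (G Y 1 + G Y (-1)) / 2)"
    by (rule sum.cong) (auto simp: spin_def)
  finally show ?thesis .
qed

lemma sum_Pow_remove:
  fixes f :: "nat set \<Rightarrow> complex"
  assumes "b < n"
  shows "(\<Sum>R\<in>Pow {..<n}. f R) = (\<Sum>R\<in>Pow ({..<n} - {b}). f R + f (insert b R))"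
proof -
  have ins: "insert b ({..<n} - {b}) = {..<n}" using assms by auto
  have "(\<Sum>R\<in>Pow (insert b ({..<n} - {b})). f R) =
      (\<Sum>R\<in>Pow ({..<n} - {b}). f R) + (\<Sum>R\<in>insert b ` Pow ({..<n} - {b}). f R)"
    unfolding Pow_insert by (rule sum.union_disjoint) auto
  also have "(\<Sum>R\<in>insert b ` Pow ({..<n} - {b}). f R) = (\<Sum>R\<in>Pow ({..<n} - {b}). f (insert b R))"
    by (rule sum.reindex_cong[where l = "insert b"]) (auto simp: inj_on_def)
  finally show ?thesis
    unfolding ins by (simp add: sum.distrib)
qed

text \<open>The strength of the field a measured vertex leaves behind: \<open>rt2\<close> from the
  mixer, one sine from the edge to the surviving neighbour and one cosine for each of the two
  neighbours averaged away.\<close>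

definition kappa :: complex where "kappa = sin_ph * cos_ph * cos_ph * rt2"

context cubic_multigraph
begin

abbreviation vtx :: "nat \<Rightarrow> nat" where "vtx h \<equiv> h div 3"
abbreviation nbr :: "nat \<Rightarrow> nat" where "nbr h \<equiv> opp h div 3"

definition cut_factor :: "nat set \<Rightarrow> nat set \<Rightarrow> nat \<Rightarrow> complex" where
  "cut_factor R Y h = (if vtx h \<in> R \<and> nbr h \<notin> R
     then cos_ph - \<i> * sin_ph * spin Y (vtx h) * spin Y (nbr h) else 1)"

definition path_term :: "(nat \<Rightarrow> complex \<Rightarrow> complex) \<Rightarrow> (nat \<Rightarrow> complex \<Rightarrow> complex) \<Rightarrow> nat set \<Rightarrow> nat set \<Rightarrow> complex" where
  "path_term D Q R Y = (\<Prod>v<n. if v \<in> R then Q v (spin Y v) else D v (spin Y v)) * (\<Prod>h<3 * n. cut_factor R Y h)"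

lemma path_sum_alt: "path_sum D Q = (\<Sum>R\<in>Pow {..<n}. \<Sum>Y\<in>Pow {..<n}. path_term D Q R Y) / 2 ^ n"
  unfolding path_sum_def path_term_def cut_weight_def cut_factor_def by (subst sum.swap) (rule refl)

lemma path_term_zero:
  assumes "v < n" "v \<in> R" "Q v = (\<lambda>_. 0)"
  shows "path_term D Q R Y = 0"
proof -
  have "(\<Prod>v<n. if v \<in> R then Q v (spin Y v) else D v (spin Y v)) = 0"
    by (rule prod_zero, simp, rule bexI[of _ v]) (use assms in auto)
  then show ?thesis by (simp add: path_term_def)
qed

text \<open>
  After averaging over the spin at \<open>b\<close>, the two neighbours that carry no other weight are averaged
  too, so that only the field on the third neighbour survives.
\<close>

lemma path_sum_remove_star:
  assumes b: "b < n"
    and star: "h0 div 3 = b" "h1 div 3 = b" "h2 div 3 = b" "h0 \<noteq> h1" "h0 \<noteq> h2" "h1 \<noteq> h2"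
    and dist: "distinct [b, nbr h0, nbr h1, nbr h2]"
    and triv: "D (nbr h1) = (\<lambda>_. 1)" "D (nbr h2) = (\<lambda>_. 1)"
    and far: "\<And>h. h < 3 * n \<Longrightarrow> vtx h = nbr h1 \<or> vtx h = nbr h2 \<Longrightarrow> nbr h \<noteq> b \<Longrightarrow> Q (nbr h) = (\<lambda>_. 0)"
    and triv': "Q (nbr h1) = (\<lambda>_. 0)" "Q (nbr h2) = (\<lambda>_. 0)"
    and Db: "D b = (\<lambda>y. 1 + \<sigma> * (rt2 * y))" and Qb: "Q b = (\<lambda>y. - \<i> * \<sigma> * (rt2 * y))"
  shows "path_sum D Q =
    path_sum (D(nbr h0 := \<lambda>y. D (nbr h0) y * (1 - kappa * \<sigma> * y))) (Q(b := \<lambda>_. 0))"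
proof -
  define x0 x1 x2 where "x0 = nbr h0" and "x1 = nbr h1" and "x2 = nbr h2"
  note xs = x0_def[symmetric] x1_def[symmetric] x2_def[symmetric]
  have hn: "h0 < 3 * n" "h1 < 3 * n" "h2 < 3 * n"
    using b star by auto
  have xn: "x0 < n" "x1 < n" "x2 < n"
    using opp_props(3)[OF hn(1)] opp_props(3)[OF hn(2)] opp_props(3)[OF hn(3)] by (auto simp: x0_def x1_def x2_def)
  have d: "b \<noteq> x0" "b \<noteq> x1" "b \<noteq> x2" "x0 \<noteq> x1" "x0 \<noteq> x2" "x1 \<noteq> x2"
    using dist by (auto simp: xs)
  have at_b: "h = h0 \<or> h = h1 \<or> h = h2" if "vtx h = b" for h
    using that star by auto
  let ?D = "D(x0 := \<lambda>y. D x0 y * (1 - kappa * \<sigma> * y))" and ?Q = "Q(b := \<lambda>_. 0)"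
  let ?V = "{..<n} - {b}"
  let ?H = "{..<3 * n} - {h0, h1, h2, opp h0}"
  \<comment> \<open>Flipping \<open>b\<close> amounts to multiplying the unflipped term by
    \<open>- kappa * \<sigma> * spin Y x0\<close>. It contributes nothing if \<open>x0\<close> is
    flipped too: the edge between them is then uncut and the weight left at \<open>b\<close> is odd
    in its spin.\<close>
  have claim: "(\<Sum>Y\<in>Pow {..<n}. path_term D Q (insert b R) Y) =
      (\<Sum>Y\<in>Pow {..<n}. (if x0 \<in> R then 0 else - kappa * \<sigma> * spin Y x0) * path_term D Q R Y)"
    if R: "R \<subseteq> ?V" for R
  \<comment> \<open>If \<open>x1\<close>, \<open>x2\<close> or another vertex next to them is
    flipped, some weight \<open>Q\<close> is zero and both sides vanish. Otherwise the spins at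
    \<open>x1\<close> and \<open>x2\<close> occur only in the edges to \<open>b\<close>.\<close>
  proof (cases "x1 \<in> R \<or> x2 \<in> R \<or> (\<exists>h<3 * n. (vtx h = x1 \<or> vtx h = x2) \<and> nbr h \<noteq> b \<and> nbr h \<in> R)")
    case True
    then obtain v where v: "v \<in> R" "Q v = (\<lambda>_. 0)"
      using triv' far by (auto simp: xs)
    then have "v < n" using R by auto
    then show ?thesis using v path_term_zero[of v] by simp
  next
    case False
    then have nR: "x1 \<notin> R" "x2 \<notin> R"
      and nR': "\<And>h. h < 3 * n \<Longrightarrow> vtx h = x1 \<or> vtx h = x2 \<Longrightarrow> nbr h \<noteq> b \<Longrightarrow> nbr h \<notin> R"
      by auto
    have bR: "b \<notin> R" using R by auto
    define K where "K Y = (\<Prod>v\<in>?V. if v \<in> R then Q v (spin Y v) else D v (spin Y v)) * (\<Prod>h\<in>?H. cut_factor R Y h)" for Y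
    have split_v: "(\<Prod>v<n. f v) = f b * (\<Prod>v\<in>?V. f v)" for f :: "nat \<Rightarrow> complex"
      using b by (intro prod.remove) auto
    have oh0: "opp h0 < 3 * n" "vtx (opp h0) = x0" "nbr (opp h0) = b" "opp h0 \<notin> {h0, h1, h2}"
      using opp_props[OF hn(1)] d(1) star by (auto simp: x0_def)
    have split_h: "(\<Prod>h<3 * n. f h) = f h0 * f h1 * f h2 * f (opp h0) * (\<Prod>h\<in>?H. f h)" for f :: "nat \<Rightarrow> complex"
    proof -
      have "(\<Prod>h<3 * n. f h) = (\<Prod>h\<in>?H. f h) * (\<Prod>h\<in>{h0, h1, h2, opp h0}. f h)"
        by (rule prod.subset_diff) (use hn oh0 in auto)
      then show ?thesis using star oh0(4) by (simp add: mult_ac)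
    qed
    have cf: "cut_factor S Y h = (if v \<in> S \<and> w \<notin> S then cos_ph - \<i> * sin_ph * spin Y v * spin Y w else 1)"
      if "vtx h = v" "nbr h = w" for S Y h v w
      using that by (simp only: cut_factor_def)
    note cf_at = cf[OF star(1) x0_def[symmetric]] cf[OF star(2) x1_def[symmetric]] cf[OF star(3) x2_def[symmetric]]
      cf[OF oh0(2,3)]
    have t0: "path_term D Q R Y = K Y * D b (spin Y b) *
        (if x0 \<in> R then cos_ph - \<i> * sin_ph * spin Y x0 * spin Y b else 1)" for Y
      using bR unfolding path_term_def K_def split_v split_h cf_at
      by (simp add: mult_ac)
    have t1: "path_term D Q (insert b R) Y = K Y * Q b (spin Y b) *
        (if x0 \<in> R then 1 else cos_ph - \<i> * sin_ph * spin Y b * spin Y x0) *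
        (cos_ph - \<i> * sin_ph * spin Y b * spin Y x1) * (cos_ph - \<i> * sin_ph * spin Y b * spin Y x2)" for Y
    proof -
      have "cut_factor (insert b R) Y h = cut_factor R Y h" if h: "h \<in> ?H" for h
      proof -
        have h': "h < 3 * n" "vtx h \<noteq> b" using h at_b by auto
        have "vtx h \<notin> R" if "nbr h = b"
        proof -
          have "opp h = h1 \<or> opp h = h2" using at_b[of "opp h"] that h opp_props(4)[OF h'(1)] by auto
          then have "vtx h = x1 \<or> vtx h = x2" using opp_props(4)[OF h'(1)] by (auto simp: x1_def x2_def)
          then show ?thesis using nR by auto
        qed
        then show ?thesis using h' by (auto simp: cut_factor_def)
      qed
      then have 1: "(\<Prod>h\<in>?H. cut_factor (insert b R) Y h) = (\<Prod>h\<in>?H. cut_factor R Y h)"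
        by (rule prod.cong[OF refl])
      have 2: "(\<Prod>v\<in>?V. if v \<in> insert b R then Q v (spin Y v) else D v (spin Y v)) =
        (\<Prod>v\<in>?V. if v \<in> R then Q v (spin Y v) else D v (spin Y v))"
        by (rule prod.cong) auto
      have 3: "cut_factor (insert b R) Y (opp h0) = 1"
        "cut_factor (insert b R) Y h0 = (if x0 \<in> R then 1 else cos_ph - \<i> * sin_ph * spin Y b * spin Y x0)"
        "cut_factor (insert b R) Y h1 = cos_ph - \<i> * sin_ph * spin Y b * spin Y x1"
        "cut_factor (insert b R) Y h2 = cos_ph - \<i> * sin_ph * spin Y b * spin Y x2"
        using d d[symmetric] nR by (simp_all add: cf_at)
      show ?thesis
        unfolding path_term_def K_def split_v split_h 1 2 3 by (simp add: mult_ac)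
    qed
    have K: "K (sym_diff Y {a}) = K Y" if a: "a = b \<or> a = x1 \<or> a = x2" for a Y
    proof -
      have 1: "(if v \<in> R then Q v (spin (sym_diff Y {a}) v) else D v (spin (sym_diff Y {a}) v)) =
        (if v \<in> R then Q v (spin Y v) else D v (spin Y v))" if "v \<in> ?V" for v
        using a that nR triv by (auto simp: spin_flip xs)
      have 2: "cut_factor R (sym_diff Y {a}) h = cut_factor R Y h" if h: "h \<in> ?H" for h
      proof (cases "vtx h \<in> R \<and> nbr h \<notin> R")
        case True
        have hn': "h < 3 * n" using h by simp
        have "vtx h \<noteq> a" using True a bR nR by auto
        moreover have "nbr h \<noteq> a"
        proof
          assume na: "nbr h = a"
          show False
          proof (cases "a = b")
            case True': True
            then have "opp h = h1 \<or> opp h = h2" using at_b[of "opp h"] na h opp_props(4)[OF hn'] by auto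
            then have "vtx h = x1 \<or> vtx h = x2" using opp_props(4)[OF hn'] by (auto simp: x1_def x2_def)
            then show False using nR True by auto
          next
            case False
            then have "vtx (opp h) = x1 \<or> vtx (opp h) = x2" using a na by auto
            moreover have "nbr (opp h) = vtx h" using opp_props(4)[OF hn'] by simp
            ultimately show False
              using nR'[OF opp_props(3)[OF hn']] True bR by auto
          qed
        qed
        ultimately show ?thesis by (simp add: cut_factor_def spin_flip)
      qed (auto simp: cut_factor_def)
      show ?thesis
        unfolding K_def by (intro arg_cong2[where f = "(*)"] prod.cong refl) (use 1 2 in auto)
    qed
    have Kb: "K (sym_diff Y {b}) = K Y" "K (sym_diff Y {x1}) = K Y" "K (sym_diff Y {x2}) = K Y" for Y
      using K by auto
    let ?P = "\<lambda>Y. if x0 \<in> R then 1 else cos_ph - \<i> * sin_ph * spin Y b * spin Y x0"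
    have "(\<Sum>Y\<in>Pow {..<n}. path_term D Q (insert b R) Y) =
      (\<Sum>Y\<in>Pow {..<n}. (\<lambda>Y s. K Y * Q b (spin Y b) * ?P Y *
        (cos_ph - \<i> * sin_ph * spin Y b * spin Y x2) * (cos_ph - \<i> * sin_ph * spin Y b * s)) Y (spin Y x1))"
      by (simp add: t1 mult_ac)
    also have "\<dots> = (\<Sum>Y\<in>Pow {..<n}. (\<lambda>Y s. K Y * Q b (spin Y b) * ?P Y *
        cos_ph * (cos_ph - \<i> * sin_ph * spin Y b * s)) Y (spin Y x2))"
      by (subst sum_avg_out[OF xn(2)]) (use d in \<open>auto simp: Kb spin_flip algebra_simps add_divide_distrib diff_divide_distrib intro!: sum.cong\<close>)
    also have "\<dots> = (\<Sum>Y\<in>Pow {..<n}. (\<lambda>Y s. K Y * Q b s * cos_ph * cos_ph *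
        (if x0 \<in> R then 1 else cos_ph - \<i> * sin_ph * s * spin Y x0)) Y (spin Y b))"
      by (subst sum_avg_out[OF xn(3)]) (use d in \<open>auto simp: Kb spin_flip algebra_simps add_divide_distrib diff_divide_distrib intro!: sum.cong\<close>)
    also have "\<dots> = (\<Sum>Y\<in>Pow {..<n}. (if x0 \<in> R then 0 else - kappa * \<sigma> * spin Y x0) * K Y)"
      by (subst sum_avg_out[OF b]) (use d in \<open>auto simp: Kb Qb spin_flip kappa_def algebra_simps add_divide_distrib diff_divide_distrib intro!: sum.cong\<close>)
    \<comment> \<open>\<open>D b\<close> averages to 1 over the spin at \<open>b\<close>, so it can
      be inserted to recognise \<open>path_term D Q R\<close>.\<close>
    also have "\<dots> = (\<Sum>Y\<in>Pow {..<n}. (\<lambda>Y s. (if x0 \<in> R then 0 else - kappa * \<sigma> * spin Y x0) * K Y * D b s) Y (spin Y b))"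
      by (subst sum_avg_out[OF b]) (use d in \<open>auto simp: Kb Db spin_flip algebra_simps add_divide_distrib diff_divide_distrib intro!: sum.cong\<close>)
    also have "\<dots> = (\<Sum>Y\<in>Pow {..<n}. (if x0 \<in> R then 0 else - kappa * \<sigma> * spin Y x0) * path_term D Q R Y)"
      by (rule sum.cong) (auto simp: t0 mult_ac)
    finally show ?thesis .
  qed
  have rhs: "path_term ?D ?Q R Y + path_term ?D ?Q (insert b R) Y =
      path_term D Q R Y + (if x0 \<in> R then 0 else - kappa * \<sigma> * spin Y x0) * path_term D Q R Y"
    if R: "R \<subseteq> ?V" for R Y
  proof -
    have z: "path_term ?D ?Q (insert b R) Y = 0"
      by (rule path_term_zero[OF b]) auto
    have "(\<Prod>v<n. if v \<in> R then ?Q v (spin Y v) else ?D v (spin Y v)) =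
      (\<Prod>v<n. (if v = x0 then (if x0 \<in> R then 1 else 1 - kappa * \<sigma> * spin Y x0) else 1) *
         (if v \<in> R then Q v (spin Y v) else D v (spin Y v)))"
      by (rule prod.cong) (use R in \<open>auto simp: mult.commute\<close>)
    also have "\<dots> = (if x0 \<in> R then 1 else 1 - kappa * \<sigma> * spin Y x0) *
        (\<Prod>v<n. if v \<in> R then Q v (spin Y v) else D v (spin Y v))"
      using xn by (simp only: prod.distrib) (simp add: prod.delta)
    finally have eq: "(\<Prod>v<n. if v \<in> R then ?Q v (spin Y v) else ?D v (spin Y v)) = \<dots>" .
    have aux: "(if q then 1 else 1 - k * a * y) * A * B + 0 = A * B + (if q then 0 else - k * a * y) * (A * B)"
      for q and k a y A B :: complex by (simp add: algebra_simps)
    show ?thesis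
      unfolding z unfolding path_term_def eq by (rule aux)
  qed
  have "path_sum D Q = (\<Sum>R\<in>Pow ?V. (\<Sum>Y\<in>Pow {..<n}. path_term D Q R Y) +
      (\<Sum>Y\<in>Pow {..<n}. path_term D Q (insert b R) Y)) / 2 ^ n"
    unfolding path_sum_alt by (subst sum_Pow_remove[OF b]) (rule refl)
  also have "\<dots> = (\<Sum>R\<in>Pow ?V. \<Sum>Y\<in>Pow {..<n}. path_term D Q R Y +
      (if x0 \<in> R then 0 else - kappa * \<sigma> * spin Y x0) * path_term D Q R Y) / 2 ^ n"
    by (rule arg_cong[where f = "\<lambda>x. x / 2 ^ n"], rule sum.cong[OF refl]) (simp add: claim sum.distrib)
  also have "\<dots> = (\<Sum>R\<in>Pow ?V. \<Sum>Y\<in>Pow {..<n}. path_term ?D ?Q R Y + path_term ?D ?Q (insert b R) Y) / 2 ^ n"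
    by (rule arg_cong[where f = "\<lambda>x. x / 2 ^ n"], intro sum.cong refl) (simp add: rhs)
  also have "\<dots> = path_sum ?D ?Q"
    unfolding path_sum_alt by (subst sum_Pow_remove[OF b]) (simp add: sum.distrib)
  finally show ?thesis by (simp only: x0_def)
qed

end

text \<open>The cyclic shift of the three half-edges at a vertex, a bijection of order three under
  which sums over half-edges are invariant.\<close>

definition sib :: "nat \<Rightarrow> nat" where "sib h = 3 * (h div 3) + (h + 1) mod 3"

lemma sib_simps: "sib (3 * q) = 3 * q + 1" "sib (3 * q + 1) = 3 * q + 2" "sib (3 * q + 2) = 3 * q"
  by (simp_all add: sib_def, presburger+)

lemma sib_cases:
  obtains q where "h = 3 * q" "sib h = 3 * q + 1" "sib (sib h) = 3 * q + 2" "sib (sib (sib h)) = 3 * q" "h div 3 = q"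
  | q where "h = 3 * q + 1" "sib h = 3 * q + 2" "sib (sib h) = 3 * q" "sib (sib (sib h)) = 3 * q + 1" "h div 3 = q"
  | q where "h = 3 * q + 2" "sib h = 3 * q" "sib (sib h) = 3 * q + 1" "sib (sib (sib h)) = 3 * q + 2" "h div 3 = q"
proof -
  define q where "q = h div 3"
  have "h = 3 * q \<or> h = 3 * q + 1 \<or> h = 3 * q + 2" unfolding q_def by presburger
  then show ?thesis
  proof (elim disjE)
    assume a: "h = 3 * q"
    show ?thesis by (rule that(1)[of q]; simp only: a sib_simps; simp)
  next
    assume a: "h = 3 * q + 1"
    show ?thesis by (rule that(2)[of q]; simp only: a sib_simps; simp)
  next
    assume a: "h = 3 * q + 2"
    show ?thesis by (rule that(3)[of q]; simp only: a sib_simps; simp)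
  qed
qed

lemma sib_sib_sib [simp]: "sib (sib (sib h)) = h"
  by (cases h rule: sib_cases) simp_all

lemma sib_div [simp]: "sib h div 3 = h div 3"
  by (cases h rule: sib_cases) simp_all

lemma sib_neq [simp]: "sib h \<noteq> h" "sib (sib h) \<noteq> h" "h \<noteq> sib h" "h \<noteq> sib (sib h)"
  by (cases h rule: sib_cases; simp)+

lemma same_vertex: "h' div 3 = h div 3 \<longleftrightarrow> h' = h \<or> h' = sib h \<or> h' = sib (sib h)"
proof
  assume "h' div 3 = h div 3"
  then have "h' = 3 * (h div 3) \<or> h' = 3 * (h div 3) + 1 \<or> h' = 3 * (h div 3) + 2" by presburger
  then show "h' = h \<or> h' = sib h \<or> h' = sib (sib h)"
    by (cases h rule: sib_cases) auto
qed auto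

lemma sib_less: "h < 3 * n \<Longrightarrow> sib h < 3 * n"
  using sib_div[of h] by (metis div_less_iff_less_mult mult.commute zero_less_numeral)

section \<open>Averages over independent uniform spins\<close>

definition config_avg :: "nat \<Rightarrow> (nat set \<Rightarrow> complex) \<Rightarrow> complex" where
  "config_avg n f = (\<Sum>Y\<in>Pow {..<n}. f Y) / 2 ^ n"

lemma config_avg_const [simp]: "config_avg n (\<lambda>_. c) = c"
  by (simp add: config_avg_def card_Pow)

lemma config_avg_prod:
  fixes f :: "nat \<Rightarrow> complex \<Rightarrow> complex"
  shows "config_avg n (\<lambda>Y. \<Prod>v<n. f v (spin Y v)) = (\<Prod>v<n. (f v 1 + f v (-1)) / 2)"
proof -
  have "(\<Sum>Y\<in>Pow {..<n}. \<Prod>v<n. f v (spin Y v)) =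
      (\<Sum>Y\<in>Pow {..<n}. \<Prod>v<n. if v \<in> Y then f v (-1) else f v 1)"
    by (intro sum.cong prod.cong) (auto simp: spin_def)
  then show ?thesis
    by (simp add: config_avg_def sum_Pow_prod prod_dividef add.commute)
qed

lemma config_avg_indep:
  assumes f: "\<And>Y. f (Y \<inter> A) = f Y" and g: "\<And>Y. g (Y - A) = g Y"
  shows "config_avg n (\<lambda>Y. f Y * g Y) = config_avg n f * config_avg n g"
proof -
  let ?A = "{..<n} \<inter> A" and ?B = "{..<n} - A"
  have split: "(\<Sum>Y\<in>Pow {..<n}. F Y) = (\<Sum>Y1\<in>Pow ?A. \<Sum>Y2\<in>Pow ?B. F (Y1 \<union> Y2))" for F :: "nat set \<Rightarrow> complex"
  proof -
    have "(\<Sum>Y1\<in>Pow ?A. \<Sum>Y2\<in>Pow ?B. F (Y1 \<union> Y2)) = (\<Sum>(Y1, Y2)\<in>Pow ?A \<times> Pow ?B. F (Y1 \<union> Y2))"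
      by (rule sum.cartesian_product)
    also have "\<dots> = (\<Sum>Y\<in>Pow {..<n}. F Y)"
      by (rule sum.reindex_bij_witness[where i = "\<lambda>Y. (Y \<inter> A, Y - A)" and j = "\<lambda>(Y1, Y2). Y1 \<union> Y2"])
        (auto simp: Un_Diff Int_Un_distrib2 Int_absorb2 intro!: arg_cong[where f = F])
    finally show ?thesis by simp
  qed
  have ff: "f (Y1 \<union> Y2) = f Y1" if "Y1 \<subseteq> ?A" "Y2 \<subseteq> ?B" for Y1 Y2
  proof -
    have "(Y1 \<union> Y2) \<inter> A = Y1 \<inter> A" using that by auto
    then show ?thesis using f by metis
  qed
  have gg: "g (Y1 \<union> Y2) = g Y2" if "Y1 \<subseteq> ?A" "Y2 \<subseteq> ?B" for Y1 Y2
  proof -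
    have "(Y1 \<union> Y2) - A = Y2 - A" using that by auto
    then show ?thesis using g by metis
  qed
  have card: "(2::complex) ^ card ?A * 2 ^ card ?B = 2 ^ n"
  proof -
    have "card ?A + card ?B = card {..<n}"
      by (subst card_Un_disjoint[symmetric]) (auto simp: Int_Diff_Un)
    then show ?thesis by (simp add: power_add[symmetric])
  qed
  have 1: "(\<Sum>Y\<in>Pow {..<n}. f Y * g Y) = (\<Sum>Y\<in>Pow ?A. f Y) * (\<Sum>Y\<in>Pow ?B. g Y)"
    unfolding split sum_product by (intro sum.cong refl) (simp add: ff gg)
  have 2: "(\<Sum>Y\<in>Pow {..<n}. f Y) = (\<Sum>Y\<in>Pow ?A. f Y) * 2 ^ card ?B"
  proof -
    have "(\<Sum>Y\<in>Pow {..<n}. f Y) = (\<Sum>Y1\<in>Pow ?A. \<Sum>Y2\<in>Pow ?B. f Y1)"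
      unfolding split by (intro sum.cong refl) (simp add: ff)
    then show ?thesis by (simp add: card_Pow sum_distrib_right mult.commute)
  qed
  have 3: "(\<Sum>Y\<in>Pow {..<n}. g Y) = 2 ^ card ?A * (\<Sum>Y\<in>Pow ?B. g Y)"
  proof -
    have "(\<Sum>Y\<in>Pow {..<n}. g Y) = (\<Sum>Y1\<in>Pow ?A. \<Sum>Y2\<in>Pow ?B. g Y2)"
      unfolding split by (intro sum.cong refl) (simp add: gg)
    then show ?thesis by (simp add: card_Pow del: Pow_Int_eq)
  qed
  have "config_avg n f * config_avg n g = (\<Sum>Y\<in>Pow ?A. f Y) * (\<Sum>Y\<in>Pow ?B. g Y) * (2 ^ card ?A * 2 ^ card ?B) / (2 ^ n * 2 ^ n)"
    unfolding config_avg_def 2 3 by simp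
  then show ?thesis
    unfolding card config_avg_def 1 by simp
qed

lemma config_avg_out:
  assumes "a < n" "\<And>Y s. G (sym_diff Y {a}) s = G Y s"
  shows "config_avg n (\<lambda>Y. G Y (spin Y a)) = config_avg n (\<lambda>Y. (G Y 1 + G Y (-1)) / 2)"
  using sum_avg_out[where G = G, OF assms] by (simp add: config_avg_def)

lemma config_avg_factor:
  assumes "a < n" "\<And>Y. K (sym_diff Y {a}) = K Y" "\<And>Y s. f (sym_diff Y {a}) s = f Y s"
  shows "config_avg n (\<lambda>Y. K Y * f Y (spin Y a)) = config_avg n (\<lambda>Y. K Y * ((f Y 1 + f Y (-1)) / 2))"
  using config_avg_out[where G = "\<lambda>Y s. K Y * f Y s", OF assms(1)] assms(2,3)
  by (simp add: distrib_left[symmetric])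

text \<open>Given the spin at the centre \<open>u\<close> the three leaves are independent, so they
  are averaged one by one.\<close>

lemma config_avg_star:
  fixes fa fb fc :: "complex \<Rightarrow> complex \<Rightarrow> complex"
  assumes "distinct [u, a, b, c]" "u < n" "a < n" "b < n" "c < n"
  shows "config_avg n (\<lambda>Y. g (spin Y u) * fa (spin Y u) (spin Y a) * fb (spin Y u) (spin Y b) * fc (spin Y u) (spin Y c)) =
    (g 1 * ((fa 1 1 + fa 1 (-1)) / 2) * ((fb 1 1 + fb 1 (-1)) / 2) * ((fc 1 1 + fc 1 (-1)) / 2) +
     g (-1) * ((fa (-1) 1 + fa (-1) (-1)) / 2) * ((fb (-1) 1 + fb (-1) (-1)) / 2) * ((fc (-1) 1 + fc (-1) (-1)) / 2)) / 2"
proof -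
  let ?F = "\<lambda>f s. (f s 1 + f s (-1)) / 2 :: complex"
  have d: "u \<noteq> a" "u \<noteq> b" "u \<noteq> c" "a \<noteq> b" "a \<noteq> c" "b \<noteq> c"
    using assms by auto
  have e1: "config_avg n (\<lambda>Y. g (spin Y u) * fa (spin Y u) (spin Y a) * fb (spin Y u) (spin Y b) * fc (spin Y u) (spin Y c)) =
    config_avg n (\<lambda>Y. g (spin Y u) * fa (spin Y u) (spin Y a) * fb (spin Y u) (spin Y b) * ?F fc (spin Y u))"
    by (rule config_avg_factor[where f = "\<lambda>Y. fc (spin Y u)"]) (use assms d in \<open>simp_all add: spin_flip\<close>)
  have e2: "config_avg n (\<lambda>Y. g (spin Y u) * fa (spin Y u) (spin Y a) * fb (spin Y u) (spin Y b) * ?F fc (spin Y u)) = config_avg n (\<lambda>Y. g (spin Y u) * fa (spin Y u) (spin Y a) * ?F fc (spin Y u) * fb (spin Y u) (spin Y b))"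
    by (simp only: mult_ac)
  have e3: "config_avg n (\<lambda>Y. g (spin Y u) * fa (spin Y u) (spin Y a) * ?F fc (spin Y u) * fb (spin Y u) (spin Y b)) = config_avg n (\<lambda>Y. g (spin Y u) * fa (spin Y u) (spin Y a) * ?F fc (spin Y u) * ?F fb (spin Y u))"
    by (rule config_avg_factor[where f = "\<lambda>Y. fb (spin Y u)"]) (use assms d in \<open>simp_all add: spin_flip\<close>)
  have e4: "config_avg n (\<lambda>Y. g (spin Y u) * fa (spin Y u) (spin Y a) * ?F fc (spin Y u) * ?F fb (spin Y u)) = config_avg n (\<lambda>Y. g (spin Y u) * ?F fc (spin Y u) * ?F fb (spin Y u) * fa (spin Y u) (spin Y a))"
    by (simp only: mult_ac)
  have e5: "config_avg n (\<lambda>Y. g (spin Y u) * ?F fc (spin Y u) * ?F fb (spin Y u) * fa (spin Y u) (spin Y a)) = config_avg n (\<lambda>Y. g (spin Y u) * ?F fc (spin Y u) * ?F fb (spin Y u) * ?F fa (spin Y u))"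
    by (rule config_avg_factor[where f = "\<lambda>Y. fa (spin Y u)"]) (use assms d in \<open>simp_all add: spin_flip\<close>)
  have e7: "config_avg n (\<lambda>Y. (\<lambda>Y s. g s * ?F fc s * ?F fb s * ?F fa s) Y (spin Y u)) = (g 1 * ?F fc 1 * ?F fb 1 * ?F fa 1 + g (-1) * ?F fc (-1) * ?F fb (-1) * ?F fa (-1)) / 2"
    by (subst config_avg_out) (use assms in \<open>simp_all only: config_avg_const\<close>)
  have e8: "(g 1 * ?F fc 1 * ?F fb 1 * ?F fa 1 + g (-1) * ?F fc (-1) * ?F fb (-1) * ?F fa (-1)) / 2 =
    (g 1 * ?F fa 1 * ?F fb 1 * ?F fc 1 + g (-1) * ?F fa (-1) * ?F fb (-1) * ?F fc (-1)) / 2"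
    by (simp only: mult_ac)
  show ?thesis
    unfolding e1 e2 e3 e4 e5 e7 e8 by (rule refl)
qed

text \<open>Outcomes are extended by 0 off \<open>V0\<close>, so that
  \<open>1 + \<sigma> v * Z\<close> is trivial at unmeasured vertices; the empty set with \<sigma> =
  0 covers the unconditional state.\<close>

locale measured_graph = cubic_multigraph +
  fixes V0 :: "nat set" and \<sigma> :: "nat \<Rightarrow> complex"
  assumes V0_subset: "V0 \<subseteq> {..<n}"
    and two_ind: "two_independent 3 M V0"
    and \<sigma>_outside: "\<And>v. v \<notin> V0 \<Longrightarrow> \<sigma> v = 0"
    and \<sigma>_inside: "\<And>v. v \<in> V0 \<Longrightarrow> \<sigma> v = 1 \<or> \<sigma> v = -1"
begin

lemma nbr_V0_inj: "vtx h \<in> V0 \<Longrightarrow> vtx h' \<in> V0 \<Longrightarrow> nbr h = nbr h' \<Longrightarrow> h = h'"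
  using two_ind unfolding two_independent_def opp_def by (auto simp: half_edges_at_iff dest: inj_onD)

lemma nbr_V0_outside: "vtx h \<in> V0 \<Longrightarrow> nbr h \<notin> V0"
  using two_ind unfolding two_independent_def opp_def by (auto simp: half_edges_at_iff)

lemma V0_half_edge: "vtx h \<in> V0 \<Longrightarrow> h < 3 * n"
  using V0_subset by auto

text \<open>The field acting on a spin: its own outcome, or what the elimination of a measured
  neighbour leaves. At a vertex of the graph 2-independence makes at most one of the four outcomes
  non-zero.\<close>

definition field :: "nat \<Rightarrow> complex" where
  "field v = rt2 * \<sigma> v - kappa * (\<sigma> (nbr (3 * v)) + \<sigma> (nbr (3 * v + 1)) + \<sigma> (nbr (3 * v + 2)))"

lemma nbr_of_V0_nbr:
  assumes "vtx h \<in> V0" "vtx g = nbr h" "g \<noteq> opp h" "g < 3 * n"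
  shows "nbr g \<notin> V0"
proof
  assume "nbr g \<in> V0"
  moreover have "nbr (opp g) = nbr h" using assms opp_props(4)[of g] by simp
  ultimately have "opp g = h" using nbr_V0_inj[of "opp g" h] assms by auto
  then show False using assms opp_props(4)[of g] by auto
qed

lemma nbr_sum_at:
  assumes "vtx h \<in> V0"
  shows "\<sigma> (nbr (3 * nbr h)) + \<sigma> (nbr (3 * nbr h + 1)) + \<sigma> (nbr (3 * nbr h + 2)) = \<sigma> (vtx h)"
proof -
  have hn: "h < 3 * n" using V0_half_edge assms by blast
  define v where "v = nbr h"
  have vn: "v < n" using opp_props(3)[OF hn] by (auto simp: v_def)
  have z: "\<sigma> (nbr g) = (if g = opp h then \<sigma> (vtx h) else 0)" if "g \<in> {3 * v, 3 * v + 1, 3 * v + 2}" for g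
  proof (cases "g = opp h")
    case True
    then show ?thesis using opp_props(4)[OF hn] by simp
  next
    case False
    have "g < 3 * n" "vtx g = nbr h" using that vn by (auto simp: v_def)
    then show ?thesis using nbr_of_V0_nbr[OF assms _ False] \<sigma>_outside False by auto
  qed
  have "opp h = 3 * v \<or> opp h = 3 * v + 1 \<or> opp h = 3 * v + 2"
    unfolding v_def by presburger
  then show ?thesis
    unfolding v_def[symmetric] using z[of "3 * v"] z[of "3 * v + 1"] z[of "3 * v + 2"] by auto
qed

lemma field_V0:
  assumes "v \<in> V0"
  shows "field v = rt2 * \<sigma> v"
proof -
  have "\<sigma> (nbr g) = 0" if "vtx g = v" for g
    using nbr_V0_outside[of g] that assms \<sigma>_outside by auto
  from this[of "3 * v"] this[of "3 * v + 1"] this[of "3 * v + 2"] show ?thesis by (simp add: field_def)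
qed

lemma field_nbr:
  assumes "vtx h \<in> V0"
  shows "field (nbr h) = - kappa * \<sigma> (vtx h)"
  using nbr_sum_at[OF assms] \<sigma>_outside[OF nbr_V0_outside[OF assms]] by (simp add: field_def)

lemma field_other:
  assumes "v \<notin> V0" "v < n" "\<And>h. vtx h \<in> V0 \<Longrightarrow> nbr h \<noteq> v"
  shows "field v = 0"
proof -
  have "\<sigma> (nbr g) = 0" if g: "vtx g = v" for g
  proof (rule \<sigma>_outside)
    have "g < 3 * n" using g assms(2) by auto
    then have "nbr (opp g) = v" using opp_props(4) g by simp
    then show "nbr g \<notin> V0" using assms(3)[of "opp g"] by auto
  qed
  from this[of "3 * v"] this[of "3 * v + 1"] this[of "3 * v + 2"] show ?thesis
    using assms(1) \<sigma>_outside by (simp add: field_def)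
qed

definition ball :: "nat set \<Rightarrow> nat set" where
  "ball T = T \<union> {nbr h |h. vtx h \<in> T}"

text \<open>What elimination near \<open>T\<close> requires: a measured vertex that meets
  \<open>ball T\<close> through one half-edge only has two neighbours untouched by \<open>T\<close>.
  These can be averaged out, and its field goes to the neighbour in the ball.\<close>

definition clean :: "nat set \<Rightarrow> bool" where
  "clean T \<longleftrightarrow> T \<subseteq> {..<n} - V0 \<and>
     (\<forall>h h'. vtx h \<in> V0 \<longrightarrow> vtx h' = vtx h \<longrightarrow> nbr h \<in> ball T \<longrightarrow> nbr h' \<in> ball T \<longrightarrow> h = h')"

text \<open>Each measured vertex hands its field to a single neighbour, chosen in
  \<open>ball T\<close> if possible. Away from the ball the resulting \<open>r\<close> depends on
  this choice and may differ from \<open>field\<close>, which is harmless because a factor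
  \<open>1 + r v * y\<close> averages to 1.\<close>

lemma path_sum_reduce:
  assumes T: "clean T"
  obtains r where "\<And>v. v \<in> ball T \<Longrightarrow> r v = field v"
    "path_sum (\<lambda>v. if v \<in> T then Dt v else (\<lambda>y. 1 + \<sigma> v * (rt2 * y)))
       (\<lambda>v. if v \<in> T then Qt v else (\<lambda>y. - \<i> * \<sigma> v * (rt2 * y))) =
     path_sum (\<lambda>v. if v \<in> T then (\<lambda>y. Dt v y * (1 + field v * y)) else (\<lambda>y. 1 + r v * y))
       (\<lambda>v. if v \<in> T then Qt v else (\<lambda>_. 0))"
proof -
  \<comment> \<open>The half-edge along which \<open>b\<close> passes on its field; the default
    \<open>3 * b\<close> serves measured vertices without a neighbour in the ball.\<close>
  define arm where "arm b = (if \<exists>h. vtx h = b \<and> nbr h \<in> ball T then SOME h. vtx h = b \<and> nbr h \<in> ball T else 3 * b)" for b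
  have arm_at: "vtx (arm b) = b" for b
    unfolding arm_def using someI_ex[of "\<lambda>h. vtx h = b \<and> nbr h \<in> ball T"] by auto
  have arm_ball: "nbr (arm b) \<in> ball T" if "vtx h = b" "nbr h \<in> ball T" for b h
    unfolding arm_def using that someI_ex[of "\<lambda>h. vtx h = b \<and> nbr h \<in> ball T"] by auto
  have arm_unique: "h = arm b" if "b \<in> V0" "vtx h = b" "nbr h \<in> ball T" for b h
    using T that arm_ball[OF that(2,3)] arm_at[of b] unfolding clean_def by auto
  have TV: "T \<inter> V0 = {}" "T \<subseteq> {..<n}" using T by (auto simp: clean_def)
  define D where "D = (\<lambda>v. if v \<in> T then Dt v else (\<lambda>y. 1 + \<sigma> v * (rt2 * y)))"
  define Q where "Q = (\<lambda>v. if v \<in> T then Qt v else (\<lambda>y. - \<i> * \<sigma> v * (rt2 * y)))"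
  define DS where "DS S = (\<lambda>v y. D v y * (\<Prod>b\<in>S. if nbr (arm b) = v then 1 - kappa * \<sigma> b * y else 1))" for S
  define QS where "QS S = (\<lambda>v. if v \<in> S then (\<lambda>_. 0) else Q v)" for S
  have fin: "finite V0" using V0_subset finite_subset by blast
  \<comment> \<open>\<open>DS S\<close> carries the fields handed on so far, and \<open>QS S\<close>
    forbids flips of the vertices already eliminated. By 2-independence distinct measured vertices
    have disjoint sets of neighbours, so the weights at the two neighbours to be averaged out are
    still 1.\<close>
  have main: "path_sum D Q = path_sum (DS S) (QS S)" if "finite S" "S \<subseteq> V0" for S
    using that
  proof (induction S rule: finite_induct)
    case empty
    then show ?case by (simp add: DS_def QS_def)
  next
    case (insert b S)
    then have bV: "b \<in> V0" and SV: "S \<subseteq> V0" by auto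
    let ?h0 = "arm b" let ?h1 = "sib ?h0" let ?h2 = "sib (sib ?h0)"
    have at: "vtx ?h0 = b" "vtx ?h1 = b" "vtx ?h2 = b" using arm_at by auto
    have out: "nbr ?h0 \<notin> V0" "nbr ?h1 \<notin> V0" "nbr ?h2 \<notin> V0" using nbr_V0_outside at bV by auto
    have dist: "distinct [b, nbr ?h0, nbr ?h1, nbr ?h2]"
    proof -
      have "nbr ?h0 \<noteq> nbr ?h1" "nbr ?h0 \<noteq> nbr ?h2" "nbr ?h1 \<noteq> nbr ?h2"
        using nbr_V0_inj[of ?h0 ?h1] nbr_V0_inj[of ?h0 ?h2] nbr_V0_inj[of ?h1 ?h2] bV
        unfolding at by (metis sib_neq)+
      moreover have "nbr ?h0 \<noteq> b" "nbr ?h1 \<noteq> b" "nbr ?h2 \<noteq> b"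
        using out bV by metis+
      ultimately show ?thesis by (simp only: distinct.simps list.set insert_iff empty_iff not_False_eq_True simp_thms) metis
    qed
    have nT: "nbr h \<notin> ball T" if "h = ?h1 \<or> h = ?h2" for h
    proof
      assume "nbr h \<in> ball T"
      moreover have "vtx h = b" using that at by metis
      ultimately have "h = ?h0" using arm_unique[OF bV] by blast
      then show False using that sib_neq by metis
    qed
    have triv: "DS S (nbr h) = (\<lambda>_. 1)" if h: "h = ?h1 \<or> h = ?h2" for h
    proof -
      have "nbr h \<notin> T" using nT[OF h] by (auto simp: ball_def)
      moreover have "\<sigma> (nbr h) = 0" using out h \<sigma>_outside by auto
      moreover have "nbr (arm b') \<noteq> nbr h" if "b' \<in> S" for b'
      proof
        assume "nbr (arm b') = nbr h"
        moreover have "vtx h = b" using h at by metis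
        ultimately have "arm b' = h" using nbr_V0_inj[of "arm b'" h] arm_at[of b'] that SV bV by auto
        then have "b' = b" using arm_at[of b'] \<open>vtx h = b\<close> by metis
        then show False using that insert.hyps by auto
      qed
      ultimately show ?thesis by (auto simp: DS_def D_def fun_eq_iff intro!: prod.neutral)
    qed
    have trivQ: "QS S (nbr h) = (\<lambda>_. 0)" if h: "h = ?h1 \<or> h = ?h2" for h
    proof -
      have "nbr h \<notin> T" using nT[OF h] by (auto simp: ball_def)
      moreover have "\<sigma> (nbr h) = 0" using out h \<sigma>_outside by auto
      ultimately show ?thesis by (auto simp: QS_def Q_def)
    qed
    have Db: "DS S b = (\<lambda>y. 1 + \<sigma> b * (rt2 * y))"
    proof -
      have "nbr (arm b') \<noteq> b" if "b' \<in> S" for b'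
        using nbr_V0_outside[of "arm b'"] arm_at[of b'] that SV bV by auto
      then show ?thesis using TV bV by (auto simp: DS_def D_def fun_eq_iff intro!: prod.neutral)
    qed
    have "path_sum (DS S) (QS S) =
      path_sum ((DS S)(nbr ?h0 := \<lambda>y. DS S (nbr ?h0) y * (1 - kappa * \<sigma> b * y))) ((QS S)(b := \<lambda>_. 0))"
    proof (rule path_sum_remove_star[of b ?h0 ?h1 ?h2])
      show "b < n" using bV V0_subset by auto
      show "QS S b = (\<lambda>y. - \<i> * \<sigma> b * (rt2 * y))"
        using TV bV insert.hyps by (auto simp: QS_def Q_def)
      fix h assume h: "h < 3 * n" "vtx h = nbr ?h1 \<or> vtx h = nbr ?h2" and hb: "nbr h \<noteq> b"
      then obtain h' where h': "h' = ?h1 \<or> h' = ?h2" "vtx h = nbr h'" by auto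
      have op2: "nbr (opp h) = vtx h" using opp_props(4)[OF h(1)] by simp
      have "nbr h \<notin> T"
      proof
        assume "nbr h \<in> T"
        then have "vtx h \<in> ball T" using op2 unfolding ball_def by force
        then show False using nT h' by auto
      qed
      moreover have "nbr h \<notin> V0"
      proof
        assume "nbr h \<in> V0"
        moreover have "vtx h' = b" using h' at by metis
        ultimately have "opp h = h'" using nbr_V0_inj[of "opp h" h'] op2 h'(2) bV by metis
        then show False using hb h'(1) at by metis
      qed
      ultimately show "QS S (nbr h) = (\<lambda>_. 0)" using \<sigma>_outside by (auto simp: QS_def Q_def)
    qed (use at dist triv trivQ Db in auto)
    also have "(DS S)(nbr ?h0 := \<lambda>y. DS S (nbr ?h0) y * (1 - kappa * \<sigma> b * y)) = DS (insert b S)"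
      using insert.hyps by (auto simp: DS_def fun_eq_iff)
    also have "(QS S)(b := \<lambda>_. 0) = QS (insert b S)"
      by (auto simp: QS_def fun_eq_iff)
    finally show ?case using insert by auto
  qed
  \<comment> \<open>Arms of distinct measured vertices end at distinct vertices, so the product at a
    vertex has at most one non-trivial factor and \<open>THE\<close> picks it out.\<close>
  define r' where "r' v = (if \<exists>b\<in>V0. nbr (arm b) = v then - kappa * \<sigma> (THE b. b \<in> V0 \<and> nbr (arm b) = v) else 0)" for v
  have arm_inj: "b = b'" if "b \<in> V0" "b' \<in> V0" "nbr (arm b) = nbr (arm b')" for b b'
    using nbr_V0_inj[of "arm b" "arm b'"] arm_at that by metis
  have r': "(\<Prod>b\<in>V0. if nbr (arm b) = v then 1 - kappa * \<sigma> b * y else 1) = 1 + r' v * y" for v y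
  proof (cases "\<exists>b\<in>V0. nbr (arm b) = v")
    case True
    then obtain b where b: "b \<in> V0" "nbr (arm b) = v" by auto
    then have the: "(THE b. b \<in> V0 \<and> nbr (arm b) = v) = b" using arm_inj by blast
    have "(\<Prod>b\<in>V0. if nbr (arm b) = v then 1 - kappa * \<sigma> b * y else 1) =
      (\<Prod>b'\<in>V0. if b' = b then 1 - kappa * \<sigma> b' * y else 1)"
      by (rule prod.cong) (use b arm_inj in auto)
    then show ?thesis using b the fin True by (simp add: r'_def)
  next
    case False
    then show ?thesis by (auto simp: r'_def intro!: prod.neutral)
  qed
  have r'V0: "r' v = 0" if "v \<in> V0" for v
    using that nbr_V0_outside arm_at by (auto simp: r'_def)
  define r where "r v = rt2 * \<sigma> v + r' v" for v
  have rB: "r v = field v" if v: "v \<in> ball T" for v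
  proof (cases "v \<in> V0")
    case True
    then show ?thesis by (simp add: r_def r'V0 field_V0)
  next
    case nV: False
    show ?thesis
    proof (cases "\<exists>b\<in>V0. nbr (arm b) = v")
      case True
      then obtain b where b: "b \<in> V0" "nbr (arm b) = v" by auto
      then have the: "(THE b. b \<in> V0 \<and> nbr (arm b) = v) = b" using arm_inj by blast
      have "field v = - kappa * \<sigma> b" using field_nbr[of "arm b"] b arm_at[of b] by simp
      then show ?thesis using True the nV \<sigma>_outside by (simp add: r_def r'_def)
    next
      case False
      have vn: "v < n"
      proof -
        have "nbr h < n" if "vtx h \<in> T" for h
      proof -
        have "vtx h < n" using that TV by auto
        then have "h < 3 * n" by auto
        then have "opp h < 3 * n" by (rule opp_props)
        then show ?thesis by auto
      qed
        then show ?thesis using v TV by (auto simp: ball_def)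
      qed
      have "field v = 0"
      proof (rule field_other[OF nV vn])
        fix h assume h: "vtx h \<in> V0"
        show "nbr h \<noteq> v"
          using arm_unique[OF h refl] False h v by auto
      qed
      then show ?thesis using False nV \<sigma>_outside by (simp add: r_def r'_def)
    qed
  qed
  have "path_sum D Q = path_sum (DS V0) (QS V0)" using main fin by blast
  also have "DS V0 = (\<lambda>v. if v \<in> T then (\<lambda>y. Dt v y * (1 + field v * y)) else (\<lambda>y. 1 + r v * y))"
  proof (rule ext)
    fix v
    have "r' v = field v" if "v \<in> T"
    proof -
      have "v \<in> ball T" using that by (simp add: ball_def)
      moreover have "\<sigma> v = 0" using that TV \<sigma>_outside by blast
      ultimately show ?thesis using rB[of v] by (simp add: r_def)
    qed
    moreover have "(1 + \<sigma> v * (rt2 * y)) * (1 + r' v * y) = 1 + r v * y" if "v \<notin> T" for y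
      using r'V0[of v] \<sigma>_outside[of v] by (cases "v \<in> V0") (auto simp: r_def mult_ac)
    ultimately show "DS V0 v = (if v \<in> T then (\<lambda>y. Dt v y * (1 + field v * y)) else (\<lambda>y. 1 + r v * y))"
      unfolding DS_def r' D_def by (auto simp: fun_eq_iff)
  qed
  also have "QS V0 = (\<lambda>v. if v \<in> T then Qt v else (\<lambda>_. 0))"
    using TV \<sigma>_outside by (auto simp: QS_def Q_def fun_eq_iff)
  finally show ?thesis using that rB unfolding D_def Q_def by blast
qed

end

section \<open>Correlations around clean edges\<close>

context cubic_multigraph
begin

text \<open>A vertex with \<open>Q v = 0\<close> cannot be flipped, so only the few subsets of
  \<open>T\<close> remain as difference sets.\<close>

lemma path_sum_config_avg:
  assumes "T \<subseteq> {..<n}" "\<And>v. v < n \<Longrightarrow> v \<notin> T \<Longrightarrow> Q v = (\<lambda>_. 0)"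
  shows "path_sum D Q = (\<Sum>R\<in>Pow T. config_avg n (path_term D Q R))"
proof -
  have "path_sum D Q = (\<Sum>R\<in>Pow {..<n}. config_avg n (path_term D Q R))"
    by (simp add: path_sum_alt config_avg_def sum_divide_distrib)
  also have "\<dots> = (\<Sum>R\<in>Pow T. config_avg n (path_term D Q R))"
  proof (rule sum.mono_neutral_right)
    show "\<forall>R\<in>Pow {..<n} - Pow T. config_avg n (path_term D Q R) = 0"
    proof
      fix R assume "R \<in> Pow {..<n} - Pow T"
      then obtain v where "v \<in> R" "v \<notin> T" "v < n" by auto
      then have "path_term D Q R = (\<lambda>_. 0)"
        using path_term_zero assms(2) by (auto simp: fun_eq_iff)
      then show "config_avg n (path_term D Q R) = 0" by simp
    qed
  qed (use assms(1) in auto)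
  finally show ?thesis .
qed

lemma config_avg_empty: "config_avg n (path_term D Q {}) = (\<Prod>v<n. (D v 1 + D v (-1)) / 2)"
  unfolding config_avg_prod[symmetric] by (simp add: path_term_def[abs_def] cut_factor_def)

text \<open>A leaf of a flipped centre: \<open>f\<close> is the weight of the leaf and
  \<open>s\<close> the spin at the centre.\<close>

definition edge_avg :: "(complex \<Rightarrow> complex) \<Rightarrow> complex \<Rightarrow> complex" where
  "edge_avg f s = (f 1 * (cos_ph - \<i> * sin_ph * s * 1) + f (-1) * (cos_ph - \<i> * sin_ph * s * (-1))) / 2"

lemma prod_half_edges_at:
  fixes f :: "nat \<Rightarrow> complex"
  assumes "vtx g < n" "\<And>h. h < 3 * n \<Longrightarrow> vtx h \<noteq> vtx g \<Longrightarrow> f h = 1"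
  shows "(\<Prod>h<3 * n. f h) = f g * f (sib g) * f (sib (sib g))"
proof -
  have "(\<Prod>h<3 * n. f h) = (\<Prod>h\<in>{g, sib g, sib (sib g)}. f h)"
  proof (rule prod.mono_neutral_right)
    have "h < 3 * n" if "vtx h = vtx g" for h using assms(1) that by auto
    then show "{g, sib g, sib (sib g)} \<subseteq> {..<3 * n}" by auto
    show "\<forall>h\<in>{..<3 * n} - {g, sib g, sib (sib g)}. f h = 1"
      using assms(2) same_vertex[of _ g] by auto
  qed simp
  then show ?thesis by (simp add: mult.assoc)
qed

lemma prod_extract:
  fixes f :: "nat \<Rightarrow> complex"
  assumes "distinct xs" "set xs \<subseteq> {..<n}"
  shows "(\<Prod>v<n. f v) = (\<Prod>v\<leftarrow>xs. f v) * (\<Prod>v<n. if v \<in> set xs then 1 else f v)"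
proof -
  have "(\<Prod>v<n. f v) = (\<Prod>v<n. (if v \<in> set xs then f v else 1) * (if v \<in> set xs then 1 else f v))"
    by (rule prod.cong) auto
  also have "\<dots> = (\<Prod>v<n. if v \<in> set xs then f v else 1) * (\<Prod>v<n. if v \<in> set xs then 1 else f v)"
    by (rule prod.distrib)
  also have "(\<Prod>v<n. if v \<in> set xs then f v else 1) = (\<Prod>v\<in>set xs. f v)"
    by (rule prod.mono_neutral_cong_right) (use assms in auto)
  also have "\<dots> = (\<Prod>v\<leftarrow>xs. f v)"
    using assms(1) by (rule prod.distinct_set_conv_list)
  finally show ?thesis .
qed

lemma config_avg_rest:
  assumes "\<And>v. v < n \<Longrightarrow> v \<notin> S \<Longrightarrow> D v 1 + D v (-1) = 2"
  shows "config_avg n (\<lambda>Y. \<Prod>v<n. if v \<in> S then 1 else D v (spin Y v)) = 1"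
proof -
  have "config_avg n (\<lambda>Y. \<Prod>v<n. if v \<in> S then 1 else D v (spin Y v)) =
      (\<Prod>v<n. ((if v \<in> S then 1 else D v 1) + (if v \<in> S then 1 else D v (-1))) / 2)"
    using config_avg_prod[of n "\<lambda>v y. if v \<in> S then 1 else D v y"] by simp
  also have "\<dots> = 1"
    by (rule prod.neutral) (use assms in auto)
  finally show ?thesis .
qed

lemma config_avg_single:
  assumes u: "vtx g = u" "u < n"
    and dist: "distinct [u, nbr g, nbr (sib g), nbr (sib (sib g))]"
    and D: "\<And>v. v < n \<Longrightarrow> v \<notin> {u, nbr g, nbr (sib g), nbr (sib (sib g))} \<Longrightarrow> D v 1 + D v (-1) = 2"
  shows "config_avg n (path_term D Q {u}) =
    (Q u 1 * edge_avg (D (nbr g)) 1 * edge_avg (D (nbr (sib g))) 1 * edge_avg (D (nbr (sib (sib g)))) 1 +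
     Q u (-1) * edge_avg (D (nbr g)) (-1) * edge_avg (D (nbr (sib g))) (-1) * edge_avg (D (nbr (sib (sib g)))) (-1)) / 2"
proof -
  define a b c where "a = nbr g" and "b = nbr (sib g)" and "c = nbr (sib (sib g))"
  note abc = a_def[symmetric] b_def[symmetric] c_def[symmetric]
  have gn: "g < 3 * n" using u by auto
  have n: "a < n" "b < n" "c < n"
    using opp_props(3)[OF gn] opp_props(3)[OF sib_less[OF gn]] opp_props(3)[OF sib_less[OF sib_less[OF gn]]]
    by (auto simp: a_def b_def c_def)
  have d: "distinct [u, a, b, c]" using dist by (simp only: abc)
  have d': "a \<noteq> u" "b \<noteq> u" "c \<noteq> u" "a \<noteq> b" "a \<noteq> c" "b \<noteq> c" using d by auto
  let ?w = "\<lambda>x y :: complex. cos_ph - \<i> * sin_ph * x * y"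
  let ?f = "\<lambda>Y. Q u (spin Y u) * (D a (spin Y a) * ?w (spin Y u) (spin Y a)) *
     (D b (spin Y b) * ?w (spin Y u) (spin Y b)) * (D c (spin Y c) * ?w (spin Y u) (spin Y c))"
  let ?g = "\<lambda>Y. \<Prod>v<n. if v \<in> set [u, a, b, c] then 1 else D v (spin Y v)"
  have cf: "cut_factor {u} Y h = ?w (spin Y u) (spin Y v)" if "vtx h = u" "nbr h = v" "v \<noteq> u" for h v Y
    using that by (simp add: cut_factor_def)
  have "path_term D Q {u} Y = ?f Y * ?g Y" for Y
  proof -
    have "(\<Prod>h<3 * n. cut_factor {u} Y h) =
        cut_factor {u} Y g * cut_factor {u} Y (sib g) * cut_factor {u} Y (sib (sib g))"
      by (rule prod_half_edges_at) (use u in \<open>auto simp: cut_factor_def\<close>)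
    also have "\<dots> = ?w (spin Y u) (spin Y a) * ?w (spin Y u) (spin Y b) * ?w (spin Y u) (spin Y c)"
      using cf[OF u(1) a_def[symmetric] d'(1)] cf[of "sib g" b] cf[of "sib (sib g)" c] u d' by (simp add: abc)
    finally have 1: "(\<Prod>h<3 * n. cut_factor {u} Y h) = \<dots>" .
    have "(\<Prod>v<n. if v \<in> {u} then Q v (spin Y v) else D v (spin Y v)) =
      Q u (spin Y u) * D a (spin Y a) * D b (spin Y b) * D c (spin Y c) *
      (\<Prod>v<n. if v \<in> set [u, a, b, c] then 1 else if v \<in> {u} then Q v (spin Y v) else D v (spin Y v))"
      by (subst prod_extract[of "[u, a, b, c]"]) (use d d' n u in \<open>simp_all add: mult.assoc\<close>)
    also have "(\<Prod>v<n. if v \<in> set [u, a, b, c] then 1 else if v \<in> {u} then Q v (spin Y v) else D v (spin Y v)) = ?g Y"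
      by (rule prod.cong) auto
    finally show ?thesis unfolding path_term_def 1 by (simp only: mult_ac)
  qed
  then have "config_avg n (path_term D Q {u}) = config_avg n (\<lambda>Y. ?f Y * ?g Y)" by presburger
  also have "\<dots> = config_avg n ?f * config_avg n ?g"
    by (rule config_avg_indep[where A = "{u, a, b, c}"]) (auto simp: spin_def intro!: prod.cong)
  also have "config_avg n ?g = 1"
    by (rule config_avg_rest) (use D in \<open>simp add: abc\<close>)
  also have "config_avg n ?f = (Q u 1 * edge_avg (D a) 1 * edge_avg (D b) 1 * edge_avg (D c) 1 +
     Q u (-1) * edge_avg (D a) (-1) * edge_avg (D b) (-1) * edge_avg (D c) (-1)) / 2"
    unfolding edge_avg_def
    by (rule config_avg_star[where fa = "\<lambda>x y. D a y * ?w x y" and fb = "\<lambda>x y. D b y * ?w x y" and fc = "\<lambda>x y. D c y * ?w x y"])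
      (use d n u in auto)
  finally show ?thesis by (simp only: a_def b_def c_def mult_1_right)
qed

text \<open>With both ends flipped the edge between them is not cut, so the stars at
  \<open>u\<close> and \<open>w\<close> share no factor and the average is a product.\<close>

lemma config_avg_double:
  assumes u: "vtx g = u" "u < n" and w: "nbr g = w"
    and dist: "distinct [u, w, nbr (sib g), nbr (sib (sib g)), nbr (sib (opp g)), nbr (sib (sib (opp g)))]"
    and D: "\<And>v. v < n \<Longrightarrow> v \<notin> {u, w, nbr (sib g), nbr (sib (sib g)), nbr (sib (opp g)), nbr (sib (sib (opp g)))} \<Longrightarrow>
      D v 1 + D v (-1) = 2"
  shows "config_avg n (path_term D Q {u, w}) =
    ((Q u 1 * edge_avg (D (nbr (sib g))) 1 * edge_avg (D (nbr (sib (sib g)))) 1 +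
     Q u (-1) * edge_avg (D (nbr (sib g))) (-1) * edge_avg (D (nbr (sib (sib g)))) (-1)) / 2) *
    ((Q w 1 * edge_avg (D (nbr (sib (opp g)))) 1 * edge_avg (D (nbr (sib (sib (opp g))))) 1 +
     Q w (-1) * edge_avg (D (nbr (sib (opp g)))) (-1) * edge_avg (D (nbr (sib (sib (opp g))))) (-1)) / 2)"
proof -
  define g' where "g' = opp g"
  define a b c e where "a = nbr (sib g)" and "b = nbr (sib (sib g))" and "c = nbr (sib g')" and "e = nbr (sib (sib g'))"
  note abc = g'_def[symmetric] a_def[symmetric] b_def[symmetric] c_def[symmetric] e_def[symmetric]
  have gn: "g < 3 * n" using u by auto
  have gn': "g' < 3 * n" and gg: "opp g' = g" and gw: "vtx g' = w"
    using opp_props[OF gn] w by (auto simp: g'_def)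
  have wn: "w < n" using gn' gw by auto
  have n: "a < n" "b < n" "c < n" "e < n"
    using opp_props(3)[OF sib_less[OF gn]] opp_props(3)[OF sib_less[OF sib_less[OF gn]]]
      opp_props(3)[OF sib_less[OF gn']] opp_props(3)[OF sib_less[OF sib_less[OF gn']]]
    by (auto simp: a_def b_def c_def e_def)
  have d: "distinct [u, w, a, b, c, e]" using dist by (simp only: abc)
  have d': "a \<noteq> u" "b \<noteq> u" "c \<noteq> u" "e \<noteq> u" "a \<noteq> w" "b \<noteq> w" "c \<noteq> w" "e \<noteq> w" "u \<noteq> w" "w \<noteq> u"
    using d[simplified] by blast+
  let ?w = "\<lambda>x y :: complex. cos_ph - \<i> * sin_ph * x * y"
  let ?f1 = "\<lambda>Y. Q u (spin Y u) * (D a (spin Y a) * ?w (spin Y u) (spin Y a)) *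
     (D b (spin Y b) * ?w (spin Y u) (spin Y b)) * 1"
  let ?f2 = "\<lambda>Y. Q w (spin Y w) * (D c (spin Y c) * ?w (spin Y w) (spin Y c)) *
     (D e (spin Y e) * ?w (spin Y w) (spin Y e)) * 1"
  let ?g = "\<lambda>Y. \<Prod>v<n. if v \<in> set [u, w, a, b, c, e] then 1 else D v (spin Y v)"
  have cf: "cut_factor {u, w} Y h = ?w (spin Y x) (spin Y v)" if "vtx h = x" "nbr h = v" "x = u \<or> x = w" "v \<noteq> u" "v \<noteq> w" for h v x Y
    using that by (auto simp: cut_factor_def)
  have "path_term D Q {u, w} Y = ?f1 Y * (?f2 Y * ?g Y)" for Y
  proof -
    have "(\<Prod>h<3 * n. cut_factor {u, w} Y h) =
        (\<Prod>h<3 * n. (if vtx h = u then cut_factor {u, w} Y h else 1) * (if vtx h = w then cut_factor {u, w} Y h else 1))"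
    proof (rule prod.cong[OF refl])
      fix h
      have "cut_factor {u, w} Y h = 1" if "vtx h \<noteq> u" "vtx h \<noteq> w"
        using that by (simp add: cut_factor_def)
      then show "cut_factor {u, w} Y h =
          (if vtx h = u then cut_factor {u, w} Y h else 1) * (if vtx h = w then cut_factor {u, w} Y h else 1)"
        using d'(9) by (cases "vtx h = u"; cases "vtx h = w") (simp_all only: if_True if_False mult_1_left mult_1_right, simp_all)
    qed
    also have "\<dots> = (\<Prod>h<3 * n. if vtx h = u then cut_factor {u, w} Y h else 1) *
        (\<Prod>h<3 * n. if vtx h = w then cut_factor {u, w} Y h else 1)"
      by (rule prod.distrib)
    also have "(\<Prod>h<3 * n. if vtx h = u then cut_factor {u, w} Y h else 1) =
        cut_factor {u, w} Y g * cut_factor {u, w} Y (sib g) * cut_factor {u, w} Y (sib (sib g))"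
      by (subst prod_half_edges_at[of g]) (use u in auto)
    also have "(\<Prod>h<3 * n. if vtx h = w then cut_factor {u, w} Y h else 1) =
        cut_factor {u, w} Y g' * cut_factor {u, w} Y (sib g') * cut_factor {u, w} Y (sib (sib g'))"
      by (subst prod_half_edges_at[of g']) (use wn gw in auto)
    also have "cut_factor {u, w} Y g = 1"
      using u w by (simp add: cut_factor_def)
    also have "cut_factor {u, w} Y g' = 1"
      using u gg gw by (simp add: cut_factor_def)
    also have "cut_factor {u, w} Y (sib g) = ?w (spin Y u) (spin Y a)"
      by (rule cf) (simp_all add: u abc d')
    also have "cut_factor {u, w} Y (sib (sib g)) = ?w (spin Y u) (spin Y b)"
      by (rule cf) (simp_all add: u abc d')
    also have "cut_factor {u, w} Y (sib g') = ?w (spin Y w) (spin Y c)"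
      by (rule cf) (simp_all add: gw abc d')
    also have "cut_factor {u, w} Y (sib (sib g')) = ?w (spin Y w) (spin Y e)"
      by (rule cf) (simp_all add: gw abc d')
    finally have 1: "(\<Prod>h<3 * n. cut_factor {u, w} Y h) =
        1 * ?w (spin Y u) (spin Y a) * ?w (spin Y u) (spin Y b) *
        (1 * ?w (spin Y w) (spin Y c) * ?w (spin Y w) (spin Y e))" .
    have "(\<Prod>v<n. if v \<in> {u, w} then Q v (spin Y v) else D v (spin Y v)) =
      Q u (spin Y u) * Q w (spin Y w) * D a (spin Y a) * D b (spin Y b) * D c (spin Y c) * D e (spin Y e) *
      (\<Prod>v<n. if v \<in> set [u, w, a, b, c, e] then 1 else if v \<in> {u, w} then Q v (spin Y v) else D v (spin Y v))"
      by (subst prod_extract[of "[u, w, a, b, c, e]"]) (use d d' n u wn in \<open>simp_all add: mult.assoc\<close>)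
    also have "(\<Prod>v<n. if v \<in> set [u, w, a, b, c, e] then 1 else if v \<in> {u, w} then Q v (spin Y v) else D v (spin Y v)) = ?g Y"
      by (rule prod.cong) auto
    finally show ?thesis unfolding path_term_def 1 by (simp only: mult_ac mult_1_left mult_1_right)
  qed
  then have "config_avg n (path_term D Q {u, w}) = config_avg n (\<lambda>Y. ?f1 Y * (?f2 Y * ?g Y))" by presburger
  also have "\<dots> = config_avg n ?f1 * config_avg n (\<lambda>Y. ?f2 Y * ?g Y)"
    by (rule config_avg_indep[where A = "{u, a, b}"]) (use d in \<open>auto simp: spin_def intro!: prod.cong arg_cong2[where f = "(*)"]\<close>)
  also have "config_avg n (\<lambda>Y. ?f2 Y * ?g Y) = config_avg n ?f2 * config_avg n ?g"
    by (rule config_avg_indep[where A = "{w, c, e}"]) (use d in \<open>auto simp: spin_def intro!: prod.cong\<close>)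
  also have "config_avg n ?g = 1"
    by (rule config_avg_rest) (use D in \<open>simp add: abc\<close>)
  also have "config_avg n ?f1 = (Q u 1 * edge_avg (D a) 1 * edge_avg (D b) 1 * ((1 + 1) / 2) +
     Q u (-1) * edge_avg (D a) (-1) * edge_avg (D b) (-1) * ((1 + 1) / 2)) / 2"
    unfolding edge_avg_def
    by (rule config_avg_star[where c = w and fa = "\<lambda>x y. D a y * ?w x y" and fb = "\<lambda>x y. D b y * ?w x y" and fc = "\<lambda>x y. 1"])
      (use d n u wn in auto)
  also have "config_avg n ?f2 = (Q w 1 * edge_avg (D c) 1 * edge_avg (D e) 1 * ((1 + 1) / 2) +
     Q w (-1) * edge_avg (D c) (-1) * edge_avg (D e) (-1) * ((1 + 1) / 2)) / 2"
    unfolding edge_avg_def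
    by (rule config_avg_star[where c = u and fa = "\<lambda>x y. D c y * ?w x y" and fb = "\<lambda>x y. D e y * ?w x y" and fc = "\<lambda>x y. 1"])
      (use d n u wn in auto)
  finally show ?thesis by (simp add: a_def b_def c_def e_def g'_def)
qed

lemma edge_avg_linear: "edge_avg (\<lambda>y. 1 + r * y) s = cos_ph - \<i> * sin_ph * s * r"
  by (simp add: edge_avg_def field_simps)

lemma edge_avg_shifted: "edge_avg (\<lambda>y. rt2 * y * (1 + r * y)) s = rt2 * (cos_ph * r - \<i> * sin_ph * s)"
  by (simp add: edge_avg_def field_simps)

end

text \<open>The correlation of adjacent spins in a tree neighbourhood, with fields \<open>ru\<close>
  and \<open>rw\<close> at the two ends \<open>u\<close> and \<open>w\<close>, \<open>a\<close> and
  \<open>b\<close> at the other neighbours of \<open>u\<close>, \<open>c\<close> and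
  \<open>e\<close> at those of \<open>w\<close>. The terms stem from the difference sets {}, {u},
  {w} and {u, w}. When all fields are 0 only \<open>- sin_ph * cos_ph * cos_ph\<close> survives, the
  unconditional correlation.\<close>

definition pair_corr :: "complex \<Rightarrow> complex \<Rightarrow> complex \<Rightarrow> complex \<Rightarrow> complex \<Rightarrow> complex \<Rightarrow> complex" where
  "pair_corr ru rw a b c e = (ru * rw - 2 * (sin_ph * cos_ph * cos_ph)
     - sin_ph * cos_ph * cos_ph * (rw * (a + b) + ru * (c + e))
     + sin_ph * sin_ph * sin_ph * (a * b + c * e)
     + sin_ph * sin_ph * cos_ph * cos_ph * (a + b) * (c + e)) / 2"

text \<open>The mean of one spin with field \<open>rx\<close> whose neighbours carry the fields
  \<open>a\<close>, \<open>b\<close>, \<open>c\<close>; the first term belongs to the empty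
  difference set, the others to the flipped spin.\<close>

definition single_corr :: "complex \<Rightarrow> complex \<Rightarrow> complex \<Rightarrow> complex \<Rightarrow> complex" where
  "single_corr rx a b c = rt2 * (rx - sin_ph * cos_ph * cos_ph * (a + b + c) + sin_ph * sin_ph * sin_ph * a * b * c)"

context measured_graph
begin

text \<open>Measured bits are thus uniform: every outcome on \<open>V0\<close> has probability one
  over 2 to the power \<open>card V0\<close>. With no vertex kept, all factors left after
  elimination average to 1.\<close>

lemma stat_norm: "stat (\<lambda>_. 1) \<sigma> = 1"
proof -
  have "clean {}" by (simp add: clean_def ball_def)
  then obtain r where "path_sum (\<lambda>v. if v \<in> {} then (\<lambda>_. 0) else (\<lambda>y. 1 + \<sigma> v * (rt2 * y)))
       (\<lambda>v. if v \<in> {} then (\<lambda>_. 0) else (\<lambda>y. - \<i> * \<sigma> v * (rt2 * y))) =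
     path_sum (\<lambda>v. if v \<in> {} then (\<lambda>y. 0 * (1 + field v * y)) else (\<lambda>y. 1 + r v * y))
       (\<lambda>v. if v \<in> {} then (\<lambda>_. 0) else (\<lambda>_. 0))"
    by (rule path_sum_reduce)
  then have "stat (\<lambda>_. 1) \<sigma> = path_sum (\<lambda>v y. 1 + r v * y) (\<lambda>v _. 0)"
    unfolding stat_path_sum by simp
  also have "\<dots> = 1"
    by (subst path_sum_config_avg[of "{}"]) (simp_all add: config_avg_empty)
  finally show ?thesis .
qed

lemma stat_single:
  assumes cl: "clean {x}" and g: "vtx g = x" "x < n"
    and dist: "distinct [x, nbr g, nbr (sib g), nbr (sib (sib g))]"
  shows "stat ((\<lambda>_. 1)(x := 0)) (\<sigma>(x := 1)) =
    single_corr (field x) (field (nbr g)) (field (nbr (sib g))) (field (nbr (sib (sib g))))"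
proof -
  let ?T = "{x}"
  obtain r where r: "\<And>v. v \<in> ball ?T \<Longrightarrow> r v = field v"
    and eq: "path_sum (\<lambda>v. if v \<in> ?T then (\<lambda>y. rt2 * y) else (\<lambda>y. 1 + \<sigma> v * (rt2 * y)))
       (\<lambda>v. if v \<in> ?T then (\<lambda>y. - \<i> * (rt2 * y)) else (\<lambda>y. - \<i> * \<sigma> v * (rt2 * y))) =
     path_sum (\<lambda>v. if v \<in> ?T then (\<lambda>y. rt2 * y * (1 + field v * y)) else (\<lambda>y. 1 + r v * y))
       (\<lambda>v. if v \<in> ?T then (\<lambda>y. - \<i> * (rt2 * y)) else (\<lambda>_. 0))"
    by (rule path_sum_reduce[OF cl, where Dt = "\<lambda>_ y. rt2 * y" and Qt = "\<lambda>_ y. - \<i> * (rt2 * y)"]) (erule that[rotated], blast)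
  let ?D = "\<lambda>v. if v \<in> ?T then (\<lambda>y. rt2 * y * (1 + field v * y)) else (\<lambda>y. 1 + r v * y)"
  let ?Q = "\<lambda>v. if v \<in> ?T then (\<lambda>y. - \<i> * (rt2 * y)) else (\<lambda>_. 0)"
  have "stat ((\<lambda>_. 1)(x := 0)) (\<sigma>(x := 1)) = path_sum ?D ?Q"
    unfolding stat_path_sum eq[symmetric] by (rule arg_cong2[where f = path_sum]) (auto simp: fun_eq_iff)
  also have "\<dots> = config_avg n (path_term ?D ?Q {}) + config_avg n (path_term ?D ?Q {x})"
    by (subst path_sum_config_avg[of "{x}"]) (use g in \<open>auto simp: Pow_insert\<close>)
  also have "config_avg n (path_term ?D ?Q {}) = rt2 * field x"
  proof -
    have "(\<Prod>v<n. (?D v 1 + ?D v (-1)) / 2) = (\<Prod>v<n. if v = x then rt2 * field x else 1)"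
      by (rule prod.cong) (auto simp: field_simps)
    then show ?thesis using g by (simp add: config_avg_empty)
  qed
  also have "config_avg n (path_term ?D ?Q {x}) = - rt2 * (sin_ph * cos_ph * cos_ph * (field (nbr g) + field (nbr (sib g)) + field (nbr (sib (sib g))))
     - sin_ph * sin_ph * sin_ph * field (nbr g) * field (nbr (sib g)) * field (nbr (sib (sib g))))"
  proof -
    have in_ball: "nbr h \<in> ball {x}" if "vtx h = x" for h using that by (auto simp: ball_def)
    have D: "?D (nbr h) = (\<lambda>y. 1 + field (nbr h) * y)" if "h = g \<or> h = sib g \<or> h = sib (sib g)" for h
      using that dist r[OF in_ball[of h]] g by auto
    have e: "edge_avg (?D (nbr h)) s = cos_ph - \<i> * sin_ph * s * field (nbr h)" if "h = g \<or> h = sib g \<or> h = sib (sib g)" for h s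
      unfolding D[OF that] by (rule edge_avg_linear)
    have "config_avg n (path_term ?D ?Q {x}) =
      (?Q x 1 * edge_avg (?D (nbr g)) 1 * edge_avg (?D (nbr (sib g))) 1 * edge_avg (?D (nbr (sib (sib g)))) 1 +
       ?Q x (-1) * edge_avg (?D (nbr g)) (-1) * edge_avg (?D (nbr (sib g))) (-1) * edge_avg (?D (nbr (sib (sib g)))) (-1)) / 2"
      by (rule config_avg_single[OF g dist]) auto
    also have "\<dots> = - rt2 * (sin_ph * cos_ph * cos_ph * (field (nbr g) + field (nbr (sib g)) + field (nbr (sib (sib g))))
     - sin_ph * sin_ph * sin_ph * field (nbr g) * field (nbr (sib g)) * field (nbr (sib (sib g))))"
    proof -
      have "(- (\<i> * (t * 1)) * (c - \<i> * s * 1 * a) * (c - \<i> * s * 1 * b) * (c - \<i> * s * 1 * d) +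
         - (\<i> * (t * (-1))) * (c - \<i> * s * (-1) * a) * (c - \<i> * s * (-1) * b) * (c - \<i> * s * (-1) * d)) / 2 =
         - t * (s * c * c * (a + b + d) - s * s * s * a * b * d)" for t c s a b d :: complex
        by (simp add: field_simps)
      from this[of rt2 cos_ph sin_ph] show ?thesis
        using e by simp
    qed
    finally show ?thesis .
  qed
  finally show ?thesis by (rule trans) (simp add: single_corr_def algebra_simps)
qed

text \<open>When just one end is flipped, the other is an ordinary leaf, but with weight
  \<open>rt2 * y * (1 + field w * y)\<close>; this is the case \<open>edge_avg_shifted\<close> is
  made for.\<close>

lemma stat_pair:
  assumes cl: "clean {u, w}" and g: "vtx g = u" "u < n" "nbr g = w"
    and dist: "distinct [u, w, nbr (sib g), nbr (sib (sib g)), nbr (sib (opp g)), nbr (sib (sib (opp g)))]"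
  shows "stat ((\<lambda>_. 1)(u := 0, w := 0)) (\<sigma>(u := 1, w := 1)) =
    pair_corr (field u) (field w) (field (nbr (sib g))) (field (nbr (sib (sib g))))
      (field (nbr (sib (opp g)))) (field (nbr (sib (sib (opp g)))))"
proof -
  let ?T = "{u, w}"
  obtain r where r: "\<And>v. v \<in> ball ?T \<Longrightarrow> r v = field v"
    and eq: "path_sum (\<lambda>v. if v \<in> ?T then (\<lambda>y. rt2 * y) else (\<lambda>y. 1 + \<sigma> v * (rt2 * y)))
       (\<lambda>v. if v \<in> ?T then (\<lambda>y. - \<i> * (rt2 * y)) else (\<lambda>y. - \<i> * \<sigma> v * (rt2 * y))) =
     path_sum (\<lambda>v. if v \<in> ?T then (\<lambda>y. rt2 * y * (1 + field v * y)) else (\<lambda>y. 1 + r v * y))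
       (\<lambda>v. if v \<in> ?T then (\<lambda>y. - \<i> * (rt2 * y)) else (\<lambda>_. 0))"
    by (rule path_sum_reduce[OF cl, where Dt = "\<lambda>_ y. rt2 * y" and Qt = "\<lambda>_ y. - \<i> * (rt2 * y)"]) (erule that[rotated], blast)
  let ?D = "\<lambda>v. if v \<in> ?T then (\<lambda>y. rt2 * y * (1 + field v * y)) else (\<lambda>y. 1 + r v * y)"
  let ?Q = "\<lambda>v. if v \<in> ?T then (\<lambda>y. - \<i> * (rt2 * y)) else (\<lambda>_. 0)"
  define a b c e where "a = nbr (sib g)" and "b = nbr (sib (sib g))" and "c = nbr (sib (opp g))" and "e = nbr (sib (sib (opp g)))"
  note abc = a_def[symmetric] b_def[symmetric] c_def[symmetric] e_def[symmetric]
  have gn: "g < 3 * n" using g by auto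
  have g': "opp (opp g) = g" "vtx (opp g) = w" "opp g < 3 * n" using opp_props[OF gn] g by auto
  have wn: "w < n" using g' by auto
  have d: "distinct [u, w, a, b, c, e]" using dist by (simp only: abc)
  have uw: "u \<noteq> w" "w \<noteq> u" using d by auto
  have B: "a \<in> ball ?T" "b \<in> ball ?T" "c \<in> ball ?T" "e \<in> ball ?T"
  proof -
    have "nbr h \<in> ball ?T" if "vtx h = u \<or> vtx h = w" for h
      using that unfolding ball_def by blast
    then show "a \<in> ball ?T" "b \<in> ball ?T" "c \<in> ball ?T" "e \<in> ball ?T"
      unfolding a_def b_def c_def e_def using g g' by simp_all
  qed
  have D: "?D a = (\<lambda>y. 1 + field a * y)" "?D b = (\<lambda>y. 1 + field b * y)" "?D c = (\<lambda>y. 1 + field c * y)" "?D e = (\<lambda>y. 1 + field e * y)"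
    "?D u = (\<lambda>y. rt2 * y * (1 + field u * y))" "?D w = (\<lambda>y. rt2 * y * (1 + field w * y))"
    using d r[OF B(1)] r[OF B(2)] r[OF B(3)] r[OF B(4)] by auto
  have Q: "?Q u = (\<lambda>y. - \<i> * (rt2 * y))" "?Q w = (\<lambda>y. - \<i> * (rt2 * y))" by auto
  have E: "edge_avg (?D a) s = cos_ph - \<i> * sin_ph * s * field a" "edge_avg (?D b) s = cos_ph - \<i> * sin_ph * s * field b"
    "edge_avg (?D c) s = cos_ph - \<i> * sin_ph * s * field c" "edge_avg (?D e) s = cos_ph - \<i> * sin_ph * s * field e"
    "edge_avg (?D u) s = rt2 * (cos_ph * field u - \<i> * sin_ph * s)" "edge_avg (?D w) s = rt2 * (cos_ph * field w - \<i> * sin_ph * s)" for s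
    unfolding D edge_avg_linear edge_avg_shifted by (rule refl)+
  have "stat ((\<lambda>_. 1)(u := 0, w := 0)) (\<sigma>(u := 1, w := 1)) = path_sum ?D ?Q"
    unfolding stat_path_sum eq[symmetric] by (rule arg_cong2[where f = path_sum]) (auto simp: fun_eq_iff)
  also have "\<dots> = config_avg n (path_term ?D ?Q {}) + config_avg n (path_term ?D ?Q {u}) +
      config_avg n (path_term ?D ?Q {w}) + config_avg n (path_term ?D ?Q {u, w})"
  proof -
    have "Pow {u, w} = {{}, {u}, {w}, {u, w}}" by auto
    moreover have "{u} \<noteq> {u, w}" "{w} \<noteq> {u, w}" using uw by auto
    ultimately show ?thesis
      by (subst path_sum_config_avg[of "{u, w}"]) (use g wn uw in \<open>simp_all add: add.assoc\<close>)
  qed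
  also have "config_avg n (path_term ?D ?Q {}) = rt2 * rt2 * (field u * field w)"
  proof -
    have "(\<Prod>v<n. (?D v 1 + ?D v (-1)) / 2) = (\<Prod>v<n. (if v = u then rt2 * field u else 1) * (if v = w then rt2 * field w else 1))"
      by (rule prod.cong) (use uw in \<open>auto simp: field_simps\<close>)
    then show ?thesis using g wn by (simp add: config_avg_empty prod.distrib)
  qed
  also have "config_avg n (path_term ?D ?Q {u}) = - (rt2 * rt2) * (sin_ph * cos_ph * cos_ph * field w * (field a + field b) + sin_ph * cos_ph * cos_ph
     - sin_ph * sin_ph * sin_ph * field a * field b)"
  proof -
    have "config_avg n (path_term ?D ?Q {u}) =
      (?Q u 1 * edge_avg (?D w) 1 * edge_avg (?D a) 1 * edge_avg (?D b) 1 +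
       ?Q u (-1) * edge_avg (?D w) (-1) * edge_avg (?D a) (-1) * edge_avg (?D b) (-1)) / 2"
      using config_avg_single[OF g(1,2), of ?D ?Q] d by (auto simp only: g(3) abc) auto
    also have "\<dots> = - (rt2 * rt2) * (sin_ph * cos_ph * cos_ph * field w * (field a + field b) + sin_ph * cos_ph * cos_ph
     - sin_ph * sin_ph * sin_ph * field a * field b)"
      unfolding E Q by (simp add: field_simps)
    finally show ?thesis .
  qed
  also have "config_avg n (path_term ?D ?Q {w}) = - (rt2 * rt2) * (sin_ph * cos_ph * cos_ph * field u * (field c + field e) + sin_ph * cos_ph * cos_ph
     - sin_ph * sin_ph * sin_ph * field c * field e)"
  proof -
    have "config_avg n (path_term ?D ?Q {w}) =
      (?Q w 1 * edge_avg (?D u) 1 * edge_avg (?D c) 1 * edge_avg (?D e) 1 +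
       ?Q w (-1) * edge_avg (?D u) (-1) * edge_avg (?D c) (-1) * edge_avg (?D e) (-1)) / 2"
      using config_avg_single[OF g'(2) wn, of ?D ?Q] d by (auto simp only: g'(1) g(1) abc) auto
    also have "\<dots> = - (rt2 * rt2) * (sin_ph * cos_ph * cos_ph * field u * (field c + field e) + sin_ph * cos_ph * cos_ph
     - sin_ph * sin_ph * sin_ph * field c * field e)"
      unfolding E Q by (simp add: field_simps)
    finally show ?thesis .
  qed
  also have "config_avg n (path_term ?D ?Q {u, w}) = rt2 * rt2 * (sin_ph * sin_ph * cos_ph * cos_ph * (field a + field b) * (field c + field e))"
  proof -
    have "config_avg n (path_term ?D ?Q {u, w}) =
      ((?Q u 1 * edge_avg (?D a) 1 * edge_avg (?D b) 1 + ?Q u (-1) * edge_avg (?D a) (-1) * edge_avg (?D b) (-1)) / 2) *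
      ((?Q w 1 * edge_avg (?D c) 1 * edge_avg (?D e) 1 + ?Q w (-1) * edge_avg (?D c) (-1) * edge_avg (?D e) (-1)) / 2)"
      using config_avg_double[OF g, of ?D ?Q] d by (auto simp only: abc) auto
    also have "\<dots> = (- rt2 * sin_ph * cos_ph * (field a + field b)) * (- rt2 * sin_ph * cos_ph * (field c + field e))"
      unfolding E Q by (rule arg_cong2[where f = "(*)"]) (simp_all add: field_simps)
    finally show ?thesis by (simp add: algebra_simps)
  qed
  finally show ?thesis
    by (rule trans) (unfold rt2_sq pair_corr_def abc, simp add: field_simps)
qed

end

section \<open>The energy shift as a sum over half-edges\<close>

context cubic_multigraph
begin

text \<open>The second clause supplies what \<open>clean\<close> demands of measured vertices other
  than the two ends of the edge. By \<open>not_local_tree_cyclic\<close> the property fails only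
  next to a cycle of length at most five.\<close>

definition local_tree :: "nat \<Rightarrow> bool" where
  "local_tree g \<longleftrightarrow>
     distinct [vtx g, nbr g, nbr (sib g), nbr (sib (sib g)), nbr (sib (opp g)), nbr (sib (sib (opp g)))] \<and>
     (\<forall>h h'. vtx h < n \<longrightarrow> vtx h' = vtx h \<longrightarrow> vtx h \<noteq> vtx g \<longrightarrow> vtx h \<noteq> nbr g \<longrightarrow>
        nbr h \<in> {vtx g, nbr g, nbr (sib g), nbr (sib (sib g)), nbr (sib (opp g)), nbr (sib (sib (opp g)))} \<longrightarrow>
        nbr h' \<in> {vtx g, nbr g, nbr (sib g), nbr (sib (sib g)), nbr (sib (opp g)), nbr (sib (sib (opp g)))} \<longrightarrow> h = h')"

lemma sum_sib:
  fixes f :: "nat \<Rightarrow> complex"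
  shows "(\<Sum>h\<in>{h. h < 3 * n \<and> vtx h \<notin> W}. f (sib h)) = (\<Sum>h\<in>{h. h < 3 * n \<and> vtx h \<notin> W}. f h)"
  by (rule sum.reindex_bij_witness[where i = "\<lambda>h. sib (sib h)" and j = sib])
    (auto intro: sib_less)

text \<open>Every edge, loops included, is seen from both of its half-edges, which turns the factor
  1 / 2 into 1 / 4.\<close>

lemma sum_edge_spins: "(\<Sum>e\<in>M. (1 / 2) * (1 - edge_spins e X)) = (\<Sum>g<3 * n. 1 - spin X (vtx g) * spin X (nbr g)) / 4"
proof -
  have "(\<Sum>g<3 * n. 1 - spin X (vtx g) * spin X (nbr g)) = (\<Sum>e\<in>M. \<Sum>g\<in>e. 1 - spin X (vtx g) * spin X (nbr g))"
    by (rule sum_half_edges[OF matching'])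
  also have "\<dots> = (\<Sum>e\<in>M. 4 * ((1 / 2) * (1 - edge_spins e X)))"
  proof (rule sum.cong[OF refl])
    fix e assume "e \<in> M"
    then obtain h where h: "h < 3 * n" "e = {h, opp h}" "opp h \<noteq> h" by (rule edge_cases)
    then have "h \<noteq> opp h" by metis
    with h show "(\<Sum>g\<in>e. 1 - spin X (vtx g) * spin X (nbr g)) = 4 * ((1 / 2) * (1 - edge_spins e X))"
      by (simp add: edge_spins_pair opp_props mult.commute)
  qed
  finally show ?thesis
    unfolding sum_distrib_left[symmetric] by (metis nonzero_mult_div_cancel_left zero_neq_numeral)
qed

end

section \<open>Crude bounds, for half-edges that are not locally tree-like\<close>

lemma norm_constants: "cmod rt2 \<le> 1" "cmod cos_ph \<le> 1" "cmod sin_ph \<le> 1"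
  by (simp_all add: rt2_def cos_ph_def sin_ph_def norm_divide divide_le_eq real_sqrt_ge_one)

lemma norm_mult_le: "cmod x \<le> a \<Longrightarrow> cmod y \<le> b \<Longrightarrow> 0 \<le> a \<Longrightarrow> cmod (x * y) \<le> a * b"
  by (simp add: norm_mult mult_mono)

lemma norm_constants_prod:
  "cmod (sin_ph * cos_ph * cos_ph) \<le> 1" "cmod (sin_ph * sin_ph * sin_ph) \<le> 1"
  "cmod (sin_ph * sin_ph * cos_ph * cos_ph) \<le> 1" "cmod kappa \<le> 1"
  using norm_constants by (simp_all add: norm_mult kappa_def mult_le_one)

lemma norm_pair_corr:
  assumes "cmod ru \<le> 4" "cmod rw \<le> 4" "cmod a \<le> 4" "cmod b \<le> 4" "cmod c \<le> 4" "cmod e \<le> 4"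
  shows "cmod (pair_corr ru rw a b c e) \<le> 100"
proof -
  have 1: "cmod (ru * rw) \<le> 4 * 4" by (rule norm_mult_le) (use assms in auto)
  have 2: "cmod (a + b) \<le> 8" "cmod (c + e) \<le> 8"
    using norm_triangle_ineq[of a b] norm_triangle_ineq[of c e] assms by linarith+
  have 3: "cmod (rw * (a + b)) \<le> 4 * 8" "cmod (ru * (c + e)) \<le> 4 * 8"
    by (rule norm_mult_le; use assms 2 in simp)+
  have 4: "cmod (sin_ph * cos_ph * cos_ph * (rw * (a + b) + ru * (c + e))) \<le> 1 * 64"
    by (rule norm_mult_le) (use norm_constants_prod norm_triangle_ineq[of "rw * (a + b)" "ru * (c + e)"] 3 in auto)
  have 5: "cmod (a * b) \<le> 4 * 4" "cmod (c * e) \<le> 4 * 4"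
    by (rule norm_mult_le; use assms in simp)+
  have 6: "cmod (sin_ph * sin_ph * sin_ph * (a * b + c * e)) \<le> 1 * 32"
    by (rule norm_mult_le) (use norm_constants_prod norm_triangle_ineq[of "a * b" "c * e"] 5 in auto)
  have 7: "cmod (sin_ph * sin_ph * cos_ph * cos_ph * (a + b) * (c + e)) \<le> 1 * 8 * 8"
    by (rule norm_mult_le, rule norm_mult_le) (use norm_constants_prod 2 in auto)
  have 8: "cmod (2 * (sin_ph * cos_ph * cos_ph)) \<le> 2 * 1"
    by (rule norm_mult_le) (use norm_constants_prod in auto)
  have "cmod (ru * rw - 2 * (sin_ph * cos_ph * cos_ph)
     - sin_ph * cos_ph * cos_ph * (rw * (a + b) + ru * (c + e))
     + sin_ph * sin_ph * sin_ph * (a * b + c * e)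
     + sin_ph * sin_ph * cos_ph * cos_ph * (a + b) * (c + e)) \<le> 16 + 2 + 64 + 32 + 64"
    by (intro order_trans[OF norm_triangle_ineq] order_trans[OF norm_triangle_ineq4] add_mono) (use 1 4 6 7 8 in auto)
  then show ?thesis unfolding pair_corr_def by (simp add: norm_divide)
qed

lemma norm_single_corr:
  assumes "cmod rx \<le> 4" "cmod a \<le> 4" "cmod b \<le> 4" "cmod c \<le> 4"
  shows "cmod (single_corr rx a b c) \<le> 100"
proof -
  have 1: "cmod (a + b + c) \<le> 4 + 4 + 4"
    by (intro order_trans[OF norm_triangle_ineq] add_mono) (use assms in auto)
  have 2: "cmod (sin_ph * cos_ph * cos_ph * (a + b + c)) \<le> 1 * 12"
    by (rule norm_mult_le) (use norm_constants_prod 1 in auto)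
  have 3: "cmod (sin_ph * sin_ph * sin_ph * a * b * c) \<le> 1 * 4 * 4 * 4"
    by (rule norm_mult_le, rule norm_mult_le, rule norm_mult_le) (use norm_constants_prod assms in auto)
  have 4: "cmod (rx - sin_ph * cos_ph * cos_ph * (a + b + c) + sin_ph * sin_ph * sin_ph * a * b * c) \<le> 4 + 12 + 64"
    by (intro order_trans[OF norm_triangle_ineq] order_trans[OF norm_triangle_ineq4] add_mono) (use assms 2 3 in auto)
  have "cmod (single_corr rx a b c) \<le> 1 * 80"
    unfolding single_corr_def by (rule norm_mult_le) (use norm_constants 4 in auto)
  then show ?thesis by simp
qed

section \<open>Conditional correlations along an edge\<close>

context measured_graph
begin

text \<open>The diagonal of the projector onto the outcomes, scaled by 2 to the power
  \<open>card V0\<close>. By \<open>sum_weight\<close> this scaling normalises the conditional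
  state, so \<open>corr\<close> is already the conditional correlation.\<close>

definition weight :: "nat set \<Rightarrow> complex" where
  "weight X = (\<Prod>v<n. 1 + \<sigma> v * spin X v)"

definition corr :: "nat \<Rightarrow> complex" where
  "corr g = (\<Sum>X\<in>Pow {..<n}. of_real ((cmod (amp n M X))\<^sup>2) * (weight X * (spin X (vtx g) * spin X (nbr g))))"

text \<open>Each factor is 0, 1 or 2, so the weights are non-negative and \<open>corr\<close> is an
  average of the values 1 and -1.\<close>

lemma weight_real: "weight X = of_real (cmod (weight X))"
proof -
  have "\<exists>t\<ge>0. 1 + \<sigma> v * spin X v = of_real t" for v
  proof -
    have "1 + \<sigma> v * spin X v = of_real 1 \<or> 1 + \<sigma> v * spin X v = of_real 2 \<or> 1 + \<sigma> v * spin X v = of_real 0"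
      using \<sigma>_inside[of v] \<sigma>_outside[of v] by (cases "v \<in> V0") (auto simp: spin_def)
    then show ?thesis
      by (elim disjE) (rule exI[of _ 1], simp, rule exI[of _ 2], simp, rule exI[of _ 0], simp)
  qed
  then obtain t where t: "\<And>v. t v \<ge> 0" "\<And>v. 1 + \<sigma> v * spin X v = of_real (t v)" by metis
  have "weight X = of_real (\<Prod>v<n. t v)" unfolding weight_def t(2) by simp
  moreover have "(\<Prod>v<n. t v) \<ge> 0" by (rule prod_nonneg) (use t in auto)
  ultimately show ?thesis by (metis abs_of_nonneg norm_of_real)
qed

lemma sum_weight: "(\<Sum>X\<in>Pow {..<n}. of_real ((cmod (amp n M X))\<^sup>2) * weight X) = 1"
  using stat_norm unfolding stat_def weight_def .

lemma norm_corr: "cmod (corr g) \<le> 1"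
proof -
  have "cmod (corr g) \<le> (\<Sum>X\<in>Pow {..<n}. cmod (of_real ((cmod (amp n M X))\<^sup>2) * (weight X * (spin X (vtx g) * spin X (nbr g)))))"
    unfolding corr_def by (rule norm_sum)
  also have "\<dots> = (\<Sum>X\<in>Pow {..<n}. (cmod (amp n M X))\<^sup>2 * cmod (weight X))"
    by (rule sum.cong) (auto simp: norm_mult spin_def simp del: of_real_power)
  also have "complex_of_real \<dots> = (\<Sum>X\<in>Pow {..<n}. of_real ((cmod (amp n M X))\<^sup>2) * weight X)"
    by (simp add: weight_real[symmetric])
  then have "(\<Sum>X\<in>Pow {..<n}. (cmod (amp n M X))\<^sup>2 * cmod (weight X)) = 1"
    unfolding sum_weight by (metis of_real_eq_1_iff)
  finally show ?thesis .
qed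

lemma corr_opp: "g < 3 * n \<Longrightarrow> corr (opp g) = corr g"
  by (simp add: corr_def opp_props mult.commute)

lemma weight_two:
  assumes "u \<notin> V0" "w \<notin> V0" "u \<noteq> w" "u < n" "w < n"
  shows "weight X * (spin X u * spin X w) = (\<Prod>v<n. ((\<lambda>_. 1)(u := 0, w := 0)) v + (\<sigma>(u := 1, w := 1)) v * spin X v)"
proof -
  have "(\<Prod>v<n. ((\<lambda>_. 1)(u := 0, w := 0)) v + (\<sigma>(u := 1, w := 1)) v * spin X v) =
     (\<Prod>v<n. (1 + \<sigma> v * spin X v) * ((if v = u then spin X u else 1) * (if v = w then spin X w else 1)))"
    by (rule prod.cong) (use assms \<sigma>_outside in auto)
  also have "\<dots> = weight X * (spin X u * spin X w)"
    using assms by (simp add: prod.distrib weight_def)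
  finally show ?thesis by simp
qed

lemma weight_one:
  assumes "x \<notin> V0" "x < n"
  shows "weight X * spin X x = (\<Prod>v<n. ((\<lambda>_. 1)(x := 0)) v + (\<sigma>(x := 1)) v * spin X v)"
proof -
  have "(\<Prod>v<n. ((\<lambda>_. 1)(x := 0)) v + (\<sigma>(x := 1)) v * spin X v) =
     (\<Prod>v<n. (1 + \<sigma> v * spin X v) * (if v = x then spin X x else 1))"
    by (rule prod.cong) (use assms \<sigma>_outside in auto)
  also have "\<dots> = weight X * spin X x"
    using assms by (simp add: prod.distrib weight_def)
  finally show ?thesis by simp
qed

text \<open>Where the weight is non-zero, the spin at \<open>b\<close> equals its outcome.\<close>

lemma weight_V0:
  assumes "b \<in> V0"
  shows "weight X * spin X b = \<sigma> b * weight X"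
proof -
  have b: "b < n" using assms V0_subset by auto
  have "(1 + \<sigma> b * spin X b) * spin X b = \<sigma> b * (1 + \<sigma> b * spin X b)"
    using \<sigma>_inside[OF assms] by (auto simp: spin_def)
  then have "(1 + \<sigma> b * spin X b) * R * spin X b = \<sigma> b * ((1 + \<sigma> b * spin X b) * R)" for R
    by (metis mult.assoc mult.commute)
  moreover have "weight X = (1 + \<sigma> b * spin X b) * (\<Prod>v\<in>{..<n} - {b}. 1 + \<sigma> v * spin X v)"
    unfolding weight_def using b by (intro prod.remove) auto
  ultimately show ?thesis by (simp only:)
qed

definition nbhd :: "nat \<Rightarrow> nat set" where
  "nbhd g = {vtx g, nbr g, nbr (sib g), nbr (sib (sib g)), nbr (sib (opp g)), nbr (sib (sib (opp g)))}"

lemma ball_pair: "g < 3 * n \<Longrightarrow> ball {vtx g, nbr g} \<subseteq> nbhd g"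
proof
  fix v assume g: "g < 3 * n" and v: "v \<in> ball {vtx g, nbr g}"
  have *: "nbr h \<in> nbhd g" if "vtx h = vtx g \<or> vtx h = vtx (opp g)" for h
  proof -
    have "h \<in> {g, sib g, sib (sib g), opp g, sib (opp g), sib (sib (opp g))}"
      using that unfolding same_vertex by (elim disjE) simp_all
    then have "nbr h \<in> nbr ` {g, sib g, sib (sib g), opp g, sib (opp g), sib (sib (opp g))}"
      by (rule imageI)
    also have "\<dots> = nbhd g"
      unfolding nbhd_def image_insert image_empty opp_props(4)[OF g] by blast
    finally show ?thesis .
  qed
  have "vtx g \<in> nbhd g" "nbr g \<in> nbhd g" unfolding nbhd_def by blast+
  then show "v \<in> nbhd g" using v * unfolding ball_def by blast
qed

lemma ball_single: "ball {vtx g} \<subseteq> {vtx g, nbr g, nbr (sib g), nbr (sib (sib g))}"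
proof
  fix v assume "v \<in> ball {vtx g}"
  then consider "v = vtx g" | h where "v = nbr h" "vtx h = vtx g" unfolding ball_def by blast
  then show "v \<in> {vtx g, nbr g, nbr (sib g), nbr (sib (sib g))}"
    by cases (simp, simp only: same_vertex insert_iff, blast)
qed

lemma corr_pair:
  assumes g: "g < 3 * n" "local_tree g" and V: "vtx g \<notin> V0" "nbr g \<notin> V0"
  shows "corr g = pair_corr (field (vtx g)) (field (nbr g)) (field (nbr (sib g))) (field (nbr (sib (sib g))))
      (field (nbr (sib (opp g)))) (field (nbr (sib (sib (opp g)))))"
proof -
  have d: "distinct [vtx g, nbr g, nbr (sib g), nbr (sib (sib g)), nbr (sib (opp g)), nbr (sib (sib (opp g)))]"
    using g(2) by (simp only: local_tree_def)
  have n: "vtx g < n" "nbr g < n" using g(1) opp_props(3)[OF g(1)] by auto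
  have "clean {vtx g, nbr g}"
    unfolding clean_def
  proof (intro conjI allI impI)
    show "{vtx g, nbr g} \<subseteq> {..<n} - V0" using n V by auto
    fix h h' assume h: "vtx h \<in> V0" "vtx h' = vtx h" "nbr h \<in> ball {vtx g, nbr g}" "nbr h' \<in> ball {vtx g, nbr g}"
    have "nbr h \<in> nbhd g" "nbr h' \<in> nbhd g" using h(3,4) ball_pair[OF g(1)] by blast+
    moreover have "vtx h < n" using V0_half_edge[OF h(1)] by auto
    moreover have "vtx h \<noteq> vtx g" "vtx h \<noteq> nbr g" using h(1) V by metis+
    ultimately show "h = h'" using g(2) h(2) unfolding local_tree_def nbhd_def by blast
  qed
  note s = stat_pair[OF this refl n(1) refl d]
  have uw: "vtx g \<noteq> nbr g" using d by (simp only: distinct.simps list.set) blast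
  have "corr g = stat ((\<lambda>_. 1)(vtx g := 0, nbr g := 0)) (\<sigma>(vtx g := 1, nbr g := 1))"
    unfolding corr_def stat_def weight_two[OF V uw n] by (rule refl)
  then show ?thesis using s by (rule trans)
qed

text \<open>The measured end contributes only the sign \<open>\<sigma> (nbr g)\<close>, so it
  suffices to keep \<open>vtx g\<close>. The measured vertex \<open>nbr g\<close> itself is outside
  the second clause of \<open>local_tree\<close>; for it \<open>clean\<close> follows from the
  distinctness of the six vertices.\<close>

lemma corr_boundary:
  assumes g: "g < 3 * n" "local_tree g" and V: "vtx g \<notin> V0" "nbr g \<in> V0"
  shows "corr g = \<sigma> (nbr g) * single_corr (field (vtx g)) (field (nbr g)) (field (nbr (sib g))) (field (nbr (sib (sib g))))"
proof -
  have d: "distinct [vtx g, nbr g, nbr (sib g), nbr (sib (sib g)), nbr (sib (opp g)), nbr (sib (sib (opp g)))]"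
    using g(2) by (simp only: local_tree_def)
  have d4: "distinct [vtx g, nbr g, nbr (sib g), nbr (sib (sib g))]"
    using d by (simp only: distinct.simps list.set insert_iff empty_iff) blast
  have n: "vtx g < n" "nbr g < n" using g(1) opp_props(3)[OF g(1)] by auto
  have "clean {vtx g}"
    unfolding clean_def
  proof (intro conjI allI impI)
    show "{vtx g} \<subseteq> {..<n} - V0" using n V by auto
    fix h h' assume h: "vtx h \<in> V0" "vtx h' = vtx h" "nbr h \<in> ball {vtx g}" "nbr h' \<in> ball {vtx g}"
    have B: "nbr h \<in> {vtx g, nbr g, nbr (sib g), nbr (sib (sib g))}" "nbr h' \<in> {vtx g, nbr g, nbr (sib g), nbr (sib (sib g))}"
      using h(3,4) ball_single by blast+
    show "h = h'"
    proof (cases "vtx h = nbr g")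
      case True
      have "k = opp g" if k: "vtx k = nbr g" "nbr k \<in> {vtx g, nbr g, nbr (sib g), nbr (sib (sib g))}" for k
      proof (rule ccontr)
        assume "k \<noteq> opp g"
        then have "k = sib (opp g) \<or> k = sib (sib (opp g))" using same_vertex[of k "opp g"] k(1) by auto
        then show False using k(2) d by (auto simp only: distinct.simps list.set insert_iff empty_iff)
      qed
      then show ?thesis using True h(2) B by metis
    next
      case False
      have "vtx h < n" using V0_half_edge[OF h(1)] by auto
      moreover have "vtx h \<noteq> vtx g" using h(1) V by metis
      moreover have "nbr h \<in> nbhd g" "nbr h' \<in> nbhd g" using B by (auto simp: nbhd_def)
      ultimately show "h = h'" using g(2) h(2) False unfolding local_tree_def nbhd_def by blast
    qed
  qed
  note s = stat_single[OF this refl n(1) d4]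
  have "corr g = \<sigma> (nbr g) * stat ((\<lambda>_. 1)(vtx g := 0)) (\<sigma>(vtx g := 1))"
  proof -
    have "weight X * (spin X (vtx g) * spin X (nbr g)) = \<sigma> (nbr g) * (weight X * spin X (vtx g))" for X
      using weight_V0[OF V(2), of X] by (metis mult.assoc mult.commute)
    note key = this
    show ?thesis
      unfolding corr_def stat_def weight_one[OF V(1) n(1), symmetric] key sum_distrib_left
      by (rule sum.cong[OF refl]) (rule mult.left_commute)
  qed
  then show ?thesis unfolding s .
qed

text \<open>The closed form is defined at every half-edge, also where the graph is not locally a
  tree and it may differ from \<open>corr\<close>: only a sum over all half-edges can be rearranged
  by \<open>sib\<close> and \<open>opp\<close>.\<close>

definition corr_formula :: "nat \<Rightarrow> complex" where
  "corr_formula g = (if vtx g \<in> V0 then \<sigma> (vtx g) * single_corr (field (nbr g)) (field (vtx g)) (field (nbr (sib (opp g)))) (field (nbr (sib (sib (opp g)))))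
     else if nbr g \<in> V0 then \<sigma> (nbr g) * single_corr (field (vtx g)) (field (nbr g)) (field (nbr (sib g))) (field (nbr (sib (sib g))))
     else pair_corr (field (vtx g)) (field (nbr g)) (field (nbr (sib g))) (field (nbr (sib (sib g))))
      (field (nbr (sib (opp g)))) (field (nbr (sib (sib (opp g))))))"

lemma local_tree_opp: "g < 3 * n \<Longrightarrow> local_tree g \<Longrightarrow> local_tree (opp g)"
proof -
  assume g: "g < 3 * n" "local_tree g"
  have o: "opp (opp g) = g" using opp_props[OF g(1)] by simp
  have s: "{nbr g, vtx g, nbr (sib (opp g)), nbr (sib (sib (opp g))), nbr (sib g), nbr (sib (sib g))} =
    {vtx g, nbr g, nbr (sib g), nbr (sib (sib g)), nbr (sib (opp g)), nbr (sib (sib (opp g)))}" by blast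
  have d: "distinct [vtx g, nbr g, nbr (sib g), nbr (sib (sib g)), nbr (sib (opp g)), nbr (sib (sib (opp g)))]"
    using g(2) by (simp only: local_tree_def)
  then have "distinct [nbr g, vtx g, nbr (sib (opp g)), nbr (sib (sib (opp g))), nbr (sib g), nbr (sib (sib g))]"
    using distinct_card[OF d] s by (intro card_distinct) (simp only: list.set list.size)
  then show ?thesis using g(2) unfolding local_tree_def o s by metis
qed

lemma corr_eq_formula:
  assumes g: "g < 3 * n" "local_tree g"
  shows "corr g = corr_formula g"
proof (cases "vtx g \<in> V0")
  case True
  have o: "opp g < 3 * n" "opp (opp g) = g" using opp_props[OF g(1)] by auto
  have "corr g = corr (opp g)" using corr_opp[OF g(1)] by simp
  also have "\<dots> = \<sigma> (nbr (opp g)) * single_corr (field (vtx (opp g))) (field (nbr (opp g))) (field (nbr (sib (opp g)))) (field (nbr (sib (sib (opp g)))))"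
    by (rule corr_boundary[OF o(1) local_tree_opp[OF g]]) (use True nbr_V0_outside o in auto)
  finally show ?thesis using True by (simp add: corr_formula_def o)
next
  case False
  then show ?thesis using corr_pair[OF g] corr_boundary[OF g] by (simp add: corr_formula_def)
qed

lemma norm_field: "cmod (field v) \<le> 4"
proof -
  have s: "cmod (\<sigma> v) \<le> 1" for v
    using \<sigma>_inside[of v] \<sigma>_outside[of v] by (cases "v \<in> V0") auto
  have 1: "cmod (\<sigma> (nbr (3 * v)) + \<sigma> (nbr (3 * v + 1)) + \<sigma> (nbr (3 * v + 2))) \<le> 1 + 1 + 1"
    by (intro order_trans[OF norm_triangle_ineq] add_mono s)
  have 2: "cmod (kappa * (\<sigma> (nbr (3 * v)) + \<sigma> (nbr (3 * v + 1)) + \<sigma> (nbr (3 * v + 2)))) \<le> 1 * 3"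
    by (rule norm_mult_le) (use norm_constants_prod 1 in auto)
  have 3: "cmod (rt2 * \<sigma> v) \<le> 1 * 1"
    by (rule norm_mult_le) (use norm_constants s in auto)
  show ?thesis unfolding field_def using norm_triangle_ineq4[of "rt2 * \<sigma> v" "kappa * (\<sigma> (nbr (3 * v)) + \<sigma> (nbr (3 * v + 1)) + \<sigma> (nbr (3 * v + 2)))"] 2 3
    by linarith
qed

lemma norm_corr_formula: "cmod (corr_formula g) \<le> 100"
proof -
  have s: "cmod (\<sigma> v) \<le> 1" for v
    using \<sigma>_inside[of v] \<sigma>_outside[of v] by (cases "v \<in> V0") auto
  have "cmod (\<sigma> v * single_corr (field a) (field b) (field c) (field d)) \<le> 1 * 100" for v a b c d
    by (rule norm_mult_le[OF s norm_single_corr]) (simp_all add: norm_field)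
  then show ?thesis unfolding corr_formula_def using norm_pair_corr norm_field by simp
qed

end

section \<open>Collecting the closed forms into three quadratic sums\<close>

context measured_graph
begin

text \<open>\<open>o_val\<close> is the outcome across \<open>h\<close>, \<open>v_val\<close> the
  total outcome around the vertex of \<open>h\<close>, \<open>nu\<close> the same at the far end,
  and \<open>P_val\<close> adds \<open>nu\<close> over the two siblings. Their products pair
  vertices next to \<open>V0\<close>: \<open>v_val h * nu h\<close> at distance one,
  \<open>nu h * P_val h\<close> at distance two, \<open>P_val h * P_val (opp h)\<close> at distance
  three.\<close>

definition o_val :: "nat \<Rightarrow> complex" where "o_val h = \<sigma> (nbr h)"
definition v_val :: "nat \<Rightarrow> complex" where "v_val h = o_val h + o_val (sib h) + o_val (sib (sib h))"
definition nu :: "nat \<Rightarrow> complex" where "nu h = v_val (opp h)"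
definition P_val :: "nat \<Rightarrow> complex" where "P_val h = nu (sib h) + nu (sib (sib h))"

definition outer :: "nat set" where "outer = {h. h < 3 * n \<and> vtx h \<notin> V0}"
definition inner :: "nat set" where "inner = {h. h < 3 * n \<and> vtx h \<notin> V0 \<and> nbr h \<notin> V0}"
definition boundary :: "nat set" where "boundary = {h. h < 3 * n \<and> vtx h \<notin> V0 \<and> nbr h \<in> V0}"

lemma finite_half_edge_sets [simp]: "finite outer" "finite inner" "finite boundary"
  by (auto simp: outer_def inner_def boundary_def)

lemma outer_split: "outer = inner \<union> boundary" "inner \<inter> boundary = {}"
  by (auto simp: outer_def inner_def boundary_def)

lemma v_val_sib [simp]: "v_val (sib h) = v_val h"
  by (simp add: v_val_def add_ac)

lemma field_eq: "field (vtx h) = rt2 * \<sigma> (vtx h) - kappa * v_val h"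
proof -
  have "\<sigma> (nbr (3 * vtx h)) + \<sigma> (nbr (3 * vtx h + 1)) + \<sigma> (nbr (3 * vtx h + 2)) = v_val h"
    by (cases h rule: sib_cases) (simp_all add: v_val_def o_val_def add_ac)
  then show ?thesis by (simp add: field_def)
qed

lemma field_nbr_eq: "field (nbr h) = rt2 * o_val h - kappa * nu h"
  using field_eq[of "opp h"] by (simp add: o_val_def nu_def)

lemma o_val_inner: "h \<in> inner \<Longrightarrow> o_val h = 0"
  by (simp add: o_val_def inner_def \<sigma>_outside)

lemma o_val_sq: "nbr h \<in> V0 \<Longrightarrow> o_val h * o_val h = 1"
  using \<sigma>_inside[of "nbr h"] by (auto simp: o_val_def)

lemma o_val_nonzero: "o_val h \<noteq> 0 \<Longrightarrow> nbr h \<in> V0"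
  using \<sigma>_outside by (auto simp: o_val_def)

text \<open>2-independence in product form: here, that a measured vertex has no measured neighbour;
  in \<open>o_o\<close>, that no vertex has two measured neighbours.\<close>

lemma o_nu: "h < 3 * n \<Longrightarrow> o_val h * nu h = 0"
proof (cases "nbr h \<in> V0")
  case True
  have "o_val k = 0" if "vtx k = nbr h" for k
    using nbr_V0_outside[of k] that True \<sigma>_outside by (simp add: o_val_def)
  then have "nu h = 0" by (simp add: nu_def v_val_def)
  then show ?thesis by simp
qed (use \<sigma>_outside in \<open>simp add: o_val_def\<close>)

lemma o_o:
  assumes "h < 3 * n" "k < 3 * n" "vtx h = vtx k" "h \<noteq> k"
  shows "o_val h * o_val k = 0"
proof (rule ccontr)
  assume "o_val h * o_val k \<noteq> 0"
  then have V: "nbr h \<in> V0" "nbr k \<in> V0" using o_val_nonzero by auto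
  have "opp h = opp k"
    using nbr_V0_inj[of "opp h" "opp k"] V assms opp_props(4)[of h] opp_props(4)[of k] by simp
  then show False using assms opp_props(4)[of h] opp_props(4)[of k] by metis
qed

lemma inner_opp: "h \<in> inner \<Longrightarrow> opp h \<in> inner" "h \<in> inner \<Longrightarrow> opp (opp h) = h"
  by (auto simp: inner_def opp_props)

lemma outer_sib: "h \<in> outer \<Longrightarrow> sib h \<in> outer"
  by (auto simp: outer_def intro: sib_less)

lemma sum_outer_sib:
  fixes f :: "nat \<Rightarrow> complex"
  shows "(\<Sum>h\<in>outer. f (sib h)) = (\<Sum>h\<in>outer. f h)"
  unfolding outer_def by (rule sum_sib)

lemma sum_inner_opp:
  fixes f :: "nat \<Rightarrow> complex"
  shows "(\<Sum>h\<in>inner. f (opp h)) = (\<Sum>h\<in>inner. f h)"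
  by (rule sum.reindex_bij_witness[where i = opp and j = opp]) (auto simp: inner_opp)

lemma nu_opp_inner: "h \<in> inner \<Longrightarrow> nu (opp h) = v_val h" "h \<in> inner \<Longrightarrow> v_val (opp h) = nu h"
  by (simp_all add: nu_def inner_opp)

lemma field_products:
  assumes "h < 3 * n"
  shows "field (nbr (sib h)) * field (nbr (sib (sib h))) = 2 / 27 * (nu (sib h) * nu (sib (sib h)))
    - sin_ph / 3 * (o_val (sib h) * nu (sib (sib h)) + o_val (sib (sib h)) * nu (sib h))"
proof -
  have 1: "o_val (sib h) * o_val (sib (sib h)) = 0"
    by (rule o_o) (use assms in \<open>auto intro: sib_less\<close>)
  have k: "kappa * kappa = 2 / 27" "rt2 * kappa = sin_ph / 3"
  proof -
    have "kappa * kappa = (sin_ph * sin_ph) * (cos_ph * cos_ph) * (cos_ph * cos_ph) * (rt2 * rt2)"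
      by (simp add: kappa_def)
    then show "kappa * kappa = 2 / 27" by (simp add: sin_ph_sq cos_ph_sq rt2_sq)
    have "rt2 * kappa = sin_ph * (cos_ph * cos_ph) * (rt2 * rt2)" by (simp add: kappa_def)
    then show "rt2 * kappa = sin_ph / 3" by (simp add: cos_ph_sq rt2_sq)
  qed
  have "field (nbr (sib h)) * field (nbr (sib (sib h))) =
    (rt2 * rt2) * (o_val (sib h) * o_val (sib (sib h))) + (kappa * kappa) * (nu (sib h) * nu (sib (sib h)))
    - (rt2 * kappa) * (o_val (sib h) * nu (sib (sib h)) + o_val (sib (sib h)) * nu (sib h))"
    unfolding field_nbr_eq by (simp add: algebra_simps)
  then show ?thesis unfolding 1 k by simp
qed

lemma field_sum_inner:
  assumes "h \<in> inner"
  shows "field (nbr (sib h)) + field (nbr (sib (sib h))) = rt2 * v_val h - kappa * P_val h"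
  unfolding field_nbr_eq using o_val_inner[OF assms] by (simp add: v_val_def P_val_def algebra_simps)

lemma constants:
  "sin_ph * cos_ph * cos_ph = 2 / 3 * sin_ph" "sin_ph * sin_ph * sin_ph = sin_ph / 3"
  "sin_ph * sin_ph * cos_ph * cos_ph = 2 / 9" "kappa * kappa = 2 / 27" "rt2 * kappa = sin_ph / 3"
  "rt2 * rt2 = 1 / 2" "sin_ph * sin_ph = 1 / 3"
proof -
  show 1: "sin_ph * cos_ph * cos_ph = 2 / 3 * sin_ph"
    using cos_ph_sq by (metis mult.assoc mult.commute)
  show "sin_ph * sin_ph * sin_ph = sin_ph / 3" by (simp add: sin_ph_sq)
  have "sin_ph * sin_ph * cos_ph * cos_ph = (sin_ph * sin_ph) * (cos_ph * cos_ph)" by simp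
  then show "sin_ph * sin_ph * cos_ph * cos_ph = 2 / 9" by (simp add: sin_ph_sq cos_ph_sq)
  have k: "kappa = 2 / 3 * sin_ph * rt2" unfolding kappa_def 1 by simp
  have "kappa * kappa = 4 / 9 * (sin_ph * sin_ph) * (rt2 * rt2)" unfolding k by simp
  then show "kappa * kappa = 2 / 27" by (simp add: sin_ph_sq rt2_sq)
  have "rt2 * kappa = 2 / 3 * sin_ph * (rt2 * rt2)" unfolding k by simp
  then show "rt2 * kappa = sin_ph / 3" by (simp add: rt2_sq)
qed (rule rt2_sq sin_ph_sq)+

text \<open>Both ends unmeasured. Adding \<open>sin_ph * cos_ph * cos_ph\<close> subtracts the
  unconditional correlation, and the factor 2 removes the denominator of \<open>pair_corr\<close>.
  Fields are linear in the outcomes, so what remains is homogeneous of degree two.\<close>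

lemma corr_formula_inner:
  assumes h: "h \<in> inner"
  shows "2 * (corr_formula h + sin_ph * cos_ph * cos_ph) = v_val h * nu h / 3
    - 10 / 81 * sin_ph * (nu h * P_val h + v_val h * P_val (opp h))
    + 2 / 81 * sin_ph * (nu (sib h) * nu (sib (sib h)) + nu (sib (opp h)) * nu (sib (sib (opp h))))
    - (o_val (sib h) * nu (sib (sib h)) + o_val (sib (sib h)) * nu (sib h)
       + (o_val (sib (opp h)) * nu (sib (sib (opp h))) + o_val (sib (sib (opp h))) * nu (sib (opp h)))) / 27
    + 4 / 243 * (P_val h * P_val (opp h))"
proof -
  have hn: "h < 3 * n" "opp h < 3 * n" and V: "vtx h \<notin> V0" "nbr h \<notin> V0"
    using h opp_props by (auto simp: inner_def)
  have u: "field (vtx h) = - kappa * v_val h" "field (nbr h) = - kappa * nu h"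
    using field_eq[of h] field_nbr_eq[of h] o_val_inner[OF h] \<sigma>_outside[OF V(1)] by auto
  have s: "field (nbr (sib h)) + field (nbr (sib (sib h))) = rt2 * v_val h - kappa * P_val h"
    "field (nbr (sib (opp h))) + field (nbr (sib (sib (opp h)))) = rt2 * nu h - kappa * P_val (opp h)"
    using field_sum_inner[OF h] field_sum_inner[OF inner_opp(1)[OF h]] nu_opp_inner(2)[OF h] by auto
  have "2 * (corr_formula h + sin_ph * cos_ph * cos_ph) = field (vtx h) * field (nbr h)
     - sin_ph * cos_ph * cos_ph * (field (nbr h) * (field (nbr (sib h)) + field (nbr (sib (sib h))))
         + field (vtx h) * (field (nbr (sib (opp h))) + field (nbr (sib (sib (opp h))))))
     + sin_ph * sin_ph * sin_ph * (field (nbr (sib h)) * field (nbr (sib (sib h))) + field (nbr (sib (opp h))) * field (nbr (sib (sib (opp h)))))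
     + sin_ph * sin_ph * cos_ph * cos_ph * (field (nbr (sib h)) + field (nbr (sib (sib h)))) * (field (nbr (sib (opp h))) + field (nbr (sib (sib (opp h)))))"
  proof -
    have g: "2 * ((x - 2 * q - r + s + t) / 2 + q) = x - r + s + t" for x q r s t :: complex
      by (simp add: field_simps)
    show ?thesis
      unfolding corr_formula_def pair_corr_def by (simp only: V if_False) (rule g)
  qed
  also have "\<dots> = (kappa * kappa) * (v_val h * nu h)
     + (sin_ph * cos_ph * cos_ph) * (2 * (rt2 * kappa) * (v_val h * nu h) - (kappa * kappa) * (nu h * P_val h + v_val h * P_val (opp h)))
     + sin_ph * sin_ph * sin_ph * (field (nbr (sib h)) * field (nbr (sib (sib h))) + field (nbr (sib (opp h))) * field (nbr (sib (sib (opp h)))))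
     + sin_ph * sin_ph * cos_ph * cos_ph * ((rt2 * rt2) * (v_val h * nu h) - (rt2 * kappa) * (nu h * P_val h + v_val h * P_val (opp h))
        + (kappa * kappa) * (P_val h * P_val (opp h)))"
    unfolding u s by (simp add: algebra_simps)
  also have "\<dots> = v_val h * nu h / 3
    - 10 / 81 * sin_ph * (nu h * P_val h + v_val h * P_val (opp h))
    + 2 / 81 * sin_ph * (nu (sib h) * nu (sib (sib h)) + nu (sib (opp h)) * nu (sib (sib (opp h))))
    - (o_val (sib h) * nu (sib (sib h)) + o_val (sib (sib h)) * nu (sib h)
       + (o_val (sib (opp h)) * nu (sib (sib (opp h))) + o_val (sib (sib (opp h))) * nu (sib (opp h)))) / 27
    + 4 / 243 * (P_val h * P_val (opp h))"
  proof -
    have gen: "2 / 27 * x + 2 / 3 * s * (2 * (s / 3) * x - 2 / 27 * y) + s / 3 * (2 / 27 * a - s / 3 * b + (2 / 27 * a' - s / 3 * b'))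
      + 2 / 9 * (1 / 2 * x - s / 3 * y + 2 / 27 * z) = x / 3 - 10 / 81 * s * y + 2 / 81 * s * (a + a') - (b + b') / 27 + 4 / 243 * z"
      if "s * s = 1 / 3" for s x y z a a' b b' :: complex
    proof -
      have ss: "s * (s * t) = t / 3" for t
        unfolding mult.assoc[symmetric] that by simp
      show ?thesis by (simp add: ss that algebra_simps add_divide_distrib diff_divide_distrib)
    qed
    show ?thesis
      unfolding constants(1-6) field_products[OF hn(1)] field_products[OF hn(2)] by (rule gen[OF constants(7)])
  qed
  finally show ?thesis .
qed

text \<open>One end measured. Its outcome squares to 1 where it meets the sign in front of
  \<open>single_corr\<close>; this produces the constant baseline and lowers the cubic term to
  degree two.\<close>

lemma corr_formula_boundary:
  assumes h: "h \<in> boundary"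
  shows "corr_formula h + sin_ph * cos_ph * cos_ph = 2 / 27 * (o_val h * P_val h) + sin_ph / 81 * (nu (sib h) * nu (sib (sib h)))"
proof -
  have hn: "h < 3 * n" and V: "vtx h \<notin> V0" "nbr h \<in> V0" using h by (auto simp: boundary_def)
  have o2: "o_val h * o_val h = 1" using o_val_sq V by simp
  have "o_val h \<noteq> 0" using o2 by auto
  then have z: "o_val (sib h) = 0" "o_val (sib (sib h)) = 0" "nu h = 0"
    using o_o[of h "sib h"] o_o[of h "sib (sib h)"] o_nu[of h] hn sib_less[OF hn] sib_less[OF sib_less[OF hn]] by auto
  have f: "field (vtx h) = - kappa * o_val h" "field (nbr h) = rt2 * o_val h"
    "field (nbr (sib h)) = - kappa * nu (sib h)" "field (nbr (sib (sib h))) = - kappa * nu (sib (sib h))"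
    using field_eq[of h] field_nbr_eq[of h] field_nbr_eq[of "sib h"] field_nbr_eq[of "sib (sib h)"] z \<sigma>_outside[OF V(1)]
    by (auto simp: v_val_def)
  have "corr_formula h = o_val h * (rt2 * (- kappa * o_val h - sin_ph * cos_ph * cos_ph * (rt2 * o_val h - kappa * P_val h)
     + sin_ph * sin_ph * sin_ph * (rt2 * o_val h) * (- kappa * nu (sib h)) * (- kappa * nu (sib (sib h)))))"
    using V unfolding corr_formula_def single_corr_def f by (simp add: o_val_def P_val_def algebra_simps)
  also have "\<dots> = (o_val h * o_val h) * (- (rt2 * kappa) - (sin_ph * cos_ph * cos_ph) * (rt2 * rt2)
     + (sin_ph * sin_ph * sin_ph) * (rt2 * rt2) * (kappa * kappa) * (nu (sib h) * nu (sib (sib h))))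
     + (sin_ph * cos_ph * cos_ph) * (rt2 * kappa) * (o_val h * P_val h)"
    by (simp add: algebra_simps)
  also have "\<dots> = - (sin_ph / 3) - (2 / 3 * sin_ph) * (1 / 2) + sin_ph / 3 * (1 / 2) * (2 / 27) * (nu (sib h) * nu (sib (sib h)))
     + 2 / 9 * (sin_ph * sin_ph) * (o_val h * P_val h)"
    unfolding o2 constants by (simp add: field_simps constants(7))
  also have "\<dots> + sin_ph * cos_ph * cos_ph = 2 / 27 * (o_val h * P_val h) + sin_ph / 81 * (nu (sib h) * nu (sib (sib h)))"
    unfolding constants by (simp add: field_simps)
  finally show ?thesis .
qed

text \<open>Shifts by \<open>sib\<close> and \<open>opp\<close> identify the mixed sums: those in
  \<open>o_val\<close> and \<open>nu\<close> all equal the sum of \<open>v_val g * nu g\<close>, and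
  the products of \<open>nu\<close> over the two siblings, summed over \<open>outer\<close>, amount
  to half the sum of \<open>nu g * P_val g\<close>. The coefficients arise as 5 / 18 = 1 / 6 - 1 /
  27 + 2 * (2 / 27) and 1 / 9 = 10 / 81 - 1 / 81.\<close>

lemma total_shift:
  "(\<Sum>g<3 * n. corr_formula g + sin_ph * cos_ph * cos_ph) =
     5 / 18 * (\<Sum>g\<in>inner. v_val g * nu g) - sin_ph / 9 * (\<Sum>g\<in>inner. nu g * P_val g)
     + 2 / 243 * (\<Sum>g\<in>inner. P_val g * P_val (opp g))"
proof -
  let ?f = "\<lambda>g. corr_formula g + sin_ph * cos_ph * cos_ph"
  let ?X = "\<Sum>g\<in>inner. v_val g * nu g" and ?Y = "\<Sum>g\<in>inner. nu g * P_val g"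
  let ?Z = "\<Sum>g\<in>inner. P_val g * P_val (opp g)"
  let ?N = "\<lambda>g. nu (sib g) * nu (sib (sib g))"
  let ?O = "\<lambda>g. o_val (sib g) * nu (sib (sib g)) + o_val (sib (sib g)) * nu (sib g)"
  have nu_bd: "nu h = 0" if "h \<in> boundary" for h
    using o_nu[of h] o_val_sq[of h] that by (auto simp: boundary_def)
  have o_bd: "o_val (sib h) = 0" "o_val (sib (sib h)) = 0" if "h \<in> boundary" for h
  proof -
    have hn: "h < 3 * n" "o_val h \<noteq> 0" using that o_val_sq[of h] by (auto simp: boundary_def)
    then show "o_val (sib h) = 0" "o_val (sib (sib h)) = 0"
      using o_o[of h "sib h"] o_o[of h "sib (sib h)"] sib_less[OF hn(1)] sib_less[OF sib_less[OF hn(1)]] by auto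
  qed
  have to_outer: "(\<Sum>g\<in>outer. f g) = (\<Sum>g\<in>inner. f g) + (\<Sum>g\<in>boundary. f g)" for f :: "nat \<Rightarrow> complex"
    unfolding outer_split(1) by (rule sum.union_disjoint) (simp_all add: outer_split)
  define W where "W = (\<Sum>h\<in>outer. nu h * nu (sib h))"
  have shift: "(\<Sum>h\<in>outer. f h) = (\<Sum>h\<in>outer. f (sib h))" "(\<Sum>h\<in>outer. f h) = (\<Sum>h\<in>outer. f (sib (sib h)))" for f :: "nat \<Rightarrow> complex"
    using sum_outer_sib[of f] sum_outer_sib[of "\<lambda>h. f (sib h)"] by auto
  have N: "(\<Sum>h\<in>outer. ?N h) = W"
    unfolding W_def using shift(1)[of "\<lambda>h. nu h * nu (sib h)"] by simp
  have Y: "?Y = 2 * W"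
  proof -
    have "?Y = (\<Sum>h\<in>outer. nu h * P_val h)"
      unfolding to_outer by (simp add: nu_bd)
    also have "\<dots> = W + (\<Sum>h\<in>outer. nu h * nu (sib (sib h)))"
      by (simp add: P_val_def W_def distrib_left sum.distrib)
    also have "(\<Sum>h\<in>outer. nu h * nu (sib (sib h))) = W"
      unfolding W_def using shift(1)[of "\<lambda>h. nu h * nu (sib (sib h))"] by (simp add: mult.commute)
    finally show ?thesis by simp
  qed
  have Y': "(\<Sum>g\<in>inner. v_val g * P_val (opp g)) = ?Y"
    using sum_inner_opp[of "\<lambda>g. nu g * P_val g"] by (simp add: nu_opp_inner)
  have X: "(\<Sum>h\<in>outer. nu h * (o_val (sib h) + o_val (sib (sib h)))) = ?X"
  proof -
    have "nu h * (o_val (sib h) + o_val (sib (sib h))) = v_val h * nu h" if "h \<in> outer" for h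
      using o_nu[of h] that by (simp add: v_val_def outer_def algebra_simps)
    then have "(\<Sum>h\<in>outer. nu h * (o_val (sib h) + o_val (sib (sib h)))) = (\<Sum>h\<in>outer. v_val h * nu h)"
      by (rule sum.cong[OF refl])
    then show ?thesis unfolding to_outer by (simp add: nu_bd)
  qed
  have Osum: "(\<Sum>g\<in>inner. ?O g) = ?X"
  proof -
    have "(\<Sum>g\<in>inner. ?O g) = (\<Sum>g\<in>outer. ?O g)"
      unfolding to_outer by (simp add: o_bd)
    also have "\<dots> = (\<Sum>g\<in>outer. o_val (sib g) * nu (sib (sib g))) + (\<Sum>g\<in>outer. o_val (sib (sib g)) * nu (sib g))"
      by (rule sum.distrib)
    also have "(\<Sum>g\<in>outer. o_val (sib g) * nu (sib (sib g))) = (\<Sum>g\<in>outer. nu g * o_val (sib (sib g)))"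
      using shift(2)[of "\<lambda>g. nu g * o_val (sib (sib g))"] by (simp add: mult.commute)
    also have "(\<Sum>g\<in>outer. o_val (sib (sib g)) * nu (sib g)) = (\<Sum>g\<in>outer. nu g * o_val (sib g))"
      using shift(1)[of "\<lambda>g. nu g * o_val (sib g)"] by (simp add: mult.commute)
    finally show ?thesis unfolding X[symmetric] by (simp add: distrib_left sum.distrib)
  qed
  have oP: "(\<Sum>g\<in>boundary. o_val g * P_val g) = ?X"
  proof -
    have "(\<Sum>g\<in>boundary. o_val g * P_val g) = (\<Sum>g\<in>outer. o_val g * P_val g)"
      unfolding to_outer by (simp add: o_val_inner)
    also have "\<dots> = (\<Sum>g\<in>outer. o_val g * nu (sib g)) + (\<Sum>g\<in>outer. o_val g * nu (sib (sib g)))"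
      by (simp add: P_val_def distrib_left sum.distrib)
    also have "(\<Sum>g\<in>outer. o_val g * nu (sib g)) = (\<Sum>g\<in>outer. nu g * o_val (sib (sib g)))"
      using shift(2)[of "\<lambda>g. o_val g * nu (sib g)"] by (simp add: mult.commute)
    also have "(\<Sum>g\<in>outer. o_val g * nu (sib (sib g))) = (\<Sum>g\<in>outer. nu g * o_val (sib g))"
      using shift(1)[of "\<lambda>g. o_val g * nu (sib (sib g))"] by (simp add: mult.commute)
    finally show ?thesis unfolding X[symmetric] by (simp add: distrib_left sum.distrib)
  qed
  \<comment> \<open>Inner half-edges, and boundary half-edges counted together with their partners
    at \<open>V0\<close>, give the products \<open>?N\<close> the same coefficient, so the two
    partial sums merge into \<open>W\<close>.\<close>
  have Ninner: "(\<Sum>g\<in>inner. ?N g) + (\<Sum>g\<in>boundary. ?N g) = W"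
    using N unfolding to_outer .
  have opp_sums: "(\<Sum>g\<in>inner. ?N (opp g)) = (\<Sum>g\<in>inner. ?N g)" "(\<Sum>g\<in>inner. ?O (opp g)) = (\<Sum>g\<in>inner. ?O g)"
    by (rule sum_inner_opp)+
  have inner_sum: "2 * (\<Sum>g\<in>inner. ?f g) = ?X / 3 - 10 / 81 * sin_ph * (?Y + ?Y)
    + 2 / 81 * sin_ph * ((\<Sum>g\<in>inner. ?N g) + (\<Sum>g\<in>inner. ?N g)) - (?X + ?X) / 27 + 4 / 243 * ?Z"
  proof -
    have "2 * (\<Sum>g\<in>inner. ?f g) = (\<Sum>g\<in>inner. v_val g * nu g / 3
      - 10 / 81 * sin_ph * (nu g * P_val g + v_val g * P_val (opp g))
      + 2 / 81 * sin_ph * (?N g + ?N (opp g)) - (?O g + ?O (opp g)) / 27 + 4 / 243 * (P_val g * P_val (opp g)))"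
      unfolding sum_distrib_left by (rule sum.cong[OF refl]) (rule corr_formula_inner)
    also have "\<dots> = (\<Sum>g\<in>inner. v_val g * nu g) / 3 - 10 / 81 * sin_ph * ((\<Sum>g\<in>inner. nu g * P_val g) + (\<Sum>g\<in>inner. v_val g * P_val (opp g)))
      + 2 / 81 * sin_ph * ((\<Sum>g\<in>inner. ?N g) + (\<Sum>g\<in>inner. ?N (opp g))) - ((\<Sum>g\<in>inner. ?O g) + (\<Sum>g\<in>inner. ?O (opp g))) / 27
      + 4 / 243 * (\<Sum>g\<in>inner. P_val g * P_val (opp g))"
      by (simp only: sum.distrib sum_subtractf sum_distrib_left[symmetric] sum_divide_distrib[symmetric])
    finally show ?thesis unfolding opp_sums Y' Osum .
  qed
  have bd_sum: "(\<Sum>g\<in>boundary. ?f g) = 2 / 27 * ?X + sin_ph / 81 * (\<Sum>g\<in>boundary. ?N g)"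
  proof -
    have "(\<Sum>g\<in>boundary. ?f g) = (\<Sum>g\<in>boundary. 2 / 27 * (o_val g * P_val g) + sin_ph / 81 * ?N g)"
      by (rule sum.cong[OF refl]) (rule corr_formula_boundary)
    also have "\<dots> = 2 / 27 * (\<Sum>g\<in>boundary. o_val g * P_val g) + sin_ph / 81 * (\<Sum>g\<in>boundary. ?N g)"
      by (simp only: sum.distrib sum_distrib_left[symmetric])
    finally show ?thesis unfolding oP .
  qed
  have V0_sum: "(\<Sum>g\<in>{g. g < 3 * n \<and> vtx g \<in> V0}. ?f g) = (\<Sum>g\<in>boundary. ?f g)"
  proof (rule sum.reindex_bij_witness[where i = opp and j = opp])
    fix g assume "g \<in> {g. g < 3 * n \<and> vtx g \<in> V0}"
    then have g: "g < 3 * n" "vtx g \<in> V0" by auto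
    show "opp g \<in> boundary" "opp (opp g) = g" using g nbr_V0_outside[of g] opp_props[OF g(1)] by (auto simp: boundary_def)
    show "?f (opp g) = ?f g"
      using g nbr_V0_outside[of g] opp_props[OF g(1)] by (simp add: corr_formula_def)
  qed (auto simp: boundary_def opp_props)
  have "(\<Sum>g<3 * n. ?f g) = (\<Sum>g\<in>outer. ?f g) + (\<Sum>g\<in>{g. g < 3 * n \<and> vtx g \<in> V0}. ?f g)"
    by (subst sum.union_disjoint[symmetric]) (auto simp: outer_def intro!: sum.cong)
  also have "\<dots> = (\<Sum>g\<in>inner. ?f g) + 2 * (\<Sum>g\<in>boundary. ?f g)"
    unfolding V0_sum to_outer by simp
  also have "\<dots> = 5 / 18 * ?X - sin_ph / 9 * ?Y + 2 / 243 * ?Z"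
  proof -
    have gen: "a + 2 * b = 5 / 18 * x - s / 9 * y + 2 / 243 * z"
      if "2 * a = x / 3 - 10 / 81 * s * (y + y) + 2 / 81 * s * (m + m) - (x + x) / 27 + 4 / 243 * z"
        "b = 2 / 27 * x + s / 81 * k" "m + k = w" "y = 2 * w" for a b x y z m k w s :: complex
    proof -
      have a: "a = x / 6 - 10 / 81 * s * y + 2 / 81 * s * m - x / 27 + 2 / 243 * z"
        using that(1) by (simp add: field_simps)
      have m: "m = y / 2 - k" using that(3,4) by (simp add: field_simps)
      show ?thesis unfolding a that(2) m by (simp add: field_simps)
    qed
    show ?thesis by (rule gen[OF inner_sum bd_sum Ninner Y])
  qed
  finally show ?thesis .
qed

end

section \<open>From correlations to energies, uniformly in the outcomes\<close>

context measured_graph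
begin

definition energy :: real where "energy = Re (\<Sum>g<3 * n. 1 - corr g) / 4"

definition near :: "nat \<Rightarrow> bool" where
  "near h \<longleftrightarrow> nbr h \<in> V0 \<or> nbr (sib h) \<in> V0 \<or> nbr (sib (sib h)) \<in> V0"

text \<open>A measured far end is excluded because \<open>nu\<close> vanishes there by
  \<open>o_nu\<close>.\<close>

definition ind_nu :: "nat \<Rightarrow> real" where "ind_nu h = of_bool (near (opp h) \<and> nbr h \<notin> V0)"
definition ind_P :: "nat \<Rightarrow> real" where "ind_P h = ind_nu (sib h) + ind_nu (sib (sib h))"

text \<open>The bound once outcomes are replaced by absolute values: it depends on the graph and on
  \<open>V0\<close>, not on \<sigma>, and so survives the maximum over \<sigma>.\<close>

definition Y_sum :: real where
  "Y_sum = 5 / 18 * (\<Sum>g\<in>inner. of_bool (near g) * ind_nu g) + (1 / sqrt 3) / 9 * (\<Sum>g\<in>inner. ind_nu g * ind_P g)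
     + 2 / 243 * (\<Sum>g\<in>inner. ind_P g * ind_P (opp g))"

lemma norm_v_val: "h < 3 * n \<Longrightarrow> cmod (v_val h) \<le> of_bool (near h)"
proof -
  assume hn: "h < 3 * n"
  note hs = sib_less[OF hn] sib_less[OF sib_less[OF hn]]
  have s: "cmod (o_val k) \<le> 1" for k
    using \<sigma>_inside[of "nbr k"] \<sigma>_outside[of "nbr k"] by (cases "nbr k \<in> V0") (auto simp: o_val_def)
  have z: "o_val h = 0 \<or> o_val (sib h) = 0" "o_val h = 0 \<or> o_val (sib (sib h)) = 0" "o_val (sib h) = 0 \<or> o_val (sib (sib h)) = 0"
    using o_o[of h "sib h"] o_o[of h "sib (sib h)"] o_o[of "sib h" "sib (sib h)"] hn hs by auto
  show ?thesis
  proof (cases "near h")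
    case True
    then show ?thesis using z s[of h] s[of "sib h"] s[of "sib (sib h)"] by (auto simp: v_val_def)
  next
    case False
    then have "o_val h = 0" "o_val (sib h) = 0" "o_val (sib (sib h)) = 0"
      using \<sigma>_outside by (auto simp: near_def o_val_def)
    then show ?thesis by (simp add: v_val_def)
  qed
qed

lemma norm_nu: "h < 3 * n \<Longrightarrow> cmod (nu h) \<le> ind_nu h"
proof -
  assume h: "h < 3 * n"
  show ?thesis
  proof (cases "nbr h \<in> V0")
    case True
    then have "nu h = 0" using o_nu[OF h] o_val_sq[OF True] by auto
    then show ?thesis by (simp add: ind_nu_def)
  next
    case False
    then show ?thesis using norm_v_val[OF opp_props(3)[OF h]] by (simp add: nu_def ind_nu_def)
  qed
qed

lemma norm_P_val: "h < 3 * n \<Longrightarrow> cmod (P_val h) \<le> ind_P h"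
  unfolding P_val_def ind_P_def
  by (intro order_trans[OF norm_triangle_ineq] add_mono norm_nu sib_less)

lemma norm_sum_le:
  assumes "\<And>g. g \<in> A \<Longrightarrow> cmod (f g) \<le> F g"
  shows "cmod (\<Sum>g\<in>A. f g) \<le> (\<Sum>g\<in>A. F g)"
  using norm_sum[of f A] sum_mono[of A "\<lambda>g. cmod (f g)" F] assms by fastforce

lemma norm_total: "cmod (\<Sum>g<3 * n. corr_formula g + sin_ph * cos_ph * cos_ph) \<le> Y_sum"
proof -
  have i: "g < 3 * n" "opp g < 3 * n" if "g \<in> inner" for g
    using that opp_props by (auto simp: inner_def)
  have nn: "0 \<le> ind_nu g" "0 \<le> ind_P g" for g by (auto simp: ind_nu_def ind_P_def)
  have 1: "cmod (\<Sum>g\<in>inner. v_val g * nu g) \<le> (\<Sum>g\<in>inner. of_bool (near g) * ind_nu g)"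
    by (rule norm_sum_le, rule norm_mult_le) (use i norm_v_val norm_nu in auto)
  have 2: "cmod (\<Sum>g\<in>inner. nu g * P_val g) \<le> (\<Sum>g\<in>inner. ind_nu g * ind_P g)"
    by (rule norm_sum_le, rule norm_mult_le) (use i norm_P_val norm_nu nn in auto)
  have 3: "cmod (\<Sum>g\<in>inner. P_val g * P_val (opp g)) \<le> (\<Sum>g\<in>inner. ind_P g * ind_P (opp g))"
    by (rule norm_sum_le, rule norm_mult_le) (use i norm_P_val nn in auto)
  have s: "cmod (sin_ph / 9) = (1 / sqrt 3) / 9" by (simp add: sin_ph_def norm_divide)
  have "cmod (a - b + c) \<le> cmod a + cmod b + cmod c" for a b c :: complex
    by (intro order_trans[OF norm_triangle_ineq] add_mono norm_triangle_ineq4 order_refl)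
  then have "cmod (\<Sum>g<3 * n. corr_formula g + sin_ph * cos_ph * cos_ph) \<le>
    cmod (5 / 18 * (\<Sum>g\<in>inner. v_val g * nu g)) + cmod (sin_ph / 9 * (\<Sum>g\<in>inner. nu g * P_val g))
     + cmod (2 / 243 * (\<Sum>g\<in>inner. P_val g * P_val (opp g)))"
    unfolding total_shift .
  also have "\<dots> = 5 / 18 * cmod (\<Sum>g\<in>inner. v_val g * nu g) + (1 / sqrt 3) / 9 * cmod (\<Sum>g\<in>inner. nu g * P_val g)
     + 2 / 243 * cmod (\<Sum>g\<in>inner. P_val g * P_val (opp g))"
    unfolding norm_mult s by simp
  also have "\<dots> \<le> Y_sum"
    unfolding Y_sum_def by (intro add_mono mult_left_mono 1 2 3) auto
  finally show ?thesis .
qed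

text \<open>\<open>corr0\<close> stands for the unconditional correlations. At a half-edge that is
  not locally tree-like, removing the closed form costs at most 101 and the true difference is at
  most 2; a quarter of 103 is below 26.\<close>

lemma energy_shift:
  assumes base: "\<And>g. g < 3 * n \<Longrightarrow> local_tree g \<Longrightarrow> corr0 g = - (sin_ph * cos_ph * cos_ph)"
    and bound: "\<And>g. cmod (corr0 g) \<le> 1"
  shows "energy - Re (\<Sum>g<3 * n. 1 - corr0 g) / 4 \<le> Y_sum / 4 + 26 * real (card {g. g < 3 * n \<and> \<not> local_tree g})"
proof -
  let ?B = "{g. g < 3 * n \<and> \<not> local_tree g}" and ?q = "sin_ph * cos_ph * cos_ph"
  have split: "(\<Sum>g<3 * n. f g) = (\<Sum>g\<in>{..<3 * n} - ?B. f g) + (\<Sum>g\<in>?B. f g)" for f :: "nat \<Rightarrow> complex"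
    by (rule sum.subset_diff) auto
  have "(\<Sum>g<3 * n. corr0 g - corr g) = (\<Sum>g\<in>{..<3 * n} - ?B. - (corr_formula g + ?q)) + (\<Sum>g\<in>?B. corr0 g - corr g)"
    unfolding split by (intro arg_cong2[where f = "(+)"] sum.cong refl) (auto simp: corr_eq_formula base)
  also have "(\<Sum>g\<in>{..<3 * n} - ?B. - (corr_formula g + ?q)) = - (\<Sum>g<3 * n. corr_formula g + ?q) + (\<Sum>g\<in>?B. corr_formula g + ?q)"
    unfolding split sum_negf by simp
  finally have eq: "(\<Sum>g<3 * n. corr0 g - corr g) = - (\<Sum>g<3 * n. corr_formula g + ?q)
      + ((\<Sum>g\<in>?B. corr_formula g + ?q) + (\<Sum>g\<in>?B. corr0 g - corr g))" by simp
  have q: "cmod ?q \<le> 1" by (rule norm_constants_prod)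
  have 1: "cmod (\<Sum>g\<in>?B. corr_formula g + ?q) \<le> (\<Sum>g\<in>?B. 101)"
  proof (rule norm_sum_le)
    show "cmod (corr_formula g + ?q) \<le> 101" for g
      using norm_triangle_ineq[of "corr_formula g" ?q] norm_corr_formula[of g] q by linarith
  qed
  have 2: "cmod (\<Sum>g\<in>?B. corr0 g - corr g) \<le> (\<Sum>g\<in>?B. 2)"
  proof (rule norm_sum_le)
    show "cmod (corr0 g - corr g) \<le> 2" for g
      using norm_triangle_ineq4[of "corr0 g" "corr g"] norm_corr[of g] bound[of g] by linarith
  qed
  have tri: "cmod (- a + (b + c)) \<le> cmod a + (cmod b + cmod c)" for a b c :: complex
    by (intro order_trans[OF norm_triangle_ineq] add_mono norm_triangle_ineq) simp
  have "energy - Re (\<Sum>g<3 * n. 1 - corr0 g) / 4 = Re (\<Sum>g<3 * n. corr0 g - corr g) / 4"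
    by (simp add: energy_def sum_subtractf diff_divide_distrib[symmetric])
  also have "\<dots> \<le> cmod (\<Sum>g<3 * n. corr0 g - corr g) / 4"
    by (intro divide_right_mono complex_Re_le_cmod) simp
  also have "cmod (\<Sum>g<3 * n. corr0 g - corr g) \<le> Y_sum + ((\<Sum>g\<in>?B. 101) + (\<Sum>g\<in>?B. 2))"
    unfolding eq by (rule order_trans[OF tri]) (intro add_mono norm_total 1 2)
  finally show ?thesis by (simp add: divide_right_mono)
qed

lemma corr_eq_base: "V0 = {} \<Longrightarrow> g < 3 * n \<Longrightarrow> local_tree g \<Longrightarrow> corr g = - (sin_ph * cos_ph * cos_ph)"
proof -
  assume V: "V0 = {}" and g: "g < 3 * n" "local_tree g"
  have "field v = 0" for v using V \<sigma>_outside by (simp add: field_def)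
  then show ?thesis using corr_pair[OF g] V by (simp add: pair_corr_def)
qed

lemma quad_form_eq:
  "(\<Sum>i<2 ^ n. (cmod (psi3 n M $ i))\<^sup>2 * Re (weight (bits i) * (\<Sum>e\<in>M. (1 / 2) * (1 - edge_spins e (bits i))))) = energy"
proof -
  let ?w = "\<lambda>X. complex_of_real ((cmod (amp n M X))\<^sup>2)"
  have "(\<Sum>i<2 ^ n. (cmod (psi3 n M $ i))\<^sup>2 * Re (weight (bits i) * (\<Sum>e\<in>M. (1 / 2) * (1 - edge_spins e (bits i))))) =
    (\<Sum>X\<in>Pow {..<n}. (cmod (amp n M X))\<^sup>2 * Re (weight X * (\<Sum>e\<in>M. (1 / 2) * (1 - edge_spins e X))))"
    unfolding sum_bits[symmetric] by (rule sum.cong) (simp_all add: psi3_entry)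
  also have "\<dots> = Re (\<Sum>X\<in>Pow {..<n}. ?w X * (weight X * (\<Sum>e\<in>M. (1 / 2) * (1 - edge_spins e X))))"
    unfolding Re_sum by (intro sum.cong refl) (simp del: of_real_power)
  also have "(\<Sum>X\<in>Pow {..<n}. ?w X * (weight X * (\<Sum>e\<in>M. (1 / 2) * (1 - edge_spins e X)))) =
    (\<Sum>g<3 * n. 1 - corr g) / 4"
  proof -
    have "(\<Sum>X\<in>Pow {..<n}. ?w X * (weight X * (\<Sum>e\<in>M. (1 / 2) * (1 - edge_spins e X)))) =
      (\<Sum>X\<in>Pow {..<n}. \<Sum>g<3 * n. ?w X * weight X - ?w X * (weight X * (spin X (vtx g) * spin X (nbr g)))) / 4"
      unfolding sum_edge_spins sum_divide_distrib sum_distrib_left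
      by (intro sum.cong refl) (simp add: field_simps del: of_real_power)
    also have "(\<Sum>X\<in>Pow {..<n}. \<Sum>g<3 * n. ?w X * weight X - ?w X * (weight X * (spin X (vtx g) * spin X (nbr g)))) =
      (\<Sum>g<3 * n. 1 - corr g)"
      unfolding sum_weight[symmetric] corr_def by (subst sum.swap) (simp add: sum_subtractf del: of_real_power)
    finally show ?thesis .
  qed
  finally show ?thesis by (simp add: energy_def)
qed

end

context cubic_multigraph
begin

lemma unconditional_energy:
  "quad_form (psi3 n M) (H_MaxCut 3 n M) = measured_graph.energy n M (\<lambda>_. 0)"
proof -
  interpret e: measured_graph n M "{}" "\<lambda>_. 0"
    by unfold_locales (auto simp: two_independent_def half_edges_at_def)
  have w: "e.weight X = 1" for X by (simp add: e.weight_def)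
  show ?thesis
    unfolding e.quad_form_eq[symmetric] w H_MaxCut_diag by (subst quad_form_diag) simp_all
qed

text \<open>As \<open>weight\<close> is 2 to the power \<open>card V0\<close> times the diagonal of
  the projector, idempotence turns numerator and squared norm into averages of \<open>weight\<close>
  itself, and the common factor cancels.\<close>

lemma conditional_energy:
  assumes V0: "V0 \<subseteq> {..<n}" "two_independent 3 M V0" and s: "s \<in> V0 \<rightarrow>\<^sub>E {-1, 1}"
  shows "measured_graph n M V0 (\<lambda>v. if v \<in> V0 then of_int (s v) else 0)"
    and "quad_form (psi3 n M) (spin_proj n V0 s * H_MaxCut 3 n M * spin_proj n V0 s)
      / norm_sq (spin_proj n V0 s *\<^sub>v psi3 n M) =
      measured_graph.energy n M (\<lambda>v. if v \<in> V0 then of_int (s v) else 0)"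
proof -
  let ?\<sigma> = "\<lambda>v. if v \<in> V0 then complex_of_int (s v) else 0"
  have sv: "s v = 1 \<or> s v = -1" if "v \<in> V0" for v using s that by auto
  show mg: "measured_graph n M V0 ?\<sigma>"
    by unfold_locales (use V0 sv in fastforce)+
  interpret e: measured_graph n M V0 ?\<sigma> by (rule mg)
  have fin: "finite V0" using V0 finite_subset by blast
  let ?k = "card V0"
  have wt: "(\<Prod>v\<in>V0. (1 / 2) * (1 + complex_of_int (s v) * spin X v)) = e.weight X / 2 ^ ?k" for X
  proof -
    have "e.weight X = (\<Prod>v\<in>V0. 1 + complex_of_int (s v) * spin X v)"
      unfolding e.weight_def by (rule prod.mono_neutral_cong_right) (use V0 in auto)
    then show ?thesis unfolding prod.distrib by (simp add: power_one_over)
  qed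
  have sq: "e.weight X * e.weight X = 2 ^ ?k * e.weight X" for X
  proof -
    have eq: "e.weight X = (\<Prod>v\<in>V0. 1 + complex_of_int (s v) * spin X v)"
      unfolding e.weight_def by (rule prod.mono_neutral_cong_right) (use V0 in auto)
    have "(\<Prod>v\<in>V0. (1 + complex_of_int (s v) * spin X v) * (1 + complex_of_int (s v) * spin X v)) =
      (\<Prod>v\<in>V0. 2 * (1 + complex_of_int (s v) * spin X v))"
    proof (rule prod.cong[OF refl])
      fix v assume "v \<in> V0"
      then show "(1 + complex_of_int (s v) * spin X v) * (1 + complex_of_int (s v) * spin X v) = 2 * (1 + complex_of_int (s v) * spin X v)"
        using sv[of v] by (auto simp: spin_def)
    qed
    then show ?thesis unfolding eq prod.distrib by simp
  qed
  have proj: "spin_proj n V0 s = diag_op n (\<lambda>i. e.weight (bits i) / 2 ^ ?k)"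
    unfolding spin_proj_diag[OF V0(1)] wt by (rule refl)
  have num: "quad_form (psi3 n M) (spin_proj n V0 s * H_MaxCut 3 n M * spin_proj n V0 s) = e.energy / 2 ^ ?k"
  proof -
    have "e.weight X / 2 ^ ?k * H * (e.weight X / 2 ^ ?k) = (e.weight X * H) / 2 ^ ?k" for X and H :: complex
    proof -
      have "e.weight X / 2 ^ ?k * H * (e.weight X / 2 ^ ?k) = (e.weight X * e.weight X) * H / (2 ^ ?k * 2 ^ ?k)" by simp
      then show ?thesis unfolding sq by simp
    qed
    then have "spin_proj n V0 s * H_MaxCut 3 n M * spin_proj n V0 s =
      diag_op n (\<lambda>i. (e.weight (bits i) * (\<Sum>e\<in>M. (1 / 2) * (1 - edge_spins e (bits i)))) / 2 ^ ?k)"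
      unfolding proj H_MaxCut_diag diag_op_mult by simp
    then have "quad_form (psi3 n M) (spin_proj n V0 s * H_MaxCut 3 n M * spin_proj n V0 s) =
      (\<Sum>i<2 ^ n. (cmod (psi3 n M $ i))\<^sup>2 * Re ((e.weight (bits i) * (\<Sum>e\<in>M. (1 / 2) * (1 - edge_spins e (bits i)))) / 2 ^ ?k))"
      by (simp add: quad_form_diag)
    also have "\<dots> = (\<Sum>i<2 ^ n. (cmod (psi3 n M $ i))\<^sup>2 * Re (e.weight (bits i) * (\<Sum>e\<in>M. (1 / 2) * (1 - edge_spins e (bits i)))) / 2 ^ ?k)"
    proof (intro sum.cong refl)
      have "Re (z / 2 ^ ?k) = Re z / 2 ^ ?k" for z
        using Re_divide_of_real[of z "2 ^ ?k"] by simp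
      then show "(cmod (psi3 n M $ i))\<^sup>2 * Re ((e.weight (bits i) * (\<Sum>e\<in>M. (1 / 2) * (1 - edge_spins e (bits i)))) / 2 ^ ?k) =
        (cmod (psi3 n M $ i))\<^sup>2 * Re (e.weight (bits i) * (\<Sum>e\<in>M. (1 / 2) * (1 - edge_spins e (bits i)))) / 2 ^ ?k" for i by simp
    qed
    finally show ?thesis unfolding sum_divide_distrib[symmetric] e.quad_form_eq .
  qed
  have den: "norm_sq (spin_proj n V0 s *\<^sub>v psi3 n M) = 1 / 2 ^ ?k"
  proof -
    have "(cmod (e.weight X / 2 ^ ?k))\<^sup>2 = cmod (e.weight X) / 2 ^ ?k" for X
    proof -
      have "cmod (e.weight X) * cmod (e.weight X) = 2 ^ ?k * cmod (e.weight X)"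
        using arg_cong[OF sq[of X], of cmod] by (simp add: norm_mult norm_power)
      then have "cmod (e.weight X) * cmod (e.weight X) / (2 ^ ?k * 2 ^ ?k) = 2 ^ ?k * cmod (e.weight X) / (2 ^ ?k * 2 ^ ?k)"
        by (simp only:)
      then have "cmod (e.weight X) * cmod (e.weight X) / (2 ^ ?k * 2 ^ ?k) = cmod (e.weight X) / 2 ^ ?k"
        by (simp only: mult_divide_mult_cancel_left_if) simp
      then show ?thesis by (simp add: norm_divide norm_power power2_eq_square)
    qed
    then have "norm_sq (spin_proj n V0 s *\<^sub>v psi3 n M) = (\<Sum>i<2 ^ n. (cmod (psi3 n M $ i))\<^sup>2 * (cmod (e.weight (bits i)) / 2 ^ ?k))"
      unfolding proj by (simp add: norm_sq_diag)
    also have "\<dots> = (\<Sum>i<2 ^ n. (cmod (amp n M (bits i)))\<^sup>2 * cmod (e.weight (bits i))) / 2 ^ ?k"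
      unfolding sum_divide_distrib by (intro sum.cong refl) (simp add: psi3_entry)
    also have "(\<Sum>i<2 ^ n. (cmod (amp n M (bits i)))\<^sup>2 * cmod (e.weight (bits i))) = 1"
    proof -
      have "complex_of_real (\<Sum>X\<in>Pow {..<n}. (cmod (amp n M X))\<^sup>2 * cmod (e.weight X)) = 1"
        using e.sum_weight by (simp add: e.weight_real[symmetric])
      then show ?thesis
        unfolding sum_bits[of "\<lambda>X. (cmod (amp n M X))\<^sup>2 * cmod (e.weight X)"] by (metis of_real_eq_1_iff)
    qed
    finally show ?thesis .
  qed
  show "quad_form (psi3 n M) (spin_proj n V0 s * H_MaxCut 3 n M * spin_proj n V0 s)
      / norm_sq (spin_proj n V0 s *\<^sub>v psi3 n M) = e.energy"
    unfolding num den by simp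
qed

end

section \<open>Short cycles\<close>

context cubic_multigraph
begin

text \<open>A walk is the list of half-edges through which it leaves its vertices;
  \<open>t \<noteq> opp s\<close> forbids returning along the edge just used. Loops and double edges
  give closed walks of length one and two.\<close>

fun nb_walk :: "nat list \<Rightarrow> bool" where
  "nb_walk [] = False"
| "nb_walk [t] = (t < 3 * n)"
| "nb_walk (s # t # ts) = (s < 3 * n \<and> vtx t = nbr s \<and> t \<noteq> opp s \<and> nb_walk (t # ts))"

text \<open>Backtracking where the walk closes up is allowed here; for distinct vertices it cannot
  happen, as the proof of \<open>cycle_pairs\<close> shows.\<close>

definition closed_walk :: "nat list \<Rightarrow> bool" where
  "closed_walk ts \<longleftrightarrow> nb_walk ts \<and> nbr (last ts) = vtx (hd ts)"

definition cycle :: "nat list \<Rightarrow> bool" where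
  "cycle ts \<longleftrightarrow> closed_walk ts \<and> length ts \<le> 5 \<and> distinct (map (\<lambda>t. t div 3) ts)"

definition cyclic :: "nat \<Rightarrow> bool" where
  "cyclic v \<longleftrightarrow> (\<exists>ts. cycle ts \<and> vtx (hd ts) = v)"

lemma nb_walk_less: "nb_walk ts \<Longrightarrow> t \<in> set ts \<Longrightarrow> t < 3 * n"
  by (induction ts rule: nb_walk.induct) auto

lemma nb_walk_step: "nb_walk ts \<Longrightarrow> Suc i < length ts \<Longrightarrow> vtx (ts ! Suc i) = nbr (ts ! i)"
proof (induction ts arbitrary: i rule: nb_walk.induct)
  case (3 s t ts)
  then show ?case by (cases i) auto
qed auto

lemma nb_walk_prefix: "nb_walk ts \<Longrightarrow> 0 < k \<Longrightarrow> nb_walk (take k ts)"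
proof (induction ts arbitrary: k rule: nb_walk.induct)
  case (2 t)
  then show ?case by (cases k) auto
next
  case (3 s t ts)
  obtain k' where k: "k = Suc k'" using 3(3) by (cases k) auto
  show ?case
  proof (cases k')
    case (Suc k'')
    have "nb_walk (t # ts)" using 3(2) by simp
    then have "nb_walk (take (Suc k'') (t # ts))" using 3(1) by blast
    then show ?thesis using 3(2) k Suc by simp
  qed (use 3 k in auto)
qed auto

lemma nb_walk_suffix: "nb_walk ts \<Longrightarrow> i < length ts \<Longrightarrow> nb_walk (drop i ts)"
proof (induction ts arbitrary: i rule: nb_walk.induct)
  case (3 s t ts)
  then show ?case by (cases i) auto
qed auto

lemma nb_walk_append:
  "nb_walk xs \<Longrightarrow> nb_walk ys \<Longrightarrow> vtx (hd ys) = nbr (last xs) \<Longrightarrow> hd ys \<noteq> opp (last xs) \<Longrightarrow> nb_walk (xs @ ys)"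
proof (induction xs rule: nb_walk.induct)
  case (2 t)
  then show ?case by (cases ys) auto
qed auto

text \<open>A repeated vertex splits off a shorter closed walk. In a walk of several steps the index
  avoids the last position, because in the application the last half-edge may sit at a vertex
  outside \<open>places\<close>.\<close>

lemma closed_walk_cyclic:
  assumes "closed_walk ts" "length ts \<le> 5"
  shows "\<exists>i. (i = 0 \<or> Suc i < length ts) \<and> cyclic (vtx (ts ! i))"
  using assms
proof (induction "length ts" arbitrary: ts rule: less_induct)
  case less
  have w: "nb_walk ts" using less.prems by (simp add: closed_walk_def)
  then have ne: "ts \<noteq> []" by auto
  show ?case
  proof (cases "distinct (map (\<lambda>t. t div 3) ts)")
    case True
    then have "cyclic (vtx (hd ts))" using less.prems by (auto simp: cyclic_def cycle_def)
    then show ?thesis using ne by (auto simp: hd_conv_nth)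
  next
    case False
    then obtain i j where ij: "i < length ts" "j < length ts" "i \<noteq> j" "vtx (ts ! i) = vtx (ts ! j)"
      by (auto simp: distinct_conv_nth)
    then obtain i j where ij: "i < j" "j < length ts" "vtx (ts ! i) = vtx (ts ! j)"
      by (metis linorder_neqE_nat)
    let ?s = "take (j - i) (drop i ts)"
    have len: "length ?s = j - i" using ij by auto
    have sw: "nb_walk ?s" using nb_walk_prefix[OF nb_walk_suffix[OF w, of i]] ij by auto
    have nth: "?s ! k = ts ! (i + k)" if "k < j - i" for k using that ij by auto
    have sne: "?s \<noteq> []" using sw by auto
    have "last ?s = ts ! (j - 1)"
    proof -
      have "last ?s = ?s ! (j - i - 1)" using last_conv_nth[OF sne] len by simp
      also have "\<dots> = ts ! (i + (j - i - 1))" using ij by (intro nth) simp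
      also have "i + (j - i - 1) = j - 1" using ij by simp
      finally show ?thesis .
    qed
    moreover have "hd ?s = ts ! i" using hd_conv_nth[OF sne] ij nth[of 0] by simp
    moreover have "nbr (ts ! (j - 1)) = vtx (ts ! j)" using nb_walk_step[OF w, of "j - 1"] ij by auto
    ultimately have "closed_walk ?s" using sw ij by (auto simp: closed_walk_def)
    moreover have "length ?s < length ts" "length ?s \<le> 5" using len ij less.prems by auto
    ultimately obtain k where k: "k = 0 \<or> Suc k < length ?s" "cyclic (vtx (?s ! k))"
      using less.hyps by blast
    then have "k < j - i" using len ij by auto
    then show ?thesis using k nth[of k] ij by (intro exI[of _ "i + k"]) auto
  qed
qed

definition places :: "nat \<Rightarrow> nat list" where
  "places g = [vtx g, nbr g, nbr (sib g), nbr (sib (sib g)), nbr (sib (opp g)), nbr (sib (sib (opp g)))]"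

lemma length_places [simp]: "length (places g) = 6"
  by (simp add: places_def)

text \<open>The last step of the connecting walk starts at an end of the edge of \<open>g\<close>.
  Hence a step to a vertex that is neither end can be appended without backtracking; two such extra
  steps lead from length three to the bound five.\<close>

definition link :: "nat \<Rightarrow> nat \<Rightarrow> nat \<Rightarrow> bool" where
  "link g a b \<longleftrightarrow> (\<exists>L. nb_walk L \<and> vtx (hd L) = a \<and> nbr (last L) = b \<and> length L \<le> 3 \<and>
     vtx (last L) \<in> {vtx g, nbr g} \<and> (\<forall>t\<in>set L. vtx t \<in> set (places g)))"

lemma link_places:
  assumes g: "g < 3 * n" and ij: "i < j" "j < 6"
  shows "link g (places g ! i) (places g ! j)"
proof -
  define g' g1 g2 k1 k2 where "g' = opp g" and "g1 = sib g" and "g2 = sib (sib g)" and "k1 = sib g'" and "k2 = sib (sib g')"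
  have n: "g' < 3 * n" "g1 < 3 * n" "g2 < 3 * n" "k1 < 3 * n" "k2 < 3 * n"
    using g opp_props(3)[OF g] sib_less by (auto simp: g'_def g1_def g2_def k1_def k2_def)
  have no: "opp g1 < 3 * n" "opp g2 < 3 * n" "opp k1 < 3 * n" using n opp_props by auto
  have oo: "opp g' = g" "opp (opp g1) = g1" "opp (opp g2) = g2" "opp (opp k1) = k1" "opp g = g'"
    using n g opp_props by (auto simp: g'_def)
  have v: "vtx g1 = vtx g" "vtx g2 = vtx g" "vtx k1 = vtx g'" "vtx k2 = vtx g'"
    by (auto simp: g1_def g2_def k1_def k2_def g'_def)
  have d: "g1 \<noteq> g" "g2 \<noteq> g" "g2 \<noteq> g1" "k1 \<noteq> g'" "k2 \<noteq> g'" "k2 \<noteq> k1"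
    using sib_neq[of g] sib_neq[of "sib g"] sib_neq[of g'] sib_neq[of "sib g'"]
    by (auto simp: g1_def g2_def k1_def k2_def simp del: sib_neq)
  have p: "places g = [vtx g, nbr g, nbr g1, nbr g2, nbr k1, nbr k2]"
    by (simp add: places_def g1_def g2_def k1_def k2_def g'_def)
  have l: "link g a b" if "nb_walk L" "vtx (hd L) = a" "nbr (last L) = b" "length L \<le> 3"
     "vtx (last L) \<in> {vtx g, nbr g}" "\<forall>t\<in>set L. vtx t \<in> set [vtx g, nbr g, nbr g1, nbr g2, nbr k1, nbr k2]" for L a b
    using that unfolding link_def p by blast
  have 0: "link g (vtx g) (nbr g)" by (rule l[of "[g]"]) (simp_all add: g)
  have 1: "link g (vtx g) (nbr g1)" by (rule l[of "[g1]"]) (simp_all add: n v)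
  have 2: "link g (vtx g) (nbr g2)" by (rule l[of "[g2]"]) (simp_all add: n v)
  have 3: "link g (vtx g) (nbr k1)" by (rule l[of "[g, k1]"]) (simp_all add: n v d d[symmetric] oo g)
  have 4: "link g (vtx g) (nbr k2)" by (rule l[of "[g, k2]"]) (simp_all add: n v d d[symmetric] oo g)
  have 5: "link g (nbr g) (nbr g1)" by (rule l[of "[g', g1]"]) (simp_all add: n v d d[symmetric] oo g)
  have 6: "link g (nbr g) (nbr g2)" by (rule l[of "[g', g2]"]) (simp_all add: n v d d[symmetric] oo g)
  have 7: "link g (nbr g) (nbr k1)" by (rule l[of "[k1]"]) (simp_all add: n v d d[symmetric] oo g)
  have 8: "link g (nbr g) (nbr k2)" by (rule l[of "[k2]"]) (simp_all add: n v d d[symmetric] oo g)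
  have 9: "link g (nbr g1) (nbr g2)" by (rule l[of "[opp g1, g2]"]) (simp_all add: n no v d d[symmetric] oo g)
  have 10: "link g (nbr g1) (nbr k1)" by (rule l[of "[opp g1, g, k1]"]) (simp_all add: n no v d d[symmetric] oo g)
  have 11: "link g (nbr g1) (nbr k2)" by (rule l[of "[opp g1, g, k2]"]) (simp_all add: n no v d d[symmetric] oo g)
  have 12: "link g (nbr g2) (nbr k1)" by (rule l[of "[opp g2, g, k1]"]) (simp_all add: n no v d d[symmetric] oo g)
  have 13: "link g (nbr g2) (nbr k2)" by (rule l[of "[opp g2, g, k2]"]) (simp_all add: n no v d d[symmetric] oo g)
  have 14: "link g (nbr k1) (nbr k2)" by (rule l[of "[opp k1, k2]"]) (simp_all add: n no v d d[symmetric] oo g)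
  have "j = 1 \<or> j = 2 \<or> j = 3 \<or> j = 4 \<or> j = 5" using ij by arith
  moreover have "i = 0 \<or> i = 1 \<or> i = 2 \<or> i = 3 \<or> i = 4" using ij by arith
  ultimately show ?thesis
    using ij(1) by (elim disjE) (simp_all add: p 0 1 2 3 4 5 6 7 8 9 10 11 12 13 14)
qed

lemma set_nth_mem: "(\<forall>t\<in>set L. vtx t \<in> S) \<Longrightarrow> i < length L \<Longrightarrow> vtx (L ! i) \<in> S"
  by auto

text \<open>Two coinciding places close up a walk of length at most three. A vertex attached twice
  to the places closes up a walk between its two attachment points with two more steps.\<close>

lemma not_local_tree_cyclic:
  assumes g: "g < 3 * n" and bad: "\<not> local_tree g"
  shows "\<exists>v\<in>set (places g). cyclic v"
proof (cases "distinct (places g)")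
  case False
  then obtain i j where "i < 6" "j < 6" "i \<noteq> j" "places g ! i = places g ! j"
    by (auto simp: distinct_conv_nth)
  then obtain i j where ij: "i < j" "j < 6" "places g ! i = places g ! j"
    by (metis linorder_neqE_nat)
  then obtain L where L: "nb_walk L" "vtx (hd L) = nbr (last L)" "length L \<le> 3" "\<forall>t\<in>set L. vtx t \<in> set (places g)"
    using link_places[OF g ij(1,2)] by (auto simp: link_def)
  then have "closed_walk L" "length L \<le> 5" by (auto simp: closed_walk_def)
  then obtain k where "k = 0 \<or> Suc k < length L" "cyclic (vtx (L ! k))" using closed_walk_cyclic by blast
  moreover have "L \<noteq> []" using L(1) by auto
  ultimately show ?thesis using set_nth_mem[OF L(4), of k] by (cases L) auto
next
  case True
  have P: "set (places g) = {vtx g, nbr g, nbr (sib g), nbr (sib (sib g)), nbr (sib (opp g)), nbr (sib (sib (opp g)))}"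
    by (simp add: places_def)
  obtain h h' where h: "vtx h < n" "vtx h' = vtx h" "vtx h \<noteq> vtx g" "vtx h \<noteq> nbr g" "nbr h \<in> set (places g)" "nbr h' \<in> set (places g)" "h \<noteq> h'"
    using bad True unfolding local_tree_def P[symmetric] places_def[symmetric] by blast
  have main: ?thesis if h: "vtx h < n" "vtx h' = vtx h" "vtx h \<noteq> vtx g" "vtx h \<noteq> nbr g" "h \<noteq> h'"
    and ij: "nbr h = places g ! i" "nbr h' = places g ! j" "i \<le> j" "j < 6" for h h' i j
  proof -
    have hn: "h < 3 * n" "h' < 3 * n" using h(1,2) by auto
    have o: "opp (opp h) = h" "opp (opp h') = h'" "opp h < 3 * n" "opp h' < 3 * n" using hn opp_props by auto
    have pm: "nbr h \<in> set (places g)" using nth_mem[of i "places g"] ij by simp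
    show ?thesis
    proof (cases "i = j")
      case True
      have "closed_walk [opp h, h']"
        using o hn h ij True by (auto simp: closed_walk_def)
      then obtain k where "k = 0 \<or> Suc k < length [opp h, h']" "cyclic (vtx ([opp h, h'] ! k))"
        using closed_walk_cyclic[of "[opp h, h']"] by auto
      then have "k = 0" "cyclic (nbr h)" by auto
      then show ?thesis using pm by blast
    next
      case False
      then have "i < j" using ij by simp
      then obtain L where L: "nb_walk L" "vtx (hd L) = nbr h" "nbr (last L) = nbr h'" "length L \<le> 3"
        "vtx (last L) \<in> {vtx g, nbr g}" "\<forall>t\<in>set L. vtx t \<in> set (places g)"
        using link_places[OF g _ ij(4)] ij by (auto simp: link_def)
      have Lne: "L \<noteq> []" using L(1) by auto
      have "last L < 3 * n" using nb_walk_less[OF L(1)] Lne by auto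
      then have "opp h' \<noteq> opp (last L)"
        using L(5) h o opp_props(4)[of "last L"] by (metis insert_iff singletonD)
      moreover have "nb_walk [opp h', h]" using o hn h by auto
      ultimately have "nb_walk (L @ [opp h', h])"
        using L by (intro nb_walk_append) auto
      then have "closed_walk (L @ [opp h', h])" "length (L @ [opp h', h]) \<le> 5"
        using L Lne by (auto simp: closed_walk_def)
      then obtain k where k: "k = 0 \<or> Suc k < length (L @ [opp h', h])" "cyclic (vtx ((L @ [opp h', h]) ! k))"
        using closed_walk_cyclic by blast
      have pm': "nbr h' \<in> set (places g)" using nth_mem[of j "places g"] ij by simp
      have "k = 0 \<or> Suc k < length L + 2" "0 < length L" using k(1) Lne by simp_all
      then consider "k < length L" | "k = length L" by linarith
      then have "vtx ((L @ [opp h', h]) ! k) \<in> set (places g)"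
        by cases (use set_nth_mem[OF L(6)] pm' in \<open>auto simp: nth_append\<close>)
      then show ?thesis using k by blast
    qed
  qed
  obtain i j where ij: "i < 6" "j < 6" "nbr h = places g ! i" "nbr h' = places g ! j"
    using h(5,6) by (metis in_set_conv_nth length_places)
  show ?thesis
  proof (cases "i \<le> j")
    case True
    show ?thesis by (rule main[OF h(1,2,3,4,7) ij(3,4) True ij(2)])
  next
    case False
    then have "j \<le> i" by simp
    show ?thesis
      by (rule main[OF _ _ _ _ h(7)[symmetric] ij(4,3) \<open>j \<le> i\<close> ij(1)]) (simp_all add: h)
  qed
qed

text \<open>Each of the six places of \<open>g\<close> is reached from \<open>g\<close> through one
  fixed half-edge; the set \<open>?N\<close> inverts these six maps.\<close>

lemma card_not_local_tree:
  "card {g. g < 3 * n \<and> \<not> local_tree g} \<le> 6 * card {h. h < 3 * n \<and> cyclic (vtx h)}"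
proof -
  let ?C = "{h. h < 3 * n \<and> cyclic (vtx h)}"
  let ?N = "\<lambda>h. {h, opp h, sib (opp h), sib (sib (opp h)), opp (sib (opp h)), opp (sib (sib (opp h)))}"
  have "{g. g < 3 * n \<and> \<not> local_tree g} \<subseteq> (\<Union>h\<in>?C. ?N h)"
  proof
    fix g assume "g \<in> {g. g < 3 * n \<and> \<not> local_tree g}"
    then have g: "g < 3 * n" "\<not> local_tree g" by auto
    have n: "opp g < 3 * n" "sib g < 3 * n" "sib (sib g) < 3 * n" "sib (opp g) < 3 * n" "sib (sib (opp g)) < 3 * n"
      using g opp_props(3)[OF g(1)] sib_less by auto
    have n': "opp (sib g) < 3 * n" "opp (sib (sib g)) < 3 * n" "opp (sib (opp g)) < 3 * n" "opp (sib (sib (opp g))) < 3 * n"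
      using n opp_props by auto
    have oo: "opp (opp g) = g" "opp (opp (sib g)) = sib g" "opp (opp (sib (sib g))) = sib (sib g)"
      "opp (opp (sib (opp g))) = sib (opp g)" "opp (opp (sib (sib (opp g)))) = sib (sib (opp g))"
      using g n opp_props by auto
    obtain v where v: "v \<in> set (places g)" "cyclic v" using not_local_tree_cyclic[OF g] by blast
    then consider "cyclic (vtx g)" | "cyclic (vtx (opp g))" | "cyclic (vtx (opp (sib g)))" | "cyclic (vtx (opp (sib (sib g))))"
      | "cyclic (vtx (opp (sib (opp g))))" | "cyclic (vtx (opp (sib (sib (opp g)))))"
      by (auto simp: places_def)
    then show "g \<in> (\<Union>h\<in>?C. ?N h)"
    proof cases
      case 1 then show ?thesis using g by (intro UN_I[of g]) auto
    next
      case 2 then show ?thesis using n oo by (intro UN_I[of "opp g"]) auto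
    next
      case 3 then show ?thesis using n' oo by (intro UN_I[of "opp (sib g)"]) auto
    next
      case 4 then show ?thesis using n' oo by (intro UN_I[of "opp (sib (sib g))"]) auto
    next
      case 5 then show ?thesis using n' oo by (intro UN_I[of "opp (sib (opp g))"]) auto
    next
      case 6 then show ?thesis using n' oo by (intro UN_I[of "opp (sib (sib (opp g)))"]) auto
    qed
  qed
  then have "card {g. g < 3 * n \<and> \<not> local_tree g} \<le> card (\<Union>h\<in>?C. ?N h)"
    by (intro card_mono) auto
  also have "\<dots> \<le> (\<Sum>h\<in>?C. card (?N h))" by (rule card_UN_le) simp
  also have "\<dots> \<le> (\<Sum>h\<in>?C. 6)"
  proof (rule sum_mono)
    fix h
    have "card (?N h) \<le> card (set [h, opp h, sib (opp h), sib (sib (opp h)), opp (sib (opp h)), opp (sib (sib (opp h)))])" by simp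
    also have "\<dots> \<le> 6" by (rule order_trans[OF card_length]) simp
    finally show "card (?N h) \<le> 6" .
  qed
  finally show ?thesis by (simp add: mult.commute)
qed

end

section \<open>Uniform perfect matchings\<close>

lemma perfect_matchings_iff:
  "M \<in> perfect_matchings H \<longleftrightarrow> \<Union>M = H \<and> (\<forall>e\<in>M. \<forall>e'\<in>M. e \<noteq> e' \<longrightarrow> e \<inter> e' = {}) \<and> (\<forall>e\<in>M. card e = 2)"
  unfolding perfect_matchings_def partition_on_def disjoint_def by (auto simp: disjnt_def)

lemma finite_perfect_matchings [simp]: "finite H \<Longrightarrow> finite (perfect_matchings H)"
  by (rule finite_subset[of _ "Pow (Pow H)"]) (auto simp: perfect_matchings_iff)

lemma perfect_matchings_Un:
  assumes "B \<in> perfect_matchings A" "N \<in> perfect_matchings C" "A \<inter> C = {}"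
  shows "B \<union> N \<in> perfect_matchings (A \<union> C)"
proof -
  have "e \<inter> e' = {}" if "e \<in> B" "e' \<in> N" for e e'
    using assms that unfolding perfect_matchings_iff by blast
  note cross = this
  have B: "\<Union>B = A" "\<And>e e'. e \<in> B \<Longrightarrow> e' \<in> B \<Longrightarrow> e \<noteq> e' \<Longrightarrow> e \<inter> e' = {}" "\<And>e. e \<in> B \<Longrightarrow> card e = 2"
    using assms(1) unfolding perfect_matchings_iff by blast+
  have N: "\<Union>N = C" "\<And>e e'. e \<in> N \<Longrightarrow> e' \<in> N \<Longrightarrow> e \<noteq> e' \<Longrightarrow> e \<inter> e' = {}" "\<And>e. e \<in> N \<Longrightarrow> card e = 2"
    using assms(2) unfolding perfect_matchings_iff by blast+
  show ?thesis
    unfolding perfect_matchings_iff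
  proof (intro conjI ballI impI)
    show "\<Union>(B \<union> N) = A \<union> C" unfolding Union_Un_distrib B(1) N(1) by (rule refl)
    show "card e = 2" if "e \<in> B \<union> N" for e using that B(3)[of e] N(3)[of e] by auto
    fix e e' assume "e \<in> B \<union> N" "e' \<in> B \<union> N" "e \<noteq> e'"
    then show "e \<inter> e' = {}"
      using B(2)[of e e'] N(2)[of e e'] cross[of e e'] cross[of e' e] by (auto simp: Int_commute)
  qed
qed

lemma perfect_matchings_empty [simp]: "perfect_matchings {} = {{}}"
proof (intro equalityI subsetI)
  fix M :: "nat set set" assume "M \<in> perfect_matchings {}"
  then have "\<forall>e\<in>M. e = {} \<and> card e = 2" by (auto simp: perfect_matchings_iff)
  then show "M \<in> {{}}" by fastforce
qed (simp add: perfect_matchings_iff)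

lemma perfect_matchings_restrict:
  assumes "M \<in> perfect_matchings H" "B \<subseteq> M"
  shows "B \<in> perfect_matchings (\<Union>B)" "M - B \<in> perfect_matchings (H - \<Union>B)"
proof -
  show "B \<in> perfect_matchings (\<Union>B)" using assms unfolding perfect_matchings_iff by blast
  have "\<Union>(M - B) = H - \<Union>B"
  proof (intro equalityI subsetI)
    fix x assume "x \<in> \<Union>(M - B)"
    then obtain e where e: "e \<in> M" "e \<notin> B" "x \<in> e" by blast
    then have "x \<notin> \<Union>B"
      using perfect_matchings_disjoint[OF assms(1) e(1) _ e(3)] assms(2) by blast
    then show "x \<in> H - \<Union>B" using e perfect_matchings_Union[OF assms(1)] by blast
  next
    fix x assume "x \<in> H - \<Union>B"
    then show "x \<in> \<Union>(M - B)" using perfect_matchings_Union[OF assms(1)] by blast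
  qed
  then show "M - B \<in> perfect_matchings (H - \<Union>B)" using assms unfolding perfect_matchings_iff by blast
qed

lemma singleton_matching: "a \<noteq> b \<Longrightarrow> {{a, b}} \<in> perfect_matchings {a, b}"
  by (auto simp: perfect_matchings_iff)

lemma matchings_with_edge:
  assumes "a \<in> H" "b \<in> H" "a \<noteq> b"
  shows "{M \<in> perfect_matchings H. {a, b} \<in> M} = insert {a, b} ` perfect_matchings (H - {a, b})"
    and "inj_on (insert {a, b}) (perfect_matchings (H - {a, b}))"
proof -
  have notin: "{a, b} \<notin> N" if "N \<in> perfect_matchings (H - {a, b})" for N
    using that by (auto simp: perfect_matchings_iff)
  show "{M \<in> perfect_matchings H. {a, b} \<in> M} = insert {a, b} ` perfect_matchings (H - {a, b})"
  proof (intro subset_antisym subsetI)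
    fix M assume "M \<in> {M \<in> perfect_matchings H. {a, b} \<in> M}"
    then have "M - {{a, b}} \<in> perfect_matchings (H - {a, b})" "M = insert {a, b} (M - {{a, b}})"
      using perfect_matchings_restrict(2)[of M H "{{a, b}}"] by auto
    then show "M \<in> insert {a, b} ` perfect_matchings (H - {a, b})" by blast
  next
    fix M assume "M \<in> insert {a, b} ` perfect_matchings (H - {a, b})"
    then obtain N where N: "N \<in> perfect_matchings (H - {a, b})" "M = insert {a, b} N" by auto
    have "{{a, b}} \<union> N \<in> perfect_matchings ({a, b} \<union> (H - {a, b}))"
      by (rule perfect_matchings_Un[OF singleton_matching N(1)]) (use assms in auto)
    moreover have "{a, b} \<union> (H - {a, b}) = H" using assms by auto
    ultimately show "M \<in> {M \<in> perfect_matchings H. {a, b} \<in> M}" using N by auto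
  qed
  show "inj_on (insert {a, b}) (perfect_matchings (H - {a, b}))"
    using notin by (intro inj_onI) (metis insert_ident)
qed

lemma matchings_decomp:
  assumes "h \<in> H"
  shows "perfect_matchings H = (\<Union>x\<in>H - {h}. {M \<in> perfect_matchings H. {h, x} \<in> M})"
  using partner_props[of _ H h] assms by blast

lemma sum_matchings_decomp:
  fixes f :: "nat set set \<Rightarrow> 'b :: comm_monoid_add"
  assumes "finite H" "h \<in> H"
  shows "(\<Sum>M\<in>perfect_matchings H. f M) = (\<Sum>x\<in>H - {h}. \<Sum>N\<in>perfect_matchings (H - {h, x}). f (insert {h, x} N))"
proof -
  have "(\<Sum>M\<in>perfect_matchings H. f M) = (\<Sum>M\<in>(\<Union>x\<in>H - {h}. {M \<in> perfect_matchings H. {h, x} \<in> M}). f M)"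
    using matchings_decomp[OF assms(2)] by simp
  also have "\<dots> = (\<Sum>x\<in>H - {h}. \<Sum>M\<in>{M \<in> perfect_matchings H. {h, x} \<in> M}. f M)"
  proof (rule sum.UNION_disjoint)
    have "x = y" if "M \<in> perfect_matchings H" "{h, x} \<in> M" "{h, y} \<in> M" for M x y
      using partner_eqI[OF that(1,2)] partner_eqI[OF that(1,3)] by simp
    then show "\<forall>i\<in>H - {h}. \<forall>j\<in>H - {h}. i \<noteq> j \<longrightarrow>
      {M \<in> perfect_matchings H. {h, i} \<in> M} \<inter> {M \<in> perfect_matchings H. {h, j} \<in> M} = {}" by blast
  qed (use assms in auto)
  also have "\<dots> = (\<Sum>x\<in>H - {h}. \<Sum>N\<in>perfect_matchings (H - {h, x}). f (insert {h, x} N))"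
  proof (rule sum.cong[OF refl])
    fix x assume "x \<in> H - {h}"
    then have x: "x \<in> H" "h \<noteq> x" by auto
    show "(\<Sum>M\<in>{M \<in> perfect_matchings H. {h, x} \<in> M}. f M) = (\<Sum>N\<in>perfect_matchings (H - {h, x}). f (insert {h, x} N))"
      unfolding matchings_with_edge(1)[OF assms(2) x] by (rule sum.reindex_cong[OF matchings_with_edge(2)[OF assms(2) x]]) auto
  qed
  finally show ?thesis .
qed

text \<open>The double factorial (2 j - 1)!!.\<close>

fun odd_fact :: "nat \<Rightarrow> nat" where
  "odd_fact 0 = 1"
| "odd_fact (Suc j) = (2 * j + 1) * odd_fact j"

lemma odd_fact_pos [simp]: "0 < odd_fact j"
  by (induction j) auto

lemma card_perfect_matchings:
  assumes "finite H" "card H = 2 * j"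
  shows "card (perfect_matchings H) = odd_fact j"
  using assms
proof (induction j arbitrary: H)
  case 0
  then show ?case by simp
next
  case (Suc j)
  then obtain h where h: "h \<in> H" by fastforce
  have "card (perfect_matchings H) = (\<Sum>x\<in>H - {h}. \<Sum>N\<in>perfect_matchings (H - {h, x}). 1)"
    unfolding card_eq_sum by (rule sum_matchings_decomp[OF Suc.prems(1) h])
  also have "\<dots> = (\<Sum>x\<in>H - {h}. odd_fact j)"
  proof (rule sum.cong[OF refl])
    fix x assume "x \<in> H - {h}"
    then have "card (H - {h, x}) = 2 * j" using Suc.prems h by (subst card_Diff_subset) auto
    then show "(\<Sum>N\<in>perfect_matchings (H - {h, x}). 1) = odd_fact j"
      using Suc.IH[of "H - {h, x}"] Suc.prems by simp
  qed
  also have "\<dots> = card (H - {h}) * odd_fact j" by simp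
  also have "card (H - {h}) = 2 * j + 1" using Suc.prems h by simp
  finally show ?case by simp
qed

definition matching_avg :: "nat set \<Rightarrow> (nat set set \<Rightarrow> real) \<Rightarrow> real" where
  "matching_avg H f = (\<Sum>M\<in>perfect_matchings H. f M) / real (card (perfect_matchings H))"

lemma matching_avg_decomp:
  assumes "finite H" "card H = 2 * Suc j" "h \<in> H"
  shows "matching_avg H f =
    (\<Sum>x\<in>H - {h}. matching_avg (H - {h, x}) (\<lambda>N. f (insert {h, x} N))) / real (card (H - {h}))"
proof -
  have c: "card (perfect_matchings (H - {h, x})) = odd_fact j" if "x \<in> H - {h}" for x
    by (rule card_perfect_matchings) (use assms that in \<open>auto simp: card_Diff_subset\<close>)
  have "(\<Sum>x\<in>H - {h}. matching_avg (H - {h, x}) (\<lambda>N. f (insert {h, x} N))) =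
    (\<Sum>x\<in>H - {h}. (\<Sum>N\<in>perfect_matchings (H - {h, x}). f (insert {h, x} N)) / odd_fact j)"
    by (rule sum.cong) (auto simp: matching_avg_def c)
  also have "\<dots> = (\<Sum>M\<in>perfect_matchings H. f M) / odd_fact j"
    by (simp add: sum_divide_distrib[symmetric] sum_matchings_decomp[OF assms(1,3)])
  finally have 1: "(\<Sum>x\<in>H - {h}. matching_avg (H - {h, x}) (\<lambda>N. f (insert {h, x} N))) =
    (\<Sum>M\<in>perfect_matchings H. f M) / odd_fact j" .
  have 2: "card (H - {h}) = 2 * j + 1" using assms by simp
  have 3: "matching_avg H f = (\<Sum>M\<in>perfect_matchings H. f M) / real ((2 * j + 1) * odd_fact j)"
    using card_perfect_matchings[OF assms(1,2)] by (simp add: matching_avg_def)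
  show ?thesis unfolding 1 2 3 of_nat_mult by (simp add: mult.commute)
qed

lemma matching_avg_mono:
  "finite H \<Longrightarrow> (\<And>M. M \<in> perfect_matchings H \<Longrightarrow> f M \<le> g M) \<Longrightarrow> matching_avg H f \<le> matching_avg H g"
  unfolding matching_avg_def by (intro divide_right_mono sum_mono) auto

lemma matching_avg_sum: "matching_avg H (\<lambda>M. \<Sum>i\<in>I. f i M) = (\<Sum>i\<in>I. matching_avg H (f i))"
  unfolding matching_avg_def by (subst sum.swap) (simp add: sum_divide_distrib)

lemma matching_avg_cmult: "matching_avg H (\<lambda>M. c * f M) = c * matching_avg H f"
  unfolding matching_avg_def by (simp add: sum_distrib_left)

lemma matching_avg_add: "matching_avg H (\<lambda>M. f M + g M) = matching_avg H f + matching_avg H g"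
  unfolding matching_avg_def by (simp add: sum.distrib add_divide_distrib)

section \<open>Matchings containing prescribed pairs\<close>

definition has_pairs :: "(nat \<times> nat) list \<Rightarrow> nat set set \<Rightarrow> bool" where
  "has_pairs ps M \<longleftrightarrow> (\<forall>(a, b)\<in>set ps. {a, b} \<in> M)"

definition flat :: "(nat \<times> nat) list \<Rightarrow> nat list" where
  "flat ps = concat (map (\<lambda>(a, b). [a, b]) ps)"

lemma flat_simps [simp]: "flat [] = []" "flat ((a, b) # ps) = a # b # flat ps"
  by (simp_all add: flat_def)

lemma in_flat: "(c, d) \<in> set ps \<Longrightarrow> c \<in> set (flat ps) \<and> d \<in> set (flat ps)"
  by (force simp: flat_def)

lemma card_has_pairs:
  assumes "finite H" "card H = 2 * j" "distinct (flat ps)" "set (flat ps) \<subseteq> H"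
  shows "card {M \<in> perfect_matchings H. has_pairs ps M} = odd_fact (j - length ps) \<and> length ps \<le> j"
  using assms
proof (induction ps arbitrary: H j)
  case Nil
  then show ?case by (simp add: has_pairs_def card_perfect_matchings)
next
  case (Cons p ps)
  obtain a b where p: "p = (a, b)" by fastforce
  have ab: "a \<in> H" "b \<in> H" "a \<noteq> b" "a \<notin> set (flat ps)" "b \<notin> set (flat ps)" "distinct (flat ps)" "set (flat ps) \<subseteq> H - {a, b}"
    using Cons.prems by (auto simp: p)
  have "card {a, b} \<le> card H" by (rule card_mono) (use Cons.prems ab in auto)
  then have j: "j = Suc (j - 1)" using Cons.prems ab by auto
  have cH: "card (H - {a, b}) = 2 * (j - 1)" using Cons.prems ab by (subst card_Diff_subset) auto
  have IH: "card {M \<in> perfect_matchings (H - {a, b}). has_pairs ps M} = odd_fact (j - 1 - length ps) \<and> length ps \<le> j - 1"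
    by (rule Cons.IH) (use Cons.prems(1) ab(6,7) cH in simp_all)
  have "{M \<in> perfect_matchings H. has_pairs (p # ps) M} = {M \<in> {M \<in> perfect_matchings H. {a, b} \<in> M}. has_pairs ps M}"
    by (auto simp: p has_pairs_def)
  also have "\<dots> = insert {a, b} ` {N \<in> perfect_matchings (H - {a, b}). has_pairs ps N}"
  proof -
    have "has_pairs ps (insert {a, b} N) \<longleftrightarrow> has_pairs ps N" for N
    proof -
      have "{c, d} \<noteq> {a, b}" if "(c, d) \<in> set ps" for c d
        using in_flat[OF that] ab(4,5) by (auto simp: doubleton_eq_iff)
      then show ?thesis by (auto simp: has_pairs_def)
    qed
    then show ?thesis unfolding matchings_with_edge(1)[OF ab(1-3)] by blast
  qed
  finally have "card {M \<in> perfect_matchings H. has_pairs (p # ps) M} = card {N \<in> perfect_matchings (H - {a, b}). has_pairs ps N}"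
    using matchings_with_edge(2)[OF ab(1-3)] by (simp add: card_image inj_on_subset)
  then show ?case using IH j by auto
qed

lemma odd_fact_ratio:
  "l \<le> j \<Longrightarrow> real (odd_fact (j - l)) / real (odd_fact j) = (\<Prod>i<l. 1 / (2 * real j - 1 - 2 * real i))"
proof (induction l)
  case (Suc l)
  define q where "q = j - Suc l"
  have q: "j - l = Suc q" "j = q + Suc l" using Suc.prems by (auto simp: q_def)
  have "real (odd_fact (j - l)) = (2 * real q + 1) * real (odd_fact q)" by (simp add: q algebra_simps)
  moreover have "2 * real q + 1 = 2 * real j - 1 - 2 * real l" using q(2) by simp
  moreover have "2 * real q + 1 > 0" by simp
  ultimately have "real (odd_fact (j - l)) = (2 * real j - 1 - 2 * real l) * real (odd_fact q)"
    "2 * real j - 1 - 2 * real l > 0" by simp_all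
  then have "real (odd_fact q) = real (odd_fact (j - l)) * (1 / (2 * real j - 1 - 2 * real l))"
    by simp
  then have "real (odd_fact q) / real (odd_fact j) = real (odd_fact (j - l)) / real (odd_fact j) * (1 / (2 * real j - 1 - 2 * real l))"
    by simp
  also have "real (odd_fact (j - l)) / real (odd_fact j) = (\<Prod>i<l. 1 / (2 * real j - 1 - 2 * real i))"
    using Suc by simp
  finally show ?case by (simp only: q_def prod.lessThan_Suc)
qed simp

lemma matching_avg_pairs:
  assumes "finite H" "card H = 2 * j" "distinct (flat ps)" "set (flat ps) \<subseteq> H"
  shows "matching_avg H (\<lambda>M. of_bool (has_pairs ps M)) = (\<Prod>i<length ps. 1 / (real (card H) - 1 - 2 * real i))"
proof -
  have "(\<Sum>M\<in>perfect_matchings H. of_bool (has_pairs ps M)) = real (card {M \<in> perfect_matchings H. has_pairs ps M})"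
    using assms(1) by (simp add: of_bool_def sum.If_cases Int_def)
  then have "matching_avg H (\<lambda>M. of_bool (has_pairs ps M)) = real (odd_fact (j - length ps)) / real (odd_fact j)"
    using card_has_pairs[OF assms] card_perfect_matchings[OF assms(1,2)] by (simp add: matching_avg_def)
  then show ?thesis
    using odd_fact_ratio[of "length ps" j] card_has_pairs[OF assms] assms(2) by simp
qed

section \<open>Concentration under uniform matchings\<close>

lemma exp_le_quadratic:
  fixes t :: real
  assumes "\<bar>t\<bar> \<le> 1"
  shows "exp t \<le> 1 + t + t\<^sup>2"
proof (cases "0 \<le> t")
  case True
  then show ?thesis using exp_bound assms by auto
next
  case False
  define x where "x = - t"
  have x: "0 \<le> x" "t = - x" using False by (auto simp: x_def)
  have 1: "1 + x + x\<^sup>2 / 2 \<le> exp x" using exp_lower_Taylor_quadratic[OF x(1)] .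
  have pos: "0 < 1 + x + x\<^sup>2 / 2" using x by (simp add: add_pos_nonneg)
  \<comment> \<open>For negative t the reciprocal is bounded instead: the quadratic lower bound of
    \<open>exp x\<close>, multiplied by \<open>1 - x + x\<^sup>2\<close>, is at least 1.\<close>
  have "1 \<le> (1 + x + x\<^sup>2 / 2) * (1 - x + x\<^sup>2)"
  proof -
    have "(1 + x + x\<^sup>2 / 2) * (1 - x + x\<^sup>2) = 1 + x ^ 2 / 2 + x ^ 3 / 2 + x ^ 4 / 2"
      by (simp add: field_simps power2_eq_square power3_eq_cube power4_eq_xxxx)
    then show ?thesis using x by simp
  qed
  also have "\<dots> \<le> exp x * (1 - x + x\<^sup>2)"
  proof (rule mult_right_mono[OF 1])
    have "1 - x + x\<^sup>2 = (x - 1 / 2)\<^sup>2 + 3 / 4" by (simp add: power2_eq_square field_simps)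
    then show "0 \<le> 1 - x + x\<^sup>2" by simp
  qed
  finally have "1 / exp x \<le> 1 - x + x\<^sup>2" by (simp add: field_simps)
  then show ?thesis using x by (simp add: exp_minus inverse_eq_divide)
qed

text \<open>A weak form of Hoeffding's lemma: the linear term averages to 0 and
  \<open>exp_le_quadratic\<close> bounds the rest, which works as long as
  \<open>l * D \<le> 1\<close>.\<close>

lemma centered_exp_avg:
  fixes e :: "'a \<Rightarrow> real"
  assumes X: "finite X" "X \<noteq> {}" and D: "\<And>x y. x \<in> X \<Longrightarrow> y \<in> X \<Longrightarrow> \<bar>e x - e y\<bar> \<le> D"
    and l: "0 \<le> l" "l * D \<le> 1" and m: "m = (\<Sum>x\<in>X. e x) / real (card X)"
  shows "(\<Sum>x\<in>X. exp (l * (e x - m))) / real (card X) \<le> exp (l\<^sup>2 * D\<^sup>2)"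
proof -
  have c: "real (card X) > 0" using X by (simp add: card_gt_0_iff)
  have dev: "\<bar>e x - m\<bar> \<le> D" if x: "x \<in> X" for x
  proof -
    have "e x - m = (\<Sum>y\<in>X. e x - e y) / real (card X)"
      using c by (simp add: m sum_subtractf field_simps)
    also have "\<bar>\<dots>\<bar> \<le> (\<Sum>y\<in>X. \<bar>e x - e y\<bar>) / real (card X)"
      using c by (simp add: abs_divide divide_right_mono sum_abs)
    also have "\<dots> \<le> (\<Sum>y\<in>X. D) / real (card X)"
      using D x by (intro divide_right_mono sum_mono) auto
    finally show ?thesis using c by simp
  qed
  have "exp (l * (e x - m)) \<le> 1 + l * (e x - m) + l\<^sup>2 * D\<^sup>2" if x: "x \<in> X" for x
  proof -
    have "\<bar>l * (e x - m)\<bar> \<le> l * D" using dev[OF x] l by (simp add: abs_mult mult_left_mono)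
    then have "exp (l * (e x - m)) \<le> 1 + l * (e x - m) + (l * (e x - m))\<^sup>2"
      using l by (intro exp_le_quadratic) auto
    also have "(l * (e x - m))\<^sup>2 \<le> (l * D)\<^sup>2"
      using \<open>\<bar>l * (e x - m)\<bar> \<le> l * D\<close> by (metis abs_ge_zero power2_abs power_mono)
    finally show ?thesis by (simp add: power_mult_distrib)
  qed
  then have "(\<Sum>x\<in>X. exp (l * (e x - m))) \<le> (\<Sum>x\<in>X. 1 + l * (e x - m) + l\<^sup>2 * D\<^sup>2)"
    by (rule sum_mono)
  also have "\<dots> = real (card X) * (1 + l\<^sup>2 * D\<^sup>2)"
    using c by (simp add: sum.distrib sum_distrib_left[symmetric] sum_subtractf m algebra_simps)
  finally have "(\<Sum>x\<in>X. exp (l * (e x - m))) / real (card X) \<le> 1 + l\<^sup>2 * D\<^sup>2"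
    using c by (simp add: field_simps)
  also have "\<dots> \<le> exp (l\<^sup>2 * D\<^sup>2)" by (rule exp_ge_add_one_self)
  finally show ?thesis .
qed

section \<open>Switchings and exponential concentration\<close>

definition swap :: "nat \<Rightarrow> nat \<Rightarrow> nat \<Rightarrow> nat" where
  "swap x y z = (if z = x then y else if z = y then x else z)"

lemma swap_swap [simp]: "swap x y (swap x y z) = z"
  by (simp add: swap_def)

lemma swap_image_image [simp]: "swap x y ` swap x y ` A = A"
  by (simp add: image_image)

lemma inj_swap: "inj (swap x y)"
  by (metis injI swap_swap)

lemma swap_matching:
  assumes "M \<in> perfect_matchings H"
  shows "(`) (swap x y) ` M \<in> perfect_matchings (swap x y ` H)"
proof -
  have c: "card (swap x y ` e) = card e" for e
    by (rule card_image) (use inj_swap in \<open>rule inj_on_subset, simp\<close>)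
  have i: "swap x y ` e \<inter> swap x y ` e' = swap x y ` (e \<inter> e')" for e e'
    by (rule image_Int[symmetric, OF inj_swap])
  have u: "\<Union>((`) (swap x y) ` M) = swap x y ` \<Union>M" by blast
  show ?thesis
    unfolding perfect_matchings_iff u perfect_matchings_Union[OF assms]
  proof (intro conjI ballI impI refl)
    show "card f = 2" if "f \<in> (`) (swap x y) ` M" for f
      using that c perfect_matchings_card[OF assms] by auto
    fix f f' assume "f \<in> (`) (swap x y) ` M" "f' \<in> (`) (swap x y) ` M" "f \<noteq> f'"
    then obtain e e' where e: "e \<in> M" "e' \<in> M" "f = swap x y ` e" "f' = swap x y ` e'" "e \<noteq> e'" by blast
    then have "e \<inter> e' = {}" using assms unfolding perfect_matchings_iff by blast
    then show "f \<inter> f' = {}" unfolding e i by simp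
  qed
qed

text \<open>Four is the reach of a switching: exchanging the roles of \<open>x\<close> and
  \<open>y\<close> in a matching changes partners only at \<open>x\<close>, \<open>y\<close> and
  their two partners.\<close>

definition lipschitz_matching :: "nat set \<Rightarrow> (nat set set \<Rightarrow> real) \<Rightarrow> real \<Rightarrow> bool" where
  "lipschitz_matching H f D \<longleftrightarrow> (\<forall>M\<in>perfect_matchings H. \<forall>N\<in>perfect_matchings H.
     card {h \<in> H. partner M h \<noteq> partner N h} \<le> 4 \<longrightarrow> \<bar>f M - f N\<bar> \<le> D)"

lemma partner_insert:
  assumes "N \<in> perfect_matchings (H - {a, b})" "a \<in> H" "b \<in> H" "a \<noteq> b" "h \<in> H - {a, b}"
  shows "partner (insert {a, b} N) h = partner N h"
proof (rule partner_eqI)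
  show "insert {a, b} N \<in> perfect_matchings H" using matchings_with_edge(1)[OF assms(2-4)] assms(1) by auto
  show "{h, partner N h} \<in> insert {a, b} N" using partner_props(1)[OF assms(1,5)] by simp
qed

lemma lipschitz_insert:
  assumes "lipschitz_matching H f D" "finite H" "a \<in> H" "b \<in> H" "a \<noteq> b"
  shows "lipschitz_matching (H - {a, b}) (\<lambda>N. f (insert {a, b} N)) D"
  unfolding lipschitz_matching_def
proof (intro ballI impI)
  fix M N assume MN: "M \<in> perfect_matchings (H - {a, b})" "N \<in> perfect_matchings (H - {a, b})"
    and c: "card {h \<in> H - {a, b}. partner M h \<noteq> partner N h} \<le> 4"
  have in_H: "insert {a, b} K \<in> perfect_matchings H" if "K \<in> perfect_matchings (H - {a, b})" for K
    using matchings_with_edge(1)[OF assms(3-5)] that by auto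
  have ab: "partner (insert {a, b} K) a = b" "partner (insert {a, b} K) b = a" if "K \<in> perfect_matchings (H - {a, b})" for K
    using partner_eqI[OF in_H[OF that], of a b] partner_eqI[OF in_H[OF that], of b a] by (auto simp: insert_commute)
  have "{h \<in> H. partner (insert {a, b} M) h \<noteq> partner (insert {a, b} N) h} = {h \<in> H - {a, b}. partner M h \<noteq> partner N h}"
  proof (rule Set.set_eqI)
    fix x
    show "x \<in> {h \<in> H. partner (insert {a, b} M) h \<noteq> partner (insert {a, b} N) h} \<longleftrightarrow>
      x \<in> {h \<in> H - {a, b}. partner M h \<noteq> partner N h}"
      using ab[OF MN(1)] ab[OF MN(2)] partner_insert[OF MN(1) assms(3-5), of x] partner_insert[OF MN(2) assms(3-5), of x]
      by (cases "x = a"; cases "x = b") auto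
  qed
  then show "\<bar>f (insert {a, b} M) - f (insert {a, b} N)\<bar> \<le> D"
    using assms(1) in_H MN c unfolding lipschitz_matching_def by auto
qed

lemma swap_avg_diff:
  assumes f: "lipschitz_matching H f D" and fin: "finite H" and D: "0 \<le> D"
    and h: "h \<in> H" and x: "x \<in> H - {h}" and y: "y \<in> H - {h}"
  shows "\<bar>matching_avg (H - {h, x}) (\<lambda>N. f (insert {h, x} N)) - matching_avg (H - {h, y}) (\<lambda>N. f (insert {h, y} N))\<bar> \<le> D"
proof (cases "x = y")
  case False
  let ?t = "swap x y" and ?T = "\<lambda>M. (`) (swap x y) ` M"
  have TT: "?T (?T M) = M" for M by (simp add: image_image)
  have img: "?t ` (H - {h, x}) = H - {h, y}" "?t ` (H - {h, y}) = H - {h, x}"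
    using x y by (auto simp: swap_def image_iff)
  have bij: "bij_betw ?T (perfect_matchings (H - {h, x})) (perfect_matchings (H - {h, y}))"
    by (rule bij_betw_byWitness[where f' = ?T])
      (use TT swap_matching[of _ "H - {h, x}" x y] swap_matching[of _ "H - {h, y}" x y] img in auto)
  then have card: "card (perfect_matchings (H - {h, y})) = card (perfect_matchings (H - {h, x}))"
    by (simp add: bij_betw_same_card)
  have close: "\<bar>f (insert {h, x} N) - f (insert {h, y} (?T N))\<bar> \<le> D" if N: "N \<in> perfect_matchings (H - {h, x})" for N
  proof -
    have hx: "h \<noteq> x" "x \<in> H" "h \<noteq> y" "y \<in> H" using x y by auto
    let ?M = "insert {h, x} N" and ?M' = "insert {h, y} (?T N)"
    have M: "?M \<in> perfect_matchings H" using matchings_with_edge(1)[OF h hx(2,1)] N by auto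
    have "?T N \<in> perfect_matchings (H - {h, y})" using bij N by (auto simp: bij_betw_def)
    then have M': "?M' \<in> perfect_matchings H" using matchings_with_edge(1)[OF h hx(4,3)] by auto
    have th: "?t h = h" "?t x = y" using hx by (auto simp: swap_def)
    have M'T: "?M' = ?T ?M" using th by simp
    have p: "partner ?M' z = ?t (partner ?M (?t z))" if "z \<in> H" for z
    proof (rule partner_eqI[OF M'])
      have "?t z \<in> H" using that hx by (auto simp: swap_def)
      then have "{?t z, partner ?M (?t z)} \<in> ?M" using partner_props[OF M] by simp
      then have "?t ` {?t z, partner ?M (?t z)} \<in> ?T ?M" by (rule imageI)
      then show "{z, ?t (partner ?M (?t z))} \<in> ?M'" unfolding M'T[symmetric] by simp
    qed
    have "{z \<in> H. partner ?M z \<noteq> partner ?M' z} \<subseteq> {x, y, partner ?M x, partner ?M y}"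
    proof
      fix z assume "z \<in> {z \<in> H. partner ?M z \<noteq> partner ?M' z}"
      then have z: "z \<in> H" "partner ?M z \<noteq> ?t (partner ?M (?t z))" using p by auto
      show "z \<in> {x, y, partner ?M x, partner ?M y}"
      proof (rule ccontr)
        assume "z \<notin> {x, y, partner ?M x, partner ?M y}"
        then have "?t z = z" "partner ?M z \<noteq> x" "partner ?M z \<noteq> y"
          using partner_props(4)[OF M z(1)] by (auto simp: swap_def)
        then show False using z(2) by (auto simp: swap_def)
      qed
    qed
    then have "card {z \<in> H. partner ?M z \<noteq> partner ?M' z} \<le> card {x, y, partner ?M x, partner ?M y}"
      by (intro card_mono) auto
    also have "\<dots> \<le> 4" using card_length[of "[x, y, partner ?M x, partner ?M y]"] by simp
    finally show ?thesis using f M M' unfolding lipschitz_matching_def by blast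
  qed
  let ?c = "real (card (perfect_matchings (H - {h, x})))"
  have "matching_avg (H - {h, y}) (\<lambda>N. f (insert {h, y} N)) = (\<Sum>N\<in>perfect_matchings (H - {h, x}). f (insert {h, y} (?T N))) / ?c"
    unfolding matching_avg_def card sum.reindex_bij_betw[OF bij, of "\<lambda>N. f (insert {h, y} N)", symmetric] by (rule refl)
  then have "matching_avg (H - {h, x}) (\<lambda>N. f (insert {h, x} N)) - matching_avg (H - {h, y}) (\<lambda>N. f (insert {h, y} N)) =
    (\<Sum>N\<in>perfect_matchings (H - {h, x}). f (insert {h, x} N) - f (insert {h, y} (?T N))) / ?c"
    by (simp add: matching_avg_def sum_subtractf diff_divide_distrib)
  also have "\<bar>\<dots>\<bar> \<le> (\<Sum>N\<in>perfect_matchings (H - {h, x}). \<bar>f (insert {h, x} N) - f (insert {h, y} (?T N))\<bar>) / ?c"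
    by (simp add: abs_divide divide_right_mono sum_abs)
  also have "\<dots> \<le> (\<Sum>N\<in>perfect_matchings (H - {h, x}). D) / ?c"
    by (intro divide_right_mono sum_mono close) auto
  also have "\<dots> \<le> D" using D by simp
  finally show ?thesis .
qed (use D in simp)

text \<open>
  Expose the partner of one point at a time: swapping two candidate partners is a bijection between
  the corresponding sets of completions, so the conditional averages differ by at most \<open>D\<close>.
\<close>

lemma matching_mgf:
  assumes "finite H" "card H = 2 * j" "lipschitz_matching H f D" "0 \<le> D" "0 \<le> l" "l * D \<le> 1"
  shows "matching_avg H (\<lambda>M. exp (l * (f M - matching_avg H f))) \<le> exp (l\<^sup>2 * D\<^sup>2 * real j)"
  using assms(1-3)
proof (induction j arbitrary: H f)
  case 0
  then show ?case by (simp add: matching_avg_def)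
next
  case (Suc j)
  then obtain h where h: "h \<in> H" by fastforce
  let ?e = "\<lambda>x. matching_avg (H - {h, x}) (\<lambda>N. f (insert {h, x} N))"
  let ?m = "matching_avg H f" and ?X = "H - {h}"
  have cX: "card ?X = 2 * j + 1" using Suc.prems h by simp
  have m: "?m = (\<Sum>x\<in>?X. ?e x) / real (card ?X)" by (rule matching_avg_decomp[OF Suc.prems(1,2) h])
  have IH: "matching_avg (H - {h, x}) (\<lambda>N. exp (l * (f (insert {h, x} N) - ?e x))) \<le> exp (l\<^sup>2 * D\<^sup>2 * real j)"
    if x: "x \<in> ?X" for x
  proof (rule Suc.IH)
    show "card (H - {h, x}) = 2 * j" using Suc.prems h x by (subst card_Diff_subset) auto
    show "lipschitz_matching (H - {h, x}) (\<lambda>N. f (insert {h, x} N)) D"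
      using lipschitz_insert[OF Suc.prems(3,1) h] x by auto
  qed (use Suc.prems in auto)
  have "matching_avg H (\<lambda>M. exp (l * (f M - ?m))) =
    (\<Sum>x\<in>?X. matching_avg (H - {h, x}) (\<lambda>N. exp (l * (f (insert {h, x} N) - ?m)))) / real (card ?X)"
    by (rule matching_avg_decomp[OF Suc.prems(1,2) h])
  also have "\<dots> = (\<Sum>x\<in>?X. exp (l * (?e x - ?m)) * matching_avg (H - {h, x}) (\<lambda>N. exp (l * (f (insert {h, x} N) - ?e x)))) / real (card ?X)"
    unfolding matching_avg_cmult[symmetric] exp_add[symmetric] by (simp add: algebra_simps)
  also have "\<dots> \<le> (\<Sum>x\<in>?X. exp (l * (?e x - ?m)) * exp (l\<^sup>2 * D\<^sup>2 * real j)) / real (card ?X)"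
    by (intro divide_right_mono sum_mono mult_left_mono IH) auto
  also have "\<dots> = (\<Sum>x\<in>?X. exp (l * (?e x - ?m))) / real (card ?X) * exp (l\<^sup>2 * D\<^sup>2 * real j)"
    by (simp add: sum_distrib_right)
  also have "\<dots> \<le> exp (l\<^sup>2 * D\<^sup>2) * exp (l\<^sup>2 * D\<^sup>2 * real j)"
  proof (rule mult_right_mono[OF centered_exp_avg])
    show "?X \<noteq> {}" using cX by (metis add_is_0 card.empty one_neq_zero)
    show "\<bar>?e x - ?e y\<bar> \<le> D" if "x \<in> ?X" "y \<in> ?X" for x y
      by (rule swap_avg_diff[OF Suc.prems(3,1) assms(4) h that])
  qed (use assms Suc.prems m in auto)
  also have "\<dots> = exp (l\<^sup>2 * D\<^sup>2 * real (Suc j))"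
    by (simp add: exp_add[symmetric] algebra_simps)
  finally show ?case .
qed

lemma matching_tail:
  assumes "finite H" "card H = 2 * j" "lipschitz_matching H f D" "0 \<le> D" "0 \<le> l" "l * D \<le> 1"
  shows "real (card {M \<in> perfect_matchings H. matching_avg H f + s \<le> f M}) \<le>
    exp (l\<^sup>2 * D\<^sup>2 * real j - l * s) * real (card (perfect_matchings H))"
proof -
  let ?c = "real (card (perfect_matchings H))" and ?S = "{M \<in> perfect_matchings H. matching_avg H f + s \<le> f M}"
  have c: "?c > 0" using card_perfect_matchings[OF assms(1,2)] by simp
  have "exp (l * s) * real (card ?S) = (\<Sum>M\<in>?S. exp (l * s))" by simp
  also have "\<dots> \<le> (\<Sum>M\<in>?S. exp (l * (f M - matching_avg H f)))"
    by (rule sum_mono) (use assms(5) in \<open>auto intro!: mult_left_mono\<close>)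
  also have "\<dots> \<le> (\<Sum>M\<in>perfect_matchings H. exp (l * (f M - matching_avg H f)))"
    by (rule sum_mono2) (use assms(1) in auto)
  also have "\<dots> = ?c * matching_avg H (\<lambda>M. exp (l * (f M - matching_avg H f)))"
    using c by (simp add: matching_avg_def)
  also have "\<dots> \<le> ?c * exp (l\<^sup>2 * D\<^sup>2 * real j)"
    using matching_mgf[OF assms] c by (intro mult_left_mono) auto
  finally have "real (card ?S) \<le> ?c * exp (l\<^sup>2 * D\<^sup>2 * real j) / exp (l * s)"
    by (simp add: field_simps)
  then show ?thesis by (simp add: exp_diff mult_ac)
qed

section \<open>Local sums over the half-edges of a matching\<close>

definition sibs :: "nat \<Rightarrow> nat set" where "sibs g = {sib g, sib (sib g)}"

lemma finite_sibs [simp]: "finite (sibs g)" and card_sibs: "card (sibs g) = 2"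
  by (simp_all add: sibs_def)

text \<open>The numbers 3, 4, 5 are the lengths of the paths between the two measured vertices
  involved, with \<open>A\<close> in the role of the inner half-edges next to \<open>V0\<close>. The
  \<open>distinct\<close> clauses of \<open>loc4\<close> and \<open>loc5\<close> turn every
  indicator into an event about disjoint pairs, whose probability is explicit; where the graph is
  locally a tree they hold automatically.\<close>

definition loc3 :: "nat set \<Rightarrow> (nat \<Rightarrow> nat) \<Rightarrow> nat \<Rightarrow> real" where
  "loc3 A p g = of_bool (g \<in> A \<and> p g \<in> A)"

definition loc4 :: "nat set \<Rightarrow> nat set \<Rightarrow> (nat \<Rightarrow> nat) \<Rightarrow> nat \<Rightarrow> real" where
  "loc4 H A p g = (\<Sum>k\<in>sibs g \<inter> H. of_bool (p g \<in> A \<and> p k \<in> A \<and> distinct [g, p g, k, p k]))"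

definition loc5 :: "nat set \<Rightarrow> nat set \<Rightarrow> (nat \<Rightarrow> nat) \<Rightarrow> nat \<Rightarrow> real" where
  "loc5 H A p g = (\<Sum>k\<in>sibs g \<inter> H. \<Sum>k'\<in>sibs (p g) \<inter> H.
     of_bool (p k \<in> A \<and> p k' \<in> A \<and> distinct [g, p g, k, p k, k', p k']))"

definition loc_weight :: "nat set \<Rightarrow> nat set \<Rightarrow> (nat \<Rightarrow> nat) \<Rightarrow> nat \<Rightarrow> real" where
  "loc_weight H A p g = 5 / 18 * loc3 A p g + 1 / sqrt 3 / 9 * loc4 H A p g + 2 / 243 * loc5 H A p g"

definition loc_sum :: "nat set \<Rightarrow> nat set \<Rightarrow> nat set set \<Rightarrow> real" where
  "loc_sum H A M = (\<Sum>g\<in>H. loc_weight H A (partner M) g)"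

lemma card_sibs_Int: "card (sibs g \<inter> H) \<le> 2"
  using card_mono[of "sibs g" "sibs g \<inter> H"] by (simp add: card_sibs)

lemma loc_bounds:
  "0 \<le> loc3 A p g" "loc3 A p g \<le> 1" "0 \<le> loc4 H A p g" "loc4 H A p g \<le> 2" "0 \<le> loc5 H A p g" "loc5 H A p g \<le> 4"
proof -
  show "0 \<le> loc3 A p g" "loc3 A p g \<le> 1" by (simp_all add: loc3_def)
  show "0 \<le> loc4 H A p g" unfolding loc4_def by (rule sum_nonneg) simp
  show "0 \<le> loc5 H A p g" unfolding loc5_def by (rule sum_nonneg, rule sum_nonneg) simp
  have s: "(\<Sum>k\<in>sibs g \<inter> H. f k) \<le> 2 * c" if "\<And>k. f k \<le> c" "0 \<le> c" for f :: "nat \<Rightarrow> real" and c g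
  proof -
    have "(\<Sum>k\<in>sibs g \<inter> H. f k) \<le> (\<Sum>k\<in>sibs g \<inter> H. c)" by (rule sum_mono) (rule that)
    also have "\<dots> = real (card (sibs g \<inter> H)) * c" by simp
    also have "\<dots> \<le> 2 * c" using card_sibs_Int[of g H] that(2) by (intro mult_right_mono) auto
    finally show ?thesis .
  qed
  show "loc4 H A p g \<le> 2" unfolding loc4_def by (rule order_trans[OF s[of _ 1]]) simp_all
  have "loc5 H A p g \<le> 2 * (2 * 1)" unfolding loc5_def by (intro s) auto
  then show "loc5 H A p g \<le> 4" by simp
qed

lemma inv_sqrt3_bounds: "0 \<le> 1 / sqrt 3" "1 / sqrt 3 \<le> 1"
  by (simp_all add: divide_le_eq real_sqrt_ge_one)

lemma loc_weight_bounds: "0 \<le> loc_weight H A p g" "loc_weight H A p g \<le> 1"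
proof -
  have "0 \<le> 1 / sqrt 3 / 9 * loc4 H A p g"
    using loc_bounds(3)[of H A p g] inv_sqrt3_bounds by simp
  then show "0 \<le> loc_weight H A p g"
    using loc_bounds(1)[of A p g] loc_bounds(5)[of H A p g] by (simp add: loc_weight_def add_nonneg_nonneg)
  have "1 / sqrt 3 / 9 * loc4 H A p g \<le> 1 / 9 * 2"
    using loc_bounds(3,4)[of H A p g] inv_sqrt3_bounds by (intro mult_mono) auto
  then show "loc_weight H A p g \<le> 1"
    using loc_bounds(2)[of A p g] loc_bounds(6)[of H A p g] by (simp add: loc_weight_def)
qed

lemma loc_weight_cong:
  assumes "p g = q g" "\<And>k. k \<in> sibs g \<Longrightarrow> p k = q k" "\<And>k. k \<in> sibs (p g) \<Longrightarrow> p k = q k"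
  shows "loc_weight H A p g = loc_weight H A q g"
proof -
  have "loc4 H A p g = loc4 H A q g"
    unfolding loc4_def by (rule sum.cong) (use assms in auto)
  moreover have "loc5 H A p g = loc5 H A q g"
    unfolding loc5_def assms(1)[symmetric] by (intro sum.cong refl) (use assms in auto)
  ultimately show ?thesis using assms(1) by (simp add: loc_weight_def loc3_def)
qed

lemma mem_sibs: "k \<in> sibs g \<longleftrightarrow> g \<in> sibs k"
  by (auto simp: sibs_def)

text \<open>A changed partner at \<open>d\<close> affects the weight only at \<open>d\<close>, at
  its two siblings and at the partners of those. This gives at most 4 * 5 summands, each in
  [0, 1].\<close>

lemma lipschitz_loc_sum:
  assumes fin: "finite H"
  shows "lipschitz_matching H (loc_sum H A) 20"
  unfolding lipschitz_matching_def
proof (intro ballI impI)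
  fix M N assume M: "M \<in> perfect_matchings H" and N: "N \<in> perfect_matchings H"
    and c: "card {h \<in> H. partner M h \<noteq> partner N h} \<le> 4"
  let ?p = "partner M" and ?q = "partner N"
  let ?D = "{h \<in> H. ?p h \<noteq> ?q h}"
  let ?U = "\<lambda>d. {d, sib d, sib (sib d), ?p (sib d), ?p (sib (sib d))}"
  let ?W = "{g \<in> H. loc_weight H A ?p g \<noteq> loc_weight H A ?q g}"
  have finD: "finite ?D" using fin by simp
  \<comment> \<open>Partners of half-edges outside \<open>H\<close> are unspecified; the weight
    evaluates \<open>p\<close> only inside \<open>H\<close>, so these values can be set to 0 before
    comparing.\<close>
  have restrict: "loc_weight H A (\<lambda>h. if h \<in> H then p h else 0) g = loc_weight H A p g"
    if "g \<in> H" for p g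
  proof -
    have "loc4 H A (\<lambda>h. if h \<in> H then p h else 0) g = loc4 H A p g"
      unfolding loc4_def by (rule sum.cong) (use that in auto)
    moreover have "loc5 H A (\<lambda>h. if h \<in> H then p h else 0) g = loc5 H A p g"
      unfolding loc5_def using that by (intro sum.cong) auto
    ultimately show ?thesis using that by (simp add: loc_weight_def loc3_def)
  qed
  have sub: "?W \<subseteq> (\<Union>d\<in>?D. ?U d)"
  proof
    fix g assume "g \<in> ?W"
    then have g: "g \<in> H" "loc_weight H A ?p g \<noteq> loc_weight H A ?q g" by auto
    show "g \<in> (\<Union>d\<in>?D. ?U d)"
    proof (rule ccontr)
      assume no: "g \<notin> (\<Union>d\<in>?D. ?U d)"
      let ?p' = "\<lambda>h. if h \<in> H then ?p h else 0" and ?q' = "\<lambda>h. if h \<in> H then ?q h else 0"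
      have "loc_weight H A ?p' g = loc_weight H A ?q' g"
      proof (rule loc_weight_cong)
        show "?p' g = ?q' g" using no g by auto
        fix k
        show "?p' k = ?q' k" if k: "k \<in> sibs g"
        proof (rule ccontr)
          assume "?p' k \<noteq> ?q' k"
          then have "k \<in> ?D" by (auto split: if_splits)
          moreover have "g \<in> ?U k" using k mem_sibs[of k g] by (auto simp: sibs_def)
          ultimately show False using no by blast
        qed
        show "?p' k = ?q' k" if k: "k \<in> sibs (?p' g)"
        proof (rule ccontr)
          assume "?p' k \<noteq> ?q' k"
          then have kD: "k \<in> ?D" by (auto split: if_splits)
          have "?p g \<in> sibs k" using k g mem_sibs by auto
          then have "?p (?p g) \<in> ?U k" by (auto simp: sibs_def)
          then have "g \<in> ?U k" using partner_props(4)[OF M g(1)] by simp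
          then show False using no kD by blast
        qed
      qed
      then show False using g restrict by simp
    qed
  qed
  have "card ?W \<le> card (\<Union>d\<in>?D. ?U d)" by (rule card_mono) (use sub finD in auto)
  also have "\<dots> \<le> (\<Sum>d\<in>?D. card (?U d))" by (rule card_UN_le) (rule finD)
  also have "\<dots> \<le> (\<Sum>d\<in>?D. 5)"
  proof (rule sum_mono)
    fix d
    show "card (?U d) \<le> 5" using card_length[of "[d, sib d, sib (sib d), ?p (sib d), ?p (sib (sib d))]"] by simp
  qed
  also have "\<dots> \<le> 20" using c by simp
  finally have cW: "card ?W \<le> 20" .
  have "loc_sum H A M - loc_sum H A N = (\<Sum>g\<in>H. loc_weight H A ?p g - loc_weight H A ?q g)"
    by (simp add: loc_sum_def sum_subtractf)
  also have "\<dots> = (\<Sum>g\<in>?W. loc_weight H A ?p g - loc_weight H A ?q g)"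
    by (rule sum.mono_neutral_right) (use fin in auto)
  also have "\<bar>\<dots>\<bar> \<le> (\<Sum>g\<in>?W. 1)"
  proof (rule order_trans[OF sum_abs], rule sum_mono)
    show "\<bar>loc_weight H A ?p g - loc_weight H A ?q g\<bar> \<le> 1" for g
      using loc_weight_bounds[of H A ?p g] loc_weight_bounds[of H A ?q g] by linarith
  qed
  finally show "\<bar>loc_sum H A M - loc_sum H A N\<bar> \<le> 20" using cW by simp
qed

definition sib_pairs :: "nat set \<Rightarrow> (nat \<times> nat) set" where
  "sib_pairs H = (SIGMA g:H. sibs g \<inter> H)"

lemma finite_sib_pairs: "finite H \<Longrightarrow> finite (sib_pairs H)"
  by (auto simp: sib_pairs_def)

lemma of_bool_le_sum:
  fixes Q :: "'a \<Rightarrow> bool"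
  assumes "finite I" "P \<Longrightarrow> \<exists>i\<in>I. Q i"
  shows "(of_bool P :: real) \<le> (\<Sum>i\<in>I. of_bool (Q i))"
proof (cases P)
  case True
  then obtain i where i: "i \<in> I" "Q i" using assms(2) by blast
  have "(of_bool (Q i) :: real) \<le> (\<Sum>i\<in>I. of_bool (Q i))"
    by (rule member_le_sum) (use i assms in auto)
  then show ?thesis using i True by simp
qed (auto intro!: sum_nonneg)

lemma sum_sibs_le:
  fixes Q :: "nat \<Rightarrow> bool"
  assumes "finite H" "g' \<in> H"
  shows "(\<Sum>k'\<in>sibs g' \<inter> H. (of_bool (Q k') :: real)) \<le> (\<Sum>(a, k')\<in>sib_pairs H. of_bool (a = g' \<and> Q k'))"
proof -
  have "(\<Sum>k'\<in>sibs g' \<inter> H. (of_bool (Q k') :: real)) = (\<Sum>(a, k')\<in>{g'} \<times> (sibs g' \<inter> H). of_bool (a = g' \<and> Q k'))"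
    by (simp add: sum.cartesian_product[symmetric])
  also have "\<dots> \<le> (\<Sum>(a, k')\<in>sib_pairs H. of_bool (a = g' \<and> Q k'))"
    by (rule sum_mono2) (use assms finite_sib_pairs in \<open>auto simp: sib_pairs_def\<close>)
  finally show ?thesis .
qed

text \<open>If the pairs are not disjoint the left side is 0, and the length condition keeps the
  denominators on the right positive.\<close>

lemma avg_pairs_le_long:
  assumes "finite H" "card H = 2 * j" "2 * length ps \<le> card H" "set (flat ps) \<subseteq> H"
  shows "matching_avg H (\<lambda>M. of_bool (distinct (flat ps) \<and> has_pairs ps M)) \<le> (\<Prod>i<length ps. 1 / (real (card H) - 1 - 2 * real i))"
proof (cases "distinct (flat ps)")
  case True
  then show ?thesis using matching_avg_pairs[OF assms(1,2) True assms(4)] by simp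
next
  case False
  have "0 \<le> 1 / (real (card H) - 1 - 2 * real i)" if "i < length ps" for i
  proof -
    have "2 * i + 2 \<le> card H" using that assms(3) by linarith
    then have "real (2 * i + 2) \<le> real (card H)" by (rule of_nat_mono)
    then show ?thesis by simp
  qed
  then have "0 \<le> (\<Prod>i<length ps. 1 / (real (card H) - 1 - 2 * real i))" by (intro prod_nonneg) auto
  then show ?thesis using False by (simp add: matching_avg_def)
qed

lemma avg_pairs_le:
  assumes "finite H" "card H = 2 * j" "card H > 5" "length ps \<le> 3" "set (flat ps) \<subseteq> H"
  shows "matching_avg H (\<lambda>M. of_bool (distinct (flat ps) \<and> has_pairs ps M)) \<le> (\<Prod>i<length ps. 1 / (real (card H) - 1 - 2 * real i))"
  by (rule avg_pairs_le_long) (use assms in auto)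

lemma has_pairs_partner:
  assumes "M \<in> perfect_matchings H" "\<And>a b. (a, b) \<in> set ps \<Longrightarrow> a \<in> H \<and> b = partner M a"
  shows "has_pairs ps M"
  using assms partner_props(1)[OF assms(1)] by (auto simp: has_pairs_def)

text \<open>Each indicator is bounded by a sum, over the possible partners, of events that certain
  disjoint pairs are matched. One, two or three pairs occur, which gives the denominators; the free
  choices are two endpoints in \<open>A\<close> and none, one or two sibling pairs, which give the
  numerators.\<close>

lemma avg_loc_sum:
  assumes fin: "finite H" and H: "card H = 2 * j" "card H > 5" and A: "A \<subseteq> H"
  shows "matching_avg H (loc_sum H A) \<le>
    5 / 18 * (real (card A) ^ 2 / (real (card H) - 1))
    + 1 / sqrt 3 / 9 * (real (card (sib_pairs H)) * real (card A) ^ 2 / ((real (card H) - 1) * (real (card H) - 3)))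
    + 2 / 243 * (real (card (sib_pairs H)) ^ 2 * real (card A) ^ 2 / ((real (card H) - 1) * (real (card H) - 3) * (real (card H) - 5)))"
proof -
  let ?m = "real (card H)"
  have finA: "finite A" using A fin finite_subset by blast
  note finS = finite_sib_pairs[OF fin]
  have sS: "(\<Sum>g\<in>H. \<Sum>k\<in>sibs g \<inter> H. F g k) = (\<Sum>gk\<in>sib_pairs H. F (fst gk) (snd gk))" for F :: "nat \<Rightarrow> nat \<Rightarrow> real"
    unfolding sib_pairs_def by (subst sum.Sigma) (simp_all add: fin case_prod_unfold)
  have split: "loc_sum H A M = 5 / 18 * (\<Sum>g\<in>H. loc3 A (partner M) g) + 1 / sqrt 3 / 9 * (\<Sum>g\<in>H. loc4 H A (partner M) g)
      + 2 / 243 * (\<Sum>g\<in>H. loc5 H A (partner M) g)" for M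
    by (simp only: loc_sum_def loc_weight_def sum.distrib sum_distrib_left[symmetric])
  have 3: "matching_avg H (\<lambda>M. \<Sum>g\<in>H. loc3 A (partner M) g) \<le> real (card A) ^ 2 / (?m - 1)"
  proof -
    have "matching_avg H (\<lambda>M. \<Sum>g\<in>H. loc3 A (partner M) g) \<le>
        matching_avg H (\<lambda>M. \<Sum>(g, x)\<in>A \<times> A. of_bool (distinct (flat [(g, x)]) \<and> has_pairs [(g, x)] M))"
    proof (rule matching_avg_mono[OF fin])
      fix M assume M: "M \<in> perfect_matchings H"
      have "(\<Sum>g\<in>H. loc3 A (partner M) g) = (\<Sum>g\<in>A. loc3 A (partner M) g)"
        by (rule sum.mono_neutral_right) (use fin A in \<open>auto simp: loc3_def\<close>)
      also have "\<dots> \<le> (\<Sum>g\<in>A. \<Sum>x\<in>A. of_bool (distinct (flat [(g, x)]) \<and> has_pairs [(g, x)] M))"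
      proof (rule sum_mono)
        fix g assume g: "g \<in> A"
        then have gH: "g \<in> H" using A by auto
        show "loc3 A (partner M) g \<le> (\<Sum>x\<in>A. of_bool (distinct (flat [(g, x)]) \<and> has_pairs [(g, x)] M))"
          unfolding loc3_def
          by (rule of_bool_le_sum[OF finA], rule bexI[of _ "partner M g"])
            (use gH partner_props[OF M gH] has_pairs_partner[OF M, of "[(g, partner M g)]"] in auto)
      qed
      finally show "(\<Sum>g\<in>H. loc3 A (partner M) g) \<le> (\<Sum>(g, x)\<in>A \<times> A. of_bool (distinct (flat [(g, x)]) \<and> has_pairs [(g, x)] M))"
        by (simp only: sum.cartesian_product)
    qed
    also have "\<dots> = (\<Sum>(g, x)\<in>A \<times> A. matching_avg H (\<lambda>M. of_bool (distinct (flat [(g, x)]) \<and> has_pairs [(g, x)] M)))"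
      by (simp only: case_prod_unfold matching_avg_sum)
    also have "\<dots> \<le> (\<Sum>(g, x)\<in>A \<times> A. 1 / (?m - 1))"
    proof (rule sum_mono, clarify)
      fix g x assume "g \<in> A" "x \<in> A"
      then have "set (flat [(g, x)]) \<subseteq> H" using A by auto
      from avg_pairs_le[OF fin H _ this]
      show "matching_avg H (\<lambda>M. of_bool (distinct (flat [(g, x)]) \<and> has_pairs [(g, x)] M)) \<le> 1 / (?m - 1)"
        by (simp del: flat_simps)
    qed
    also have "\<dots> = real (card A) ^ 2 / (?m - 1)"
      by (simp add: case_prod_unfold card_cartesian_product power2_eq_square)
    finally show ?thesis .
  qed
  have 4: "matching_avg H (\<lambda>M. \<Sum>g\<in>H. loc4 H A (partner M) g) \<le> real (card (sib_pairs H)) * real (card A) ^ 2 / ((?m - 1) * (?m - 3))"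
  proof -
    let ?I = "sib_pairs H \<times> (A \<times> A)"
    let ?ps = "\<lambda>i. [(fst (fst i), fst (snd i)), (snd (fst i), snd (snd i))]"
    have "matching_avg H (\<lambda>M. \<Sum>g\<in>H. loc4 H A (partner M) g) \<le>
        matching_avg H (\<lambda>M. \<Sum>i\<in>?I. of_bool (distinct (flat (?ps i)) \<and> has_pairs (?ps i) M))"
    proof (rule matching_avg_mono[OF fin])
      fix M assume M: "M \<in> perfect_matchings H"
      let ?p = "partner M"
      have "(\<Sum>g\<in>H. loc4 H A ?p g) = (\<Sum>gk\<in>sib_pairs H. of_bool (?p (fst gk) \<in> A \<and> ?p (snd gk) \<in> A \<and> distinct [fst gk, ?p (fst gk), snd gk, ?p (snd gk)]))"
        unfolding loc4_def by (rule sS)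
      also have "\<dots> \<le> (\<Sum>gk\<in>sib_pairs H. \<Sum>xy\<in>A \<times> A. of_bool (distinct (flat (?ps (gk, xy))) \<and> has_pairs (?ps (gk, xy)) M))"
      proof (rule sum_mono)
        fix gk assume "gk \<in> sib_pairs H"
        then have gk: "fst gk \<in> H" "snd gk \<in> H" by (auto simp: sib_pairs_def)
        show "of_bool (?p (fst gk) \<in> A \<and> ?p (snd gk) \<in> A \<and> distinct [fst gk, ?p (fst gk), snd gk, ?p (snd gk)]) \<le>
          (\<Sum>xy\<in>A \<times> A. of_bool (distinct (flat (?ps (gk, xy))) \<and> has_pairs (?ps (gk, xy)) M) :: real)"
        proof (rule of_bool_le_sum)
          assume P: "?p (fst gk) \<in> A \<and> ?p (snd gk) \<in> A \<and> distinct [fst gk, ?p (fst gk), snd gk, ?p (snd gk)]"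
          let ?xy = "(?p (fst gk), ?p (snd gk))"
          have "has_pairs (?ps (gk, ?xy)) M" by (rule has_pairs_partner[OF M]) (use gk in auto)
          moreover have "distinct (flat (?ps (gk, ?xy)))" using P by (simp only: flat_simps fst_conv snd_conv)
          moreover have "?xy \<in> A \<times> A" using P by simp
          ultimately show "\<exists>xy\<in>A \<times> A. distinct (flat (?ps (gk, xy))) \<and> has_pairs (?ps (gk, xy)) M" by blast
        qed (use finA in simp)
      qed
      finally show "(\<Sum>g\<in>H. loc4 H A ?p g) \<le> (\<Sum>i\<in>?I. of_bool (distinct (flat (?ps i)) \<and> has_pairs (?ps i) M))"
        by (simp only: sum.cartesian_product case_prod_unfold prod.collapse)
    qed
    also have "\<dots> = (\<Sum>i\<in>?I. matching_avg H (\<lambda>M. of_bool (distinct (flat (?ps i)) \<and> has_pairs (?ps i) M)))"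
      by (rule matching_avg_sum)
    also have "\<dots> \<le> (\<Sum>i\<in>?I. 1 / ((?m - 1) * (?m - 3)))"
    proof (rule sum_mono)
      fix i assume "i \<in> ?I"
      then have "set (flat (?ps i)) \<subseteq> H" using A by (auto simp: sib_pairs_def)
      from avg_pairs_le[OF fin H _ this]
      show "matching_avg H (\<lambda>M. of_bool (distinct (flat (?ps i)) \<and> has_pairs (?ps i) M)) \<le> 1 / ((?m - 1) * (?m - 3))"
        by (simp del: flat_simps add: numeral_2_eq_2)
    qed
    also have "\<dots> = real (card (sib_pairs H)) * real (card A) ^ 2 / ((?m - 1) * (?m - 3))"
      by (simp add: card_cartesian_product power2_eq_square)
    finally show ?thesis .
  qed
  have 5: "matching_avg H (\<lambda>M. \<Sum>g\<in>H. loc5 H A (partner M) g) \<le>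
      real (card (sib_pairs H)) ^ 2 * real (card A) ^ 2 / ((?m - 1) * (?m - 3) * (?m - 5))"
  proof -
    let ?I = "sib_pairs H \<times> (sib_pairs H \<times> (A \<times> A))"
    let ?ps = "\<lambda>i. [(fst (fst i), fst (fst (snd i))), (snd (fst i), fst (snd (snd i))), (snd (fst (snd i)), snd (snd (snd i)))]"
    have "matching_avg H (\<lambda>M. \<Sum>g\<in>H. loc5 H A (partner M) g) \<le>
        matching_avg H (\<lambda>M. \<Sum>i\<in>?I. of_bool (distinct (flat (?ps i)) \<and> has_pairs (?ps i) M))"
    proof (rule matching_avg_mono[OF fin])
      fix M assume M: "M \<in> perfect_matchings H"
      let ?p = "partner M"
      let ?R = "\<lambda>g k k'. ?p k \<in> A \<and> ?p k' \<in> A \<and> distinct [g, ?p g, k, ?p k, k', ?p k']"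
      have "(\<Sum>g\<in>H. loc5 H A ?p g) = (\<Sum>gk\<in>sib_pairs H. \<Sum>k'\<in>sibs (?p (fst gk)) \<inter> H. of_bool (?R (fst gk) (snd gk) k'))"
        unfolding loc5_def by (rule sS)
      \<comment> \<open>The partner of \<open>g\<close> is released as a free variable, the first
        component of a second sibling pair; requiring the pair of both to be matched will tie it
        back.\<close>
      also have "\<dots> \<le> (\<Sum>gk\<in>sib_pairs H. \<Sum>ak\<in>sib_pairs H. of_bool (fst ak = ?p (fst gk) \<and> ?R (fst gk) (snd gk) (snd ak)))"
      proof (rule sum_mono)
        fix gk assume "gk \<in> sib_pairs H"
        then have "?p (fst gk) \<in> H" using partner_props(3)[OF M] by (auto simp: sib_pairs_def)
        from sum_sibs_le[OF fin this, of "?R (fst gk) (snd gk)"]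
        show "(\<Sum>k'\<in>sibs (?p (fst gk)) \<inter> H. (of_bool (?R (fst gk) (snd gk) k') :: real)) \<le>
          (\<Sum>ak\<in>sib_pairs H. of_bool (fst ak = ?p (fst gk) \<and> ?R (fst gk) (snd gk) (snd ak)))"
          by (simp only: case_prod_unfold)
      qed
      also have "\<dots> \<le> (\<Sum>gk\<in>sib_pairs H. \<Sum>ak\<in>sib_pairs H. \<Sum>xy\<in>A \<times> A.
          of_bool (distinct (flat (?ps (gk, (ak, xy)))) \<and> has_pairs (?ps (gk, (ak, xy))) M))"
      proof (intro sum_mono)
        fix gk ak assume "gk \<in> sib_pairs H" "ak \<in> sib_pairs H"
        then have gk: "fst gk \<in> H" "snd gk \<in> H" "fst ak \<in> H" "snd ak \<in> H" by (auto simp: sib_pairs_def)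
        show "of_bool (fst ak = ?p (fst gk) \<and> ?R (fst gk) (snd gk) (snd ak)) \<le>
          (\<Sum>xy\<in>A \<times> A. of_bool (distinct (flat (?ps (gk, (ak, xy)))) \<and> has_pairs (?ps (gk, (ak, xy))) M) :: real)"
        proof (rule of_bool_le_sum)
          assume P: "fst ak = ?p (fst gk) \<and> ?R (fst gk) (snd gk) (snd ak)"
          let ?xy = "(?p (snd gk), ?p (snd ak))"
          have "has_pairs (?ps (gk, (ak, ?xy))) M" by (rule has_pairs_partner[OF M]) (use gk P in auto)
          moreover have "distinct (flat (?ps (gk, (ak, ?xy))))" using P by (simp only: flat_simps fst_conv snd_conv)
          moreover have "?xy \<in> A \<times> A" using P by simp
          ultimately show "\<exists>xy\<in>A \<times> A. distinct (flat (?ps (gk, (ak, xy)))) \<and> has_pairs (?ps (gk, (ak, xy))) M" by blast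
        qed (use finA in simp)
      qed
      finally show "(\<Sum>g\<in>H. loc5 H A ?p g) \<le> (\<Sum>i\<in>?I. of_bool (distinct (flat (?ps i)) \<and> has_pairs (?ps i) M))"
        by (simp only: sum.cartesian_product case_prod_unfold prod.collapse)
    qed
    also have "\<dots> = (\<Sum>i\<in>?I. matching_avg H (\<lambda>M. of_bool (distinct (flat (?ps i)) \<and> has_pairs (?ps i) M)))"
      by (rule matching_avg_sum)
    also have "\<dots> \<le> (\<Sum>i\<in>?I. 1 / ((?m - 1) * (?m - 3) * (?m - 5)))"
    proof (rule sum_mono)
      fix i assume "i \<in> ?I"
      then have "set (flat (?ps i)) \<subseteq> H" using A by (auto simp: sib_pairs_def)
      from avg_pairs_le[OF fin H _ this]
      show "matching_avg H (\<lambda>M. of_bool (distinct (flat (?ps i)) \<and> has_pairs (?ps i) M)) \<le> 1 / ((?m - 1) * (?m - 3) * (?m - 5))"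
        by (simp del: flat_simps add: numeral_3_eq_3)
    qed
    also have "\<dots> = real (card (sib_pairs H)) ^ 2 * real (card A) ^ 2 / ((?m - 1) * (?m - 3) * (?m - 5))"
      by (simp add: card_cartesian_product power2_eq_square)
    finally show ?thesis .
  qed
  have "matching_avg H (loc_sum H A) = 5 / 18 * matching_avg H (\<lambda>M. \<Sum>g\<in>H. loc3 A (partner M) g)
    + 1 / sqrt 3 / 9 * matching_avg H (\<lambda>M. \<Sum>g\<in>H. loc4 H A (partner M) g)
    + 2 / 243 * matching_avg H (\<lambda>M. \<Sum>g\<in>H. loc5 H A (partner M) g)"
    unfolding matching_avg_cmult[symmetric] matching_avg_add[symmetric] split[abs_def] by (rule refl)
  also have "\<dots> \<le> 5 / 18 * (real (card A) ^ 2 / (?m - 1))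
    + 1 / sqrt 3 / 9 * (real (card (sib_pairs H)) * real (card A) ^ 2 / ((?m - 1) * (?m - 3)))
    + 2 / 243 * (real (card (sib_pairs H)) ^ 2 * real (card A) ^ 2 / ((?m - 1) * (?m - 3) * (?m - 5)))"
    by (intro add_mono mult_left_mono 3 4 5) (use inv_sqrt3_bounds in auto)
  finally show ?thesis .
qed

section \<open>Bounding the energy shift by a local sum\<close>

lemma distinct_places:
  "distinct [a, b, c, d, e, f] \<Longrightarrow> a \<noteq> b" "distinct [a, b, c, d, e, f] \<Longrightarrow> c \<notin> {a, b}"
  "distinct [a, b, c, d, e, f] \<Longrightarrow> d \<notin> {a, b}" "distinct [a, b, c, d, e, f] \<Longrightarrow> e \<notin> {a, b, c, d}"
  "distinct [a, b, c, d, e, f] \<Longrightarrow> f \<notin> {a, b, c, d}"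
  by auto

lemma distinct4I:
  "a \<noteq> b \<Longrightarrow> b \<noteq> c \<Longrightarrow> d \<noteq> a \<Longrightarrow> d \<noteq> b \<Longrightarrow> d \<noteq> c \<Longrightarrow> c \<noteq> a \<Longrightarrow> distinct [a, b, c, d]"
  by auto

lemma distinct6I:
  "distinct [a, b, c, d] \<Longrightarrow> e \<noteq> a \<Longrightarrow> e \<noteq> b \<Longrightarrow> e \<noteq> c \<Longrightarrow> e \<noteq> d \<Longrightarrow>
    f \<noteq> a \<Longrightarrow> f \<noteq> b \<Longrightarrow> f \<noteq> c \<Longrightarrow> f \<noteq> d \<Longrightarrow> f \<noteq> e \<Longrightarrow> distinct [a, b, c, d, e, f]"
  by auto

context measured_graph
begin

definition near_inner :: "nat set" where "near_inner = {h \<in> inner. near h}"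

lemma ind_nu_outer: "h \<in> outer \<Longrightarrow> ind_nu h = of_bool (h \<in> inner \<and> opp h \<in> near_inner)"
  using inner_opp(1)[of h] by (auto simp: ind_nu_def near_inner_def inner_def outer_def)

lemma inner_outer: "h \<in> inner \<Longrightarrow> h \<in> outer"
  by (simp add: outer_split)

lemma ind_P_outer:
  assumes "h \<in> outer"
  shows "ind_P h = (\<Sum>k\<in>sibs h \<inter> inner. of_bool (opp k \<in> near_inner))"
proof -
  have s: "sib h \<in> outer" "sib (sib h) \<in> outer" using assms outer_sib by auto
  have "(\<Sum>k\<in>sibs h \<inter> inner. of_bool (opp k \<in> near_inner)) =
    (\<Sum>k\<in>sibs h. of_bool (k \<in> inner \<and> opp k \<in> near_inner) :: real)"
    by (rule sum.mono_neutral_cong_left) auto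
  then show ?thesis
    unfolding ind_P_def ind_nu_outer[OF s(1)] ind_nu_outer[OF s(2)] by (simp add: sibs_def)
qed

text \<open>The six places of a locally tree-like half-edge differ, so the \<open>distinct\<close>
  clauses are automatic and nothing is lost in passing to \<open>loc_weight\<close>.\<close>

lemma loc_weight_eq:
  assumes g: "g \<in> inner" "local_tree g"
  shows "5 / 18 * (of_bool (near g) * ind_nu g) + 1 / sqrt 3 / 9 * (ind_nu g * ind_P g) + 2 / 243 * (ind_P g * ind_P (opp g)) =
    loc_weight inner near_inner opp g"
proof -
  have gn: "g < 3 * n" using g by (simp add: inner_def)
  have o: "opp g \<in> inner" "opp (opp g) = g" "opp g < 3 * n" using inner_opp g gn opp_props by auto
  have d: "distinct [vtx g, nbr g, nbr (sib g), nbr (sib (sib g)), nbr (sib (opp g)), nbr (sib (sib (opp g)))]"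
    using g(2) by (simp only: local_tree_def)
  have vk: "vtx k = vtx g" "nbr k \<in> {nbr (sib g), nbr (sib (sib g))}" "k \<noteq> g" if "k \<in> sibs g" for k
    using that by (auto simp: sibs_def)
  have vk': "vtx k = nbr g" "nbr k \<in> {nbr (sib (opp g)), nbr (sib (sib (opp g)))}" "k \<noteq> opp g" if "k \<in> sibs (opp g)" for k
    using that by (auto simp: sibs_def)
  note d6 = distinct_places[OF d]
  have dist4: "distinct [g, opp g, k, opp k]" if k: "k \<in> sibs g" for k
  proof (rule distinct4I)
    have n: "nbr k \<noteq> vtx g" "nbr k \<noteq> nbr g" using vk(2)[OF k] d6(2,3) by (metis insert_iff singletonD)+
    show "g \<noteq> opp g" using d6(1) by metis
    show "opp g \<noteq> k" using vk(1)[OF k] d6(1) by metis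
    show "opp k \<noteq> g" using n by metis
    show "opp k \<noteq> opp g" using n by metis
    show "opp k \<noteq> k" using n vk(1)[OF k] by metis
    show "k \<noteq> g" by (rule vk(3)[OF k])
  qed
  have dist6: "distinct [g, opp g, k, opp k, k', opp k']" if k: "k \<in> sibs g" "k' \<in> sibs (opp g)" for k k'
  proof (rule distinct6I[OF dist4[OF k(1)]])
    have n: "nbr k \<noteq> vtx g" "nbr k \<noteq> nbr g" using vk(2)[OF k(1)] d6(2,3) by (metis insert_iff singletonD)+
    have S: "nbr k' \<notin> {vtx g, nbr g, nbr (sib g), nbr (sib (sib g))}"
      using vk'(2)[OF k(2)] d6(4,5) by (metis insert_iff singletonD)
    have "nbr k \<in> {vtx g, nbr g, nbr (sib g), nbr (sib (sib g))}"
      using vk(2)[OF k(1)] by blast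
    then have n': "nbr k' \<noteq> vtx g" "nbr k' \<noteq> nbr g" "nbr k' \<noteq> nbr k" using S by (metis insert_iff)+
    note v = vk(1)[OF k(1)] vk'(1)[OF k(2)]
    show "k' \<noteq> g" using v d6(1) by metis
    show "k' \<noteq> opp g" by (rule vk'(3)[OF k(2)])
    show "k' \<noteq> k" using v d6(1) by metis
    show "k' \<noteq> opp k" using v n by metis
    show "opp k' \<noteq> g" using n' by metis
    show "opp k' \<noteq> opp g" using n' by metis
    show "opp k' \<noteq> k" using n' v by metis
    show "opp k' \<noteq> opp k" using n' by metis
    show "opp k' \<noteq> k'" using n' v by metis
  qed
  have 1: "of_bool (near g) * ind_nu g = loc3 near_inner opp g"
    using g ind_nu_outer[OF inner_outer[OF g(1)]] by (simp add: loc3_def near_inner_def)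
  have P: "ind_P g = (\<Sum>k\<in>sibs g \<inter> inner. of_bool (opp k \<in> near_inner))"
    "ind_P (opp g) = (\<Sum>k\<in>sibs (opp g) \<inter> inner. of_bool (opp k \<in> near_inner))"
    using ind_P_outer inner_outer g o by auto
  have 2: "ind_nu g * ind_P g = loc4 inner near_inner opp g"
  proof -
    have "ind_nu g = of_bool (opp g \<in> near_inner)" using ind_nu_outer[OF inner_outer[OF g(1)]] g by simp
    then show ?thesis
      unfolding P loc4_def sum_distrib_left of_bool_conj[symmetric]
      by (intro sum.cong refl) (use dist4 in \<open>simp del: distinct.simps\<close>)
  qed
  have 3: "ind_P g * ind_P (opp g) = loc5 inner near_inner opp g"
    unfolding P loc5_def sum_product of_bool_conj[symmetric]
    by (intro sum.cong refl) (use dist6 in \<open>simp del: distinct.simps\<close>)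
  show ?thesis unfolding 1 2 3 loc_weight_def by (rule refl)
qed

lemma Y_sum_le:
  "Y_sum \<le> (\<Sum>g\<in>inner. loc_weight inner near_inner opp g) + real (card {g. g < 3 * n \<and> \<not> local_tree g})"
proof -
  let ?t = "\<lambda>g. 5 / 18 * (of_bool (near g) * ind_nu g) + 1 / sqrt 3 / 9 * (ind_nu g * ind_P g) + 2 / 243 * (ind_P g * ind_P (opp g))"
  have nn: "0 \<le> ind_nu g" "ind_nu g \<le> 1" "0 \<le> ind_P g" "ind_P g \<le> 2" for g by (auto simp: ind_nu_def ind_P_def)
  have b: "?t g \<le> 1" for g
  proof -
    have "1 / sqrt 3 / 9 * (ind_nu g * ind_P g) \<le> 1 / 9 * (1 * 2)"
      using nn inv_sqrt3_bounds by (intro mult_mono) auto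
    moreover have "ind_P g * ind_P (opp g) \<le> 2 * 2" using nn by (intro mult_mono) auto
    moreover have "of_bool (near g) * ind_nu g \<le> 1" using nn by simp
    ultimately show ?thesis by linarith
  qed
  have "Y_sum = (\<Sum>g\<in>inner. ?t g)"
    by (simp only: Y_sum_def sum.distrib sum_distrib_left[symmetric])
  also have "\<dots> \<le> (\<Sum>g\<in>inner. loc_weight inner near_inner opp g + of_bool (\<not> local_tree g))"
  proof (rule sum_mono)
    fix g assume g: "g \<in> inner"
    show "?t g \<le> loc_weight inner near_inner opp g + of_bool (\<not> local_tree g)"
      using loc_weight_eq[OF g] b[of g] loc_weight_bounds(1)[of inner near_inner opp g] by (cases "local_tree g") auto
  qed
  also have "\<dots> = (\<Sum>g\<in>inner. loc_weight inner near_inner opp g) + real (card {g \<in> inner. \<not> local_tree g})"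
    by (simp add: sum.distrib of_bool_def sum.If_cases Int_def)
  also have "card {g \<in> inner. \<not> local_tree g} \<le> card {g. g < 3 * n \<and> \<not> local_tree g}"
    by (rule card_mono) (auto simp: inner_def)
  finally show ?thesis by simp
qed

section \<open>Counting half-edges around \<open>V0\<close>\<close>

lemma card_V0_half_edges: "card {h. h < 3 * n \<and> vtx h \<in> V0} = 3 * card V0"
proof -
  have fin: "finite V0" using V0_subset finite_subset by blast
  have "{h. h < 3 * n \<and> vtx h \<in> V0} = half_edges_at 3 V0"
    using V0_half_edge by (auto simp: half_edges_at_iff)
  also have "card \<dots> = (\<Sum>v\<in>V0. card {v * 3..<(v + 1) * 3})"
    unfolding half_edges_at_def
  proof (rule card_UN_disjoint[OF fin])
    have "h div 3 = v" if "h \<in> {v * 3..<(v + 1) * 3}" for h v :: nat using that by auto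
    then show "\<forall>v\<in>V0. \<forall>w\<in>V0. v \<noteq> w \<longrightarrow> {v * 3..<(v + 1) * 3} \<inter> {w * 3..<(w + 1) * 3} = {}" by blast
  qed simp
  finally show ?thesis by simp
qed

lemma card_boundary: "card boundary = 3 * card V0"
proof -
  have "bij_betw opp {h. h < 3 * n \<and> vtx h \<in> V0} boundary"
    by (rule bij_betw_byWitness[where f' = opp])
      (use nbr_V0_outside in \<open>auto simp: boundary_def opp_props\<close>)
  then show ?thesis using card_V0_half_edges by (simp add: bij_betw_same_card)
qed

lemma card_inner: "card inner + 6 * card V0 = 3 * n"
proof -
  let ?W = "{h. h < 3 * n \<and> vtx h \<in> V0}"
  have "card {..<3 * n} = card (inner \<union> (boundary \<union> ?W))"
    by (rule arg_cong[where f = card]) (auto simp: inner_def boundary_def)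
  also have "\<dots> = card inner + (card boundary + card ?W)"
    by (subst card_Un_disjoint, simp, simp, force simp: inner_def boundary_def,
        subst card_Un_disjoint) (auto simp: boundary_def)
  finally show ?thesis using card_boundary card_V0_half_edges by simp
qed

lemma boundary_sibs:
  assumes "b \<in> boundary" "k \<in> sibs b"
  shows "k \<in> inner" "near k"
proof -
  have b: "b < 3 * n" "vtx b \<notin> V0" "nbr b \<in> V0" using assms by (auto simp: boundary_def)
  have k: "k < 3 * n" "vtx k = vtx b" "k \<noteq> b" using assms b sib_less by (auto simp: sibs_def)
  have "nbr k \<notin> V0"
  proof
    assume "nbr k \<in> V0"
    then have "o_val k \<noteq> 0" "o_val b \<noteq> 0" using o_val_sq[of k] o_val_sq[of b] b by auto
    then show False using o_o[of b k] b k by auto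
  qed
  then show "k \<in> inner" using b k by (simp add: inner_def)
  show "near k" using assms b by (auto simp: near_def sibs_def)
qed

text \<open>Each of the three edges at a measured vertex leads to a vertex with two further
  half-edges, and 2-independence keeps all of these apart.\<close>

lemma card_near_inner: "card near_inner = 6 * card V0"
proof -
  have "near_inner = (\<Union>b\<in>boundary. sibs b)"
  proof (intro equalityI subsetI)
    fix h assume "h \<in> near_inner"
    then have h: "h < 3 * n" "vtx h \<notin> V0" "nbr h \<notin> V0" "near h" by (auto simp: near_inner_def inner_def)
    then consider "nbr (sib h) \<in> V0" | "nbr (sib (sib h)) \<in> V0" by (auto simp: near_def)
    then show "h \<in> (\<Union>b\<in>boundary. sibs b)"
    proof cases
      case 1
      then have "sib h \<in> boundary" "h \<in> sibs (sib h)" using h sib_less by (auto simp: boundary_def sibs_def)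
      then show ?thesis by blast
    next
      case 2
      then have "sib (sib h) \<in> boundary" "h \<in> sibs (sib (sib h))" using h sib_less by (auto simp: boundary_def sibs_def)
      then show ?thesis by blast
    qed
  qed (use boundary_sibs in \<open>auto simp: near_inner_def\<close>)
  also have "card \<dots> = (\<Sum>b\<in>boundary. card (sibs b))"
  proof (rule card_UN_disjoint)
    show "\<forall>b\<in>boundary. \<forall>b'\<in>boundary. b \<noteq> b' \<longrightarrow> sibs b \<inter> sibs b' = {}"
    proof (intro ballI impI, rule ccontr)
      fix b b' assume b: "b \<in> boundary" "b' \<in> boundary" "b \<noteq> b'" "sibs b \<inter> sibs b' \<noteq> {}"
      then obtain k where "k \<in> sibs b" "k \<in> sibs b'" by blast
      then have "vtx b' = vtx b" unfolding sibs_def using sib_div by (metis insertE singletonD)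
      then have "b' \<in> sibs b" using b(3) same_vertex[of b' b] by (auto simp: sibs_def)
      then have "b' \<in> inner" using boundary_sibs(1) b by blast
      then show False using b outer_split by blast
    qed
  qed auto
  finally show ?thesis using card_boundary by (simp add: card_sibs)
qed

text \<open>A half-edge next to \<open>V0\<close> has a sibling that leads into \<open>V0\<close>
  and so is not inner. With \<open>k\<close> measured vertices this improves the trivial count 6 n -
  12 k of sibling pairs to 6 n - 18 k.\<close>

lemma card_sib_pairs_inner: "card (sib_pairs inner) + card near_inner \<le> 2 * card inner"
proof -
  have "card (sib_pairs inner) = (\<Sum>g\<in>inner. card (sibs g \<inter> inner))"
    unfolding sib_pairs_def by (rule card_SigmaI) auto
  also have "\<dots> \<le> (\<Sum>g\<in>inner. 2 - of_bool (near g))"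
  proof (rule sum_mono)
    fix g assume g: "g \<in> inner"
    show "card (sibs g \<inter> inner) \<le> 2 - of_bool (near g)"
    proof (cases "near g")
      case True
      then have "sib g \<notin> inner \<or> sib (sib g) \<notin> inner"
        using g by (auto simp: near_def inner_def)
      then have "sibs g \<inter> inner \<subset> sibs g" by (auto simp: sibs_def)
      then have "card (sibs g \<inter> inner) < card (sibs g)" by (rule psubset_card_mono[rotated]) simp
      then show ?thesis using True by (simp add: card_sibs)
    qed (use card_sibs_Int in auto)
  qed
  finally have "card (sib_pairs inner) + (\<Sum>g\<in>inner. of_bool (near g)) \<le> (\<Sum>g\<in>inner. 2 - of_bool (near g)) + (\<Sum>g\<in>inner. of_bool (near g))"
    by simp
  also have "\<dots> = (\<Sum>g\<in>inner. 2)"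
    unfolding sum.distrib[symmetric] by (rule sum.cong) auto
  also have "(\<Sum>g\<in>inner. of_bool (near g)) = card near_inner"
    by (simp add: near_inner_def of_bool_def sum.If_cases Int_def)
  finally show ?thesis by simp
qed

end

text \<open>Outcome-free versions of \<open>inner\<close> and \<open>near_inner\<close>, determined
  by the matching and \<open>V0\<close> alone, so that a probability law can act on them.\<close>

definition inner_half_edges :: "nat \<Rightarrow> nat set set \<Rightarrow> nat set \<Rightarrow> nat set" where
  "inner_half_edges n M V0 = {h. h < 3 * n \<and> h div 3 \<notin> V0 \<and> partner M h div 3 \<notin> V0}"

definition near_half_edges :: "nat \<Rightarrow> nat set set \<Rightarrow> nat set \<Rightarrow> nat set" where
  "near_half_edges n M V0 = {h \<in> inner_half_edges n M V0. \<exists>k\<in>sibs h. partner M k div 3 \<in> V0}"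

context cubic_multigraph
begin

lemma cubic_measured:
  assumes "V0 \<subseteq> {..<n}" "two_independent 3 M V0"
  shows "measured_graph n M V0 (\<lambda>v. if v \<in> V0 then 1 else 0)"
  by unfold_locales (use assms in auto)

text \<open>The factor 162 is 6 * 27: 26 from \<open>energy_shift\<close> and at most 1 from
  \<open>Y_sum_le\<close>, for each of the up to six half-edges charged to one half-edge at a cyclic
  vertex.\<close>

lemma max_conditional_energy_le:
  assumes V0: "V0 \<subseteq> {..<n}" "two_independent 3 M V0"
  defines "H \<equiv> inner_half_edges n M V0" and "A \<equiv> near_half_edges n M V0"
  shows "max_conditional_energy n M V0 - quad_form (psi3 n M) (H_MaxCut 3 n M) \<le>
      (\<Sum>g\<in>H. loc_weight H A (partner M) g) / 4 + 162 * real (card {h. h < 3 * n \<and> cyclic (h div 3)})"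
    and "card H + 6 * card V0 = 3 * n" "card A = 6 * card V0" "card (sib_pairs H) + card A \<le> 2 * card H" "A \<subseteq> H"
proof -
  interpret e1: measured_graph n M V0 "\<lambda>v. if v \<in> V0 then 1 else 0" by (rule cubic_measured[OF V0])
  have H: "e1.inner = H" by (simp add: H_def e1.inner_def inner_half_edges_def opp_def)
  have A: "e1.near_inner = A"
    by (auto simp: A_def near_half_edges_def e1.near_inner_def H[symmetric, unfolded H_def] e1.near_def sibs_def e1.inner_def opp_def)
  show "card H + 6 * card V0 = 3 * n" "card A = 6 * card V0" "card (sib_pairs H) + card A \<le> 2 * card H"
    using e1.card_inner e1.card_near_inner e1.card_sib_pairs_inner unfolding H A by auto
  show "A \<subseteq> H" by (auto simp: A_def H_def near_half_edges_def)
  let ?bad = "card {g. g < 3 * n \<and> \<not> local_tree g}"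
  let ?X = "\<Sum>g\<in>H. loc_weight H A (partner M) g"
  have fin: "finite V0" using V0 finite_subset by blast
  have bound: "quad_form (psi3 n M) (spin_proj n V0 s * H_MaxCut 3 n M * spin_proj n V0 s)
      / norm_sq (spin_proj n V0 s *\<^sub>v psi3 n M) \<le> quad_form (psi3 n M) (H_MaxCut 3 n M) + (?X / 4 + 27 * real ?bad)"
    if s: "s \<in> V0 \<rightarrow>\<^sub>E {-1, 1}" for s
  proof -
    let ?\<sigma> = "\<lambda>v. if v \<in> V0 then complex_of_int (s v) else 0"
    interpret e: measured_graph n M V0 ?\<sigma> by (rule conditional_energy(1)[OF V0 s])
    interpret z: measured_graph n M "{}" "\<lambda>_. 0"
      by unfold_locales (auto simp: two_independent_def half_edges_at_def)
    have He: "e.inner = H" by (simp add: H_def e.inner_def inner_half_edges_def opp_def)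
    have Ae: "e.near_inner = A"
      by (auto simp: A_def near_half_edges_def e.near_inner_def He[symmetric, unfolded H_def] e.near_def sibs_def e.inner_def opp_def)
    have "e.energy - Re (\<Sum>g<3 * n. 1 - z.corr g) / 4 \<le> e.Y_sum / 4 + 26 * real ?bad"
      by (rule e.energy_shift) (auto intro: z.corr_eq_base z.norm_corr)
    then have E: "e.energy \<le> z.energy + (e.Y_sum / 4 + 26 * real ?bad)"
      by (simp add: z.energy_def)
    have "e.Y_sum \<le> ?X + real ?bad"
      using e.Y_sum_le unfolding He Ae by (simp add: opp_def)
    then show ?thesis using E
      unfolding conditional_energy(2)[OF V0 s] unconditional_energy by linarith
  qed
  have "max_conditional_energy n M V0 \<le> quad_form (psi3 n M) (H_MaxCut 3 n M) + (?X / 4 + 27 * real ?bad)"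
    unfolding max_conditional_energy_def
  proof (rule Max.boundedI)
    show "finite ((\<lambda>\<sigma>. quad_form (psi3 n M) (spin_proj n V0 \<sigma> * H_MaxCut 3 n M * spin_proj n V0 \<sigma>)
                / norm_sq (spin_proj n V0 \<sigma> *\<^sub>v psi3 n M)) ` (V0 \<rightarrow>\<^sub>E {-1, 1}))"
      by (intro finite_imageI finite_PiE fin) simp
    show "(\<lambda>\<sigma>. quad_form (psi3 n M) (spin_proj n V0 \<sigma> * H_MaxCut 3 n M * spin_proj n V0 \<sigma>)
                / norm_sq (spin_proj n V0 \<sigma> *\<^sub>v psi3 n M)) ` (V0 \<rightarrow>\<^sub>E {-1, 1}) \<noteq> {}"
      by (simp add: PiE_eq_empty_iff)
  next
    fix a assume "a \<in> (\<lambda>\<sigma>. quad_form (psi3 n M) (spin_proj n V0 \<sigma> * H_MaxCut 3 n M * spin_proj n V0 \<sigma>)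
                / norm_sq (spin_proj n V0 \<sigma> *\<^sub>v psi3 n M)) ` (V0 \<rightarrow>\<^sub>E {-1, 1})"
    then obtain s where "s \<in> V0 \<rightarrow>\<^sub>E {-1, 1}" "a = quad_form (psi3 n M) (spin_proj n V0 s * H_MaxCut 3 n M * spin_proj n V0 s)
                / norm_sq (spin_proj n V0 s *\<^sub>v psi3 n M)" by (rule imageE)
    then show "a \<le> quad_form (psi3 n M) (H_MaxCut 3 n M) + (?X / 4 + 27 * real ?bad)"
      using bound by (simp only:)
  qed
  moreover have "real ?bad \<le> 6 * real (card {h. h < 3 * n \<and> cyclic (h div 3)})"
    using of_nat_mono[OF card_not_local_tree, where 'a = real] by simp
  ultimately show "max_conditional_energy n M V0 - quad_form (psi3 n M) (H_MaxCut 3 n M) \<le>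
      ?X / 4 + 162 * real (card {h. h < 3 * n \<and> cyclic (h div 3)})" by linarith
qed

end

section \<open>The number of short cycles\<close>

lemma distinct_flat_zip:
  "length xs = length ys \<Longrightarrow> set (flat (zip xs ys)) = set xs \<union> set ys \<and>
     (distinct (flat (zip xs ys)) \<longleftrightarrow> distinct (xs @ ys))"
  by (induction xs ys rule: list_induct2) auto

text \<open>Used to encode a cycle by the half-edges through which it leaves its vertices and, at
  each vertex, by the number of shifts from there to the half-edge of arrival. Such codes are easy
  to count, and the code of a cycle prescribes disjoint matched pairs.\<close>

definition shifts :: "nat list \<Rightarrow> nat list \<Rightarrow> nat list" where
  "shifts os ts = map2 (\<lambda>o' t. (sib ^^ o') t) os ts"

lemma same_vertex_shifts:
  assumes "length xs = length ys" "\<And>i. i < length xs \<Longrightarrow> xs ! i div 3 = ys ! i div 3"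
  shows "\<exists>os. length os = length xs \<and> set os \<subseteq> {..<3} \<and> xs = shifts os ys"
  using assms
proof (induction xs ys rule: list_induct2)
  case Nil
  then show ?case by (simp add: shifts_def)
next
  case (Cons x xs y ys)
  have "xs ! i div 3 = ys ! i div 3" if "i < length xs" for i
    using Cons.prems[of "Suc i"] that by simp
  then obtain os where os: "length os = length xs" "set os \<subseteq> {..<3}" "xs = shifts os ys"
    using Cons.IH by blast
  have "x div 3 = y div 3" using Cons.prems[of 0] by simp
  then have "x = y \<or> x = sib y \<or> x = sib (sib y)" using same_vertex by blast
  then obtain o' where "o' < 3" "x = (sib ^^ o') y"
  proof (elim disjE)
    assume "x = y" then show ?thesis using that[of 0] by simp
  next
    assume "x = sib y" then show ?thesis using that[of 1] by simp
  next
    assume "x = sib (sib y)" then show ?thesis using that[of 2] by (simp add: numeral_2_eq_2)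
  qed
  then show ?case using os by (intro exI[of _ "o' # os"]) (auto simp: shifts_def)
qed

lemma sib_pow_less: "t < 3 * n \<Longrightarrow> (sib ^^ o') t < 3 * n"
  by (induction o') (auto intro: sib_less)

context cubic_multigraph
begin

lemma nb_walk_nonbacktracking: "nb_walk ts \<Longrightarrow> Suc i < length ts \<Longrightarrow> ts ! Suc i \<noteq> opp (ts ! i)"
proof (induction ts arbitrary: i rule: nb_walk.induct)
  case (3 s t ts)
  then show ?case by (cases i) auto
qed auto

text \<open>No half-edge serves both for leaving and for arriving, since that would be backtracking.
  The walk excludes it at inner steps; at the closing step, distinctness of the vertices forces
  length at most two, where it is impossible as well.\<close>

lemma cycle_pairs:
  assumes "cycle ts"
  shows "set ts \<subseteq> {..<3 * n}" "1 \<le> length ts" "length ts \<le> 5"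
    "distinct (flat (zip ts (map opp ts)))" "has_pairs (zip ts (map opp ts)) M"
    "\<exists>os. length os = length ts \<and> set os \<subseteq> {..<3} \<and> map opp ts = shifts os (rotate1 ts)"
proof -
  have w: "nb_walk ts" and cl: "nbr (last ts) = vtx (hd ts)" and len: "length ts \<le> 5"
    and dv: "distinct (map (\<lambda>t. t div 3) ts)"
    using assms by (auto simp: cycle_def closed_walk_def)
  have ne: "ts \<noteq> []" using w by auto
  have n: "t < 3 * n" if "t \<in> set ts" for t using nb_walk_less[OF w that] .
  show "set ts \<subseteq> {..<3 * n}" "1 \<le> length ts" "length ts \<le> 5" using n ne len by (auto simp: Suc_le_eq)
  show "has_pairs (zip ts (map opp ts)) M"
    using n opp_props(1) by (auto simp: has_pairs_def in_set_zip)
  have vi: "i = j" if "i < length ts" "j < length ts" "vtx (ts ! i) = vtx (ts ! j)" for i j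
    using that dv by (auto simp: distinct_conv_nth)
  have nxt: "nbr (ts ! i) = vtx (ts ! ((i + 1) mod length ts))" if i: "i < length ts" for i
  proof (cases "Suc i < length ts")
    case True
    then show ?thesis using nb_walk_step[OF w True] by simp
  next
    case False
    then have "Suc i = length ts" using i by simp
    then have "i = length ts - 1" "(i + 1) mod length ts = 0" by simp_all
    moreover have "last ts = ts ! i" using last_conv_nth[OF ne] \<open>i = length ts - 1\<close> by metis
    ultimately show ?thesis using cl ne by (simp add: hd_conv_nth)
  qed
  have "distinct ts" using dv by (simp add: distinct_map)
  moreover have "distinct (map opp ts)"
    using \<open>distinct ts\<close> n opp_props(4) by (auto simp: distinct_map intro!: inj_onI) metis
  moreover have "set ts \<inter> set (map opp ts) = {}"
  proof (rule ccontr)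
    assume "set ts \<inter> set (map opp ts) \<noteq> {}"
    then obtain i j where ij: "i < length ts" "j < length ts" "ts ! j = opp (ts ! i)"
      by (auto simp: in_set_conv_nth)
    have "j = (i + 1) mod length ts"
      by (rule vi) (use ij nxt[OF ij(1)] ne in auto)
    show False
    proof (cases "Suc i < length ts")
      case True
      then show ?thesis using \<open>j = _\<close> nb_walk_nonbacktracking[OF w True] ij by simp
    next
      case False
      then have "Suc i = length ts" using ij(1) by linarith
      then have i: "Suc i = length ts" "j = 0" using \<open>j = _\<close> by simp_all
      show False
      proof (cases i)
        case 0
        then show False using ij i opp_props(2)[OF n[of "ts ! i"]] by simp
      next
        case (Suc i')
        have l: "1 < length ts" using i Suc by simp
        have "opp (ts ! 0) = ts ! i" using ij i opp_props(4)[OF n[of "ts ! i"]] by simp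
        moreover have "nbr (ts ! 0) = vtx (ts ! 1)" using nxt[of 0] l ne by simp
        ultimately have "i = 1" using vi[of i 1] ij l by simp
        then show False using nb_walk_nonbacktracking[OF w, of 0] \<open>opp (ts ! 0) = ts ! i\<close> l by simp
      qed
    qed
  qed
  ultimately show "distinct (flat (zip ts (map opp ts)))"
    using distinct_flat_zip[of ts "map opp ts"] by simp
  show "\<exists>os. length os = length ts \<and> set os \<subseteq> {..<3} \<and> map opp ts = shifts os (rotate1 ts)"
    using same_vertex_shifts[of "map opp ts" "rotate1 ts"] nxt by (simp add: nth_rotate1)
qed

end

definition cycle_index :: "nat \<Rightarrow> nat \<Rightarrow> (nat list \<times> nat list) set" where
  "cycle_index n l = {ts. set ts \<subseteq> {..<3 * n} \<and> length ts = l} \<times> {os. set os \<subseteq> {..<3} \<and> length os = l}"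

lemma card_cycle_index: "finite (cycle_index n l)" "card (cycle_index n l) = (3 * n) ^ l * 3 ^ l"
  by (simp_all add: cycle_index_def finite_lists_length_eq card_cartesian_product card_lists_length_eq)

definition cycle_list :: "nat list \<times> nat list \<Rightarrow> (nat \<times> nat) list" where
  "cycle_list i = zip (fst i) (shifts (snd i) (rotate1 (fst i)))"

lemma cycle_list_props:
  assumes "i \<in> cycle_index n l"
  shows "length (cycle_list i) = l" "set (flat (cycle_list i)) \<subseteq> {..<3 * n}"
proof -
  have i: "set (fst i) \<subseteq> {..<3 * n}" "length (fst i) = l" "length (snd i) = l"
    using assms by (auto simp: cycle_index_def)
  then have len: "length (fst i) = length (shifts (snd i) (rotate1 (fst i)))" by (simp add: shifts_def)
  show "length (cycle_list i) = l" using i len by (simp add: cycle_list_def)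
  have "set (shifts (snd i) (rotate1 (fst i))) \<subseteq> {..<3 * n}"
  proof
    fix x assume "x \<in> set (shifts (snd i) (rotate1 (fst i)))"
    then obtain o' t where "x = (sib ^^ o') t" "t \<in> set (rotate1 (fst i))"
      by (auto simp: shifts_def dest: set_zip_rightD)
    then show "x \<in> {..<3 * n}" using i(1) sib_pow_less by auto
  qed
  then show "set (flat (cycle_list i)) \<subseteq> {..<3 * n}"
    using distinct_flat_zip[OF len] i(1) by (simp add: cycle_list_def)
qed

definition cyclic_count :: "nat \<Rightarrow> nat set set \<Rightarrow> real" where
  "cyclic_count n M = real (card {h. h < 3 * n \<and> cubic_multigraph.cyclic n M (h div 3)})"

lemma cyclic_count_le:
  assumes "M \<in> perfect_matchings {..<3 * n}"
  shows "cyclic_count n M \<le> 3 * (\<Sum>l\<in>{1..5}. \<Sum>i\<in>cycle_index n l. of_bool (distinct (flat (cycle_list i)) \<and> has_pairs (cycle_list i) M))"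
proof -
  interpret cubic_multigraph n M
    by unfold_locales (use assms in \<open>simp add: half_edges_at_lessThan\<close>)
  let ?C = "{ts. cycle ts}"
  let ?I = "SIGMA l:{1..5}. {i \<in> cycle_index n l. distinct (flat (cycle_list i)) \<and> has_pairs (cycle_list i) M}"
  have finI: "finite ?I" using card_cycle_index(1) by (intro finite_SigmaI) auto
  have sub: "?C \<subseteq> (\<lambda>x. fst (snd x)) ` ?I"
  proof
    fix ts assume "ts \<in> ?C"
    then have c: "cycle ts" by simp
    obtain os where os: "length os = length ts" "set os \<subseteq> {..<3}" "map opp ts = shifts os (rotate1 ts)"
      using cycle_pairs(6)[OF c] by blast
    have "(ts, os) \<in> cycle_index n (length ts)" using os cycle_pairs(1)[OF c] by (auto simp: cycle_index_def)
    moreover have "cycle_list (ts, os) = zip ts (map opp ts)" using os by (simp add: cycle_list_def)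
    ultimately have "(length ts, (ts, os)) \<in> ?I" using cycle_pairs[OF c] by auto
    then show "ts \<in> (\<lambda>x. fst (snd x)) ` ?I" by force
  qed
  have finC: "finite ?C" using sub finI finite_subset by blast
  have "card ?C \<le> card ((\<lambda>x. fst (snd x)) ` ?I)" by (rule card_mono[OF finite_imageI[OF finI] sub])
  also have "\<dots> \<le> card ?I" by (rule card_image_le[OF finI])
  also have "card ?I = (\<Sum>l\<in>{1..5}. card {i \<in> cycle_index n l. distinct (flat (cycle_list i)) \<and> has_pairs (cycle_list i) M})"
    by (rule card_SigmaI) (use card_cycle_index(1) in auto)
  finally have C: "real (card ?C) \<le> (\<Sum>l\<in>{1..5}. \<Sum>i\<in>cycle_index n l. of_bool (distinct (flat (cycle_list i)) \<and> has_pairs (cycle_list i) M))"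
    using card_cycle_index(1) by (simp add: of_bool_def sum.If_cases Int_def flip: of_nat_sum)
  have "{h. h < 3 * n \<and> cyclic (h div 3)} \<subseteq> (\<Union>ts\<in>?C. {hd ts, sib (hd ts), sib (sib (hd ts))})"
  proof
    fix h assume "h \<in> {h. h < 3 * n \<and> cyclic (h div 3)}"
    then obtain ts where "cycle ts" "vtx (hd ts) = vtx h" by (auto simp: cyclic_def)
    then show "h \<in> (\<Union>ts\<in>?C. {hd ts, sib (hd ts), sib (sib (hd ts))})"
      using same_vertex[of h "hd ts"] by auto
  qed
  then have "card {h. h < 3 * n \<and> cyclic (h div 3)} \<le> card (\<Union>ts\<in>?C. {hd ts, sib (hd ts), sib (sib (hd ts))})"
    by (intro card_mono) (use finC in auto)
  also have "\<dots> \<le> (\<Sum>ts\<in>?C. card {hd ts, sib (hd ts), sib (sib (hd ts))})" by (rule card_UN_le[OF finC])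
  also have "\<dots> \<le> (\<Sum>ts\<in>?C. 3)"
  proof (rule sum_mono)
    fix ts show "card {hd ts, sib (hd ts), sib (sib (hd ts))} \<le> 3"
      using card_length[of "[hd ts, sib (hd ts), sib (sib (hd ts))]"] by simp
  qed
  finally have "card {h. h < 3 * n \<and> cyclic (h div 3)} \<le> 3 * card ?C" by simp
  then have "cyclic_count n M \<le> 3 * real (card ?C)" unfolding cyclic_count_def
    by (metis of_nat_le_iff of_nat_mult of_nat_numeral)
  then show ?thesis using C by linarith
qed

text \<open>There are \<open>(3 * n) ^ l * 3 ^ l\<close> codes of length \<open>l\<close>, and for
  \<open>n \<ge> 5\<close> each factor \<open>3 * n - 1 - 2 * i\<close> with
  \<open>i \<le> 4\<close> is at least \<open>n\<close>. The powers of \<open>n\<close> cancel and 9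
  to the power \<open>l\<close> remains.\<close>

lemma avg_cyclic_count:
  assumes n: "even n" "5 \<le> n"
  shows "matching_avg {..<3 * n} (cyclic_count n) \<le> 3 * (\<Sum>l\<in>{1..5}. 9 ^ l)"
proof -
  let ?H = "{..<3 * n}"
  obtain j where j: "3 * n = 2 * j" using n(1) by (metis dvd_def dvd_mult)
  have fin: "finite ?H" "card ?H = 2 * j" using j by auto
  have "matching_avg ?H (cyclic_count n) \<le> matching_avg ?H (\<lambda>M. 3 * (\<Sum>l\<in>{1..5}. \<Sum>i\<in>cycle_index n l.
      of_bool (distinct (flat (cycle_list i)) \<and> has_pairs (cycle_list i) M)))"
    by (rule matching_avg_mono[OF fin(1) cyclic_count_le])
  also have "\<dots> = 3 * (\<Sum>l\<in>{1..5}. \<Sum>i\<in>cycle_index n l.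
      matching_avg ?H (\<lambda>M. of_bool (distinct (flat (cycle_list i)) \<and> has_pairs (cycle_list i) M)))"
    by (simp only: matching_avg_cmult matching_avg_sum)
  also have "\<dots> \<le> 3 * (\<Sum>l\<in>{1..5}. 9 ^ l)"
  proof (intro mult_left_mono sum_mono)
    fix l :: nat assume l: "l \<in> {1..5}"
    have "(\<Sum>i\<in>cycle_index n l. matching_avg ?H (\<lambda>M. of_bool (distinct (flat (cycle_list i)) \<and> has_pairs (cycle_list i) M)))
      \<le> (\<Sum>i\<in>cycle_index n l. (1 / real n) ^ l)"
    proof (rule sum_mono)
      fix i assume i: "i \<in> cycle_index n l"
      note p = cycle_list_props[OF i]
      have "2 * length (cycle_list i) \<le> card ?H" using p(1) l n by simp
      from avg_pairs_le_long[OF fin this p(2)]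
      have "matching_avg ?H (\<lambda>M. of_bool (distinct (flat (cycle_list i)) \<and> has_pairs (cycle_list i) M)) \<le>
        (\<Prod>i<l. 1 / (real (card ?H) - 1 - 2 * real i))" unfolding p(1) .
      also have "\<dots> \<le> (\<Prod>i<l. 1 / real n)"
      proof (rule prod_mono)
        fix i assume "i \<in> {..<l}"
        then have "real i \<le> 4" using l by auto
        then have "real n \<le> real (card ?H) - 1 - 2 * real i" using n(2) by simp
        moreover have "0 < real n" using n(2) by simp
        ultimately show "0 \<le> 1 / (real (card ?H) - 1 - 2 * real i) \<and> 1 / (real (card ?H) - 1 - 2 * real i) \<le> 1 / real n"
          by (intro conjI divide_left_mono divide_nonneg_nonneg mult_pos_pos) linarith+
      qed
      finally show "matching_avg ?H (\<lambda>M. of_bool (distinct (flat (cycle_list i)) \<and> has_pairs (cycle_list i) M)) \<le> (1 / real n) ^ l"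
        by simp
    qed
    also have "\<dots> = real ((3 * n) ^ l * 3 ^ l) * (1 / real n) ^ l"
      by (simp add: card_cycle_index)
    also have "\<dots> = (real (3 * n) * 3 * (1 / real n)) ^ l"
      by (simp only: of_nat_mult of_nat_power of_nat_numeral power_mult_distrib)
    also have "real (3 * n) * 3 * (1 / real n) = 9" using n(2) by simp
    finally show "(\<Sum>i\<in>cycle_index n l. matching_avg ?H (\<lambda>M. of_bool (distinct (flat (cycle_list i)) \<and> has_pairs (cycle_list i) M))) \<le> 9 ^ l" .
  qed simp
  finally show ?thesis .
qed

text \<open>Markov's inequality. Its decay 1 / t is enough because it is applied under the
  configuration model, with t proportional to n.\<close>

lemma cyclic_count_tail:
  assumes n: "even n" "5 \<le> n" and t: "0 < t"
  shows "real (card {M \<in> perfect_matchings {..<3 * n}. t < cyclic_count n M}) \<le>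
    3 * (\<Sum>l\<in>{1..5}. 9 ^ l) / t * real (card (perfect_matchings {..<3 * n}))"
proof -
  let ?P = "perfect_matchings {..<3 * n}" and ?S = "{M \<in> perfect_matchings {..<3 * n}. t < cyclic_count n M}"
  obtain j where j: "3 * n = 2 * j" using n(1) by (metis dvd_def dvd_mult)
  have c: "0 < real (card ?P)" using card_perfect_matchings[of "{..<3 * n}" j] j by simp
  have "t * real (card ?S) = (\<Sum>M\<in>?S. t)" by simp
  also have "\<dots> \<le> (\<Sum>M\<in>?S. cyclic_count n M)" by (rule sum_mono) auto
  also have "\<dots> \<le> (\<Sum>M\<in>?P. cyclic_count n M)"
    by (rule sum_mono2) (auto simp: cyclic_count_def)
  also have "\<dots> = matching_avg {..<3 * n} (cyclic_count n) * real (card ?P)"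
    using c by (simp add: matching_avg_def)
  also have "\<dots> \<le> 3 * (\<Sum>l\<in>{1..5}. 9 ^ l) * real (card ?P)"
    by (rule mult_right_mono[OF avg_cyclic_count[OF n]]) simp
  finally show ?thesis using t by (simp add: field_simps)
qed

section \<open>The planted model\<close>

definition local_energy :: "nat \<Rightarrow> nat set set \<Rightarrow> nat set \<Rightarrow> real" where
  "local_energy n M V = (\<Sum>g\<in>inner_half_edges n M V.
     loc_weight (inner_half_edges n M V) (near_half_edges n M V) (partner M) g)"

text \<open>For \<open>k\<close> measured vertices \<open>m\<close> is the number of inner
  half-edges, \<open>6 * k\<close> the number of those next to \<open>V0\<close>, and
  \<open>s\<close> the bound on sibling pairs from \<open>card_sib_pairs_inner\<close>.\<close>

definition avg_bound :: "nat \<Rightarrow> nat \<Rightarrow> real" where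
  "avg_bound n k = (let m = 3 * real n - 6 * real k; s = 6 * real n - 18 * real k in
     5 / 18 * ((6 * real k) ^ 2 / (m - 1)) + 1 / sqrt 3 / 9 * (s * (6 * real k) ^ 2 / ((m - 1) * (m - 3)))
     + 2 / 243 * (s ^ 2 * (6 * real k) ^ 2 / ((m - 1) * (m - 3) * (m - 5))))"

lemma loc_weight_cong_on:
  assumes "g \<in> H" "\<And>h. h \<in> H \<Longrightarrow> p h = q h"
  shows "loc_weight H A p g = loc_weight H A q g"
proof -
  have "loc4 H A p g = loc4 H A q g"
    unfolding loc4_def by (rule sum.cong) (use assms in auto)
  moreover have "loc5 H A p g = loc5 H A q g"
    unfolding loc5_def using assms by (intro sum.cong) auto
  ultimately show ?thesis using assms by (simp add: loc_weight_def loc3_def)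
qed

lemma partner_Un:
  assumes "B \<union> N \<in> perfect_matchings H" "N \<in> perfect_matchings C" "h \<in> C"
  shows "partner (B \<union> N) h = partner N h"
  by (rule partner_eqI[OF assms(1)]) (use partner_props(1)[OF assms(2,3)] in simp)

definition edges_meeting :: "nat set \<Rightarrow> nat set set \<Rightarrow> nat set set" where
  "edges_meeting W M = {e \<in> M. e \<inter> W \<noteq> {}}"

text \<open>\<open>M0\<close> represents all matchings with the same edges at \<open>V\<close>:
  these edges \<open>B\<close> are frozen, and by \<open>extend_props\<close> the sets
  \<open>H\<close> and \<open>A\<close> are common to all of them.\<close>

locale planted =
  fixes n :: nat and M0 :: "nat set set" and V :: "nat set"
  assumes M0: "M0 \<in> perfect_matchings {..<3 * n}"
    and V: "V \<subseteq> {..<n}" "two_independent 3 M0 V"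
begin

abbreviation "W \<equiv> half_edges_at 3 V"
abbreviation "B \<equiv> edges_meeting W M0"
abbreviation "H \<equiv> inner_half_edges n M0 V"
abbreviation "A \<equiv> near_half_edges n M0 V"

lemma B_subset: "B \<subseteq> M0" by (auto simp: edges_meeting_def)

lemma B_matching: "B \<in> perfect_matchings (\<Union>B)"
  by (rule perfect_matchings_restrict(1)[OF M0 B_subset])

lemma H_eq: "{..<3 * n} - \<Union>B = H"
proof (rule Set.set_eqI)
  fix h
  show "h \<in> {..<3 * n} - \<Union>B \<longleftrightarrow> h \<in> H"
  proof (cases "h < 3 * n")
    case True
    then have p: "{h, partner M0 h} \<in> M0" "h \<in> {..<3 * n}" using partner_props[OF M0] by auto
    have "h \<in> \<Union>B \<longleftrightarrow> {h, partner M0 h} \<in> B"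
      using perfect_matchings_disjoint[OF M0 p(1)] B_subset by blast
    also have "\<dots> \<longleftrightarrow> h div 3 \<in> V \<or> partner M0 h div 3 \<in> V"
      using p by (auto simp: edges_meeting_def half_edges_at_iff)
    finally show ?thesis using True by (auto simp: inner_half_edges_def)
  qed (auto simp: inner_half_edges_def)
qed

lemma UB: "\<Union>B \<union> H = {..<3 * n}" "\<Union>B \<inter> H = {}" "H \<subseteq> {..<3 * n}"
proof -
  have "\<Union>B \<subseteq> {..<3 * n}" using perfect_matchings_Union[OF M0] B_subset by blast
  moreover have "U \<union> h = X \<and> U \<inter> h = {} \<and> h \<subseteq> X" if "U \<subseteq> X" "X - U = h" for U X h :: "nat set"
    using that by blast
  ultimately show "\<Union>B \<union> H = {..<3 * n}" "\<Union>B \<inter> H = {}" "H \<subseteq> {..<3 * n}"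
    using H_eq by metis+
qed

lemma W_subset: "W \<subseteq> \<Union>B"
proof
  fix h assume h: "h \<in> W"
  then have "h < 3 * n" using V(1) by (auto simp: half_edges_at_iff)
  then have "{h, partner M0 h} \<in> B"
    using partner_props(1)[OF M0, of h] h by (auto simp: edges_meeting_def)
  then show "h \<in> \<Union>B" by blast
qed

lemma extend_matching: "N \<in> perfect_matchings H \<Longrightarrow> B \<union> N \<in> perfect_matchings {..<3 * n}"
  using perfect_matchings_Un[OF B_matching _ UB(2), of N] UB(1) by simp

lemma partner_extend:
  assumes "N \<in> perfect_matchings H"
  shows "h \<in> H \<Longrightarrow> partner (B \<union> N) h = partner N h" "h \<in> \<Union>B \<Longrightarrow> partner (B \<union> N) h = partner M0 h"
proof -
  note M = extend_matching[OF assms]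
  show "h \<in> H \<Longrightarrow> partner (B \<union> N) h = partner N h" by (rule partner_Un[OF M assms])
  assume h: "h \<in> \<Union>B"
  have "partner (B \<union> N) h = partner B h"
    using partner_Un[of N B] M B_matching h by (simp add: Un_commute)
  also have "\<dots> = partner M0 h"
    using partner_props(1)[OF B_matching h] B_subset partner_eqI[OF M0, of h "partner B h"] by auto
  finally show "partner (B \<union> N) h = partner M0 h" .
qed

lemma extend_props:
  assumes N: "N \<in> perfect_matchings H"
  shows "two_independent 3 (B \<union> N) V" "edges_meeting W (B \<union> N) = B"
    "inner_half_edges n (B \<union> N) V = H" "near_half_edges n (B \<union> N) V = A"
    "local_energy n (B \<union> N) V = loc_sum H A N"
proof -
  have pW: "partner (B \<union> N) h = partner M0 h" if "h \<in> W" for h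
    using partner_extend(2)[OF N] W_subset that by blast
  have "inj_on (\<lambda>h. partner (B \<union> N) h div 3) W \<longleftrightarrow> inj_on (\<lambda>h. partner M0 h div 3) W"
    by (rule inj_on_cong) (simp add: pW)
  then show "two_independent 3 (B \<union> N) V"
    using V(2) pW by (simp add: two_independent_def)
  have "e \<inter> W = {}" if "e \<in> N" for e
    using perfect_matchings_Union[OF N] UB(2) W_subset that by blast
  then show "edges_meeting W (B \<union> N) = B"
    by (auto simp: edges_meeting_def)
  have key: "partner (B \<union> N) h div 3 \<in> V \<longleftrightarrow> partner M0 h div 3 \<in> V" if h: "h < 3 * n" for h
  proof (cases "h \<in> H")
    case True
    then have "partner (B \<union> N) h \<in> H" using partner_extend(1)[OF N] partner_props(3)[OF N] by simp
    then show ?thesis using True by (simp add: inner_half_edges_def)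
  next
    case False
    then have "h \<in> \<Union>B" using UB(1) h by blast
    then show ?thesis using partner_extend(2)[OF N] by simp
  qed
  show I: "inner_half_edges n (B \<union> N) V = H"
    using key by (auto simp: inner_half_edges_def)
  have "partner (B \<union> N) k div 3 \<in> V \<longleftrightarrow> partner M0 k div 3 \<in> V" if "k \<in> sibs h" "h \<in> H" for h k
    by (rule key) (use that sib_less in \<open>auto simp: sibs_def inner_half_edges_def\<close>)
  then show J: "near_half_edges n (B \<union> N) V = A"
    unfolding near_half_edges_def I by blast
  show "local_energy n (B \<union> N) V = loc_sum H A N"
    unfolding local_energy_def loc_sum_def I J
    by (intro sum.cong refl loc_weight_cong_on) (use partner_extend(1)[OF N] in auto)
qed

text \<open>Conditioned on the edges at \<open>V\<close>, the matching is therefore uniform on the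
  remaining half-edges, where the concentration bound applies.\<close>

lemma fibre: "{M \<in> perfect_matchings {..<3 * n}. two_independent 3 M V \<and> edges_meeting W M = B} =
    (\<lambda>N. B \<union> N) ` perfect_matchings H"
proof (intro equalityI subsetI)
  fix M assume "M \<in> {M \<in> perfect_matchings {..<3 * n}. two_independent 3 M V \<and> edges_meeting W M = B}"
  then have M: "M \<in> perfect_matchings {..<3 * n}" "edges_meeting W M = B" by auto
  have BM: "B \<subseteq> M" using M(2) by (auto simp: edges_meeting_def)
  have "M - B \<in> perfect_matchings H"
    using perfect_matchings_restrict(2)[OF M(1) BM] unfolding H_eq .
  moreover have "M = B \<union> (M - B)" using BM by blast
  ultimately show "M \<in> (\<lambda>N. B \<union> N) ` perfect_matchings H" by blast
qed (use extend_matching extend_props in auto)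

lemma inj_fibre: "inj_on (\<lambda>N. B \<union> N) (perfect_matchings H)"
proof (rule inj_onI)
  fix N N' assume N: "N \<in> perfect_matchings H" "N' \<in> perfect_matchings H" "B \<union> N = B \<union> N'"
  have "B \<inter> K = {}" if K: "K \<in> perfect_matchings H" for K
  proof (rule ccontr)
    assume "B \<inter> K \<noteq> {}"
    then obtain e where e: "e \<in> B" "e \<in> K" by blast
    then have "e \<subseteq> \<Union>B \<inter> H" using perfect_matchings_Union[OF K] by blast
    then show False using UB(2) perfect_matchings_card[OF K e(2)] by auto
  qed
  then show "N = N'" using N by blast
qed

lemma fibre_tail:
  assumes ev: "even n" and k: "5 < 3 * n - 6 * card V"
    and s: "avg_bound n (card V) + s \<le> t" and l: "0 \<le> l" "l * 20 \<le> 1"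
  shows "real (card {M \<in> perfect_matchings {..<3 * n}. two_independent 3 M V \<and> edges_meeting W M = B \<and> t < local_energy n M V}) \<le>
    exp (600 * l\<^sup>2 * real n - l * s) * real (card {M \<in> perfect_matchings {..<3 * n}. two_independent 3 M V \<and> edges_meeting W M = B})"
proof -
  interpret c: cubic_multigraph n M0
    by unfold_locales (use M0 in \<open>simp add: half_edges_at_lessThan\<close>)
  note counts = c.max_conditional_energy_le(2-5)[OF V]
  have fin: "finite H" using UB(3) finite_subset by blast
  have cH: "card H = 3 * n - 6 * card V" using counts(1) by simp
  obtain i where i: "n = 2 * i" using ev by auto
  define j where "j = 3 * i - 3 * card V"
  have j: "card H = 2 * j" using cH i by (simp add: j_def)
  have rH: "real (card H) = 3 * real n - 6 * real (card V)" using counts(1) by linarith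
  have rA: "real (card A) = 6 * real (card V)" using counts(2) by simp
  have rS: "real (card (sib_pairs H)) \<le> 6 * real n - 18 * real (card V)"
    using counts(3) rH rA by linarith
  have H5: "real (card H) > 5" using k cH by simp
  have "matching_avg H (loc_sum H A) \<le> avg_bound n (card V)"
  proof -
    have "matching_avg H (loc_sum H A) \<le>
      5 / 18 * (real (card A) ^ 2 / (real (card H) - 1))
      + 1 / sqrt 3 / 9 * (real (card (sib_pairs H)) * real (card A) ^ 2 / ((real (card H) - 1) * (real (card H) - 3)))
      + 2 / 243 * (real (card (sib_pairs H)) ^ 2 * real (card A) ^ 2 / ((real (card H) - 1) * (real (card H) - 3) * (real (card H) - 5)))"
      by (rule avg_loc_sum[OF fin j _ counts(4)]) (use H5 in simp)
    also have "\<dots> \<le> 5 / 18 * (real (card A) ^ 2 / (real (card H) - 1))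
      + 1 / sqrt 3 / 9 * ((6 * real n - 18 * real (card V)) * real (card A) ^ 2 / ((real (card H) - 1) * (real (card H) - 3)))
      + 2 / 243 * ((6 * real n - 18 * real (card V)) ^ 2 * real (card A) ^ 2 / ((real (card H) - 1) * (real (card H) - 3) * (real (card H) - 5)))"
      using H5 rS inv_sqrt3_bounds
      by (intro add_mono mult_left_mono divide_right_mono mult_right_mono power_mono order_refl) auto
    finally show ?thesis unfolding avg_bound_def Let_def rH rA .
  qed
  then have s': "s \<le> t - matching_avg H (loc_sum H A)" using s by linarith
  let ?F = "\<lambda>N. B \<union> N"
  have "{M \<in> perfect_matchings {..<3 * n}. two_independent 3 M V \<and> edges_meeting W M = B \<and> t < local_energy n M V} =
    {M \<in> {M \<in> perfect_matchings {..<3 * n}. two_independent 3 M V \<and> edges_meeting W M = B}. t < local_energy n M V}" by auto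
  also have "\<dots> = ?F ` {N \<in> perfect_matchings H. t < loc_sum H A N}"
    unfolding fibre using extend_props(5) by auto
  finally have "card {M \<in> perfect_matchings {..<3 * n}. two_independent 3 M V \<and> edges_meeting W M = B \<and> t < local_energy n M V} =
    card {N \<in> perfect_matchings H. t < loc_sum H A N}"
    by (simp add: card_image inj_on_subset[OF inj_fibre])
  also have "real \<dots> \<le> real (card {N \<in> perfect_matchings H. matching_avg H (loc_sum H A) + (t - matching_avg H (loc_sum H A)) \<le> loc_sum H A N})"
    by (intro of_nat_mono card_mono) (use fin in auto)
  also have "\<dots> \<le> exp (l\<^sup>2 * 20\<^sup>2 * real j - l * (t - matching_avg H (loc_sum H A))) * real (card (perfect_matchings H))"
    by (rule matching_tail[OF fin j lipschitz_loc_sum[OF fin]]) (use l in auto)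
  also have "\<dots> \<le> exp (600 * l\<^sup>2 * real n - l * s) * real (card (perfect_matchings H))"
  proof (rule mult_right_mono)
    \<comment> \<open>Here 600 is 20 squared times 3 / 2: the squared Lipschitz constant, times at
      most 3 n / 2 exposed pairs.\<close>
    have "2 * real j \<le> 3 * real n" using j rH by simp
    then have "l\<^sup>2 * 400 * real j \<le> l\<^sup>2 * 600 * real n"
      using mult_left_mono[of "2 * real j" "3 * real n" "l\<^sup>2 * 200"] by simp
    moreover have "l * s \<le> l * (t - matching_avg H (loc_sum H A))" using s' l by (intro mult_left_mono)
    ultimately show "exp (l\<^sup>2 * 20\<^sup>2 * real j - l * (t - matching_avg H (loc_sum H A))) \<le> exp (600 * l\<^sup>2 * real n - l * s)"
      by (simp add: mult_ac)
  qed simp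
  also have "card (perfect_matchings H) = card {M \<in> perfect_matchings {..<3 * n}. two_independent 3 M V \<and> edges_meeting W M = B}"
    unfolding fibre by (rule card_image[OF inj_fibre, symmetric])
  finally show ?thesis .
qed

end

lemma planted_tail:
  assumes V: "V \<subseteq> {..<n}" and ev: "even n" and k: "5 < 3 * n - 6 * card V"
    and s: "avg_bound n (card V) + s \<le> t" and l: "0 \<le> l" "l * 20 \<le> 1"
  shows "real (card {M \<in> perfect_matchings {..<3 * n}. two_independent 3 M V \<and> t < local_energy n M V}) \<le>
    exp (600 * l\<^sup>2 * real n - l * s) * real (card {M \<in> perfect_matchings {..<3 * n}. two_independent 3 M V})"
proof -
  let ?S = "{M \<in> perfect_matchings {..<3 * n}. two_independent 3 M V}"
  let ?f = "edges_meeting (half_edges_at 3 V)"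
  let ?x = "exp (600 * l\<^sup>2 * real n - l * s)"
  have fin: "finite ?S" by simp
  have gen: "real (card {M \<in> ?S. P M}) = (\<Sum>B\<in>?f ` ?S. real (card {M \<in> ?S. ?f M = B \<and> P M}))" for P
  proof -
    have "real (card {M \<in> ?S. P M}) = (\<Sum>M\<in>?S. of_bool (P M))"
      using fin by (simp add: of_bool_def sum.If_cases Int_def)
    also have "\<dots> = (\<Sum>B\<in>?f ` ?S. \<Sum>M\<in>{M. M \<in> ?S \<and> ?f M = B}. of_bool (P M))"
      by (rule sum.image_gen[OF fin])
    also have "\<dots> = (\<Sum>B\<in>?f ` ?S. real (card {M \<in> ?S. ?f M = B \<and> P M}))"
    proof (rule sum.cong[OF refl])
      fix B
      have "finite {M. M \<in> ?S \<and> ?f M = B}" using fin by simp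
      then show "(\<Sum>M\<in>{M. M \<in> ?S \<and> ?f M = B}. of_bool (P M)) = real (card {M \<in> ?S. ?f M = B \<and> P M})"
        by (simp add: of_bool_def sum.If_cases Int_def conj_assoc)
    qed
    finally show ?thesis .
  qed
  have "real (card {M \<in> ?S. t < local_energy n M V}) \<le> (\<Sum>B\<in>?f ` ?S. ?x * real (card {M \<in> ?S. ?f M = B \<and> True}))"
    unfolding gen[of "\<lambda>M. t < local_energy n M V"]
  proof (rule sum_mono)
    fix B assume "B \<in> ?f ` ?S"
    then obtain M0 where st: "M0 \<in> ?S" "B = ?f M0" by blast
    interpret planted n M0 V by unfold_locales (use st V in auto)
    show "real (card {M \<in> ?S. ?f M = B \<and> t < local_energy n M V}) \<le> ?x * real (card {M \<in> ?S. ?f M = B \<and> True})"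
      using fibre_tail[OF ev k s l] unfolding st(2) by (simp add: conj_assoc)
  qed
  also have "\<dots> = ?x * real (card {M \<in> ?S. True})"
    unfolding gen[of "\<lambda>_. True"] by (rule sum_distrib_left[symmetric])
  finally show ?thesis by (simp add: conj_assoc)
qed

section \<open>From the planted model to typical graphs\<close>

lemma prob_bind_uniform:
  assumes "finite S" "S \<noteq> {}"
  shows "measure_pmf.prob (bind_pmf (pmf_of_set S) f) X = (\<Sum>x\<in>S. measure_pmf.prob (f x) X) / real (card S)"
proof -
  have c: "0 < real (card S)" using assms by (simp add: card_gt_0_iff)
  have "ennreal (measure_pmf.prob (bind_pmf (pmf_of_set S) f) X) = (\<integral>\<^sup>+x. emeasure (measure_pmf (f x)) X \<partial>measure_pmf (pmf_of_set S))"
    by (simp add: measure_pmf.emeasure_eq_measure[symmetric])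
  also have "\<dots> = (\<Sum>x\<in>S. emeasure (measure_pmf (f x)) X) / ennreal (real (card S))"
    by (simp add: nn_integral_pmf_of_set[OF assms(2,1)] ennreal_of_nat_eq_real_of_nat)
  also have "(\<Sum>x\<in>S. emeasure (measure_pmf (f x)) X) = ennreal (\<Sum>x\<in>S. measure_pmf.prob (f x) X)"
    by (simp add: measure_pmf.emeasure_eq_measure)
  also have "\<dots> / ennreal (real (card S)) = ennreal ((\<Sum>x\<in>S. measure_pmf.prob (f x) X) / real (card S))"
    using c by (intro divide_ennreal sum_nonneg) auto
  finally show ?thesis
    using c by (simp add: sum_nonneg)
qed

lemma card_sum_of_bool: "finite S \<Longrightarrow> (\<Sum>x\<in>S. (of_bool (P x) :: real)) = real (card {x \<in> S. P x})"
  by (simp add: of_bool_def sum.If_cases Int_def)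

text \<open>Pairs of a graph and a set are counted in both orders. In the planted order bad pairs
  are rare, and on a typical graph dividing by the actual number of sets instead of its expectation
  loses at most \<open>exp (\<epsilon>' * real n)\<close>. Untypical graphs and graphs with many
  short cycles are discarded beforehand, under the law of the graph alone.\<close>

lemma joint_tail:
  fixes \<alpha> \<epsilon>' l s t \<delta> b :: real
  assumes ev: "even n" "5 \<le> n"
  defines "k \<equiv> nat \<lfloor>\<alpha> * real n\<rfloor>"
  assumes k: "5 < 3 * n - 6 * k"
    and E: "0 < expected_two_ind_sets 3 \<alpha> n"
    and s: "avg_bound n k + s \<le> t" and l: "0 \<le> l" "l * 20 \<le> 1" and \<delta>: "0 < \<delta>"
    and b: "t / 4 + 162 * \<delta> \<le> b"
  shows "1 - measure_pmf.prob (config_model_two_ind 3 \<alpha> n) {(M, V). V \<in> two_ind_sets 3 \<alpha> n M \<and>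
      max_conditional_energy n M V - quad_form (psi3 n M) (H_MaxCut 3 n M) \<le> b} \<le>
    (1 - measure_pmf.prob (config_model 3 n) {M. two_ind_typical 3 \<alpha> \<epsilon>' n M})
    + 3 * (\<Sum>i\<in>{1..5}. 9 ^ i) / \<delta> + exp (600 * l\<^sup>2 * real n - l * s + \<epsilon>' * real n)"
proof -
  let ?P = "perfect_matchings {..<3 * n}"
  let ?Vs = "{V. V \<subseteq> {..<n} \<and> card V = k}"
  let ?T = "two_ind_sets 3 \<alpha> n"
  let ?Q = "{(M, V). V \<in> ?T M \<and> max_conditional_energy n M V - quad_form (psi3 n M) (H_MaxCut 3 n M) \<le> b}"
  let ?x = "exp (600 * l\<^sup>2 * real n - l * s)"
  let ?E = "expected_two_ind_sets 3 \<alpha> n"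
  let ?D = "exp (- \<epsilon>' * real n) * ?E"
  let ?typ = "two_ind_typical 3 \<alpha> \<epsilon>' n"
  obtain j where j: "3 * n = 2 * j" using ev(1) by (metis dvd_def dvd_mult)
  have finP: "finite ?P" and cP: "0 < real (card ?P)"
    using card_perfect_matchings[of "{..<3 * n}" j] j by simp_all
  then have neP: "?P \<noteq> {}" by auto
  have finV: "finite ?Vs" by (rule finite_subset[of _ "Pow {..<n}"]) auto
  have T: "?T M = {V \<in> ?Vs. two_independent 3 M V}" for M
    by (auto simp: two_ind_sets_def k_def)
  have finT: "finite (?T M)" for M unfolding T using finV by simp
  have conf: "config_model 3 n = pmf_of_set ?P" by (simp add: config_model_def half_edges_at_lessThan)
  have swap: "(\<Sum>M\<in>?P. real (card {V \<in> ?T M. R M V})) = (\<Sum>V\<in>?Vs. real (card {M \<in> ?P. two_independent 3 M V \<and> R M V}))" for R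
  proof -
    have "(\<Sum>M\<in>?P. real (card {V \<in> ?T M. R M V})) = (\<Sum>M\<in>?P. \<Sum>V\<in>?Vs. of_bool (two_independent 3 M V \<and> R M V))"
      unfolding T card_sum_of_bool[OF finV] by (intro sum.cong refl arg_cong[where f = real] arg_cong[where f = card]) auto
    also have "\<dots> = (\<Sum>V\<in>?Vs. \<Sum>M\<in>?P. of_bool (two_independent 3 M V \<and> R M V))" by (rule sum.swap)
    finally show ?thesis unfolding card_sum_of_bool[OF finP] .
  qed
  have EP: "(\<Sum>M\<in>?P. real (card (?T M))) = ?E * real (card ?P)"
    using cP by (simp add: expected_two_ind_sets_def conf integral_pmf_of_set[OF neP finP])
  have planted: "(\<Sum>M\<in>?P. real (card {V \<in> ?T M. t < local_energy n M V})) \<le> ?x * (?E * real (card ?P))"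
  proof -
    have "(\<Sum>M\<in>?P. real (card {V \<in> ?T M. t < local_energy n M V})) \<le>
      (\<Sum>V\<in>?Vs. ?x * real (card {M \<in> ?P. two_independent 3 M V \<and> True}))"
      unfolding swap
    proof (rule sum_mono)
      fix V assume "V \<in> ?Vs"
      then have V: "V \<subseteq> {..<n}" "card V = k" by auto
      show "real (card {M \<in> ?P. two_independent 3 M V \<and> t < local_energy n M V}) \<le> ?x * real (card {M \<in> ?P. two_independent 3 M V \<and> True})"
        using planted_tail[OF V(1) ev(1) _ _ l, of s t] k s V(2) by simp
    qed
    also have "\<dots> = ?x * (\<Sum>M\<in>?P. real (card {V \<in> ?T M. True}))"
      unfolding swap[of "\<lambda>_ _. True"] by (rule sum_distrib_left[symmetric])
    also have "(\<Sum>M\<in>?P. real (card {V \<in> ?T M. True})) = ?E * real (card ?P)" using EP by simp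
    finally show ?thesis .
  qed
  have D: "0 < ?D" using E by simp
  let ?q = "\<lambda>M. map_pmf (Pair M) (pmf_of_set (?T M))"
  have r: "measure_pmf.prob (?q M) (- ?Q) \<le> of_bool (\<not> ?typ M) + of_bool (\<delta> < cyclic_count n M)
      + real (card {V \<in> ?T M. t < local_energy n M V}) / ?D" if M: "M \<in> ?P" for M
  proof (cases "\<not> ?typ M \<or> \<delta> < cyclic_count n M")
    case True
    have "measure_pmf.prob (?q M) (- ?Q) \<le> 1" by simp
    moreover have "0 \<le> real (card {V \<in> ?T M. t < local_energy n M V}) / ?D" using D by simp
    moreover have "1 \<le> of_bool (\<not> ?typ M) + (of_bool (\<delta> < cyclic_count n M) :: real)" using True by auto
    ultimately show ?thesis by linarith
  next
    case False
    then have ty: "?D \<le> real (card (?T M))" and cyc: "cyclic_count n M \<le> \<delta>"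
      by (auto simp: two_ind_typical_def)
    \<comment> \<open>A typical graph has at least one 2-independent set of the prescribed size, so
      the uniform choice is well defined.\<close>
    have c: "0 < real (card (?T M))" using ty D by linarith
    then have ne: "?T M \<noteq> {}" by auto
    interpret cubic_multigraph n M
      by unfold_locales (use M in \<open>simp add: half_edges_at_lessThan\<close>)
    have sub: "?T M \<inter> (Pair M -` (- ?Q)) \<subseteq> {V \<in> ?T M. t < local_energy n M V}"
    proof
      fix V assume "V \<in> ?T M \<inter> (Pair M -` (- ?Q))"
      then have V: "V \<in> ?T M" "b < max_conditional_energy n M V - quad_form (psi3 n M) (H_MaxCut 3 n M)" by auto
      then have V': "V \<subseteq> {..<n}" "two_independent 3 M V" by (auto simp: T)
      have "max_conditional_energy n M V - quad_form (psi3 n M) (H_MaxCut 3 n M) \<le> local_energy n M V / 4 + 162 * cyclic_count n M"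
        using max_conditional_energy_le(1)[OF V'] by (simp add: local_energy_def cyclic_count_def)
      then have "t < local_energy n M V" using V(2) b cyc by linarith
      then show "V \<in> {V \<in> ?T M. t < local_energy n M V}" using V by simp
    qed
    have "measure_pmf.prob (?q M) (- ?Q) = real (card (?T M \<inter> (Pair M -` (- ?Q)))) / real (card (?T M))"
      by (simp add: measure_pmf_of_set[OF ne finT])
    also have "\<dots> \<le> real (card {V \<in> ?T M. t < local_energy n M V}) / ?D"
      by (intro frac_le of_nat_mono card_mono sub) (use finT D ty in auto)
    finally show ?thesis using False by simp
  qed
  have "1 - measure_pmf.prob (config_model_two_ind 3 \<alpha> n) ?Q = measure_pmf.prob (config_model_two_ind 3 \<alpha> n) (- ?Q)"
    using measure_pmf.prob_compl[of ?Q "config_model_two_ind 3 \<alpha> n"] by (simp add: Compl_eq_Diff_UNIV)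
  also have "\<dots> = (\<Sum>M\<in>?P. measure_pmf.prob (?q M) (- ?Q)) / real (card ?P)"
    unfolding config_model_two_ind_def conf by (rule prob_bind_uniform[OF finP neP])
  also have "\<dots> \<le> (\<Sum>M\<in>?P. of_bool (\<not> ?typ M) + of_bool (\<delta> < cyclic_count n M)
      + real (card {V \<in> ?T M. t < local_energy n M V}) / ?D) / real (card ?P)"
    by (intro divide_right_mono sum_mono r) simp_all
  also have "\<dots> = real (card {M \<in> ?P. \<not> ?typ M}) / real (card ?P) + real (card {M \<in> ?P. \<delta> < cyclic_count n M}) / real (card ?P)
      + (\<Sum>M\<in>?P. real (card {V \<in> ?T M. t < local_energy n M V})) / ?D / real (card ?P)"
    unfolding sum.distrib card_sum_of_bool[OF finP] sum_divide_distrib[symmetric] by (simp only: add_divide_distrib)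
  also have "\<dots> \<le> (1 - measure_pmf.prob (config_model 3 n) {M. ?typ M})
      + 3 * (\<Sum>i\<in>{1..5}. 9 ^ i) / \<delta> + exp (600 * l\<^sup>2 * real n - l * s + \<epsilon>' * real n)"
  proof (intro add_mono)
    have "measure_pmf.prob (config_model 3 n) (- {M. ?typ M}) = 1 - measure_pmf.prob (config_model 3 n) {M. ?typ M}"
      using measure_pmf.prob_compl[of "{M. ?typ M}" "config_model 3 n"] by (simp add: Compl_eq_Diff_UNIV)
    moreover have "measure_pmf.prob (config_model 3 n) (- {M. ?typ M}) = real (card {M \<in> ?P. \<not> ?typ M}) / real (card ?P)"
      unfolding conf measure_pmf_of_set[OF neP finP]
      by (rule arg_cong[where f = "\<lambda>S. real (card S) / real (card ?P)"]) auto
    ultimately show "real (card {M \<in> ?P. \<not> ?typ M}) / real (card ?P) \<le> 1 - measure_pmf.prob (config_model 3 n) {M. ?typ M}" by simp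
    show "real (card {M \<in> ?P. \<delta> < cyclic_count n M}) / real (card ?P) \<le> 3 * (\<Sum>i\<in>{1..5}. 9 ^ i) / \<delta>"
      using cyclic_count_tail[OF ev \<delta>] cP by (simp only: pos_divide_le_eq)
    have "(\<Sum>M\<in>?P. real (card {V \<in> ?T M. t < local_energy n M V})) / ?D / real (card ?P) \<le> ?x * (?E * real (card ?P)) / ?D / real (card ?P)"
      by (intro divide_right_mono planted) (use D in auto)
    also have "\<dots> = ?x / exp (- \<epsilon>' * real n)" using E cP neP by simp
    also have "\<dots> = exp (600 * l\<^sup>2 * real n - l * s + \<epsilon>' * real n)" by (simp add: exp_diff[symmetric])
    finally show "(\<Sum>M\<in>?P. real (card {V \<in> ?T M. t < local_energy n M V})) / ?D / real (card ?P) \<le> exp (600 * l\<^sup>2 * real n - l * s + \<epsilon>' * real n)" .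
  qed
  finally show ?thesis .
qed

section \<open>The limiting rate and the stated polynomial\<close>

definition rate :: "real \<Rightarrow> real" where
  "rate a = a\<^sup>2 * (0.18125 - 0.83875 * a + 0.99 * a\<^sup>2) / (0.5 - a) ^ 3"

text \<open>\<open>avg_bound\<close> per vertex, with \<open>a\<close> for the density of measured
  vertices and \<open>u\<close> for 1 / n. As a function of both it is continuous at
  \<open>u = 0\<close> for densities below 1 / 4, so the limit can be read off.\<close>

definition avg_rate :: "real \<Rightarrow> real \<Rightarrow> real" where
  "avg_rate a u = 5 / 18 * (36 * a\<^sup>2 / (3 - 6 * a - u))
    + 1 / sqrt 3 / 9 * ((6 - 18 * a) * (36 * a\<^sup>2) / ((3 - 6 * a - u) * (3 - 6 * a - 3 * u)))
    + 2 / 243 * ((6 - 18 * a)\<^sup>2 * (36 * a\<^sup>2) / ((3 - 6 * a - u) * (3 - 6 * a - 3 * u) * (3 - 6 * a - 5 * u)))"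

lemma avg_bound_rate:
  assumes "0 < n"
  shows "avg_bound n k = real n * avg_rate (real k / real n) (1 / real n)"
proof -
  define a u N where "a = real k / real n" and "u = 1 / real n" and "N = real n"
  have N: "N > 0" "real k = a * N" "1 = u * N" using assms by (auto simp: a_def u_def N_def)
  have m: "3 * real n - 6 * real k - 1 = N * (3 - 6 * a - u)" "3 * real n - 6 * real k - 3 = N * (3 - 6 * a - 3 * u)"
    "3 * real n - 6 * real k - 5 = N * (3 - 6 * a - 5 * u)" "6 * real n - 18 * real k = N * (6 - 18 * a)"
    "(6 * real k)\<^sup>2 = N\<^sup>2 * (36 * a\<^sup>2)"
    using N by (simp_all add: N_def[symmetric] power_mult_distrib algebra_simps)
  have c1: "N\<^sup>2 * x / (N * y) = N * (x / y)" for x y using N(1) by (simp add: power2_eq_square)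
  have c2: "N * z * (N\<^sup>2 * x) / (N * y * (N * y')) = N * (z * x / (y * y'))" for x y y' z
    using N(1) by (simp add: power2_eq_square)
  have c3: "(N * z)\<^sup>2 * (N\<^sup>2 * x) / (N * y * (N * y') * (N * y'')) = N * (z\<^sup>2 * x / (y * y' * y''))" for x y y' y'' z
    using N(1) by (simp add: power2_eq_square mult_ac)
  have d: "p * (N * x) + q * (N * y) + r * (N * z) = N * (p * x + q * y + r * z)" for p q r x y z
    by (simp add: distrib_left)
  show ?thesis
    unfolding avg_bound_def Let_def m c1 c2 c3 d
    unfolding avg_rate_def a_def[symmetric] u_def[symmetric] unfolding N_def[symmetric] ..
qed

text \<open>At \<open>u = 0\<close> all denominators are powers of \<open>w = 0.5 - a\<close>, so
  the average is \<open>a\<^sup>2 / w ^ 3\<close> times a quadratic polynomial in \<open>a\<close>.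
  The stated polynomial dominates it below 1 / 4, which bounds the threshold at degree 3.\<close>

lemma rate_bound:
  assumes "0 < a" "a < 1 / 4"
  shows "avg_rate a 0 / 4 \<le> rate a"
proof -
  define w where "w = 0.5 - a"
  have w: "0 < w" "3 - 6 * a = 6 * w" using assms by (auto simp: w_def)
  let ?s = "1 / sqrt 3"
  have s: "?s \<le> 0.57736" "0 \<le> ?s"
  proof -
    have "1 / 0.57736 \<le> sqrt 3" by (rule real_le_rsqrt) (simp add: power2_eq_square)
    then show "?s \<le> 0.57736" by (simp add: field_simps)
  qed simp
  have "avg_rate a 0 / 4 = a\<^sup>2 / w ^ 3 * (5 / 12 * w\<^sup>2 + ?s / 18 * ((3 - 9 * a) * w) + 1 / 81 * (1 - 3 * a)\<^sup>2)"
  proof -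
    have e: "6 - 18 * a = 2 * (3 - 9 * a)" "(6 - 18 * a)\<^sup>2 = 36 * (1 - 3 * a)\<^sup>2" by (simp_all add: power2_eq_square algebra_simps)
    have "avg_rate a 0 = 5 / 18 * (36 * a\<^sup>2 / (6 * w)) + ?s / 9 * (2 * (3 - 9 * a) * (36 * a\<^sup>2) / (6 * w * (6 * w)))
      + 2 / 243 * (36 * (1 - 3 * a)\<^sup>2 * (36 * a\<^sup>2) / (6 * w * (6 * w) * (6 * w)))"
      unfolding avg_rate_def using w(2) e by simp
    moreover have "36 * a\<^sup>2 / (6 * w) = a\<^sup>2 / w ^ 3 * (6 * w\<^sup>2)"
      "2 * (3 - 9 * a) * (36 * a\<^sup>2) / (6 * w * (6 * w)) = a\<^sup>2 / w ^ 3 * (2 * ((3 - 9 * a) * w))"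
      "36 * (1 - 3 * a)\<^sup>2 * (36 * a\<^sup>2) / (6 * w * (6 * w) * (6 * w)) = a\<^sup>2 / w ^ 3 * (6 * (1 - 3 * a)\<^sup>2)"
      using w(1) by (simp_all add: field_simps power2_eq_square power3_eq_cube)
    moreover have "(5 / 18 * (A * (6 * X)) + r / 9 * (A * (2 * Y)) + 2 / 243 * (A * (6 * Z))) / 4 =
      A * (5 / 12 * X + r / 18 * Y + 1 / 81 * Z)" for A r X Y Z :: real
      by (simp add: algebra_simps)
    ultimately show ?thesis by presburger
  qed
  also have "\<dots> \<le> a\<^sup>2 / w ^ 3 * (0.18125 - 0.83875 * a + 0.99 * a\<^sup>2)"
  proof (rule mult_left_mono)
    have "?s / 18 * ((3 - 9 * a) * w) \<le> 0.57736 / 18 * ((3 - 9 * a) * w)"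
      using s w assms by (intro mult_right_mono divide_right_mono mult_nonneg_nonneg) auto
    moreover have "5 / 12 * w\<^sup>2 + 0.57736 / 18 * ((3 - 9 * a) * w) + 1 / 81 * (1 - 3 * a)\<^sup>2 \<le> 0.18125 - 0.83875 * a + 0.99 * a\<^sup>2"
    proof -
      \<comment> \<open>The difference of the two polynomials decreases towards
        \<open>a = 1 / 4\<close>, where it is smallest, about 0.0006; expanded in \<open>d\<close>
        all three coefficients are positive.\<close>
      define d where "d = 1 / 4 - a"
      have d: "0 \<le> d" "a = 1 / 4 - d" using assms by (auto simp: d_def)
      have "0.18125 - 0.83875 * a + 0.99 * a\<^sup>2 - (5 / 12 * w\<^sup>2 + 0.57736 / 18 * ((3 - 9 * a) * w) + 1 / 81 * (1 - 3 * a)\<^sup>2)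
         = (0.99 - 5 / 12 - 0.57736 / 2 - 1 / 9) * d\<^sup>2
           + (0.83875 - 0.495 - 5 / 24 - 0.57736 / 6 - 1 / 54) * d
           + (0.18125 - 0.83875 / 4 + 0.99 / 16 - 5 / 192 - 0.57736 / 96 - 1 / 1296)"
        unfolding w_def d(2) by (simp add: power2_eq_square field_simps)
      moreover have "0 \<le> (0.99 - 5 / 12 - 0.57736 / 2 - 1 / 9) * d\<^sup>2" by (intro mult_nonneg_nonneg) auto
      moreover have "0 \<le> (0.83875 - 0.495 - 5 / 24 - 0.57736 / 6 - 1 / 54) * d" using d by (intro mult_nonneg_nonneg) auto
      moreover have "(0::real) \<le> 0.18125 - 0.83875 / 4 + 0.99 / 16 - 5 / 192 - 0.57736 / 96 - 1 / 1296" by simp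
      ultimately show ?thesis by linarith
    qed
    ultimately show "5 / 12 * w\<^sup>2 + ?s / 18 * ((3 - 9 * a) * w) + 1 / 81 * (1 - 3 * a)\<^sup>2 \<le> 0.18125 - 0.83875 * a + 0.99 * a\<^sup>2"
      by linarith
  qed (use w in simp)
  finally show ?thesis by (simp add: rate_def w_def)
qed
theorem proposition19:
  fixes \<alpha>_star \<alpha> :: real
  assumes threshold: "two_ind_threshold 3 \<alpha>_star"
    and conjecture: "\<And>a \<epsilon>. 0 < a \<Longrightarrow> a < \<alpha>_star \<Longrightarrow> 0 < \<epsilon> \<Longrightarrow>
      \<exists>nbar. whp 3 (config_model 3) (\<lambda>n M. n \<ge> nbar \<longrightarrow> two_ind_typical 3 a \<epsilon> n M)"
    and \<alpha>: "0 < \<alpha>" "\<alpha> < \<alpha>_star"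
  shows "\<exists>C::real. \<forall>\<epsilon>>0. \<exists>nbar.
    whp 3 (config_model_two_ind 3 \<alpha>) (\<lambda>n (M, V0). n \<ge> nbar \<longrightarrow>
      V0 \<in> two_ind_sets 3 \<alpha> n M \<and>
      max_conditional_energy n M V0 - quad_form (psi3 n M) (H_MaxCut 3 n M)
        \<le> (\<alpha>\<^sup>2 * (0.18125 - 0.83875 * \<alpha> + 0.99 * \<alpha>\<^sup>2) / (0.5 - \<alpha>) ^ 3 + 0.59 * \<epsilon>) * real n + C)"
proof (rule exI[of _ 0], intro allI impI)
  \<comment> \<open>The O(1) term has been chosen as 0: the contribution of short cycles, which is
    bounded only in expectation, is charged to the term in \<epsilon> instead.\<close>
  fix \<epsilon> :: real assume \<epsilon>: "0 < \<epsilon>"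
  have \<alpha>4: "\<alpha> < 1 / 4" using threshold \<alpha>(2) unfolding two_ind_threshold_def by simp
  define l where "l = min (1 / 20) (\<epsilon> / 1800)"
  have l: "0 < l" "l * 20 \<le> 1" "1800 * l \<le> \<epsilon>" using \<epsilon> by (auto simp: l_def min_def)
  define \<epsilon>' where "\<epsilon>' = l * \<epsilon> / 6"
  have \<epsilon>': "0 < \<epsilon>'" using l \<epsilon> by (simp add: \<epsilon>'_def)
  \<comment> \<open>With deviation \<open>0.7 \<epsilon> n\<close>, these choices make \<open>600 l\<^sup>2 n - 0.7 l \<epsilon> n \<le> - 2 \<epsilon>' n\<close>, which leaves room for the factor \<open>exp (\<epsilon>' n)\<close>.\<close>
  let ?k = "\<lambda>n. nat \<lfloor>\<alpha> * real n\<rfloor>"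
  let ?b = "\<lambda>n. (rate \<alpha> + 0.59 * \<epsilon>) * real n"
  let ?Q = "\<lambda>n. {(M, V). V \<in> two_ind_sets 3 \<alpha> n M \<and> max_conditional_energy n M V - quad_form (psi3 n M) (H_MaxCut 3 n M) \<le> ?b n}"
  let ?p = "\<lambda>n. measure_pmf.prob (config_model_two_ind 3 \<alpha> n) (?Q n)"
  let ?typ = "\<lambda>n. measure_pmf.prob (config_model 3 n) {M. two_ind_typical 3 \<alpha> \<epsilon>' n M}"
  let ?K = "3 * (\<Sum>i\<in>{1..5}. 9 ^ i) :: real"
  let ?err = "\<lambda>n. (1 - ?typ n) + ?K / (\<epsilon> / 500 * real n) + exp (- (\<epsilon>' * real n))"
  have adm: "admissible 3 \<le> sequentially" by (simp add: admissible_def)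
  have big: "\<forall>\<^sub>F n in admissible 3. N \<le> n" for N
    by (rule filter_leD[OF adm]) (rule eventually_ge_at_top)
  have "\<forall>\<^sub>F n in admissible 3. even (n * 3)" by (simp add: admissible_def eventually_inf_principal)
  then have ev: "\<forall>\<^sub>F n in admissible 3. even n" by (rule eventually_mono) simp
  have inv0: "(\<lambda>n. 1 / real n) \<longlonglongrightarrow> 0" by (rule lim_1_over_n)
  have kn: "(\<lambda>n. real (?k n) / real n) \<longlonglongrightarrow> \<alpha>"
  proof (rule real_tendsto_sandwich)
    show "\<forall>\<^sub>F n in sequentially. \<alpha> - 1 / real n \<le> real (?k n) / real n"
      using eventually_gt_at_top[of 0]
    proof eventually_elim
      case (elim n)
      have "\<alpha> * real n - 1 \<le> real (?k n)" using \<alpha>(1) by linarith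
      then have "(\<alpha> * real n - 1) / real n \<le> real (?k n) / real n" by (rule divide_right_mono) simp
      then show ?case using elim by (simp add: diff_divide_distrib)
    qed
    show "\<forall>\<^sub>F n in sequentially. real (?k n) / real n \<le> \<alpha>"
      using eventually_gt_at_top[of 0]
    proof eventually_elim
      case (elim n)
      have "real (?k n) \<le> \<alpha> * real n" using \<alpha>(1) by simp
      then show ?case using elim by (simp add: field_simps)
    qed
    show "(\<lambda>n. \<alpha> - 1 / real n) \<longlonglongrightarrow> \<alpha>" using tendsto_diff[OF tendsto_const inv0, of \<alpha>] by simp
  qed simp
  have "(\<lambda>n. avg_rate (real (?k n) / real n) (1 / real n)) \<longlonglongrightarrow> avg_rate \<alpha> 0"
    unfolding avg_rate_def by (intro tendsto_intros kn inv0) (use \<alpha>4 in auto)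
  \<comment> \<open>Rounding \<alpha> n to an integer and the corrections of order 1 / n cost at
    most \<epsilon> / 20 of the rate for large n.\<close>
  moreover have "avg_rate \<alpha> 0 < 4 * (rate \<alpha> + \<epsilon> / 20)" using rate_bound[OF \<alpha>(1) \<alpha>4] \<epsilon> by (simp add: field_simps)
  ultimately have "\<forall>\<^sub>F n in sequentially. avg_rate (real (?k n) / real n) (1 / real n) < 4 * (rate \<alpha> + \<epsilon> / 20)"
    by (rule order_tendstoD(2))
  then have avg: "\<forall>\<^sub>F n in admissible 3. avg_rate (real (?k n) / real n) (1 / real n) < 4 * (rate \<alpha> + \<epsilon> / 20)"
    by (rule filter_leD[OF adm])
  \<comment> \<open>Below the threshold the expected number of sets is eventually positive, as
    \<open>joint_tail\<close> requires.\<close>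
  obtain c where c: "c > 0" "\<forall>\<^sub>F n in admissible 3. expected_two_ind_sets 3 \<alpha> n \<ge> exp (c * real n)"
    using threshold \<alpha> unfolding two_ind_threshold_def by blast
  have tail: "\<forall>\<^sub>F n in admissible 3. 1 - ?err n \<le> ?p n"
    using ev big[of 5] avg c(2)
  proof eventually_elim
    case (elim n)
    have n: "0 < real n" using elim(2) by simp
    have "real (?k n) \<le> \<alpha> * real n" using \<alpha>(1) by simp
    also have "\<dots> < 1 / 4 * real n" using \<alpha>4 n by (rule mult_strict_right_mono)
    finally have "4 * ?k n < n" by simp
    then have k: "5 < 3 * n - 6 * ?k n" using elim(2) by linarith
    have E: "0 < expected_two_ind_sets 3 \<alpha> n" using elim(4) exp_gt_zero[of "c * real n"] by linarith
    let ?s = "7 / 10 * \<epsilon> * real n"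
    let ?t = "4 * (rate \<alpha> + \<epsilon> / 20) * real n + ?s"
    have s: "avg_bound n (?k n) + ?s \<le> ?t"
      using mult_right_mono[OF less_imp_le[OF elim(3)], of "real n"] n by (simp add: avg_bound_rate mult.commute)
    \<comment> \<open>The budget: \<epsilon> / 20 for the limit, 0.7 \<epsilon> / 4 for the
      deviation and 162 \<epsilon> / 500 for short cycles add up to 0.549 \<epsilon>, within 0.59
      \<epsilon>.\<close>
    have b: "?t / 4 + 162 * (\<epsilon> / 500 * real n) \<le> ?b n"
      using mult_pos_pos[OF \<epsilon> n] by (simp add: field_simps)
    have "600 * l\<^sup>2 * real n - l * ?s + \<epsilon>' * real n \<le> - (\<epsilon>' * real n)"
    proof -
      have "1800 * l * (l * real n) \<le> \<epsilon> * (l * real n)" using l n by (intro mult_right_mono) auto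
      moreover have "0 \<le> l * \<epsilon> * real n" using l \<epsilon> n by simp
      ultimately show ?thesis by (simp add: \<epsilon>'_def power2_eq_square algebra_simps)
    qed
    then have "exp (600 * l\<^sup>2 * real n - l * ?s + \<epsilon>' * real n) \<le> exp (- (\<epsilon>' * real n))" by simp
    moreover have "1 - ?p n \<le> (1 - ?typ n) + ?K / (\<epsilon> / 500 * real n) + exp (600 * l\<^sup>2 * real n - l * ?s + \<epsilon>' * real n)"
      by (rule joint_tail[OF elim(1,2) k E s _ _ _ b]) (use l \<epsilon> n in auto)
    ultimately show ?case by linarith
  qed
  obtain nb where "((\<lambda>n. measure_pmf.prob (config_model 3 n) {M. n \<ge> nb \<longrightarrow> two_ind_typical 3 \<alpha> \<epsilon>' n M}) \<longlongrightarrow> 1) (admissible 3)"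
    using conjecture[OF \<alpha> \<epsilon>'] unfolding whp_def by blast
  \<comment> \<open>The conjecture's own bound on n is eventually met and so does not affect the
    limit.\<close>
  moreover have "\<forall>\<^sub>F n in admissible 3. measure_pmf.prob (config_model 3 n) {M. n \<ge> nb \<longrightarrow> two_ind_typical 3 \<alpha> \<epsilon>' n M} = ?typ n"
    using eventually_ge_at_top[of nb, THEN filter_leD[OF adm]] by eventually_elim simp
  ultimately have typ1: "(?typ \<longlongrightarrow> 1) (admissible 3)" by (simp cong: tendsto_cong)
  have "(\<lambda>n. ?K / (\<epsilon> / 500) * (1 / real n)) \<longlonglongrightarrow> ?K / (\<epsilon> / 500) * 0"
    by (intro tendsto_intros inv0)
  then have "(\<lambda>n. ?K / (\<epsilon> / 500 * real n)) \<longlonglongrightarrow> 0" by simp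
  then have lim2: "((\<lambda>n. ?K / (\<epsilon> / 500 * real n)) \<longlongrightarrow> 0) (admissible 3)" by (rule tendsto_mono[OF adm])
  have "(\<lambda>n. exp (- \<epsilon>') ^ n) \<longlonglongrightarrow> 0" by (rule LIMSEQ_power_zero) (use \<epsilon>' in simp)
  then have "(\<lambda>n. exp (- (\<epsilon>' * real n))) \<longlonglongrightarrow> 0" by (simp add: exp_of_nat_mult[symmetric] mult.commute)
  then have lim3: "((\<lambda>n. exp (- (\<epsilon>' * real n))) \<longlongrightarrow> 0) (admissible 3)" by (rule tendsto_mono[OF adm])
  have lim: "((\<lambda>n. 1 - ?err n) \<longlongrightarrow> 1 - ((1 - 1) + 0 + 0)) (admissible 3)"
    by (intro tendsto_intros typ1 lim2 lim3)
  have "(?p \<longlongrightarrow> 1) (admissible 3)"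
  proof (rule real_tendsto_sandwich[OF tail])
    show "\<forall>\<^sub>F n in admissible 3. ?p n \<le> 1" by simp
    show "((\<lambda>n. 1 - ?err n) \<longlongrightarrow> 1) (admissible 3)" using lim by simp
  qed simp
  \<comment> \<open>\<open>whp\<close> speaks about the limit in n, so the bound on n can be chosen
    as 0.\<close>
  then show "\<exists>nbar.
    whp 3 (config_model_two_ind 3 \<alpha>) (\<lambda>n (M, V0). n \<ge> nbar \<longrightarrow>
      V0 \<in> two_ind_sets 3 \<alpha> n M \<and>
      max_conditional_energy n M V0 - quad_form (psi3 n M) (H_MaxCut 3 n M)
        \<le> (\<alpha>\<^sup>2 * (0.18125 - 0.83875 * \<alpha> + 0.99 * \<alpha>\<^sup>2) / (0.5 - \<alpha>) ^ 3 + 0.59 * \<epsilon>) * real n + 0)"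
    by (intro exI[of _ 0]) (simp add: whp_def rate_def)
qed

end
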